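(* Let $p\ge 4$ and $n>(2p-2)^2$, and let $\lambda\vdash n$. Then $s_{(n-p,p)}\ast s_\lambda$ is multiplicity free if and only if $\lambda$ is one of $(n)$, $(1^n)$, $(n-1,1)$, $(2,1^{n-2})$.
   Context: For $\lambda,\mu\vdash n$, the Kronecker product is $s_\lambda\ast s_\mu=\sum_{\nu\vdash n}g_{\lambda,\mu,\nu}s_\nu$, where $g_{\lambda,\mu,\nu}$ is the multiplicity of the irreducible $S_n$-character $\chi^\nu$ in the pointwise product $\chi^\lambda\chi^\mu$. A symmetric function is multiplicity free if every coefficient in its expansion in Schur functions is $0$ or $1$. *)

theory Defs
  imports Complex_Main "HOL-Combinatorics.Permutations" "HOL-Library.Function_Algebras"
begin

definition is_partition :: "nat list \<Rightarrow> bool" where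
  "is_partition l \<longleftrightarrow> sorted_wrt (\<ge>) l \<and> 0 \<notin> set l"

definition partitions_of :: "nat \<Rightarrow> nat list set" where
  "partitions_of n = {l. is_partition l \<and> sum_list l = n}"


subsection \<open>Irreducible characters of symmetric groups\<close>

text \<open>
  The symmetric group on \<open>n\<close> letters is the set of \<open>\<sigma>\<close> with \<open>\<sigma> permutes {..<n}\<close>. An element
  \<open>\<Sum>\<sigma>. x \<sigma> \<cdot> \<sigma>\<close> of its complex group algebra is the coefficient function \<open>x\<close>, which
  vanishes off the group.
\<close>

type_synonym galg = "(nat \<Rightarrow> nat) \<Rightarrow> complex"

definition galg_scale :: "complex \<Rightarrow> galg \<Rightarrow> galg" where
  "galg_scale c x = (\<lambda>\<sigma>. c * x \<sigma>)"

global_interpretation galg: vector_space galg_scale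
  by unfold_locales (auto simp: galg_scale_def fun_eq_iff algebra_simps)

definition galg_carrier :: "nat \<Rightarrow> galg set" where
  "galg_carrier n = {x. \<forall>\<sigma>. \<not> \<sigma> permutes {..<n} \<longrightarrow> x \<sigma> = 0}"

definition galg_mult :: "nat \<Rightarrow> galg \<Rightarrow> galg \<Rightarrow> galg" where
  "galg_mult n x y = (\<lambda>\<sigma>. \<Sum>\<tau> | \<tau> permutes {..<n}. x \<tau> * y (inv \<tau> \<circ> \<sigma>))"

definition galg_single :: "(nat \<Rightarrow> nat) \<Rightarrow> galg" where
  "galg_single \<sigma> = (\<lambda>\<tau>. if \<tau> = \<sigma> then 1 else 0)"

text \<open>
  Row and column of the entry \<open>k\<close> in the tableau of shape \<open>l\<close> that is filled with
  \<open>0, 1, 2, \<dots>\<close> row by row.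
\<close>

definition row_of :: "nat list \<Rightarrow> nat \<Rightarrow> nat" where
  "row_of l k = (LEAST i. k < sum_list (take (Suc i) l))"

definition col_of :: "nat list \<Rightarrow> nat \<Rightarrow> nat" where
  "col_of l k = k - sum_list (take (row_of l k) l)"

definition row_group :: "nat list \<Rightarrow> (nat \<Rightarrow> nat) set" where
  "row_group l = {\<sigma>. \<sigma> permutes {..<sum_list l} \<and>
     (\<forall>k<sum_list l. row_of l (\<sigma> k) = row_of l k)}"

definition col_group :: "nat list \<Rightarrow> (nat \<Rightarrow> nat) set" where
  "col_group l = {\<sigma>. \<sigma> permutes {..<sum_list l} \<and>
     (\<forall>k<sum_list l. col_of l (\<sigma> k) = col_of l k)}"

definition row_symmetrizer :: "nat list \<Rightarrow> galg" where
  "row_symmetrizer l = (\<lambda>\<sigma>. if \<sigma> \<in> row_group l then 1 else 0)"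

definition col_antisymmetrizer :: "nat list \<Rightarrow> galg" where
  "col_antisymmetrizer l = (\<lambda>\<sigma>. if \<sigma> \<in> col_group l then of_int (sign \<sigma>) else 0)"

definition young_symmetrizer :: "nat list \<Rightarrow> galg" where
  "young_symmetrizer l = galg_mult (sum_list l) (row_symmetrizer l) (col_antisymmetrizer l)"

text \<open>
  The irreducible module indexed by \<open>l\<close> (the Specht module) is the left ideal generated by
  the Young symmetrizer; the group acts on it by left multiplication.
\<close>

definition specht_module :: "nat list \<Rightarrow> galg set" where
  "specht_module l =
     (\<lambda>x. galg_mult (sum_list l) x (young_symmetrizer l)) ` galg_carrier (sum_list l)"

text \<open>
  Trace of a linear map on a finite-dimensional invariant subspace \<open>V\<close>; the value does not
  depend on the chosen basis.
\<close>

definition trace_on :: "galg set \<Rightarrow> (galg \<Rightarrow> galg) \<Rightarrow> complex" where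
  "trace_on V T =
     (let B = (SOME B. galg.independent B \<and> galg.span B = V)
      in \<Sum>b\<in>B. galg.representation B (T b) b)"

definition irr_char :: "nat list \<Rightarrow> (nat \<Rightarrow> nat) \<Rightarrow> complex" where
  "irr_char l \<sigma> = trace_on (specht_module l) (galg_mult (sum_list l) (galg_single \<sigma>))"


subsection \<open>Kronecker coefficients\<close>

text \<open>
  The irreducible characters form a basis of the class functions, so a class function \<open>f\<close>
  has unique multiplicities \<open>g \<nu>\<close> with \<open>f = \<Sum>\<nu>. g \<nu> \<cdot> irr_char \<nu>\<close>.
\<close>

definition irr_multiplicity :: "nat \<Rightarrow> ((nat \<Rightarrow> nat) \<Rightarrow> complex) \<Rightarrow> nat list \<Rightarrow> complex" where
  "irr_multiplicity n f =
     (THE g. (\<forall>\<nu>. \<nu> \<notin> partitions_of n \<longrightarrow> g \<nu> = 0) \<and>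
        (\<forall>\<sigma>. \<sigma> permutes {..<n} \<longrightarrow> f \<sigma> = (\<Sum>\<nu>\<in>partitions_of n. g \<nu> * irr_char \<nu> \<sigma>)))"

definition kronecker_coeff :: "nat list \<Rightarrow> nat list \<Rightarrow> nat list \<Rightarrow> complex" where
  "kronecker_coeff l m \<nu> =
     irr_multiplicity (sum_list l) (\<lambda>\<sigma>. irr_char l \<sigma> * irr_char m \<sigma>) \<nu>"


subsection \<open>Schur functions and their Kronecker product\<close>

text \<open>
  A symmetric function is a formal power series in variables \<open>x\<^sub>0, x\<^sub>1, \<dots>\<close>, given by its
  coefficients: the exponent vector \<open>e\<close> stands for the monomial \<open>\<Prod>i. x\<^sub>i ^ e i\<close>.
\<close>

type_synonym symfun = "(nat \<Rightarrow> nat) \<Rightarrow> complex"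

definition cells :: "nat list \<Rightarrow> (nat \<times> nat) set" where
  "cells l = {(i, j). i < length l \<and> j < l ! i}"

text \<open>Fillings are normalised to \<open>0\<close> outside the diagram so that they can be counted.\<close>

definition ssyt :: "nat list \<Rightarrow> (nat \<times> nat \<Rightarrow> nat) set" where
  "ssyt l = {T. (\<forall>c. c \<notin> cells l \<longrightarrow> T c = 0) \<and>
     (\<forall>i j. (i, Suc j) \<in> cells l \<longrightarrow> T (i, j) \<le> T (i, Suc j)) \<and>
     (\<forall>i j. (Suc i, j) \<in> cells l \<longrightarrow> T (i, j) < T (Suc i, j))}"

definition content :: "nat list \<Rightarrow> (nat \<times> nat \<Rightarrow> nat) \<Rightarrow> nat \<Rightarrow> nat" where
  "content l T k = card {c \<in> cells l. T c = k}"

definition schur :: "nat list \<Rightarrow> symfun" where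
  "schur l = (\<lambda>e. of_nat (card {T \<in> ssyt l. content l T = e}))"

definition kronecker_product :: "nat list \<Rightarrow> nat list \<Rightarrow> symfun" where
  "kronecker_product l m =
     (\<lambda>e. \<Sum>\<nu>\<in>partitions_of (sum_list l). kronecker_coeff l m \<nu> * schur \<nu> e)"

definition schur_expansion :: "symfun \<Rightarrow> (nat list \<Rightarrow> complex) \<Rightarrow> bool" where
  "schur_expansion F c \<longleftrightarrow>
     finite {\<nu>. c \<nu> \<noteq> 0} \<and> (\<forall>\<nu>. c \<nu> \<noteq> 0 \<longrightarrow> is_partition \<nu>) \<and>
     F = (\<lambda>e. \<Sum>\<nu> | c \<nu> \<noteq> 0. c \<nu> * schur \<nu> e)"

definition multiplicity_free :: "symfun \<Rightarrow> bool" where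
  "multiplicity_free F \<longleftrightarrow> (\<exists>c. schur_expansion F c \<and> (\<forall>\<nu>. c \<nu> \<in> {0, 1}))"

end

theory Submission
  imports Defs "HOL-Computational_Algebra.Polynomial" "HOL-Library.Multiset" "HOL-Library.Nat_Bijection"
begin

text \<open>
  The Kronecker coefficient of three partitions is the dimension of the space \<open>W\<close> of highest weight
  polynomials in the variables \<open>X (i, j, k)\<close> attached to them. Products of such polynomials are nonzero
  highest weight polynomials for the sums of the partitions, so Kronecker coefficients are monotone
  under adding a triple with nonzero coefficient. For \<open>\<lambda>\<close> outside the list and \<open>n > (2p - 2)\<^sup>2\<close>,
  either \<open>\<lambda>\<close> or its conjugate is long enough for \<open>(\<lambda>, (n - p, p))\<close> to be reached in this way from one of
  \<open>((3,1,1), (3,2))\<close>, \<open>((4,2), (4,2))\<close>, \<open>((6,6), (8,4))\<close>, by adding columns (with \<open>p\<close> fixed) and \<open>(2)\<close>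
  or \<open>(2,2)\<close> (raising \<open>p\<close> by one). Each of the three pairs has a coefficient \<open>\<ge> 2\<close>, seen from two
  explicit polynomials one of which vanishes on a coordinate subspace where the other does not.

  Conversely, with \<open>\<chi> = \<chi>\<^bsup>(n - p, p)\<^esup>\<close> and \<open>\<pi>\<close> the permutation character on points, restriction to
  point stabilizers gives \<open>\<langle>\<chi>\<pi>, \<chi>\<pi>\<rangle> = 8\<close>; the constituents \<open>(n - p, p)\<close> of multiplicity \<open>2\<close> and
  \<open>(n - p \<plusminus> 1, p \<mp> 1)\<close> of multiplicity \<open>1\<close> account for \<open>6\<close>, so all other multiplicities are at most \<open>1\<close>,
  and \<open>\<chi>\<^bsup>(n - 1, 1)\<^esup> = \<pi> - 1\<close>.
\<close>

section \<open>Sums over the symmetric group\<close>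

text \<open>A multiplicity of 2 has to survive along infinite families of shapes, which character
  sums do not show. It does once the coefficient is the dimension of a space of polynomials, because
  multiplication by a nonzero polynomial is injective. The constants come from how far the three
  starting pairs reach. From (6,6) at p = 4 each (2,2) lengthens the second row by 2, so a second
  row of length 2p - 2 suffices; from (4,2) and (3,1,1) at p = 2 each (2) widens the gap between the
  first two rows by 2, so a gap of 2p - 2 suffices. If the second row and the second column both
  have at most 2p - 3 cells, the diagram without its first row and column fits into a square of side
  2p - 4, and n > (2p - 2)^2 then forces a first row or column so long that the gap is there. The
  bases chosen by \<open>SOME\<close> in \<open>trace_on\<close> disappear because traces on left
  ideals are computed as traces on the whole group algebra; ranks of idempotents also supply all
  integrality.\<close>

abbreviation perms :: "nat \<Rightarrow> (nat \<Rightarrow> nat) set" where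
  "perms n \<equiv> {\<sigma>. \<sigma> permutes {..<n}}"

lemma finite_perms [simp]: "finite (perms n)"
  by (simp add: finite_permutations)

lemma card_perms: "card (perms n) = fact n"
  by (simp add: card_permutations)

lemma perms_inv: "\<sigma> \<in> perms n \<Longrightarrow> inv \<sigma> \<in> perms n"
  by (simp add: permutes_inv)

lemma perms_comp: "\<sigma> \<in> perms n \<Longrightarrow> \<tau> \<in> perms n \<Longrightarrow> \<sigma> \<circ> \<tau> \<in> perms n"
  by (simp add: permutes_compose)

lemma perms_id: "id \<in> perms n"
  by (simp add: permutes_id)

lemma perms_inv_comp: "\<sigma> \<in> perms n \<Longrightarrow> \<tau> \<in> perms n \<Longrightarrow> inv (\<sigma> \<circ> \<tau>) = inv \<tau> \<circ> inv \<sigma>"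
  by (simp add: o_inv_distrib permutes_bij)

lemma perms_inv_inv: "\<sigma> \<in> perms n \<Longrightarrow> inv (inv \<sigma>) = \<sigma>"
  by (simp add: permutes_inv_inv)

lemma perms_cancel:
  assumes "\<sigma> \<in> perms n"
  shows "inv \<sigma> \<circ> \<sigma> = id" "\<sigma> \<circ> inv \<sigma> = id"
    "inv \<sigma> \<circ> (\<sigma> \<circ> \<tau>) = \<tau>" "\<sigma> \<circ> (inv \<sigma> \<circ> \<tau>) = \<tau>"
    "(\<tau> \<circ> \<sigma>) \<circ> inv \<sigma> = \<tau>" "(\<tau> \<circ> inv \<sigma>) \<circ> \<sigma> = \<tau>"
  using permutes_inv_o[of \<sigma> "{..<n}"] assms by (auto simp: o_assoc[symmetric], auto simp: o_assoc)

lemma perms_less: "\<sigma> \<in> perms n \<Longrightarrow> \<sigma> x < n \<longleftrightarrow> x < n"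
  using permutes_in_image[of \<sigma> "{..<n}" x] by simp

lemma perms_permutation: "\<sigma> \<in> perms n \<Longrightarrow> permutation \<sigma>"
  by (auto simp: permutation_permutes)

lemma perms_eqI:
  assumes "\<sigma> \<in> perms n" "\<tau> \<in> perms n" "\<And>x. x < n \<Longrightarrow> \<sigma> x = \<tau> x"
  shows "\<sigma> = \<tau>"
proof
  fix x show "\<sigma> x = \<tau> x"
    using assms by (cases "x < n") (auto simp: permutes_not_in)
qed

lemma sum_perms_left: "\<tau> \<in> perms n \<Longrightarrow> (\<Sum>\<sigma>\<in>perms n. f (\<tau> \<circ> \<sigma>)) = (\<Sum>\<sigma>\<in>perms n. f \<sigma>)"
  using setum_permutations_compose_left[of \<tau> "{..<n}" f] by simp

lemma sum_perms_right: "\<tau> \<in> perms n \<Longrightarrow> (\<Sum>\<sigma>\<in>perms n. f (\<sigma> \<circ> \<tau>)) = (\<Sum>\<sigma>\<in>perms n. f \<sigma>)"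
  using sum_permutations_compose_right[of \<tau> "{..<n}" f] by simp

lemma sum_perms_inv: "(\<Sum>\<sigma>\<in>perms n. f (inv \<sigma>)) = (\<Sum>\<sigma>\<in>perms n. f \<sigma>)"
  using sum_permutations_inverse[of f "{..<n}"] by simp

lemma sum_perms_conj:
  assumes "\<tau> \<in> perms n"
  shows "(\<Sum>\<sigma>\<in>perms n. f (inv \<tau> \<circ> \<sigma> \<circ> \<tau>)) = (\<Sum>\<sigma>\<in>perms n. f \<sigma>)"
proof -
  have "(\<Sum>\<sigma>\<in>perms n. f (inv \<tau> \<circ> \<sigma> \<circ> \<tau>)) = (\<Sum>\<sigma>\<in>perms n. f (inv \<tau> \<circ> \<sigma>))"
    using sum_perms_right[OF assms, of "\<lambda>\<sigma>. f (inv \<tau> \<circ> \<sigma>)"] by (simp add: o_assoc)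
  also have "\<dots> = (\<Sum>\<sigma>\<in>perms n. f \<sigma>)"
    by (rule sum_perms_left) (use assms perms_inv in auto)
  finally show ?thesis .
qed

section \<open>Traces of idempotents\<close>

text \<open>The linear algebra is set up for functions on an arbitrary index type: it serves the
  group algebra, functions on triples of permutations, and polynomial functions alike.
  \<open>galg_scale\<close> is an instance.\<close>

definition fscale :: "complex \<Rightarrow> ('i \<Rightarrow> complex) \<Rightarrow> 'i \<Rightarrow> complex" where
  "fscale c x = (\<lambda>i. c * x i)"

global_interpretation fs: vector_space fscale
  by unfold_locales (auto simp: fscale_def fun_eq_iff algebra_simps)

definition funit :: "'i \<Rightarrow> 'i \<Rightarrow> complex" where
  "funit i = (\<lambda>j. if j = i then 1 else 0)"

abbreviation flinear :: "(('i \<Rightarrow> complex) \<Rightarrow> 'j \<Rightarrow> complex) \<Rightarrow> bool" where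
  "flinear \<equiv> Vector_Spaces.linear fscale fscale"

lemma flinearI:
  assumes "\<And>x y. P (\<lambda>i. x i + y i) = (\<lambda>i. P x i + P y i)" "\<And>c x. P (\<lambda>i. c * x i) = (\<lambda>i. c * P x i)"
  shows "flinear P"
  by unfold_locales (use assms in \<open>auto simp: fscale_def plus_fun_def\<close>)

lemma galg_scale_eq: "galg_scale = fscale"
  by (intro ext) (simp add: galg_scale_def fscale_def)

lemma sum_fun_apply: "(\<Sum>a\<in>A. F a) x = (\<Sum>a\<in>A. F a x)"
  by (induction A rule: infinite_finite_induct) auto

lemma fun_eq_sum_funit:
  assumes "finite I" "\<And>i. i \<notin> I \<Longrightarrow> x i = 0"
  shows "x = (\<Sum>i\<in>I. fscale (x i) (funit i))"
proof
  fix j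
  have "(\<Sum>i\<in>I. fscale (x i) (funit i)) j = (\<Sum>i\<in>I. fscale (x i) (funit i) j)"
    by (rule sum_fun_apply)
  also have "\<dots> = (\<Sum>i\<in>I. if i = j then x j else 0)"
    by (intro sum.cong) (auto simp: fscale_def funit_def)
  also have "\<dots> = x j"
    using assms by (simp add: sum.delta)
  finally show "x j = (\<Sum>i\<in>I. fscale (x i) (funit i)) j" ..
qed

lemma finite_independent_support:
  assumes "finite I" "fs.independent B" "\<And>b i. b \<in> B \<Longrightarrow> i \<notin> I \<Longrightarrow> b i = 0"
  shows "finite B"
proof -
  have "B \<subseteq> fs.span (funit ` I)"
  proof
    fix b assume "b \<in> B"
    then have "b = (\<Sum>i\<in>I. fscale (b i) (funit i))"
      using fun_eq_sum_funit assms by blast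
    also have "\<dots> \<in> fs.span (funit ` I)"
      by (intro fs.span_sum fs.span_scale fs.span_base) auto
    finally show "b \<in> fs.span (funit ` I)" .
  qed
  then show ?thesis
    using fs.independent_span_bound[of "funit ` I" B] assms by auto
qed

text \<open>P projects onto V, so the trace of T on V is the trace of T after P on the ambient
  space: both are one double sum, of coordinates of \<open>P (funit i)\<close> in B against
  coordinates of \<open>T b\<close> in unit vectors. The right side no longer mentions the basis
  B.\<close>

lemma trace_via_projection:
  assumes fin: "finite I" and supp: "\<And>v i. v \<in> V \<Longrightarrow> i \<notin> I \<Longrightarrow> v i = 0"
    and B: "fs.independent B" "fs.span B = V"
    and P: "flinear P" "\<And>x. (\<And>i. i \<notin> I \<Longrightarrow> x i = 0) \<Longrightarrow> P x \<in> V" "\<And>v. v \<in> V \<Longrightarrow> P v = v"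
    and T: "flinear T" "\<And>v. v \<in> V \<Longrightarrow> T v \<in> V"
  shows "(\<Sum>b\<in>B. fs.representation B (T b) b) = (\<Sum>i\<in>I. T (P (funit i)) i)"
proof -
  interpret P: Vector_Spaces.linear fscale fscale P by fact
  interpret T: Vector_Spaces.linear fscale fscale T by fact
  have BV: "B \<subseteq> V" using B(2) fs.span_superset by auto
  have finB: "finite B"
    by (rule finite_independent_support[OF fin B(1)]) (use supp BV in auto)
  have PV: "P (funit i) \<in> V" if "i \<in> I" for i
    by (rule P(2)) (use that in \<open>auto simp: funit_def\<close>)
  have rep: "T (P (funit i)) i = (\<Sum>b\<in>B. fs.representation B (P (funit i)) b * T b i)" if "i \<in> I" for i
  proof -
    have "P (funit i) = (\<Sum>b\<in>B. fscale (fs.representation B (P (funit i)) b) b)"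
      using fs.sum_representation_eq[OF B(1), of "P (funit i)" B] PV[OF that] B finB by simp
    then have "T (P (funit i)) = (\<Sum>b\<in>B. fscale (fs.representation B (P (funit i)) b) (T b))"
      by (metis (no_types, lifting) T.scale T.sum sum.cong)
    then have "T (P (funit i)) i = (\<Sum>b\<in>B. fscale (fs.representation B (P (funit i)) b) (T b)) i"
      by simp
    also have "\<dots> = (\<Sum>b\<in>B. fscale (fs.representation B (P (funit i)) b) (T b) i)"
      by (rule sum_fun_apply)
    finally show ?thesis by (simp add: fscale_def)
  qed
  have "(\<Sum>i\<in>I. T (P (funit i)) i) = (\<Sum>b\<in>B. \<Sum>i\<in>I. fs.representation B (P (funit i)) b * T b i)"
    by (subst sum.swap) (simp add: rep)
  also have "\<dots> = (\<Sum>b\<in>B. fs.representation B (T b) b)"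
  proof (rule sum.cong[OF refl])
    fix b assume b: "b \<in> B"
    then have Tb: "T b \<in> V" using BV T(2) by auto
    \<comment> \<open>T b lies in V, so P fixes it; its expansion in unit vectors thus becomes one
      in the vectors \<open>P (funit i)\<close>.\<close>
    have "T b = P (T b)" using P(3)[OF Tb] by simp
    also have "T b = (\<Sum>i\<in>I. fscale (T b i) (funit i))"
      by (rule fun_eq_sum_funit[OF fin]) (use supp Tb in auto)
    then have "P (T b) = P (\<Sum>i\<in>I. fscale (T b i) (funit i))"
      by simp
    also have "\<dots> = (\<Sum>i\<in>I. fscale (T b i) (P (funit i)))"
      by (simp add: P.sum P.scale)
    finally have "fs.representation B (T b) b = fs.representation B (\<Sum>i\<in>I. fscale (T b i) (P (funit i))) b"
      by simp
    also have "\<dots> = (\<Sum>i\<in>I. fs.representation B (fscale (T b i) (P (funit i))) b)"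
      by (subst fs.representation_sum[OF B(1)]) (use B(2) fs.subspace_span[of B] PV in \<open>auto intro!: fs.subspace_scale\<close>)
    also have "\<dots> = (\<Sum>i\<in>I. T b i * fs.representation B (P (funit i)) b)"
      by (intro sum.cong refl, subst fs.representation_scale[OF B(1)]) (auto simp: B PV)
    finally show "(\<Sum>i\<in>I. fs.representation B (P (funit i)) b * T b i) = fs.representation B (T b) b"
      by (simp add: mult.commute)
  qed
  finally show ?thesis by simp
qed

text \<open>The identity acts on the range with trace equal to the dimension;
  \<open>trace_via_projection\<close> moves this trace to the ambient space.\<close>

lemma trace_idempotent:
  assumes fin: "finite I"
    and P: "flinear P" "\<And>x i. i \<notin> I \<Longrightarrow> P x i = 0" "\<And>x. P (P x) = P x"
  shows "(\<Sum>i\<in>I. P (funit i) i) = of_nat (fs.dim (range P))"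
proof -
  interpret P: Vector_Spaces.linear fscale fscale P by fact
  have sub: "fs.subspace (range P)"
    by (intro P.subspace_image) simp
  obtain B where B: "B \<subseteq> range P" "fs.independent B" "range P \<subseteq> fs.span B" "card B = fs.dim (range P)"
    using fs.basis_exists by blast
  have spB: "fs.span B = range P"
    using fs.span_minimal[OF B(1) sub] B(3) by auto
  have lid: "flinear (\<lambda>x. x :: 'a \<Rightarrow> complex)" by (intro flinearI) auto
  have "(\<Sum>b\<in>B. fs.representation B b b) = (\<Sum>i\<in>I. P (funit i) i)"
    by (rule trace_via_projection[OF fin _ B(2) spB P(1) _ _ lid]) (use P in auto)
  moreover have "(\<Sum>b\<in>B. fs.representation B b b) = (\<Sum>b\<in>B. 1)"
    by (intro sum.cong refl) (simp add: fs.representation_basis[OF B(2)])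
  ultimately show ?thesis using B(4) by simp
qed

text \<open>A finite spanning set is demanded because the ambient function spaces may be
  infinite-dimensional, and \<open>card\<close> of an infinite basis would be 0.\<close>

lemma fdim_ge_card:
  assumes "fs.independent B" "B \<subseteq> V" "V \<subseteq> fs.span C" "finite C"
  shows "finite B \<and> card B \<le> fs.dim V"
proof -
  obtain D where D: "D \<subseteq> V" "fs.independent D" "V \<subseteq> fs.span D" "card D = fs.dim V"
    using fs.basis_exists by blast
  have "finite D" using fs.independent_span_bound[OF assms(4) D(2)] D(1) assms(3) by auto
  then show ?thesis
    using fs.independent_span_bound[of D B] assms(1,2) D(3,4) by auto
qed

lemma fdim_zero_iff:
  assumes "V \<subseteq> fs.span C" "finite C"
  shows "fs.dim V = 0 \<longleftrightarrow> V \<subseteq> {0}"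
proof
  assume 0: "fs.dim V = 0"
  show "V \<subseteq> {0}"
  proof
    fix v assume "v \<in> V"
    show "v \<in> {0}"
    proof (rule ccontr)
      assume "v \<notin> {0}"
      then have "fs.independent {v}" by (simp add: fs.independent_insert)
      then have "card {v} \<le> fs.dim V" using fdim_ge_card[of "{v}" V C] \<open>v \<in> V\<close> assms by auto
      then show False using 0 by simp
    qed
  qed
next
  assume "V \<subseteq> {0}"
  then show "fs.dim V = 0"
    using fs.dim_le_card[of V "{}"] by auto
qed

section \<open>The group algebra\<close>

lemma gm_assoc: "galg_mult n (galg_mult n x y) z = galg_mult n x (galg_mult n y z)"
proof
  fix \<sigma>
  have "galg_mult n (galg_mult n x y) z \<sigma> =
      (\<Sum>\<tau>\<in>perms n. \<Sum>\<rho>\<in>perms n. x \<rho> * y (inv \<rho> \<circ> \<tau>) * z (inv \<tau> \<circ> \<sigma>))"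
    by (simp add: galg_mult_def sum_distrib_right)
  also have "\<dots> = (\<Sum>\<rho>\<in>perms n. \<Sum>\<tau>\<in>perms n. x \<rho> * y (inv \<rho> \<circ> \<tau>) * z (inv \<tau> \<circ> \<sigma>))"
    by (rule sum.swap)
  also have "\<dots> = (\<Sum>\<rho>\<in>perms n. \<Sum>\<tau>\<in>perms n. x \<rho> * y \<tau> * z (inv \<tau> \<circ> (inv \<rho> \<circ> \<sigma>)))"
  proof (rule sum.cong[OF refl])
    fix \<rho> assume \<rho>: "\<rho> \<in> perms n"
    have "(\<Sum>\<tau>\<in>perms n. x \<rho> * y (inv \<rho> \<circ> \<tau>) * z (inv \<tau> \<circ> \<sigma>)) =
       (\<Sum>\<tau>\<in>perms n. x \<rho> * y (inv \<rho> \<circ> (\<rho> \<circ> \<tau>)) * z (inv (\<rho> \<circ> \<tau>) \<circ> \<sigma>))"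
      by (rule sum_perms_left[OF \<rho>, symmetric])
    also have "\<dots> = (\<Sum>\<tau>\<in>perms n. x \<rho> * y \<tau> * z (inv \<tau> \<circ> (inv \<rho> \<circ> \<sigma>)))"
      by (intro sum.cong refl) (simp add: perms_cancel(3)[OF \<rho>] perms_inv_comp[OF \<rho>] comp_assoc)
    finally show "(\<Sum>\<tau>\<in>perms n. x \<rho> * y (inv \<rho> \<circ> \<tau>) * z (inv \<tau> \<circ> \<sigma>)) =
      (\<Sum>\<tau>\<in>perms n. x \<rho> * y \<tau> * z (inv \<tau> \<circ> (inv \<rho> \<circ> \<sigma>)))" .
  qed
  also have "\<dots> = galg_mult n x (galg_mult n y z) \<sigma>"
    by (simp add: galg_mult_def sum_distrib_left mult.assoc)
  finally show "galg_mult n (galg_mult n x y) z \<sigma> = galg_mult n x (galg_mult n y z) \<sigma>" .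
qed

lemma gm_scale_left: "galg_mult n (fscale k x) y = fscale k (galg_mult n x y)"
  by (simp add: galg_mult_def fscale_def sum_distrib_left mult.assoc)

lemma gm_scale_right: "galg_mult n x (fscale k y) = fscale k (galg_mult n x y)"
  by (simp add: galg_mult_def fscale_def sum_distrib_left mult_ac)

lemma gm_zero_left [simp]: "galg_mult n 0 y = 0" and gm_zero_right [simp]: "galg_mult n x 0 = 0"
  by (auto simp: galg_mult_def)

lemma gm_single_left:
  assumes "\<sigma> \<in> perms n"
  shows "galg_mult n (galg_single \<sigma>) y = (\<lambda>\<pi>. y (inv \<sigma> \<circ> \<pi>))"
proof
  fix \<pi>
  have "galg_mult n (galg_single \<sigma>) y \<pi> = (\<Sum>\<tau>\<in>perms n. if \<tau> = \<sigma> then y (inv \<sigma> \<circ> \<pi>) else 0)"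
    unfolding galg_mult_def galg_single_def by (intro sum.cong) auto
  then show "galg_mult n (galg_single \<sigma>) y \<pi> = y (inv \<sigma> \<circ> \<pi>)"
    using assms by (simp add: sum.delta)
qed

text \<open>Linearity in the middle factor reduces statements about sandwiches \<open>a x b\<close>
  to group elements x.\<close>

lemma gm_expand_middle:
  "galg_mult n a (galg_mult n x b) \<pi> =
     (\<Sum>\<sigma>\<in>perms n. x \<sigma> * galg_mult n a (galg_mult n (galg_single \<sigma>) b) \<pi>)"
proof -
  have "galg_mult n a (galg_mult n x b) \<pi> =
     (\<Sum>\<tau>\<in>perms n. \<Sum>\<sigma>\<in>perms n. a \<tau> * (x \<sigma> * b (inv \<sigma> \<circ> (inv \<tau> \<circ> \<pi>))))"
    by (simp add: galg_mult_def sum_distrib_left)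
  also have "\<dots> = (\<Sum>\<sigma>\<in>perms n. \<Sum>\<tau>\<in>perms n. a \<tau> * (x \<sigma> * b (inv \<sigma> \<circ> (inv \<tau> \<circ> \<pi>))))"
    by (rule sum.swap)
  also have "\<dots> = (\<Sum>\<sigma>\<in>perms n. x \<sigma> * galg_mult n a (galg_mult n (galg_single \<sigma>) b) \<pi>)"
    by (intro sum.cong refl) (simp add: gm_single_left, simp add: galg_mult_def sum_distrib_left mult_ac)
  finally show ?thesis .
qed

lemma gm_carrier: "y \<in> galg_carrier n \<Longrightarrow> galg_mult n x y \<in> galg_carrier n"
proof -
  assume y: "y \<in> galg_carrier n"
  have "\<sigma> \<in> perms n" if "\<tau> \<in> perms n" "inv \<tau> \<circ> \<sigma> \<in> perms n" for \<tau> \<sigma>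
    using perms_comp[OF that] perms_cancel(4)[OF that(1)] by simp
  then have "y (inv \<tau> \<circ> \<sigma>) = 0" if "\<tau> \<in> perms n" "\<sigma> \<notin> perms n" for \<tau> \<sigma>
    using that y unfolding galg_carrier_def by blast
  then show ?thesis
    unfolding galg_carrier_def galg_mult_def by simp
qed

text \<open>Inversion is an anti-automorphism; on elements with real coefficients it is the
  adjoint.\<close>

lemma gm_inv:
  assumes \<sigma>: "\<sigma> \<in> perms n"
  shows "galg_mult n x y (inv \<sigma>) = galg_mult n (\<lambda>\<tau>. y (inv \<tau>)) (\<lambda>\<tau>. x (inv \<tau>)) \<sigma>"
proof -
  have "galg_mult n (\<lambda>\<tau>. y (inv \<tau>)) (\<lambda>\<tau>. x (inv \<tau>)) \<sigma> =
      (\<Sum>\<tau>\<in>perms n. y (inv (\<sigma> \<circ> \<tau>)) * x (inv (inv (\<sigma> \<circ> \<tau>) \<circ> \<sigma>)))"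
    unfolding galg_mult_def by (rule sum_perms_left[OF \<sigma>, symmetric])
  also have "\<dots> = (\<Sum>\<tau>\<in>perms n. y (inv \<tau> \<circ> inv \<sigma>) * x \<tau>)"
  proof (rule sum.cong[OF refl])
    fix \<tau> assume \<tau>: "\<tau> \<in> perms n"
    have "inv (inv (\<sigma> \<circ> \<tau>) \<circ> \<sigma>) = inv (inv \<tau>)"
      using perms_inv_comp[OF \<sigma> \<tau>] perms_cancel(6)[OF \<sigma>] by simp
    then show "y (inv (\<sigma> \<circ> \<tau>)) * x (inv (inv (\<sigma> \<circ> \<tau>) \<circ> \<sigma>)) = y (inv \<tau> \<circ> inv \<sigma>) * x \<tau>"
      using perms_inv_comp[OF \<sigma> \<tau>] perms_inv_inv[OF \<tau>] by simp
  qed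
  finally show ?thesis by (simp add: galg_mult_def mult.commute)
qed

section \<open>Tableaux and their Young symmetrizers\<close>

text \<open>
  A tableau is given by the row \<open>r x\<close> and a column label \<open>c x\<close> of each entry \<open>x < n\<close>; columns are
  top-justified but their labels are arbitrary, so that the disjoint union of two tableaux is a
  tableau whose shape is the sum of the shapes. The shape is the function \<open>f\<close> of row lengths.
\<close>

definition tab :: "nat \<Rightarrow> (nat \<Rightarrow> nat) \<Rightarrow> (nat \<Rightarrow> nat) \<Rightarrow> (nat \<Rightarrow> nat) \<Rightarrow> bool" where
  "tab n r c f \<longleftrightarrow> (\<forall>x<n. \<forall>y<n. r x = r y \<longrightarrow> c x = c y \<longrightarrow> x = y) \<and>
     (\<forall>x<n. \<forall>i<r x. \<exists>y<n. c y = c x \<and> r y = i) \<and> (\<forall>i. card {x. x < n \<and> r x = i} = f i)"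

text \<open>For a tableau \<open>(r, c)\<close> the row group is \<open>stab n r\<close> and the
  column group is \<open>stab n c\<close>.\<close>

definition stab :: "nat \<Rightarrow> (nat \<Rightarrow> nat) \<Rightarrow> (nat \<Rightarrow> nat) set" where
  "stab n f = {\<sigma>. \<sigma> permutes {..<n} \<and> (\<forall>k<n. f (\<sigma> k) = f k)}"

definition rsym :: "nat \<Rightarrow> (nat \<Rightarrow> nat) \<Rightarrow> galg" where
  "rsym n r = (\<lambda>\<sigma>. if \<sigma> \<in> stab n r then 1 else 0)"

definition csym :: "nat \<Rightarrow> (nat \<Rightarrow> nat) \<Rightarrow> galg" where
  "csym n c = (\<lambda>\<sigma>. if \<sigma> \<in> stab n c then of_int (sign \<sigma>) else 0)"

definition ysym :: "nat \<Rightarrow> (nat \<Rightarrow> nat) \<Rightarrow> (nat \<Rightarrow> nat) \<Rightarrow> galg" where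
  "ysym n r c = galg_mult n (rsym n r) (csym n c)"

lemma stab_perms: "\<sigma> \<in> stab n f \<Longrightarrow> \<sigma> \<in> perms n"
  by (simp add: stab_def)

lemma finite_stab [simp]: "finite (stab n f)"
  by (rule finite_subset[OF _ finite_perms[of n]]) (auto simp: stab_def)

lemma stab_id [simp]: "id \<in> stab n f"
  by (simp add: stab_def permutes_id)

lemma stab_comp: "\<sigma> \<in> stab n f \<Longrightarrow> \<tau> \<in> stab n f \<Longrightarrow> \<sigma> \<circ> \<tau> \<in> stab n f"
  using perms_less[of \<tau> n] by (auto simp: stab_def permutes_compose)

lemma stab_inv: "\<sigma> \<in> stab n f \<Longrightarrow> inv \<sigma> \<in> stab n f"
proof -
  assume a: "\<sigma> \<in> stab n f"
  have "f (inv \<sigma> k) = f k" if "k < n" for k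
  proof -
    have "inv \<sigma> k < n" using perms_less[OF perms_inv[OF stab_perms[OF a]]] that by simp
    then have "f (\<sigma> (inv \<sigma> k)) = f (inv \<sigma> k)" using a by (simp add: stab_def)
    then show ?thesis using stab_perms[OF a] by (simp add: permutes_inverses)
  qed
  then show ?thesis using perms_inv[OF stab_perms[OF a]] by (simp add: stab_def)
qed

lemma stab_comp_iff_left: "\<sigma> \<in> stab n f \<Longrightarrow> \<sigma> \<circ> \<tau> \<in> stab n f \<longleftrightarrow> \<tau> \<in> stab n f"
  using stab_comp[of \<sigma> n f \<tau>] stab_comp[OF stab_inv, of \<sigma> n f "\<sigma> \<circ> \<tau>"]
    perms_cancel(3)[OF stab_perms, of \<sigma> n f \<tau>] by auto

lemma stab_inv_iff: "\<sigma> \<in> perms n \<Longrightarrow> inv \<sigma> \<in> stab n f \<longleftrightarrow> \<sigma> \<in> stab n f"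
  using stab_inv[of \<sigma> n f] stab_inv[of "inv \<sigma>" n f] perms_inv_inv[of \<sigma> n] by auto

lemma sum_stab_right:
  assumes "t \<in> stab n f"
  shows "(\<Sum>\<tau>\<in>stab n f. F (\<tau> \<circ> t)) = (\<Sum>\<tau>\<in>stab n f. F \<tau>)"
  by (rule sum.reindex_bij_witness[of _ "\<lambda>\<tau>. \<tau> \<circ> inv t" "\<lambda>\<tau>. \<tau> \<circ> t"])
    (use assms stab_comp stab_inv perms_cancel(5,6)[OF stab_perms[OF assms]] in auto)

lemma sum_stab_inv: "(\<Sum>\<tau>\<in>stab n f. F (inv \<tau>)) = (\<Sum>\<tau>\<in>stab n f. F \<tau>)"
  by (rule sum.reindex_bij_witness[of _ inv inv])
    (use stab_inv perms_inv_inv[OF stab_perms] in auto)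

lemma gm_rsym: "galg_mult n (rsym n r) y \<pi> = (\<Sum>\<tau>\<in>stab n r. y (inv \<tau> \<circ> \<pi>))"
proof -
  have "galg_mult n (rsym n r) y \<pi> = (\<Sum>\<tau>\<in>perms n. if \<tau> \<in> stab n r then y (inv \<tau> \<circ> \<pi>) else 0)"
    unfolding galg_mult_def rsym_def by (intro sum.cong) auto
  also have "\<dots> = (\<Sum>\<tau>\<in>perms n \<inter> stab n r. y (inv \<tau> \<circ> \<pi>))"
    by (subst sum.inter_restrict) auto
  also have "perms n \<inter> stab n r = stab n r" by (auto simp: stab_def)
  finally show ?thesis .
qed

lemma sign_perms_comp: "\<sigma> \<in> perms n \<Longrightarrow> \<tau> \<in> perms n \<Longrightarrow> sign (\<sigma> \<circ> \<tau>) = sign \<sigma> * sign \<tau>"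
  using sign_compose perms_permutation by blast

lemma sign_perms_inv: "\<sigma> \<in> perms n \<Longrightarrow> sign (inv \<sigma>) = sign \<sigma>"
  using sign_inverse perms_permutation by blast

lemma csym_left: "q \<in> stab n c \<Longrightarrow> csym n c (q \<circ> \<sigma>) = of_int (sign q) * csym n c \<sigma>"
  unfolding csym_def using stab_comp_iff_left[of q n c \<sigma>]
  by (auto simp: sign_perms_comp[OF stab_perms stab_perms])

lemma csym_inv: "\<sigma> \<in> perms n \<Longrightarrow> csym n c (inv \<sigma>) = csym n c \<sigma>"
  by (simp add: csym_def stab_inv_iff sign_perms_inv)

lemma rsym_inv: "\<sigma> \<in> perms n \<Longrightarrow> rsym n c (inv \<sigma>) = rsym n c \<sigma>"
  by (simp add: rsym_def stab_inv_iff)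

lemma sym_carrier [simp]: "rsym n r \<in> galg_carrier n" "csym n r \<in> galg_carrier n"
  "ysym n r c \<in> galg_carrier n"
  unfolding ysym_def using gm_carrier[of "csym n c" n]
  by (auto simp: galg_carrier_def rsym_def csym_def stab_def)

lemma gm_inv_cong:
  assumes \<sigma>: "\<sigma> \<in> perms n" and "\<And>\<tau>. \<tau> \<in> perms n \<Longrightarrow> x' \<tau> = x (inv \<tau>)" "\<And>\<tau>. \<tau> \<in> perms n \<Longrightarrow> y' \<tau> = y (inv \<tau>)"
  shows "galg_mult n x y (inv \<sigma>) = galg_mult n y' x' \<sigma>"
  unfolding gm_inv[OF \<sigma>] unfolding galg_mult_def
  by (intro sum.cong refl) (use assms perms_comp[OF perms_inv \<sigma>] in auto)

subsection \<open>Comparing two tableaux\<close>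

text \<open>Dominance order; \<open>g\<close> is the larger one.\<close>

definition dom :: "(nat \<Rightarrow> nat) \<Rightarrow> (nat \<Rightarrow> nat) \<Rightarrow> bool" where
  "dom f g \<longleftrightarrow> (\<forall>k. (\<Sum>i<k. f i) \<le> (\<Sum>i<k. g i))"

lemma dom_antisym: "dom f g \<Longrightarrow> dom g f \<Longrightarrow> f = g"
proof
  fix k assume "dom f g" "dom g f"
  then have *: "(\<Sum>i<k. f i) = (\<Sum>i<k. g i)" for k
    unfolding dom_def by (simp add: antisym)
  show "f k = g k" using *[of k] *[of "Suc k"] by simp
qed

lemma down_closed_eq:
  fixes A :: "nat set"
  assumes "finite A" "\<And>x i. x \<in> A \<Longrightarrow> i < x \<Longrightarrow> i \<in> A"
  shows "A = {..<card A}"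
proof -
  have "A = {..<k}" if "\<forall>x\<in>A. x < k" "k = (LEAST k. \<forall>x\<in>A. x < k)" for k
  proof -
    have "{..<k} \<subseteq> A"
    proof (cases k)
      case (Suc m)
      have "\<not> (\<forall>x\<in>A. x < m)"
        using that(2) Suc not_less_Least[of m "\<lambda>k. \<forall>x\<in>A. x < k"] by auto
      then obtain x where "x \<in> A" "m \<le> x" by auto
      then have "m \<in> A" using assms(2)[of x m] by (cases "x = m") auto
      then show ?thesis using assms(2) Suc by (auto simp: less_Suc_eq)
    qed auto
    then show ?thesis using that by auto
  qed
  moreover have "\<exists>k. \<forall>x\<in>A. x < k"
    using assms(1) finite_nat_set_iff_bounded by blast
  ultimately obtain k where "A = {..<k}" using LeastI_ex[of "\<lambda>k. \<forall>x\<in>A. x < k"] by blast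
  then show ?thesis by simp
qed

lemma tab_column:
  assumes t: "tab n r c f" and j: "C = {x. x < n \<and> c x = j}"
  shows "inj_on r C" "r ` C = {..<card C}" "finite C"
proof -
  show fin: "finite C" using j by auto
  show inj: "inj_on r C" using t unfolding tab_def inj_on_def j by auto
  have "r ` C = {..<card (r ` C)}"
  proof (rule down_closed_eq)
    fix x i assume "x \<in> r ` C" "i < x"
    then obtain y where "y < n" "c y = j" "i < r y" by (auto simp: j)
    then obtain z where "z < n" "c z = j" "r z = i" using t unfolding tab_def by metis
    then show "i \<in> r ` C" by (auto simp: j)
  qed (use fin in auto)
  then show "r ` C = {..<card C}" using card_image[OF inj] by simp
qed

lemma tab_rows_less:
  assumes t: "tab n r c f"
  shows "card {x. x < n \<and> r x < k} = (\<Sum>i<k. f i)"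
proof -
  have "{x. x < n \<and> r x < k} = (\<Union>i<k. {x. x < n \<and> r x = i})" by auto
  also have "card \<dots> = (\<Sum>i<k. card {x. x < n \<and> r x = i})"
    by (rule card_UN_disjoint) auto
  also have "\<dots> = (\<Sum>i<k. f i)" using t by (simp add: tab_def)
  finally show ?thesis .
qed

lemma card_by_columns:
  fixes c :: "nat \<Rightarrow> nat"
  shows "card {x. x < n \<and> Q x} = (\<Sum>j\<in>c ` {..<n}. card {x. x < n \<and> c x = j \<and> Q x})"
proof -
  have "{x. x < n \<and> Q x} = (\<Union>j\<in>c ` {..<n}. {x. x < n \<and> c x = j \<and> Q x})" by auto
  also have "card \<dots> = (\<Sum>j\<in>c ` {..<n}. card {x. x < n \<and> c x = j \<and> Q x})"
    by (rule card_UN_disjoint) auto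
  finally show ?thesis .
qed

lemma tab_column_card_less:
  assumes t: "tab n r c f"
  shows "card {x. x < n \<and> c x = j \<and> r x < k} = min k (card {x. x < n \<and> c x = j})"
proof -
  define C where "C = {x. x < n \<and> c x = j}"
  note C = tab_column[OF t C_def]
  have "card {x. x < n \<and> c x = j \<and> r x < k} = card (r ` {x \<in> C. r x < k})"
    by (subst card_image) (auto simp: C_def intro!: inj_on_subset[OF C(1)[unfolded C_def]] arg_cong[of _ _ card])
  also have "r ` {x \<in> C. r x < k} = r ` C \<inter> {..<k}" by auto
  also have "\<dots> = {..<min k (card C)}" using C(2) by auto
  finally show ?thesis by (simp add: C_def)
qed

lemma column_card_less_le:
  fixes n :: nat
  assumes "inj_on r {x. x < n \<and> c x = j}"
  shows "card {x. x < n \<and> c x = j \<and> r x < (k::nat)} \<le> min k (card {x. x < n \<and> c x = j})"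
proof -
  have "card {x. x < n \<and> c x = j \<and> r x < k} \<le> card {x. x < n \<and> c x = j}"
    by (rule card_mono[OF finite_subset[of _ "{..<n}"]]) auto
  moreover have "card {x. x < n \<and> c x = j \<and> r x < k} = card (r ` {x. x < n \<and> c x = j \<and> r x < k})"
    by (subst card_image) (auto intro!: inj_on_subset[OF assms])
  moreover have "\<dots> \<le> card {..<k}" by (rule card_mono) auto
  ultimately show ?thesis by simp
qed

text \<open>Count the entries with \<open>r x < k\<close> along the columns of \<open>c'\<close>.
  Within such a column the values of \<open>r\<close> are distinct, so at most \<open>min k\<close>
  of the column length lie below k, and the second tableau attains this bound in every column. If
  the shapes agree, all these bounds are equalities; then \<open>r\<close> runs through the rows of
  each column of \<open>c'\<close>, and q moves every entry inside its column to row
  \<open>r x\<close>.\<close>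

lemma no_pair_dom:
  assumes t: "tab n r c f" and t': "tab n r' c' f'"
    and no: "\<And>x y. x < n \<Longrightarrow> y < n \<Longrightarrow> r x = r y \<Longrightarrow> c' x = c' y \<Longrightarrow> x = y"
  shows "dom f f'"
    and "f = f' \<Longrightarrow> \<exists>q\<in>stab n c'. \<forall>x<n. r' (q x) = r x"
proof -
  have inj: "inj_on r {x. x < n \<and> c' x = j}" for j
    using no by (auto simp: inj_on_def)
  have le: "card {x. x < n \<and> c' x = j \<and> r x < k} \<le> card {x. x < n \<and> c' x = j \<and> r' x < k}" for j k
    using column_card_less_le[OF inj] tab_column_card_less[OF t'] by metis
  have rk: "(\<Sum>i<k. f i) = (\<Sum>j\<in>c' ` {..<n}. card {x. x < n \<and> c' x = j \<and> r x < k})" for k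
    using tab_rows_less[OF t, of k] card_by_columns[of n "\<lambda>x. r x < k" c'] by simp
  have rk': "(\<Sum>i<k. f' i) = (\<Sum>j\<in>c' ` {..<n}. card {x. x < n \<and> c' x = j \<and> r' x < k})" for k
    using tab_rows_less[OF t', of k] card_by_columns[of n "\<lambda>x. r' x < k" c'] by simp
  show "dom f f'"
    unfolding dom_def rk rk' by (auto intro!: sum_mono le)
  assume ff: "f = f'"
  have eq: "card {x. x < n \<and> c' x = j \<and> r x < k} = min k (card {x. x < n \<and> c' x = j})"
    if "j \<in> c' ` {..<n}" for j k
  proof -
    have "(\<Sum>j\<in>c' ` {..<n}. card {x. x < n \<and> c' x = j \<and> r x < k}) =
       (\<Sum>j\<in>c' ` {..<n}. card {x. x < n \<and> c' x = j \<and> r' x < k})"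
      using rk[of k] rk'[of k] ff by simp
    then have "card {x. x < n \<and> c' x = j \<and> r x < k} = card {x. x < n \<and> c' x = j \<and> r' x < k}"
      by (rule sum_mono_inv) (use le that in auto)
    then show ?thesis using tab_column_card_less[OF t'] by simp
  qed
  have ex: "\<exists>y<n. c' y = c' x \<and> r' y = r x" if x: "x < n" for x
  proof -
    define C where "C = {y. y < n \<and> c' y = c' x}"
    \<comment> \<open>With k the length of the column, equality says that every value of
      \<open>r\<close> on the column is below its length, so row \<open>r x\<close> meets the
      column.\<close>
    have "card {y \<in> C. r y < card C} = card C"
      using eq[of "c' x" "card C"] x by (simp add: C_def)
    then have "{y \<in> C. r y < card C} = C"
      by (intro card_subset_eq) (auto simp: C_def)
    then have "r x < card C" using x by (auto simp: C_def)
    then have "r x \<in> r' ` C" using tab_column(2)[OF t' C_def] by auto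
    then show ?thesis by (auto simp: C_def)
  qed
  define q where "q x = (if x < n then SOME y. y < n \<and> c' y = c' x \<and> r' y = r x else x)" for x
  have q: "q x < n" "c' (q x) = c' x" "r' (q x) = r x" if "x < n" for x
    using someI_ex[OF ex[OF that]] that unfolding q_def by auto
  have "inj_on q {..<n}"
    by (rule inj_onI) (metis q no lessThan_iff)
  moreover have "q ` {..<n} \<subseteq> {..<n}" using q by auto
  ultimately have "bij_betw q {..<n} {..<n}"
    by (simp add: bij_betw_def endo_inj_surj)
  then have "q permutes {..<n}"
    by (rule bij_imp_permutes) (auto simp: q_def)
  then show "\<exists>q\<in>stab n c'. \<forall>x<n. r' (q x) = r x"
    using q by (intro bexI[of _ q]) (auto simp: stab_def)
qed

lemma tab_comp:
  assumes t: "tab n r c f" and \<rho>: "\<rho> \<in> perms n"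
  shows "tab n (r \<circ> \<rho>) (c \<circ> \<rho>) f"
proof -
  have surj: "\<exists>y<n. \<rho> y = x" if "x < n" for x
    using that \<rho> perms_less[OF \<rho>, of "inv \<rho> x"] by (intro exI[of _ "inv \<rho> x"]) (auto simp: permutes_inverses)
  have inj: "x = y" if "\<rho> x = \<rho> y" for x y
    using that \<rho> permutes_inj[of \<rho> "{..<n}"] by (auto dest: injD)
  have im: "{x. x < n \<and> r x = i} = \<rho> ` {x. x < n \<and> r (\<rho> x) = i}" for i
    using surj perms_less[OF \<rho>] by auto
  have "card {x. x < n \<and> r x = i} = card {x. x < n \<and> r (\<rho> x) = i}" for i
    unfolding im[of i] by (rule card_image) (rule inj_on_subset[OF permutes_inj subset_UNIV], use \<rho> in simp)
  moreover have "\<exists>y<n. c (\<rho> y) = c (\<rho> x) \<and> r (\<rho> y) = i" if "x < n" "i < r (\<rho> x)" for x i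
  proof -
    have "\<exists>y<n. c y = c (\<rho> x) \<and> r y = i"
      using t that perms_less[OF \<rho>, of x] unfolding tab_def by blast
    then show ?thesis using surj by metis
  qed
  moreover have "x = y" if "x < n" "y < n" "r (\<rho> x) = r (\<rho> y)" "c (\<rho> x) = c (\<rho> y)" for x y
    by (rule inj) (use t that perms_less[OF \<rho>] in \<open>unfold tab_def, blast\<close>)
  ultimately show ?thesis
    using t unfolding tab_def by simp
qed

subsection \<open>The sandwich lemma\<close>

text \<open>The transposition of x and y lies in the row group and its conjugate by
  \<open>inv \<sigma>\<close> in the column group. Moving it through the product costs a sign, so
  the product is its own negative.\<close>

lemma sandwich_zero:
  assumes \<sigma>: "\<sigma> \<in> perms n" and xy: "x < n" "y < n" "x \<noteq> y" "r x = r y" "c (inv \<sigma> x) = c (inv \<sigma> y)"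
  shows "galg_mult n (rsym n r) (galg_mult n (galg_single \<sigma>) (csym n c)) = 0"
proof
  fix \<pi>
  define t where "t = transpose x y"
  define t' where "t' = transpose (inv \<sigma> x) (inv \<sigma> y)"
  have isp: "inv \<sigma> \<in> perms n" using \<sigma> by (rule perms_inv)
  have inj: "inj (inv \<sigma>)" using isp permutes_inj by blast
  have t: "t \<in> stab n r" using xy by (auto simp: t_def stab_def permutes_swap_id transpose_def)
  have t': "t' \<in> stab n c"
    using xy perms_less[OF isp] by (auto simp: t'_def stab_def permutes_swap_id transpose_def)
  have com: "inv \<sigma> \<circ> t = t' \<circ> inv \<sigma>"
    using inj by (auto simp: t_def t'_def fun_eq_iff transpose_def dest: injD)
  have st: "sign t' = -1" using xy inj by (auto simp: t'_def sign_swap_id dest: injD)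
  define S where "S = (\<Sum>\<tau>\<in>stab n r. csym n c (inv \<sigma> \<circ> (inv \<tau> \<circ> \<pi>)))"
  have "S = (\<Sum>\<tau>\<in>stab n r. csym n c (inv \<sigma> \<circ> (inv (\<tau> \<circ> t) \<circ> \<pi>)))"
    unfolding S_def by (rule sum_stab_right[OF t, symmetric])
  also have "\<dots> = (\<Sum>\<tau>\<in>stab n r. - csym n c (inv \<sigma> \<circ> (inv \<tau> \<circ> \<pi>)))"
  proof (rule sum.cong[OF refl])
    fix \<tau> assume \<tau>: "\<tau> \<in> stab n r"
    have "inv (\<tau> \<circ> t) = t \<circ> inv \<tau>"
      using perms_inv_comp[OF stab_perms[OF \<tau>] stab_perms[OF t]] by (simp add: t_def)
    then have "inv \<sigma> \<circ> (inv (\<tau> \<circ> t) \<circ> \<pi>) = t' \<circ> (inv \<sigma> \<circ> (inv \<tau> \<circ> \<pi>))"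
      using com by (simp add: o_assoc)
    then show "csym n c (inv \<sigma> \<circ> (inv (\<tau> \<circ> t) \<circ> \<pi>)) = - csym n c (inv \<sigma> \<circ> (inv \<tau> \<circ> \<pi>))"
      using csym_left[OF t'] st by simp
  qed
  also have "\<dots> = - S" by (simp add: S_def sum_negf)
  finally have "S = 0" by simp
  then show "galg_mult n (rsym n r) (galg_mult n (galg_single \<sigma>) (csym n c)) \<pi> = 0 \<pi>"
    by (simp add: gm_rsym gm_single_left[OF \<sigma>] S_def)
qed

lemma sandwich_not_dom:
  assumes t: "tab n r c f" and t': "tab n r' c' f'" and nd: "\<not> dom f f'" and \<sigma>: "\<sigma> \<in> perms n"
  shows "galg_mult n (rsym n r) (galg_mult n (galg_single \<sigma>) (csym n c')) = 0"
proof -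
  have "\<exists>x y. x < n \<and> y < n \<and> r x = r y \<and> (c' \<circ> inv \<sigma>) x = (c' \<circ> inv \<sigma>) y \<and> x \<noteq> y"
    using no_pair_dom(1)[OF t tab_comp[OF t' perms_inv[OF \<sigma>]]] nd by blast
  then show ?thesis using sandwich_zero[OF \<sigma>] by auto
qed

text \<open>Unless \<open>sandwich_zero\<close> applies, \<open>no_pair_dom\<close> for the tableau
  relabelled by \<open>inv \<sigma>\<close> yields \<open>inv \<sigma> = inv q' \<circ> p\<close>
  with p in the row group and q' in the column group. The row sum absorbs p, and q' leaves only its
  sign.\<close>

lemma sandwich_scalar:
  assumes t: "tab n r c f" and \<sigma>: "\<sigma> \<in> perms n"
  shows "\<exists>s. galg_mult n (rsym n r) (galg_mult n (galg_single \<sigma>) (csym n c)) = fscale s (ysym n r c)"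
proof (cases "\<exists>x y. x < n \<and> y < n \<and> r x = r y \<and> (c \<circ> inv \<sigma>) x = (c \<circ> inv \<sigma>) y \<and> x \<noteq> y")
  case True
  then have "galg_mult n (rsym n r) (galg_mult n (galg_single \<sigma>) (csym n c)) = 0"
    using sandwich_zero[OF \<sigma>] by auto
  then show ?thesis by (intro exI[of _ 0]) (auto simp: fscale_def)
next
  case False
  have isp: "inv \<sigma> \<in> perms n" using \<sigma> by (rule perms_inv)
  obtain q where q: "q \<in> stab n (c \<circ> inv \<sigma>)" "\<forall>x<n. r (inv \<sigma> (q x)) = r x"
    using no_pair_dom(2)[OF t tab_comp[OF t isp]] False by auto
  define p where "p = inv \<sigma> \<circ> q"
  define q' where "q' = inv \<sigma> \<circ> q \<circ> \<sigma>"
  have qp: "q \<in> perms n" using q(1) stab_perms by auto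
  have p: "p \<in> stab n r" using q isp qp perms_comp[OF isp qp] by (auto simp: p_def stab_def)
  have q': "q' \<in> stab n c"
  proof -
    have "c (q' x) = c x" if "x < n" for x
    proof -
      have "(c \<circ> inv \<sigma>) (q (\<sigma> x)) = (c \<circ> inv \<sigma>) (\<sigma> x)"
        using q(1) perms_less[OF \<sigma>, of x] that by (simp add: stab_def)
      then show ?thesis using \<sigma> by (simp add: q'_def permutes_inverses)
    qed
    then show ?thesis using perms_comp[OF perms_comp[OF isp qp] \<sigma>] by (simp add: stab_def q'_def)
  qed
  have "inv q' \<circ> p = inv q' \<circ> (q' \<circ> inv \<sigma>)"
    using \<sigma> by (simp add: p_def q'_def perms_cancel(5))
  then have eq: "inv \<sigma> = inv q' \<circ> p"
    using perms_cancel(3)[OF stab_perms[OF q']] by simp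
  have "galg_mult n (rsym n r) (galg_mult n (galg_single \<sigma>) (csym n c)) \<pi> =
      of_int (sign q') * ysym n r c \<pi>" for \<pi>
  proof -
    have "galg_mult n (rsym n r) (galg_mult n (galg_single \<sigma>) (csym n c)) \<pi> =
      (\<Sum>\<tau>\<in>stab n r. csym n c (inv q' \<circ> (p \<circ> (inv \<tau> \<circ> \<pi>))))"
      by (simp add: gm_rsym gm_single_left[OF \<sigma>] eq o_assoc)
    also have "\<dots> = (\<Sum>\<tau>\<in>stab n r. of_int (sign q') * csym n c (p \<circ> (inv \<tau> \<circ> \<pi>)))"
      by (simp add: csym_left[OF stab_inv[OF q']] sign_perms_inv[OF stab_perms[OF q']])
    also have "\<dots> = (\<Sum>\<tau>\<in>stab n r. of_int (sign q') * csym n c (p \<circ> (inv (\<tau> \<circ> p) \<circ> \<pi>)))"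
      by (rule sum_stab_right[OF p, symmetric])
    also have "\<dots> = (\<Sum>\<tau>\<in>stab n r. of_int (sign q') * csym n c (inv \<tau> \<circ> \<pi>))"
    proof (rule sum.cong[OF refl])
      fix \<tau> assume \<tau>: "\<tau> \<in> stab n r"
      have "p \<circ> (inv (\<tau> \<circ> p) \<circ> \<pi>) = inv \<tau> \<circ> \<pi>"
        using perms_inv_comp[OF stab_perms[OF \<tau>] stab_perms[OF p]] perms_cancel(4)[OF stab_perms[OF p]]
        by (simp add: o_assoc[symmetric])
      then show "of_int (sign q') * csym n c (p \<circ> (inv (\<tau> \<circ> p) \<circ> \<pi>)) = of_int (sign q') * csym n c (inv \<tau> \<circ> \<pi>)"
        by simp
    qed
    finally show ?thesis by (simp add: ysym_def gm_rsym sum_distrib_left)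
  qed
  then show ?thesis by (intro exI[of _ "of_int (sign q')"]) (auto simp: fscale_def)
qed

subsection \<open>Primitive idempotents\<close>

lemma tab_stab_trivial:
  assumes t: "tab n r c f" and "\<tau> \<in> stab n r" "\<tau> \<in> stab n c"
  shows "\<tau> = id"
proof (rule perms_eqI[OF stab_perms[OF assms(2)] perms_id])
  fix x assume x: "x < n"
  have "\<tau> x < n" using perms_less[OF stab_perms[OF assms(2)]] x by simp
  moreover have "r (\<tau> x) = r x" "c (\<tau> x) = c x" using assms x by (auto simp: stab_def)
  ultimately show "\<tau> x = id x" using t x unfolding tab_def by auto
qed

text \<open>Row group and column group meet only in \<open>id\<close>. Hence \<open>yk\<close>, the
  value of the square of the symmetrizer at \<open>id\<close>, is the scalar by which the square
  differs from the symmetrizer.\<close>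

lemma ysym_id:
  assumes t: "tab n r c f"
  shows "ysym n r c id = 1"
proof -
  have "ysym n r c id = (\<Sum>\<tau>\<in>stab n r. csym n c (inv \<tau>))"
    by (simp add: ysym_def gm_rsym)
  also have "\<dots> = (\<Sum>\<tau>\<in>stab n r. csym n c \<tau>)"
    by (rule sum_stab_inv)
  also have "\<dots> = (\<Sum>\<tau>\<in>stab n r. if \<tau> = id then 1 else 0)"
    by (intro sum.cong refl) (use tab_stab_trivial[OF t] in \<open>auto simp: csym_def\<close>)
  also have "\<dots> = 1" by simp
  finally show ?thesis .
qed

lemma gm_rsym_rsym: "galg_mult n (rsym n r) (rsym n r) = fscale (of_nat (card (stab n r))) (rsym n r)"
proof
  fix \<pi>
  have "(\<Sum>\<tau>\<in>stab n r. rsym n r (inv \<tau> \<circ> \<pi>)) = (\<Sum>\<tau>\<in>stab n r. rsym n r \<pi>)"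
    by (intro sum.cong refl) (simp add: rsym_def stab_comp_iff_left stab_inv)
  then show "galg_mult n (rsym n r) (rsym n r) \<pi> = fscale (of_nat (card (stab n r))) (rsym n r) \<pi>"
    by (simp add: gm_rsym fscale_def)
qed

lemma gm_csym: "galg_mult n (csym n c) y \<pi> = (\<Sum>\<tau>\<in>stab n c. of_int (sign \<tau>) * y (inv \<tau> \<circ> \<pi>))"
proof -
  have "galg_mult n (csym n c) y \<pi> = (\<Sum>\<tau>\<in>perms n. if \<tau> \<in> stab n c then of_int (sign \<tau>) * y (inv \<tau> \<circ> \<pi>) else 0)"
    unfolding galg_mult_def csym_def by (intro sum.cong) auto
  also have "\<dots> = (\<Sum>\<tau>\<in>perms n \<inter> stab n c. of_int (sign \<tau>) * y (inv \<tau> \<circ> \<pi>))"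
    by (subst sum.inter_restrict) auto
  also have "perms n \<inter> stab n c = stab n c" by (auto simp: stab_def)
  finally show ?thesis .
qed

lemma gm_csym_csym: "galg_mult n (csym n c) (csym n c) = fscale (of_nat (card (stab n c))) (csym n c)"
proof
  fix \<pi>
  have sq: "of_int (sign \<tau>) * (of_int (sign \<tau>) * z) = (z::complex)" for \<tau> :: "nat \<Rightarrow> nat" and z
    by (metis mult.assoc mult_1 of_int_1 of_int_mult sign_idempotent)
  have "(\<Sum>\<tau>\<in>stab n c. of_int (sign \<tau>) * csym n c (inv \<tau> \<circ> \<pi>)) = (\<Sum>\<tau>\<in>stab n c. csym n c \<pi>)"
    by (intro sum.cong refl) (simp add: csym_left stab_inv sign_perms_inv[OF stab_perms] sq)
  then show "galg_mult n (csym n c) (csym n c) \<pi> = fscale (of_nat (card (stab n c))) (csym n c) \<pi>"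
    by (simp add: gm_csym fscale_def)
qed

lemma sandwich:
  assumes t: "tab n r c f"
  shows "\<exists>s. galg_mult n (rsym n r) (galg_mult n x (csym n c)) = fscale s (ysym n r c)"
proof -
  obtain \<phi> where \<phi>: "\<And>\<sigma>. \<sigma> \<in> perms n \<Longrightarrow>
      galg_mult n (rsym n r) (galg_mult n (galg_single \<sigma>) (csym n c)) = fscale (\<phi> \<sigma>) (ysym n r c)"
    using sandwich_scalar[OF t] by metis
  have "galg_mult n (rsym n r) (galg_mult n x (csym n c)) \<pi> =
      fscale (\<Sum>\<sigma>\<in>perms n. x \<sigma> * \<phi> \<sigma>) (ysym n r c) \<pi>" for \<pi>
    by (subst gm_expand_middle) (simp add: \<phi> fscale_def sum_distrib_right mult.assoc)
  then show ?thesis by blast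
qed

definition yk :: "nat \<Rightarrow> (nat \<Rightarrow> nat) \<Rightarrow> (nat \<Rightarrow> nat) \<Rightarrow> complex" where
  "yk n r c = galg_mult n (ysym n r c) (ysym n r c) id"

lemma ysym_sq:
  assumes t: "tab n r c f"
  shows "galg_mult n (ysym n r c) (ysym n r c) = fscale (yk n r c) (ysym n r c)"
proof -
  have "galg_mult n (ysym n r c) (ysym n r c) =
    galg_mult n (rsym n r) (galg_mult n (galg_mult n (csym n c) (rsym n r)) (csym n c))"
    by (simp add: ysym_def gm_assoc)
  then obtain s where s: "galg_mult n (ysym n r c) (ysym n r c) = fscale s (ysym n r c)"
    using sandwich[OF t] by metis
  then have "yk n r c = s" by (simp add: yk_def fscale_def ysym_id[OF t])
  then show ?thesis using s by simp
qed

lemma gm_Reals: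
  assumes "\<And>\<tau>. x \<tau> \<in> \<real>" "\<And>\<tau>. y \<tau> \<in> \<real>"
  shows "galg_mult n x y \<sigma> \<in> \<real>"
  unfolding galg_mult_def using assms by (auto intro!: sum_in_Reals Reals_mult)

lemma sym_Reals: "rsym n r \<sigma> \<in> \<real>" "csym n c \<sigma> \<in> \<real>"
  by (auto simp: rsym_def csym_def)

text \<open>At \<open>id\<close>, the product of x with its adjoint y is the sum of the squares of
  the real coefficients of x.\<close>

lemma gm_adjoint_zero:
  assumes x: "\<And>\<tau>. x \<tau> \<in> \<real>" and y: "\<And>\<tau>. \<tau> \<in> perms n \<Longrightarrow> y (inv \<tau>) = x \<tau>"
    and z: "galg_mult n x y id = 0" and \<sigma>: "\<sigma> \<in> perms n"
  shows "x \<sigma> = 0"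
proof -
  have "galg_mult n x y id = (\<Sum>\<tau>\<in>perms n. x \<tau> * x \<tau>)"
    unfolding galg_mult_def by (intro sum.cong refl) (simp add: y)
  also have "\<dots> = of_real (\<Sum>\<tau>\<in>perms n. (Re (x \<tau>))\<^sup>2)"
    unfolding of_real_sum by (intro sum.cong refl)
      (use x in \<open>auto simp: complex_is_Real_iff complex_eq_iff power2_eq_square\<close>)
  finally have "of_real (\<Sum>\<tau>\<in>perms n. (Re (x \<tau>))\<^sup>2) = (0::complex)" using z by metis
  then have "(\<Sum>\<tau>\<in>perms n. (Re (x \<tau>))\<^sup>2) = 0" by (simp only: of_real_eq_0_iff)
  then have "Re (x \<sigma>) = 0" using \<sigma> by (simp add: sum_nonneg_eq_0_iff)
  then show ?thesis using x[of \<sigma>] by (simp add: complex_is_Real_iff complex_eq_iff)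
qed

text \<open>
  If \<open>(ab)\<^sup>2 = 0\<close> then the self-adjoint element \<open>aba\<close> squares to \<open>0\<close>, so it vanishes; then so does
  \<open>(ab)(ab)\<^sup>* = |C| aba\<close>, hence \<open>ab = 0\<close>.
\<close>

lemma yk_nonzero:
  assumes t: "tab n r c f"
  shows "yk n r c \<noteq> 0"
proof
  assume "yk n r c = 0"
  define a where "a = rsym n r"
  define b where "b = csym n c"
  define h where "h = galg_mult n (galg_mult n a b) a"
  have z: "galg_mult n (galg_mult n a b) (galg_mult n a b) = 0"
    using ysym_sq[OF t] \<open>yk n r c = 0\<close> by (auto simp: a_def b_def ysym_def fscale_def)
  have R: "a \<tau> \<in> \<real>" "b \<tau> \<in> \<real>" for \<tau> by (auto simp: a_def b_def sym_Reals)
  have inv: "a (inv \<tau>) = a \<tau>" "b (inv \<tau>) = b \<tau>" if "\<tau> \<in> perms n" for \<tau>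
    using that by (simp_all add: a_def b_def rsym_inv csym_inv)
  have "galg_mult n h h = galg_mult n (galg_mult n a b) (galg_mult n (galg_mult n a a) (galg_mult n b a))"
    by (simp add: h_def gm_assoc)
  also have "\<dots> = fscale (of_nat (card (stab n r))) (galg_mult n (galg_mult n (galg_mult n a b) (galg_mult n a b)) a)"
    by (simp add: a_def gm_rsym_rsym gm_scale_left gm_scale_right gm_assoc)
  finally have hh: "galg_mult n h h = 0" by (simp add: z fscale_def fun_eq_iff)
  have h_inv: "h (inv \<tau>) = h \<tau>" if \<tau>: "\<tau> \<in> perms n" for \<tau>
  proof -
    have "h (inv \<tau>) = galg_mult n a (galg_mult n b a) \<tau>"
      unfolding h_def by (rule gm_inv_cong[OF \<tau>]) (auto simp: inv intro!: gm_inv_cong[symmetric])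
    then show ?thesis by (simp add: h_def gm_assoc)
  qed
  have h_Re: "h \<tau> \<in> \<real>" for \<tau>
    unfolding h_def by (intro gm_Reals R)
  have hz: "h \<sigma> = 0" if "\<sigma> \<in> perms n" for \<sigma>
    by (rule gm_adjoint_zero[where y = h and n = n]) (use h_inv hh h_Re that in auto)
  have "galg_mult n (galg_mult n a b) (galg_mult n b a) = galg_mult n a (galg_mult n (galg_mult n b b) a)"
    by (simp add: gm_assoc)
  also have "\<dots> = fscale (of_nat (card (stab n c))) h"
    by (simp add: b_def gm_csym_csym gm_scale_left gm_scale_right gm_assoc h_def)
  finally have "galg_mult n (galg_mult n a b) (galg_mult n b a) id = 0"
    using hz[OF perms_id] by (simp add: fscale_def)
  then have "galg_mult n a b id = 0"
    by (rule gm_adjoint_zero[rotated 2]) (auto simp: inv permutes_id intro!: gm_Reals R gm_inv_cong)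
  then show False using ysym_id[OF t] by (simp add: ysym_def a_def b_def)
qed

definition ye :: "nat \<Rightarrow> (nat \<Rightarrow> nat) \<Rightarrow> (nat \<Rightarrow> nat) \<Rightarrow> galg" where
  "ye n r c = fscale (1 / yk n r c) (ysym n r c)"

lemma ye_idem:
  assumes t: "tab n r c f"
  shows "galg_mult n (ye n r c) (ye n r c) = ye n r c"
  using yk_nonzero[OF t] by (simp add: ye_def gm_scale_left gm_scale_right ysym_sq[OF t])

lemma ye_id: "tab n r c f \<Longrightarrow> ye n r c id \<noteq> 0"
  using yk_nonzero by (simp add: ye_def fscale_def ysym_id)

text \<open>Every \<open>e \<sigma> e\<close> is a multiple \<open>\<phi> \<sigma>\<close> of e, so
  the left side is the sum of all \<open>e \<sigma> * \<phi> \<sigma>\<close>. Expanding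
  \<open>e e e = e\<close> in the middle factor and comparing values at \<open>id\<close> shows that
  this sum is 1. Through \<open>ip_chr_chr\<close> it becomes the norm of a character.\<close>

lemma ye_trace_same:
  assumes t: "tab n r c f"
  shows "(\<Sum>\<sigma>\<in>perms n. galg_mult n (ye n r c) (galg_mult n (galg_single \<sigma>) (ye n r c)) \<sigma>) = 1"
proof -
  define e where "e = ye n r c"
  have "\<exists>s. galg_mult n e (galg_mult n (galg_single \<sigma>) e) = fscale s e" for \<sigma>
  proof -
    have "galg_mult n e (galg_mult n (galg_single \<sigma>) e) = fscale (1 / yk n r c * (1 / yk n r c)) (galg_mult n (rsym n r)
        (galg_mult n (galg_mult n (csym n c) (galg_mult n (galg_single \<sigma>) (rsym n r))) (csym n c)))"
      by (simp add: e_def ye_def ysym_def gm_scale_left gm_scale_right gm_assoc)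
    moreover obtain s where "galg_mult n (rsym n r)
        (galg_mult n (galg_mult n (csym n c) (galg_mult n (galg_single \<sigma>) (rsym n r))) (csym n c)) = fscale s (ysym n r c)"
      using sandwich[OF t] by blast
    moreover have "ysym n r c = fscale (yk n r c) e"
      using yk_nonzero[OF t] by (simp add: e_def ye_def)
    ultimately show ?thesis by auto
  qed
  then obtain \<phi> where \<phi>: "\<And>\<sigma>. galg_mult n e (galg_mult n (galg_single \<sigma>) e) = fscale (\<phi> \<sigma>) e"
    by metis
  have "e id = galg_mult n e (galg_mult n e e) id"
    using ye_idem[OF t] by (simp add: e_def)
  also have "\<dots> = (\<Sum>\<sigma>\<in>perms n. e \<sigma> * \<phi> \<sigma>) * e id"
    by (subst gm_expand_middle) (simp add: \<phi> fscale_def sum_distrib_right mult.assoc)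
  finally have "(\<Sum>\<sigma>\<in>perms n. e \<sigma> * \<phi> \<sigma>) = 1"
    using ye_id[OF t] by (simp add: e_def)
  then show ?thesis by (simp add: e_def[symmetric] \<phi> fscale_def mult.commute)
qed

text \<open>The image of \<open>sandwich_not_dom\<close> under inversion, which reverses the order
  of the factors; hence the two shapes trade places in the hypothesis.\<close>

lemma rc_sandwich_not_dom:
  assumes t: "tab n r c f" and t': "tab n r' c' f'" and nd: "\<not> dom f' f" and \<sigma>: "\<sigma> \<in> perms n"
  shows "galg_mult n (csym n c) (galg_mult n (galg_single \<sigma>) (rsym n r')) = 0"
proof
  fix \<pi>
  show "galg_mult n (csym n c) (galg_mult n (galg_single \<sigma>) (rsym n r')) \<pi> = 0 \<pi>"
  proof (cases "\<pi> \<in> perms n")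
    case True
    have sg: "galg_single (inv \<sigma>) \<tau> = galg_single \<sigma> (inv \<tau>)" if "\<tau> \<in> perms n" for \<tau>
      using perms_inv_inv[OF \<sigma>] perms_inv_inv[OF that] by (auto simp: galg_single_def)
    have "galg_mult n (csym n c) (galg_mult n (galg_single \<sigma>) (rsym n r')) (inv (inv \<pi>)) =
       galg_mult n (galg_mult n (rsym n r') (galg_single (inv \<sigma>))) (csym n c) (inv \<pi>)"
      by (intro gm_inv_cong[OF perms_inv[OF True]])
        (auto simp: csym_inv rsym_inv sg intro!: gm_inv_cong[symmetric])
    then show ?thesis
      using sandwich_not_dom[OF t' t nd perms_inv[OF \<sigma>]] perms_inv_inv[OF True] by (simp add: gm_assoc)
  next
    case False
    have "galg_mult n (csym n c) (galg_mult n (galg_single \<sigma>) (rsym n r')) \<in> galg_carrier n"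
      by (intro gm_carrier) auto
    then show ?thesis using False by (simp add: galg_carrier_def)
  qed
qed

text \<open>Distinct shapes cannot dominate each other in both directions. So in
  \<open>a b \<sigma> a' b'\<close> either the inner part \<open>b \<sigma> a'\<close> vanishes or
  the outer sandwich of \<open>a\<close> and \<open>b'\<close> does.\<close>

lemma ye_orthogonal:
  assumes t: "tab n r c f" and t': "tab n r' c' f'" and ne: "f \<noteq> f'" and \<sigma>: "\<sigma> \<in> perms n"
  shows "galg_mult n (ye n r c) (galg_mult n (galg_single \<sigma>) (ye n r' c')) = 0"
proof -
  have "galg_mult n (rsym n r) (galg_mult n (galg_mult n (csym n c) (galg_mult n (galg_single \<sigma>) (rsym n r'))) (csym n c')) = 0"
  proof (cases "dom f f'")
    case True
    then have "\<not> dom f' f" using ne dom_antisym by blast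
    then show ?thesis using rc_sandwich_not_dom[OF t t' _ \<sigma>] by simp
  next
    case False
    show ?thesis
      by (rule ext, subst gm_expand_middle) (simp add: sandwich_not_dom[OF t t' False])
  qed
  then show ?thesis
    by (simp add: ye_def ysym_def gm_scale_left gm_scale_right gm_assoc)
qed

section \<open>Characters\<close>

text \<open>For an idempotent x this is the character of the left ideal that x generates, as the
  trace of right multiplication by x followed by left multiplication by \<sigma>. The inverse arises
  because x is evaluated at \<open>inv (\<sigma> \<circ> \<tau>) \<circ> \<tau>\<close>.\<close>

definition chr :: "nat \<Rightarrow> galg \<Rightarrow> (nat \<Rightarrow> nat) \<Rightarrow> complex" where
  "chr n x \<sigma> = (\<Sum>\<tau>\<in>perms n. x (inv \<tau> \<circ> (inv \<sigma> \<circ> \<tau>)))"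

text \<open>Bilinear: \<open>g (inv \<sigma>)\<close> stands where the usual inner product has the
  complex conjugate, and agrees with it on characters.\<close>

definition ip :: "nat \<Rightarrow> ((nat \<Rightarrow> nat) \<Rightarrow> complex) \<Rightarrow> ((nat \<Rightarrow> nat) \<Rightarrow> complex) \<Rightarrow> complex" where
  "ip n f g = (\<Sum>\<sigma>\<in>perms n. f \<sigma> * g (inv \<sigma>)) / fact n"

definition class_fun :: "nat \<Rightarrow> ((nat \<Rightarrow> nat) \<Rightarrow> complex) \<Rightarrow> bool" where
  "class_fun n \<psi> \<longleftrightarrow> (\<forall>\<sigma>\<in>perms n. \<forall>\<tau>\<in>perms n. \<psi> (inv \<tau> \<circ> (\<sigma> \<circ> \<tau>)) = \<psi> \<sigma>)"

lemma sum_perms_conj': "\<tau> \<in> perms n \<Longrightarrow> (\<Sum>\<sigma>\<in>perms n. f (inv \<tau> \<circ> (\<sigma> \<circ> \<tau>))) = (\<Sum>\<sigma>\<in>perms n. f \<sigma>)"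
  using sum_perms_conj[of \<tau> n f] by (simp add: comp_assoc)

lemma conj_inv:
  assumes "\<tau> \<in> perms n" "\<sigma> \<in> perms n"
  shows "inv (inv \<tau> \<circ> (\<sigma> \<circ> \<tau>)) = inv \<tau> \<circ> (inv \<sigma> \<circ> \<tau>)"
  using perms_inv_comp[OF perms_inv[OF assms(1)] perms_comp[OF assms(2,1)]] perms_inv_comp[OF assms(2,1)]
    perms_inv_inv[OF assms(1)] by (simp add: comp_assoc)

text \<open>\<open>chr n x\<close> collects the values of x over conjugates, and a class function
  does not see conjugation.\<close>

lemma ip_chr_class:
  assumes \<psi>: "class_fun n \<psi>"
  shows "ip n (chr n x) \<psi> = (\<Sum>\<sigma>\<in>perms n. x \<sigma> * \<psi> \<sigma>)"
proof -
  have "(\<Sum>\<sigma>\<in>perms n. chr n x \<sigma> * \<psi> (inv \<sigma>)) =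
     (\<Sum>\<sigma>\<in>perms n. chr n x (inv \<sigma>) * \<psi> (inv (inv \<sigma>)))"
    by (rule sum_perms_inv[symmetric])
  also have "\<dots> = (\<Sum>\<sigma>\<in>perms n. \<Sum>\<tau>\<in>perms n. x (inv \<tau> \<circ> (\<sigma> \<circ> \<tau>)) * \<psi> (inv \<tau> \<circ> (\<sigma> \<circ> \<tau>)))"
  proof (rule sum.cong[OF refl])
    fix \<sigma> assume \<sigma>: "\<sigma> \<in> perms n"
    have "chr n x (inv \<sigma>) * \<psi> (inv (inv \<sigma>)) = (\<Sum>\<tau>\<in>perms n. x (inv \<tau> \<circ> (\<sigma> \<circ> \<tau>)) * \<psi> \<sigma>)"
      using perms_inv_inv[OF \<sigma>] by (simp add: chr_def sum_distrib_right)
    also have "\<dots> = (\<Sum>\<tau>\<in>perms n. x (inv \<tau> \<circ> (\<sigma> \<circ> \<tau>)) * \<psi> (inv \<tau> \<circ> (\<sigma> \<circ> \<tau>)))"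
      by (intro sum.cong refl) (use \<psi> \<sigma> in \<open>auto simp: class_fun_def\<close>)
    finally show "chr n x (inv \<sigma>) * \<psi> (inv (inv \<sigma>)) =
      (\<Sum>\<tau>\<in>perms n. x (inv \<tau> \<circ> (\<sigma> \<circ> \<tau>)) * \<psi> (inv \<tau> \<circ> (\<sigma> \<circ> \<tau>)))" .
  qed
  also have "\<dots> = (\<Sum>\<tau>\<in>perms n. \<Sum>\<sigma>\<in>perms n. x (inv \<tau> \<circ> (\<sigma> \<circ> \<tau>)) * \<psi> (inv \<tau> \<circ> (\<sigma> \<circ> \<tau>)))"
    by (rule sum.swap)
  also have "\<dots> = (\<Sum>\<tau>\<in>perms n. \<Sum>\<sigma>\<in>perms n. x \<sigma> * \<psi> \<sigma>)"
    by (intro sum.cong refl sum_perms_conj'[where f = "\<lambda>\<sigma>. x \<sigma> * \<psi> \<sigma>"])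
  finally show ?thesis
    by (simp add: ip_def card_perms)
qed

lemma class_fun_chr: "class_fun n (chr n x)"
  unfolding class_fun_def
proof (intro ballI)
  fix \<sigma> \<tau> assume s: "\<sigma> \<in> perms n" "\<tau> \<in> perms n"
  have "chr n x (inv \<tau> \<circ> (\<sigma> \<circ> \<tau>)) = (\<Sum>\<rho>\<in>perms n. x (inv (\<tau> \<circ> \<rho>) \<circ> (inv \<sigma> \<circ> (\<tau> \<circ> \<rho>))))"
    unfolding chr_def conj_inv[OF s(2,1)]
    by (intro sum.cong refl) (simp add: perms_inv_comp[OF s(2)] comp_assoc)
  also have "\<dots> = chr n x \<sigma>"
    unfolding chr_def by (rule sum_perms_left[OF s(2)])
  finally show "chr n x (inv \<tau> \<circ> (\<sigma> \<circ> \<tau>)) = chr n x \<sigma>" .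
qed

text \<open>The right side is the trace of \<open>z \<mapsto> x z y\<close> on the group algebra.
  For idempotents x and y this operator is idempotent, which turns inner products into
  dimensions.\<close>

lemma ip_chr_chr:
  "ip n (chr n x) (chr n y) = (\<Sum>\<pi>\<in>perms n. galg_mult n x (galg_mult n (galg_single \<pi>) y) \<pi>)"
proof -
  have "ip n (chr n x) (chr n y) = (\<Sum>\<sigma>\<in>perms n. x \<sigma> * chr n y \<sigma>)"
    by (rule ip_chr_class[OF class_fun_chr])
  also have "\<dots> = (\<Sum>\<sigma>\<in>perms n. \<Sum>\<pi>\<in>perms n. x \<sigma> * y (inv \<pi> \<circ> (inv \<sigma> \<circ> \<pi>)))"
    by (simp add: chr_def sum_distrib_left)
  also have "\<dots> = (\<Sum>\<pi>\<in>perms n. \<Sum>\<sigma>\<in>perms n. x \<sigma> * y (inv \<pi> \<circ> (inv \<sigma> \<circ> \<pi>)))"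
    by (rule sum.swap)
  also have "\<dots> = (\<Sum>\<pi>\<in>perms n. galg_mult n x (galg_mult n (galg_single \<pi>) y) \<pi>)"
    by (intro sum.cong refl) (simp add: gm_single_left, simp add: galg_mult_def)
  finally show ?thesis .
qed

text \<open>Trace property; it lets the row factor and the column factor of a Young symmetrizer
  change places.\<close>

lemma chr_mult_commute:
  assumes \<sigma>: "\<sigma> \<in> perms n"
  shows "chr n (galg_mult n x y) \<sigma> = chr n (galg_mult n y x) \<sigma>"
proof -
  define s where "s = inv \<sigma>"
  have s: "s \<in> perms n" using \<sigma> perms_inv by (simp add: s_def)
  have "chr n (galg_mult n x y) \<sigma> = (\<Sum>\<rho>\<in>perms n. \<Sum>\<tau>\<in>perms n. x \<rho> * y (inv \<rho> \<circ> (inv \<tau> \<circ> (s \<circ> \<tau>))))"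
    unfolding chr_def galg_mult_def s_def by (rule sum.swap)
  also have "\<dots> = (\<Sum>\<rho>\<in>perms n. \<Sum>\<tau>\<in>perms n. x \<rho> * y (inv \<tau> \<circ> (s \<circ> (\<tau> \<circ> inv \<rho>))))"
  proof (rule sum.cong[OF refl])
    fix \<rho> assume \<rho>: "\<rho> \<in> perms n"
    have "(\<Sum>\<tau>\<in>perms n. x \<rho> * y (inv \<tau> \<circ> (s \<circ> (\<tau> \<circ> inv \<rho>)))) =
      (\<Sum>\<tau>\<in>perms n. x \<rho> * y (inv (\<tau> \<circ> \<rho>) \<circ> (s \<circ> ((\<tau> \<circ> \<rho>) \<circ> inv \<rho>))))"
      by (rule sum_perms_right[OF \<rho>, symmetric])
    also have "\<dots> = (\<Sum>\<tau>\<in>perms n. x \<rho> * y (inv \<rho> \<circ> (inv \<tau> \<circ> (s \<circ> \<tau>))))"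
    proof (rule sum.cong[OF refl])
      fix \<tau> assume \<tau>: "\<tau> \<in> perms n"
      have "inv (\<tau> \<circ> \<rho>) \<circ> (s \<circ> ((\<tau> \<circ> \<rho>) \<circ> inv \<rho>)) = inv \<rho> \<circ> (inv \<tau> \<circ> (s \<circ> \<tau>))"
        unfolding perms_cancel(5)[OF \<rho>] perms_inv_comp[OF \<tau> \<rho>] by (simp add: comp_assoc)
      then show "x \<rho> * y (inv (\<tau> \<circ> \<rho>) \<circ> (s \<circ> ((\<tau> \<circ> \<rho>) \<circ> inv \<rho>))) = x \<rho> * y (inv \<rho> \<circ> (inv \<tau> \<circ> (s \<circ> \<tau>)))"
        by simp
    qed
    finally show "(\<Sum>\<tau>\<in>perms n. x \<rho> * y (inv \<rho> \<circ> (inv \<tau> \<circ> (s \<circ> \<tau>)))) =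
      (\<Sum>\<tau>\<in>perms n. x \<rho> * y (inv \<tau> \<circ> (s \<circ> (\<tau> \<circ> inv \<rho>))))" by simp
  qed
  also have "\<dots> = (\<Sum>\<tau>\<in>perms n. \<Sum>\<rho>\<in>perms n. x \<rho> * y (inv \<tau> \<circ> (s \<circ> (\<tau> \<circ> inv \<rho>))))"
    by (rule sum.swap)
  also have "\<dots> = chr n (galg_mult n y x) \<sigma>"
    unfolding chr_def galg_mult_def s_def[symmetric]
  proof (rule sum.cong[OF refl])
    fix \<tau> assume \<tau>: "\<tau> \<in> perms n"
    define u where "u = inv \<tau> \<circ> (s \<circ> \<tau>)"
    have u: "u \<in> perms n" unfolding u_def by (intro perms_comp perms_inv s \<tau>)
    have "(\<Sum>\<rho>\<in>perms n. y \<rho> * x (inv \<rho> \<circ> u)) = (\<Sum>\<rho>\<in>perms n. y (u \<circ> \<rho>) * x (inv (u \<circ> \<rho>) \<circ> u))"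
      by (rule sum_perms_left[OF u, symmetric])
    also have "\<dots> = (\<Sum>\<rho>\<in>perms n. y (u \<circ> inv \<rho>) * x (inv (u \<circ> inv \<rho>) \<circ> u))"
      by (rule sum_perms_inv[symmetric])
    also have "\<dots> = (\<Sum>\<rho>\<in>perms n. y (u \<circ> inv \<rho>) * x \<rho>)"
    proof (rule sum.cong[OF refl])
      fix \<rho> assume \<rho>: "\<rho> \<in> perms n"
      have "inv (u \<circ> inv \<rho>) \<circ> u = \<rho>"
        unfolding perms_inv_comp[OF u perms_inv[OF \<rho>]] perms_inv_inv[OF \<rho>] by (rule perms_cancel(6)[OF u])
      then show "y (u \<circ> inv \<rho>) * x (inv (u \<circ> inv \<rho>) \<circ> u) = y (u \<circ> inv \<rho>) * x \<rho>" by simp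
    qed
    finally show "(\<Sum>\<rho>\<in>perms n. x \<rho> * y (inv \<tau> \<circ> (s \<circ> (\<tau> \<circ> inv \<rho>)))) =
      (\<Sum>\<rho>\<in>perms n. y \<rho> * x (inv \<rho> \<circ> (inv \<tau> \<circ> (s \<circ> \<tau>))))"
      by (simp add: u_def comp_assoc mult.commute)
  qed
  finally show ?thesis .
qed

lemma chr_inv:
  assumes \<sigma>: "\<sigma> \<in> perms n"
  shows "chr n x (inv \<sigma>) = chr n (\<lambda>\<tau>. x (inv \<tau>)) \<sigma>"
  unfolding chr_def perms_inv_inv[OF \<sigma>]
proof (rule sum.cong[OF refl])
  fix \<tau> assume "\<tau> \<in> perms n"
  then show "x (inv \<tau> \<circ> (\<sigma> \<circ> \<tau>)) = x (inv (inv \<tau> \<circ> (inv \<sigma> \<circ> \<tau>)))"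
    using conj_inv[of \<tau> n "inv \<sigma>"] perms_inv[OF \<sigma>] perms_inv_inv[OF \<sigma>] by simp
qed

lemma chr_scale: "chr n (fscale k x) \<sigma> = k * chr n x \<sigma>"
  by (simp add: chr_def fscale_def sum_distrib_left)

lemma chr_cong:
  assumes "\<sigma> \<in> perms n" "\<And>\<tau>. \<tau> \<in> perms n \<Longrightarrow> x \<tau> = y \<tau>"
  shows "chr n x \<sigma> = chr n y \<sigma>"
  unfolding chr_def by (intro sum.cong refl assms(2) perms_comp perms_inv assms(1))

text \<open>Inversion turns the product of row and column sums into the product in the other order,
  which \<open>chr\<close> does not distinguish.\<close>

lemma chr_ye_inv:
  assumes \<sigma>: "\<sigma> \<in> perms n"
  shows "chr n (ye n r c) (inv \<sigma>) = chr n (ye n r c) \<sigma>"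
proof -
  have "chr n (ysym n r c) (inv \<sigma>) = chr n (\<lambda>\<tau>. ysym n r c (inv \<tau>)) \<sigma>"
    by (rule chr_inv[OF \<sigma>])
  also have "\<dots> = chr n (galg_mult n (csym n c) (rsym n r)) \<sigma>"
    by (rule chr_cong[OF \<sigma>]) (auto simp: ysym_def csym_inv rsym_inv intro!: gm_inv_cong)
  also have "\<dots> = chr n (ysym n r c) \<sigma>"
    unfolding ysym_def by (rule chr_mult_commute[OF \<sigma>])
  finally show ?thesis by (simp add: ye_def chr_scale)
qed

subsection \<open>The character depends only on the shape\<close>

text \<open>Column labels are arbitrary, so the columns are numbered by decreasing height, ties
  broken by label. The columns that meet row i are those of height above i; they come first and
  therefore get exactly the numbers below \<open>f i\<close>.\<close>

lemma tab_cells: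
  assumes t: "tab n r c f"
  shows "\<exists>idx. inj_on idx (c ` {..<n}) \<and> bij_betw (\<lambda>x. (r x, idx (c x))) {..<n} (SIGMA i:UNIV. {..<f i})"
proof -
  define h where "h k = card {x. x < n \<and> c x = k}" for k
  define L where "L k k' \<longleftrightarrow> h k < h k' \<or> (h k = h k' \<and> k' < k)" for k k'
  define Pre where "Pre k = {k' \<in> c ` {..<n}. L k k'}" for k
  define idx where "idx k = card (Pre k)" for k
  have finPre: "finite (Pre k)" for k by (simp add: Pre_def)
  have less: "idx k' < idx k" if "k' \<in> c ` {..<n}" "L k k'" for k k'
  proof -
    have "Pre k' \<subset> Pre k"
    proof
      show "Pre k' \<subseteq> Pre k" using that(2) by (auto simp: Pre_def L_def)
      show "Pre k' \<noteq> Pre k" using that by (auto simp: Pre_def L_def set_eq_iff)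
    qed
    then show ?thesis unfolding idx_def by (rule psubset_card_mono[OF finPre])
  qed
  have inj: "inj_on idx (c ` {..<n})"
  proof (rule inj_onI)
    fix k k' assume k: "k \<in> c ` {..<n}" "k' \<in> c ` {..<n}" "idx k = idx k'"
    show "k = k'"
    proof (rule ccontr)
      assume "k \<noteq> k'"
      then have "L k k' \<or> L k' k" by (auto simp: L_def)
      then show False using less k by fastforce
    qed
  qed
  have injc: "inj_on c {y. y < n \<and> r y = i}" for i
    using t by (auto simp: tab_def inj_on_def)
  have row: "card {y. y < n \<and> r y = i} = f i" for i
    using t by (simp add: tab_def)
  have h_iff: "i < h k \<longleftrightarrow> k \<in> c ` {y. y < n \<and> r y = i}" for i k
  proof -
    have "r ` {x. x < n \<and> c x = k} = {..<h k}"
      using tab_column(2)[OF t refl] by (simp add: h_def)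
    then have "i < h k \<longleftrightarrow> i \<in> r ` {x. x < n \<and> c x = k}" by simp
    then show ?thesis by auto
  qed
  have bound: "idx (c x) < f (r x)" if x: "x < n" for x
  proof -
    have hx: "r x < h (c x)" using x h_iff by auto
    \<comment> \<open>Each column before that of x is at least as high and so meets the row of x.
      Counting these columns together with \<open>c x\<close> itself gives
      \<open>idx (c x) + 1 \<le> f (r x)\<close>.\<close>
    have "insert (c x) (Pre (c x)) \<subseteq> c ` {y. y < n \<and> r y = r x}"
    proof
      fix k assume "k \<in> insert (c x) (Pre (c x))"
      then have "h (c x) \<le> h k" by (auto simp: Pre_def L_def)
      then have "r x < h k" using hx by simp
      then show "k \<in> c ` {y. y < n \<and> r y = r x}" by (simp add: h_iff)
    qed
    then have "card (insert (c x) (Pre (c x))) \<le> card (c ` {y. y < n \<and> r y = r x})"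
      by (intro card_mono) auto
    also have "\<dots> = f (r x)" by (simp add: card_image[OF injc] row)
    finally have "card (insert (c x) (Pre (c x))) \<le> f (r x)" .
    moreover have "c x \<notin> Pre (c x)" by (simp add: Pre_def L_def)
    ultimately show ?thesis by (simp add: idx_def finPre)
  qed
  have surj: "\<exists>x<n. r x = i \<and> idx (c x) = j" if "j < f i" for i j
  proof -
    have inji: "inj_on (\<lambda>y. idx (c y)) {y. y < n \<and> r y = i}"
    proof (rule inj_onI)
      fix x y assume xy: "x \<in> {y. y < n \<and> r y = i}" "y \<in> {y. y < n \<and> r y = i}" "idx (c x) = idx (c y)"
      have "c x = c y" by (rule inj_onD[OF inj xy(3)]) (use xy in auto)
      then show "x = y" by (rule inj_onD[OF injc[of i]]) (use xy in auto)
    qed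
    have "(\<lambda>y. idx (c y)) ` {y. y < n \<and> r y = i} = {..<f i}"
    proof (rule card_subset_eq)
      show "(\<lambda>y. idx (c y)) ` {y. y < n \<and> r y = i} \<subseteq> {..<f i}" using bound by auto
      show "card ((\<lambda>y. idx (c y)) ` {y. y < n \<and> r y = i}) = card {..<f i}"
        using card_image[OF inji] row by simp
    qed simp
    then have "j \<in> (\<lambda>y. idx (c y)) ` {y. y < n \<and> r y = i}" using that by simp
    then show ?thesis by auto
  qed
  have "inj_on (\<lambda>x. (r x, idx (c x))) {..<n}"
  proof (rule inj_onI)
    fix x y assume xy: "x \<in> {..<n}" "y \<in> {..<n}" "(r x, idx (c x)) = (r y, idx (c y))"
    then have "c x = c y" using inj_onD[OF inj, of "c x" "c y"] by auto
    then show "x = y" using t xy by (auto simp: tab_def)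
  qed
  moreover have "(\<lambda>x. (r x, idx (c x))) ` {..<n} = (SIGMA i:UNIV. {..<f i})"
  proof (intro equalityI subsetI)
    fix p assume "p \<in> (SIGMA i:UNIV. {..<f i})"
    then obtain i j where p: "p = (i, j)" "j < f i" by auto
    then obtain x where "x < n" "r x = i" "idx (c x) = j" using surj by blast
    then show "p \<in> (\<lambda>x. (r x, idx (c x))) ` {..<n}" using p by force
  qed (use bound in auto)
  ultimately show ?thesis using inj by (auto simp: bij_betw_def)
qed

text \<open>\<open>tab_cells\<close> identifies both tableaux with the same diagram. Labels of
  columns can match only up to renaming, so only the relation of lying in a common column is
  transported.\<close>

lemma tab_same_shape:
  assumes t: "tab n r c f" and t': "tab n r' c' f"
  shows "\<exists>\<rho>\<in>perms n. (\<forall>x<n. r' (\<rho> x) = r x) \<and> (\<forall>x<n. \<forall>y<n. c x = c y \<longleftrightarrow> c' (\<rho> x) = c' (\<rho> y))"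
proof -
  obtain i where i: "inj_on i (c ` {..<n})" "bij_betw (\<lambda>x. (r x, i (c x))) {..<n} (SIGMA i:UNIV. {..<f i})"
    using tab_cells[OF t] by blast
  obtain i' where i': "inj_on i' (c' ` {..<n})" "bij_betw (\<lambda>x. (r' x, i' (c' x))) {..<n} (SIGMA i:UNIV. {..<f i})"
    using tab_cells[OF t'] by blast
  define \<theta>' where "\<theta>' = (\<lambda>x. (r' x, i' (c' x)))"
  define g where "g = inv_into {..<n} \<theta>' \<circ> (\<lambda>x. (r x, i (c x)))"
  have g: "bij_betw g {..<n} {..<n}"
    unfolding g_def by (rule bij_betw_trans[OF i(2)]) (simp add: \<theta>'_def bij_betw_inv_into[OF i'(2)])
  define \<rho> where "\<rho> x = (if x < n then g x else x)" for x
  have "bij_betw \<rho> {..<n} {..<n}"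
    using g by (rule bij_betw_cong[THEN iffD1, rotated]) (simp add: \<rho>_def)
  then have \<rho>: "\<rho> \<in> perms n"
    using bij_imp_permutes[of \<rho> "{..<n}"] by (simp add: \<rho>_def)
  have eq: "\<theta>' (\<rho> x) = (r x, i (c x))" if "x < n" for x
  proof -
    have "(r x, i (c x)) \<in> \<theta>' ` {..<n}"
      using i(2) i'(2) that unfolding bij_betw_def \<theta>'_def by blast
    then show ?thesis using that by (simp add: \<rho>_def g_def f_inv_into_f)
  qed
  have "c x = c y \<longleftrightarrow> c' (\<rho> x) = c' (\<rho> y)" if xy: "x < n" "y < n" for x y
  proof -
    have "c x = c y \<longleftrightarrow> i (c x) = i (c y)" using inj_on_eq_iff[OF i(1)] xy by auto
    also have "\<dots> \<longleftrightarrow> i' (c' (\<rho> x)) = i' (c' (\<rho> y))" using eq xy by (auto simp: \<theta>'_def)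
    also have "\<dots> \<longleftrightarrow> c' (\<rho> x) = c' (\<rho> y)" using inj_on_eq_iff[OF i'(1)] xy perms_less[OF \<rho>] by auto
    finally show ?thesis .
  qed
  moreover have "r' (\<rho> x) = r x" if "x < n" for x using eq[OF that] by (simp add: \<theta>'_def)
  ultimately show ?thesis using \<rho> by blast
qed

lemma gm_conj:
  assumes \<rho>: "\<rho> \<in> perms n" and \<sigma>: "\<sigma> \<in> perms n"
    and x: "\<And>\<tau>. \<tau> \<in> perms n \<Longrightarrow> x \<tau> = x' (\<rho> \<circ> (\<tau> \<circ> inv \<rho>))"
    and y: "\<And>\<tau>. \<tau> \<in> perms n \<Longrightarrow> y \<tau> = y' (\<rho> \<circ> (\<tau> \<circ> inv \<rho>))"
  shows "galg_mult n x y \<sigma> = galg_mult n x' y' (\<rho> \<circ> (\<sigma> \<circ> inv \<rho>))"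
proof -
  have "galg_mult n x' y' (\<rho> \<circ> (\<sigma> \<circ> inv \<rho>)) =
     (\<Sum>\<tau>\<in>perms n. x' (inv (inv \<rho>) \<circ> (\<tau> \<circ> inv \<rho>)) * y' (inv (inv (inv \<rho>) \<circ> (\<tau> \<circ> inv \<rho>)) \<circ> (\<rho> \<circ> (\<sigma> \<circ> inv \<rho>))))"
    unfolding galg_mult_def by (rule sum_perms_conj'[OF perms_inv[OF \<rho>], symmetric])
  also have "\<dots> = galg_mult n x y \<sigma>"
    unfolding galg_mult_def
  proof (rule sum.cong[OF refl])
    fix \<tau> assume \<tau>: "\<tau> \<in> perms n"
    have "inv (inv (inv \<rho>) \<circ> (\<tau> \<circ> inv \<rho>)) = \<rho> \<circ> (inv \<tau> \<circ> inv \<rho>)"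
      using conj_inv[OF perms_inv[OF \<rho>] \<tau>] perms_inv_inv[OF \<rho>] by simp
    then have "inv (inv (inv \<rho>) \<circ> (\<tau> \<circ> inv \<rho>)) \<circ> (\<rho> \<circ> (\<sigma> \<circ> inv \<rho>)) = \<rho> \<circ> ((inv \<tau> \<circ> \<sigma>) \<circ> inv \<rho>)"
      by (simp add: comp_assoc perms_cancel(3)[OF \<rho>])
    then show "x' (inv (inv \<rho>) \<circ> (\<tau> \<circ> inv \<rho>)) * y' (inv (inv (inv \<rho>) \<circ> (\<tau> \<circ> inv \<rho>)) \<circ> (\<rho> \<circ> (\<sigma> \<circ> inv \<rho>))) =
       x \<tau> * y (inv \<tau> \<circ> \<sigma>)"
      using x[OF \<tau>] y[OF perms_comp[OF perms_inv[OF \<tau>] \<sigma>]] perms_inv_inv[OF \<rho>] by simp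
  qed
  finally show ?thesis ..
qed

lemma stab_conj:
  assumes \<rho>: "\<rho> \<in> perms n" and \<sigma>: "\<sigma> \<in> perms n"
    and c: "\<And>x y. x < n \<Longrightarrow> y < n \<Longrightarrow> c x = c y \<longleftrightarrow> c' (\<rho> x) = c' (\<rho> y)"
  shows "\<rho> \<circ> (\<sigma> \<circ> inv \<rho>) \<in> stab n c' \<longleftrightarrow> \<sigma> \<in> stab n c"
proof -
  have p: "\<rho> \<circ> (\<sigma> \<circ> inv \<rho>) \<in> perms n" by (intro perms_comp perms_inv \<rho> \<sigma>)
  have "(\<forall>k<n. c' (\<rho> (\<sigma> (inv \<rho> k))) = c' k) \<longleftrightarrow> (\<forall>k<n. c (\<sigma> k) = c k)"
  proof (intro iffI allI impI)
    fix k assume a: "\<forall>k<n. c' (\<rho> (\<sigma> (inv \<rho> k))) = c' k" and k: "k < n"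
    have "c' (\<rho> (\<sigma> (inv \<rho> (\<rho> k)))) = c' (\<rho> k)" using a k perms_less[OF \<rho>] by blast
    then have "c' (\<rho> (\<sigma> k)) = c' (\<rho> k)" using \<rho> by (simp add: permutes_inverses)
    then show "c (\<sigma> k) = c k" using c k perms_less[OF \<sigma>] by blast
  next
    fix k assume a: "\<forall>k<n. c (\<sigma> k) = c k" and k: "k < n"
    have ik: "inv \<rho> k < n" using perms_less[OF perms_inv[OF \<rho>]] k by simp
    then have "c' (\<rho> (\<sigma> (inv \<rho> k))) = c' (\<rho> (inv \<rho> k))"
      using a c[of "\<sigma> (inv \<rho> k)" "inv \<rho> k"] perms_less[OF \<sigma>] by auto
    then show "c' (\<rho> (\<sigma> (inv \<rho> k))) = c' k" using \<rho> by (simp add: permutes_inverses)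
  qed
  then show ?thesis using p \<sigma> by (simp add: stab_def)
qed

text \<open>Relabelling by \<rho> conjugates the Young symmetrizer and keeps its scalar
  \<open>yk\<close>; \<open>chr\<close> sums over conjugates anyway.\<close>

lemma chr_tab_eq:
  assumes t: "tab n r c f" and t': "tab n r' c' f" and \<sigma>: "\<sigma> \<in> perms n"
  shows "chr n (ye n r c) \<sigma> = chr n (ye n r' c') \<sigma>"
proof -
  obtain \<rho> where \<rho>: "\<rho> \<in> perms n" and r: "\<forall>x<n. r' (\<rho> x) = r x"
    and c: "\<forall>x<n. \<forall>y<n. c x = c y \<longleftrightarrow> c' (\<rho> x) = c' (\<rho> y)"
    using tab_same_shape[OF t t'] by blast
  have sg: "sign (\<rho> \<circ> (\<tau> \<circ> inv \<rho>)) = sign \<tau>" if "\<tau> \<in> perms n" for \<tau>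
    using sign_perms_comp[OF \<rho> perms_comp[OF that perms_inv[OF \<rho>]]] sign_perms_comp[OF that perms_inv[OF \<rho>]]
      sign_perms_inv[OF \<rho>] by (simp add: mult.left_commute)
  have a: "rsym n r \<tau> = rsym n r' (\<rho> \<circ> (\<tau> \<circ> inv \<rho>))" if "\<tau> \<in> perms n" for \<tau>
    using stab_conj[OF \<rho> that, of r r'] r by (simp add: rsym_def)
  have b: "csym n c \<tau> = csym n c' (\<rho> \<circ> (\<tau> \<circ> inv \<rho>))" if "\<tau> \<in> perms n" for \<tau>
    using stab_conj[OF \<rho> that, of c c'] c sg[OF that] by (simp add: csym_def)
  have y: "ysym n r c \<tau> = ysym n r' c' (\<rho> \<circ> (\<tau> \<circ> inv \<rho>))" if "\<tau> \<in> perms n" for \<tau>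
    unfolding ysym_def by (rule gm_conj[OF \<rho> that]) (simp_all add: a b)
  have "yk n r c = galg_mult n (ysym n r' c') (ysym n r' c') (\<rho> \<circ> (id \<circ> inv \<rho>))"
    unfolding yk_def by (rule gm_conj[OF \<rho> perms_id]) (simp_all add: y)
  then have k: "yk n r c = yk n r' c'"
    using perms_cancel(2)[OF \<rho>] by (simp add: yk_def)
  have "chr n (ysym n r' c') \<sigma> = (\<Sum>\<tau>\<in>perms n. ysym n r' c' (inv (\<tau> \<circ> inv \<rho>) \<circ> (inv \<sigma> \<circ> (\<tau> \<circ> inv \<rho>))))"
    unfolding chr_def by (rule sum_perms_right[OF perms_inv[OF \<rho>], symmetric])
  also have "\<dots> = chr n (ysym n r c) \<sigma>"
    unfolding chr_def
  proof (rule sum.cong[OF refl])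
    fix \<tau> assume \<tau>: "\<tau> \<in> perms n"
    have "inv (\<tau> \<circ> inv \<rho>) \<circ> (inv \<sigma> \<circ> (\<tau> \<circ> inv \<rho>)) = \<rho> \<circ> ((inv \<tau> \<circ> (inv \<sigma> \<circ> \<tau>)) \<circ> inv \<rho>)"
      unfolding perms_inv_comp[OF \<tau> perms_inv[OF \<rho>]] perms_inv_inv[OF \<rho>] by (simp add: comp_assoc)
    then show "ysym n r' c' (inv (\<tau> \<circ> inv \<rho>) \<circ> (inv \<sigma> \<circ> (\<tau> \<circ> inv \<rho>))) = ysym n r c (inv \<tau> \<circ> (inv \<sigma> \<circ> \<tau>))"
      using y[OF perms_comp[OF perms_inv[OF \<tau>] perms_comp[OF perms_inv[OF \<sigma>] \<tau>]]] by simp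
  qed
  finally show ?thesis using k by (simp add: ye_def chr_scale)
qed

subsection \<open>Transposition of tableaux\<close>

lemma gm_sign:
  assumes \<sigma>: "\<sigma> \<in> perms n"
    and x: "\<And>\<tau>. \<tau> \<in> perms n \<Longrightarrow> x' \<tau> = of_int (sign \<tau>) * x \<tau>"
    and y: "\<And>\<tau>. \<tau> \<in> perms n \<Longrightarrow> y' \<tau> = of_int (sign \<tau>) * y \<tau>"
  shows "galg_mult n x' y' \<sigma> = of_int (sign \<sigma>) * galg_mult n x y \<sigma>"
  unfolding galg_mult_def sum_distrib_left
proof (rule sum.cong[OF refl])
  fix \<tau> assume \<tau>: "\<tau> \<in> perms n"
  have "sign \<tau> * sign (inv \<tau> \<circ> \<sigma>) = sign \<sigma>"
    using sign_perms_comp[OF perms_inv[OF \<tau>] \<sigma>] sign_perms_inv[OF \<tau>] by simp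
  then have "of_int (sign \<tau>) * of_int (sign (inv \<tau> \<circ> \<sigma>)) = (of_int (sign \<sigma>) :: complex)"
    by (metis of_int_mult)
  then show "x' \<tau> * y' (inv \<tau> \<circ> \<sigma>) = of_int (sign \<sigma>) * (x \<tau> * y (inv \<tau> \<circ> \<sigma>))"
    using x[OF \<tau>] y[OF perms_comp[OF perms_inv[OF \<tau>] \<sigma>]] by (simp add: mult_ac)
qed

lemma gm_id_commute: "galg_mult n x y id = galg_mult n y x id"
proof -
  have "galg_mult n x y id = (\<Sum>\<tau>\<in>perms n. x (inv \<tau>) * y (inv (inv \<tau>) \<circ> id))"
    unfolding galg_mult_def by (rule sum_perms_inv[symmetric])
  also have "\<dots> = galg_mult n y x id"
    unfolding galg_mult_def by (intro sum.cong refl) (simp add: permutes_inv_inv mult.commute)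
  finally show ?thesis .
qed

text \<open>Exchanging rows and columns replaces \<open>a b\<close> by the sign twist of
  \<open>b a\<close>, and \<open>b a\<close> has the same scalar and the same \<open>chr\<close> as
  \<open>a b\<close>.\<close>

lemma chr_ye_transpose:
  assumes \<sigma>: "\<sigma> \<in> perms n"
  shows "chr n (ye n c r) \<sigma> = of_int (sign \<sigma>) * chr n (ye n r c) \<sigma>"
proof -
  define z where "z = galg_mult n (csym n c) (rsym n r)"
  have a: "rsym n c \<tau> = of_int (sign \<tau>) * csym n c \<tau>" for \<tau>
    by (auto simp: rsym_def csym_def sign_def)
  have b: "csym n r \<tau> = of_int (sign \<tau>) * rsym n r \<tau>" for \<tau>
    by (auto simp: rsym_def csym_def)
  have y: "ysym n c r \<tau> = of_int (sign \<tau>) * z \<tau>" if "\<tau> \<in> perms n" for \<tau>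
    unfolding ysym_def z_def by (rule gm_sign[OF that a b])
  have "yk n c r = galg_mult n z z id"
    unfolding yk_def using gm_sign[OF perms_id y y] by simp
  also have "\<dots> = galg_mult n (galg_mult n (rsym n r) (galg_mult n (csym n c) (rsym n r))) (csym n c) id"
    unfolding z_def gm_assoc[of n "csym n c"] by (rule gm_id_commute)
  also have "\<dots> = yk n r c" by (simp add: yk_def ysym_def gm_assoc)
  finally have k: "yk n c r = yk n r c" .
  have "chr n (ysym n c r) \<sigma> = of_int (sign \<sigma>) * chr n z \<sigma>"
    unfolding chr_def sum_distrib_left
  proof (rule sum.cong[OF refl])
    fix \<tau> assume \<tau>: "\<tau> \<in> perms n"
    have p: "inv \<tau> \<circ> (inv \<sigma> \<circ> \<tau>) \<in> perms n" by (intro perms_comp perms_inv \<tau> \<sigma>)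
    have "sign (inv \<tau> \<circ> (inv \<sigma> \<circ> \<tau>)) = sign \<sigma>"
      using sign_perms_comp[OF perms_inv[OF \<tau>] perms_comp[OF perms_inv[OF \<sigma>] \<tau>]]
        sign_perms_comp[OF perms_inv[OF \<sigma>] \<tau>] sign_perms_inv[OF \<tau>] sign_perms_inv[OF \<sigma>]
      by (simp add: mult.left_commute)
    then show "ysym n c r (inv \<tau> \<circ> (inv \<sigma> \<circ> \<tau>)) = of_int (sign \<sigma>) * z (inv \<tau> \<circ> (inv \<sigma> \<circ> \<tau>))"
      using y[OF p] by simp
  qed
  also have "chr n z \<sigma> = chr n (ysym n r c) \<sigma>"
    unfolding z_def ysym_def by (rule chr_mult_commute[OF \<sigma>])
  finally show ?thesis using k by (simp add: ye_def chr_scale)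
qed

section \<open>Partitions\<close>

text \<open>Zero padding turns partitions into functions, so that sums of partitions are pointwise
  sums regardless of length.\<close>

definition rl :: "nat list \<Rightarrow> nat \<Rightarrow> nat" where
  "rl l i = (if i < length l then l ! i else 0)"

definition pt :: "nat \<Rightarrow> (nat \<Rightarrow> nat) \<Rightarrow> bool" where
  "pt n f \<longleftrightarrow> antimono f \<and> (\<exists>N. (\<forall>i\<ge>N. f i = 0) \<and> (\<Sum>i<N. f i) = n)"

lemma rl_inj:
  assumes "is_partition l" "is_partition m" "rl l = rl m"
  shows "l = m"
proof -
  have pos: "rl l i > 0 \<longleftrightarrow> i < length l" if "is_partition l" for l i
    using that by (auto simp: rl_def is_partition_def) (metis gr0I nth_mem)
  have "i < length l \<longleftrightarrow> i < length m" for i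
    using pos[OF assms(1), of i] pos[OF assms(2), of i] assms(3) by simp
  then have len: "length l = length m" by (metis linorder_neqE_nat less_irrefl)
  show ?thesis
  proof (rule nth_equalityI[OF len])
    fix i assume "i < length l"
    then show "l ! i = m ! i" using fun_cong[OF assms(3), of i] len by (simp add: rl_def)
  qed
qed

lemma sum_list_rl: "sum_list l = (\<Sum>i<length l. rl l i)"
  unfolding sum_list_sum_nth by (rule sum.cong) (auto simp: rl_def)

lemma partition_nth_mono: "is_partition l \<Longrightarrow> i \<le> j \<Longrightarrow> j < length l \<Longrightarrow> l ! j \<le> l ! i"
  using sorted_wrt_nth_less[of "(\<ge>)" l i j] by (cases "i = j") (auto simp: is_partition_def)

lemma pt_rl: "l \<in> partitions_of n \<Longrightarrow> pt n (rl l)"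
  unfolding pt_def
proof (intro conjI exI[of _ "length l"])
  assume l: "l \<in> partitions_of n"
  then show "antimono (rl l)"
    by (intro antimonoI) (auto simp: rl_def partitions_of_def intro: partition_nth_mono)
  show "(\<Sum>i<length l. rl l i) = n" using l sum_list_rl[of l] by (simp add: partitions_of_def)
qed (simp add: rl_def)

lemma pt_list:
  assumes "pt n f"
  shows "\<exists>l\<in>partitions_of n. rl l = f"
proof -
  obtain N where N: "\<forall>i\<ge>N. f i = 0" "(\<Sum>i<N. f i) = n" and anti: "antimono f"
    using assms by (auto simp: pt_def)
  define L where "L = (LEAST L. f L = 0)"
  have fL: "f L = 0" unfolding L_def by (rule LeastI[of _ N]) (use N in auto)
  have pos: "f i > 0" if "i < L" for i
    using not_less_Least[of i "\<lambda>L. f L = 0"] that by (auto simp: L_def)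
  have zero: "f i = 0" if "L \<le> i" for i
    using antimonoD[OF anti that] fL by simp
  have "L \<le> N" unfolding L_def by (rule Least_le) (use N in auto)
  define l where "l = map f [0..<L]"
  have "rl l = f" by (auto simp: rl_def l_def fun_eq_iff zero)
  moreover have "sum_list l = n"
  proof -
    have "sum_list l = (\<Sum>i<L. f i)" using sum_list_rl[of l] \<open>rl l = f\<close> by (simp add: l_def)
    also have "\<dots> = (\<Sum>i<N. f i)"
      by (rule sum.mono_neutral_left) (use \<open>L \<le> N\<close> zero in auto)
    finally show ?thesis using N by simp
  qed
  moreover have "is_partition l"
    unfolding is_partition_def
  proof
    show "sorted_wrt (\<ge>) l"
      unfolding sorted_wrt_iff_nth_less using antimonoD[OF anti] by (auto simp: l_def)
    show "0 \<notin> set l" using pos by (force simp: l_def)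
  qed
  ultimately show ?thesis by (auto simp: partitions_of_def)
qed

text \<open>Columns are top-justified: one that meets row j meets every row before it, so row
  lengths decrease.\<close>

lemma tab_pt:
  assumes t: "tab n r c f"
  shows "pt n f"
proof -
  have injc: "inj_on c {y. y < n \<and> r y = i}" for i
    using t by (auto simp: tab_def inj_on_def)
  have row: "card (c ` {y. y < n \<and> r y = i}) = f i" for i
    using t card_image[OF injc] by (simp add: tab_def)
  have "antimono f"
  proof (rule antimonoI)
    fix i j :: nat assume ij: "i \<le> j"
    have "c ` {y. y < n \<and> r y = j} \<subseteq> c ` {y. y < n \<and> r y = i}"
    proof
      fix k assume "k \<in> c ` {y. y < n \<and> r y = j}"
      then obtain y where y: "y < n" "r y = j" "k = c y" by auto
      show "k \<in> c ` {y. y < n \<and> r y = i}"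
      proof (cases "i = j")
        case False
        then have "i < r y" using ij y by simp
        then obtain z where "z < n" "c z = c y" "r z = i" using t y unfolding tab_def by blast
        then show ?thesis using y by (intro image_eqI[of _ _ z]) auto
      qed (use y in auto)
    qed
    then have "card (c ` {y. y < n \<and> r y = j}) \<le> card (c ` {y. y < n \<and> r y = i})"
      by (rule card_mono[rotated]) simp
    then show "f j \<le> f i" by (simp add: row)
  qed
  moreover obtain N where N: "\<forall>x<n. r x < N"
  proof -
    have "finite (r ` {..<n})" by simp
    then obtain N where "\<forall>y\<in>r ` {..<n}. y < N" using finite_nat_set_iff_bounded by blast
    then show ?thesis using that by auto
  qed
  moreover have "f i = 0" if "i \<ge> N" for i
  proof -
    have "{x. x < n \<and> r x = i} = {}" using N that by force
    then show ?thesis using t unfolding tab_def by (metis card.empty)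
  qed
  moreover have "(\<Sum>i<N. f i) = n"
  proof -
    have "{x. x < n \<and> r x < N} = {..<n}" using N by auto
    then show ?thesis using tab_rows_less[OF t, of N] by simp
  qed
  ultimately show ?thesis unfolding pt_def by blast
qed

subsection \<open>The row-by-row tableau\<close>

lemma sum_take_mono: "i \<le> j \<Longrightarrow> sum_list (take i l) \<le> sum_list (take j (l :: nat list))"
proof -
  assume "i \<le> j"
  then have "take j l = take i l @ take (j - i) (drop i l)" by (metis le_add_diff_inverse take_add)
  then show ?thesis by simp
qed

lemma sum_take_Suc: "i < length l \<Longrightarrow> sum_list (take (Suc i) l) = sum_list (take i l) + (l ! i :: nat)"
  by (simp add: take_Suc_conv_app_nth)

lemma row_col_of_cell:
  assumes i: "i < length l" and j: "j < l ! i"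
  shows "row_of l (sum_list (take i l) + j) = i" "col_of l (sum_list (take i l) + j) = j"
    "sum_list (take i l) + j < sum_list l"
proof -
  show r: "row_of l (sum_list (take i l) + j) = i"
    unfolding row_of_def
  proof (rule Least_equality)
    show "sum_list (take i l) + j < sum_list (take (Suc i) l)" using i j by (simp add: sum_take_Suc)
    fix m assume m: "sum_list (take i l) + j < sum_list (take (Suc m) l)"
    show "i \<le> m"
    proof (rule ccontr)
      assume "\<not> i \<le> m"
      then have "sum_list (take (Suc m) l) \<le> sum_list (take i l)" by (intro sum_take_mono) simp
      then show False using m by simp
    qed
  qed
  show "col_of l (sum_list (take i l) + j) = j" by (simp add: col_of_def r)
  have "sum_list (take (Suc i) l) \<le> sum_list (take (length l) l)"
    by (rule sum_take_mono) (use i in simp)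
  then show "sum_list (take i l) + j < sum_list l" using i j by (simp add: sum_take_Suc)
qed

lemma row_col_of:
  assumes k: "k < sum_list l"
  shows "row_of l k < length l" "col_of l k < l ! row_of l k" "k = sum_list (take (row_of l k) l) + col_of l k"
proof -
  define i where "i = row_of l k"
  have ex: "k < sum_list (take (Suc (length l)) l)" using k by simp
  have ki: "k < sum_list (take (Suc i) l)"
    unfolding i_def row_of_def by (rule LeastI[of "\<lambda>i. k < sum_list (take (Suc i) l)", OF ex])
  have "i \<le> m" if "k < sum_list (take (Suc m) l)" for m
    unfolding i_def row_of_def by (rule Least_le[of "\<lambda>i. k < sum_list (take (Suc i) l)", OF that])
  then have min: "\<not> k < sum_list (take (Suc m) l)" if "m < i" for m using that by force
  have le: "sum_list (take i l) \<le> k"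
    using min[of "i - 1"] by (cases i) auto
  have il: "i < length l"
  proof (rule ccontr)
    assume "\<not> i < length l"
    then have "take i l = l" by simp
    then show False using le k by simp
  qed
  show "row_of l k < length l" using il by (simp add: i_def)
  show "col_of l k < l ! row_of l k"
    using ki le il by (simp add: col_of_def i_def[symmetric] sum_take_Suc)
  show "k = sum_list (take (row_of l k) l) + col_of l k"
    using le by (simp add: col_of_def i_def[symmetric])
qed

lemma tab_row_col:
  assumes l: "is_partition l"
  shows "tab (sum_list l) (row_of l) (col_of l) (rl l)"
  unfolding tab_def
proof (intro conjI allI impI)
  fix x y assume "x < sum_list l" "y < sum_list l" "row_of l x = row_of l y" "col_of l x = col_of l y"
  then show "x = y" using row_col_of(3)[of x l] row_col_of(3)[of y l] by simp
next
  fix x i assume x: "x < sum_list l" and i: "i < row_of l x"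
  have "col_of l x < l ! i" "i < length l"
    using row_col_of(1,2)[OF x] partition_nth_mono[OF l, of i "row_of l x"] i by auto
  then show "\<exists>y<sum_list l. col_of l y = col_of l x \<and> row_of l y = i"
    using row_col_of_cell[of i l "col_of l x"] by blast
next
  fix i
  have "{x. x < sum_list l \<and> row_of l x = i} = (\<lambda>j. sum_list (take i l) + j) ` {..<rl l i}"
  proof (intro equalityI subsetI)
    fix x assume "x \<in> {x. x < sum_list l \<and> row_of l x = i}"
    then show "x \<in> (\<lambda>j. sum_list (take i l) + j) ` {..<rl l i}"
      using row_col_of[of x l] by (intro image_eqI[of _ _ "col_of l x"]) (auto simp: rl_def)
  next
    fix x assume "x \<in> (\<lambda>j. sum_list (take i l) + j) ` {..<rl l i}"
    then show "x \<in> {x. x < sum_list l \<and> row_of l x = i}"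
      using row_col_of_cell[of i l] by (auto simp: rl_def split: if_splits)
  qed
  then show "card {x. x < sum_list l \<and> row_of l x = i} = rl l i"
    by (simp add: card_image)
qed

text \<open>The conjugate partition, that is the shape of the transposed tableau
  (\<open>tab_col_row\<close>).\<close>

definition conjf :: "(nat \<Rightarrow> nat) \<Rightarrow> nat \<Rightarrow> nat" where
  "conjf f j = card {i. j < f i}"

lemma tab_col_row:
  assumes l: "is_partition l"
  shows "tab (sum_list l) (col_of l) (row_of l) (conjf (rl l))"
  unfolding tab_def
proof (intro conjI allI impI)
  fix x y assume "x < sum_list l" "y < sum_list l" "row_of l x = row_of l y" "col_of l x = col_of l y"
  then show "x = y" using row_col_of(3)[of x l] row_col_of(3)[of y l] by simp
next
  fix x j assume x: "x < sum_list l" and j: "j < col_of l x"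
  then show "\<exists>y<sum_list l. row_of l y = row_of l x \<and> col_of l y = j"
    using row_col_of_cell[of "row_of l x" l j] row_col_of(1,2)[OF x] by (metis order.strict_trans)
next
  fix j
  have "{i. j < rl l i} = row_of l ` {x. x < sum_list l \<and> col_of l x = j}"
  proof (intro equalityI subsetI)
    fix i assume "i \<in> {i. j < rl l i}"
    then show "i \<in> row_of l ` {x. x < sum_list l \<and> col_of l x = j}"
      using row_col_of_cell[of i l j]
      by (intro image_eqI[of _ _ "sum_list (take i l) + j"]) (auto simp: rl_def split: if_splits)
  next
    fix i assume "i \<in> row_of l ` {x. x < sum_list l \<and> col_of l x = j}"
    then show "i \<in> {i. j < rl l i}" using row_col_of(1,2)[of _ l] by (auto simp: rl_def)
  qed
  moreover have "inj_on (row_of l) {x. x < sum_list l \<and> col_of l x = j}"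
    by (rule inj_onI) (metis (mono_tags, lifting) mem_Collect_eq row_col_of(3))
  ultimately show "card {x. x < sum_list l \<and> col_of l x = j} = conjf (rl l) j"
    by (simp add: conjf_def card_image)
qed

lemma pt_tab:
  assumes "pt n f"
  shows "\<exists>r c. tab n r c f \<and> tab n c r (conjf f)"
  using pt_list[OF assms] tab_row_col tab_col_row by (auto simp: partitions_of_def)

lemma pt_conjf: "pt n f \<Longrightarrow> pt n (conjf f)"
  using pt_tab tab_pt by blast

lemma conjf_conjf:
  assumes "pt n f"
  shows "conjf (conjf f) = f"
proof -
  obtain N where N: "\<forall>i\<ge>N. f i = 0" and anti: "antimono f" using assms by (auto simp: pt_def)
  have "{i. j < f i} = {..<conjf f j}" for j
  proof -
    have "finite {i. j < f i}"
      by (rule finite_subset[of _ "{..<N}"]) (use N in \<open>auto simp: not_less[symmetric] intro: ccontr\<close>)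
    moreover have "k \<in> {i. j < f i}" if "i \<in> {i. j < f i}" "k < i" for i k
      using antimonoD[OF anti, of k i] that by simp
    ultimately show ?thesis using down_closed_eq[of "{i. j < f i}"] by (simp add: conjf_def)
  qed
  then have "i < conjf f j \<longleftrightarrow> j < f i" for i j by blast
  then show ?thesis by (simp add: conjf_def[of "conjf f"] fun_eq_iff)
qed

section \<open>Characters of Specht modules\<close>

text \<open>Right multiplication by the idempotent e projects the group algebra onto the Specht
  module, so \<open>trace_via_projection\<close> evaluates the trace independently of the basis
  chosen in \<open>trace_on\<close>.\<close>

lemma irr_char_canonical:
  assumes l: "l \<in> partitions_of n" and \<sigma>: "\<sigma> \<in> perms n"
  shows "irr_char l \<sigma> = chr n (ye n (row_of l) (col_of l)) \<sigma>"
proof -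
  define e where "e = ye n (row_of l) (col_of l)"
  define y where "y = ysym n (row_of l) (col_of l)"
  define V where "V = specht_module l"
  have n: "sum_list l = n" and p: "is_partition l" using l by (auto simp: partitions_of_def)
  have t: "tab n (row_of l) (col_of l) (rl l)" using tab_row_col[OF p] n by simp
  have ys: "young_symmetrizer l = y"
    unfolding young_symmetrizer_def y_def ysym_def n
    by (simp add: row_symmetrizer_def rsym_def row_group_def stab_def col_antisymmetrizer_def csym_def
        col_group_def n)
  have V: "V = (\<lambda>x. galg_mult n x y) ` galg_carrier n"
    by (simp add: V_def specht_module_def n ys)
  define P where "P = (\<lambda>x. galg_mult n x e)"
  define T where "T = galg_mult n (galg_single \<sigma>)"
  have k: "yk n (row_of l) (col_of l) \<noteq> 0" by (rule yk_nonzero[OF t])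
  have ey: "e = fscale (1 / yk n (row_of l) (col_of l)) y" by (simp add: e_def ye_def y_def)
  have ye: "galg_mult n y e = y"
    using k ysym_sq[OF t] by (simp add: ey gm_scale_right y_def)
  have lin: "flinear (\<lambda>x. galg_mult n x z)" for z
    by (rule flinearI) (auto simp: galg_mult_def algebra_simps sum.distrib sum_distrib_left)
  have linT: "flinear T"
    unfolding T_def by (rule flinearI) (auto simp: galg_mult_def algebra_simps sum.distrib sum_distrib_left)
  have carr: "fs.subspace (galg_carrier n)"
    unfolding fs.subspace_def by (auto simp: galg_carrier_def fscale_def)
  have subV: "fs.subspace V"
  proof -
    interpret L: Vector_Spaces.linear fscale fscale "\<lambda>x. galg_mult n x y" by (rule lin)
    show ?thesis unfolding V by (rule L.subspace_image[OF carr])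
  qed
  obtain B0 where B0: "B0 \<subseteq> V" "fs.independent B0" "V \<subseteq> fs.span B0" "card B0 = fs.dim V"
    by (rule fs.basis_exists[of V])
  have "fs.span B0 = V" using fs.span_minimal[OF B0(1) subV] B0(3) by auto
  then have ex: "\<exists>B. fs.independent B \<and> fs.span B = V" using B0(2) by blast
  define B where "B = (SOME B. fs.independent B \<and> fs.span B = V)"
  have B: "fs.independent B" "fs.span B = V" using someI_ex[OF ex] by (auto simp: B_def)
  have yc: "y \<in> galg_carrier n" by (simp add: y_def)
  have "irr_char l \<sigma> = (\<Sum>b\<in>B. fs.representation B (T b) b)"
    unfolding irr_char_def trace_on_def Let_def galg_scale_eq B_def V_def T_def n ..
  also have "\<dots> = (\<Sum>\<tau>\<in>perms n. T (P (funit \<tau>)) \<tau>)"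
  proof (rule trace_via_projection[OF finite_perms _ B])
    show "v \<tau> = 0" if "v \<in> V" "\<tau> \<notin> perms n" for v \<tau>
      using that gm_carrier[OF yc] by (auto simp: V galg_carrier_def)
    show "flinear P" unfolding P_def by (rule lin)
    show "P x \<in> V" if "\<And>\<tau>. \<tau> \<notin> perms n \<Longrightarrow> x \<tau> = 0" for x
    proof -
      have "fscale (1 / yk n (row_of l) (col_of l)) x \<in> galg_carrier n"
        using that by (auto simp: galg_carrier_def fscale_def)
      moreover have "P x = galg_mult n (fscale (1 / yk n (row_of l) (col_of l)) x) y"
        by (simp add: P_def ey gm_scale_left gm_scale_right)
      ultimately show ?thesis unfolding V by blast
    qed
    show "P v = v" if "v \<in> V" for v
      using that by (auto simp: V P_def gm_assoc ye)
    show "flinear T" by (rule linT)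
    show "T v \<in> V" if "v \<in> V" for v
    proof -
      obtain x where "x \<in> galg_carrier n" "v = galg_mult n x y" using \<open>v \<in> V\<close> unfolding V by blast
      then have "T v = galg_mult n (galg_mult n (galg_single \<sigma>) x) y" "galg_mult n (galg_single \<sigma>) x \<in> galg_carrier n"
        by (auto simp: T_def gm_assoc gm_carrier)
      then show ?thesis unfolding V by blast
    qed
  qed
  also have "\<dots> = chr n e \<sigma>"
    unfolding chr_def
  proof (rule sum.cong[OF refl])
    fix \<tau> assume \<tau>: "\<tau> \<in> perms n"
    have "funit \<tau> = galg_single \<tau>" by (simp add: funit_def galg_single_def)
    then show "T (P (funit \<tau>)) \<tau> = e (inv \<tau> \<circ> (inv \<sigma> \<circ> \<tau>))"
      by (simp add: T_def P_def gm_single_left[OF \<sigma>] gm_single_left[OF \<tau>])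
  qed
  finally show ?thesis by (simp add: e_def)
qed

lemma irr_char_tab:
  assumes "l \<in> partitions_of n" "tab n r c (rl l)" "\<sigma> \<in> perms n"
  shows "irr_char l \<sigma> = chr n (ye n r c) \<sigma>"
proof -
  have t: "tab n (row_of l) (col_of l) (rl l)" using tab_row_col[of l] assms(1) by (auto simp: partitions_of_def)
  show ?thesis
    unfolding irr_char_canonical[OF assms(1,3)] by (rule chr_tab_eq[OF t assms(2,3)])
qed

lemma irr_char_conj:
  assumes "l \<in> partitions_of n" "m \<in> partitions_of n" "rl m = conjf (rl l)" "\<sigma> \<in> perms n"
  shows "irr_char m \<sigma> = of_int (sign \<sigma>) * irr_char l \<sigma>"
proof -
  have t: "tab n (col_of l) (row_of l) (rl m)" using tab_col_row[of l] assms(1,3) by (auto simp: partitions_of_def)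
  show ?thesis
    unfolding irr_char_tab[OF assms(2) t assms(4)] irr_char_canonical[OF assms(1,4)]
    by (rule chr_ye_transpose[OF assms(4)])
qed

lemma irr_char_inv:
  "l \<in> partitions_of n \<Longrightarrow> \<sigma> \<in> perms n \<Longrightarrow> irr_char l (inv \<sigma>) = irr_char l \<sigma>"
  using irr_char_canonical[of l n \<sigma>] irr_char_canonical[of l n "inv \<sigma>"] chr_ye_inv[of \<sigma> n] perms_inv[of \<sigma> n]
  by simp

lemma ip_cong:
  assumes "\<And>\<sigma>. \<sigma> \<in> perms n \<Longrightarrow> f \<sigma> = f' \<sigma>" "\<And>\<sigma>. \<sigma> \<in> perms n \<Longrightarrow> g \<sigma> = g' \<sigma>"
  shows "ip n f g = ip n f' g'"
  unfolding ip_def using assms perms_inv by (auto intro!: arg_cong2[of _ _ _ _ "(/)"] sum.cong)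

lemma ip_irr_char:
  assumes l: "l \<in> partitions_of n" and m: "m \<in> partitions_of n"
  shows "ip n (irr_char l) (irr_char m) = (if l = m then 1 else 0)"
proof -
  have tl: "tab n (row_of l) (col_of l) (rl l)" using tab_row_col[of l] l by (auto simp: partitions_of_def)
  have tm: "tab n (row_of m) (col_of m) (rl m)" using tab_row_col[of m] m by (auto simp: partitions_of_def)
  have "ip n (irr_char l) (irr_char m) = ip n (chr n (ye n (row_of l) (col_of l))) (chr n (ye n (row_of m) (col_of m)))"
    by (rule ip_cong) (use irr_char_canonical l m in auto)
  also have "\<dots> = (if l = m then 1 else 0)"
  proof (cases "l = m")
    case True
    then show ?thesis using ye_trace_same[OF tl] by (simp add: ip_chr_chr)
  next
    case False
    then have "rl l \<noteq> rl m" using rl_inj[of l m] l m by (auto simp: partitions_of_def)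
    then show ?thesis using ye_orthogonal[OF tl tm] False by (simp add: ip_chr_chr)
  qed
  finally show ?thesis .
qed

lemma class_fun_cong:
  assumes "\<And>\<sigma>. \<sigma> \<in> perms n \<Longrightarrow> f \<sigma> = g \<sigma>" "class_fun n g"
  shows "class_fun n f"
  unfolding class_fun_def
proof (intro ballI)
  fix \<sigma> \<tau> assume s: "\<sigma> \<in> perms n" "\<tau> \<in> perms n"
  then show "f (inv \<tau> \<circ> (\<sigma> \<circ> \<tau>)) = f \<sigma>"
    using assms(1)[OF s(1)] assms(1)[OF perms_comp[OF perms_inv[OF s(2)] perms_comp[OF s]]] assms(2)
    by (simp add: class_fun_def)
qed

lemma class_fun_irr_char: "l \<in> partitions_of n \<Longrightarrow> class_fun n (irr_char l)"
  by (rule class_fun_cong[OF irr_char_canonical class_fun_chr])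

section \<open>Conjugacy classes and completeness of the irreducible characters\<close>

lemma fibre_bij:
  assumes fin: "finite A" "finite B" and eq: "\<And>k. card {a \<in> A. f a = k} = card {b \<in> B. g b = k}"
  shows "\<exists>h. bij_betw h A B \<and> (\<forall>a\<in>A. g (h a) = f a)"
proof -
  have "\<exists>h. bij_betw h {a \<in> A. f a = k} {b \<in> B. g b = k}" for k
    by (rule finite_same_card_bij) (use fin eq in auto)
  then obtain H where H: "\<And>k. bij_betw (H k) {a \<in> A. f a = k} {b \<in> B. g b = k}" by metis
  define h where "h a = H (f a) a" for a
  have hB: "h a \<in> B \<and> g (h a) = f a" if "a \<in> A" for a
    using bij_betwE[OF H[of "f a"]] that by (auto simp: h_def)
  have "inj_on h A"
  proof (rule inj_onI)
    fix a b assume ab: "a \<in> A" "b \<in> A" "h a = h b"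
    then have "f a = f b" using hB by metis
    then show "a = b" using inj_onD[OF bij_betw_imp_inj_on[OF H[of "f a"]], of a b] ab by (simp add: h_def)
  qed
  moreover have "b \<in> h ` A" if "b \<in> B" for b
  proof -
    have "b \<in> H (g b) ` {a \<in> A. f a = g b}"
      using H[of "g b"] that by (simp add: bij_betw_def)
    then obtain a where "a \<in> A" "f a = g b" "H (g b) a = b" by auto
    then show ?thesis by (intro image_eqI[of _ _ a]) (auto simp: h_def)
  qed
  ultimately show ?thesis using hB by (intro exI[of _ h]) (auto simp: bij_betw_def)
qed

lemma perms_of_fibres:
  assumes "\<And>k. card {x. x < n \<and> f x = k} = card {x. x < n \<and> g x = k}"
  shows "\<exists>\<rho>\<in>perms n. \<forall>x<n. g (\<rho> x) = f x"
proof -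
  have "card {x \<in> {..<n}. f x = k} = card {x \<in> {..<n}. g x = k}" for k using assms[of k] by simp
  then obtain h where h: "bij_betw h {..<n} {..<n}" "\<forall>a\<in>{..<n}. g (h a) = f a"
    using fibre_bij[of "{..<n}" "{..<n}" f g] by auto
  define \<rho> where "\<rho> x = (if x < n then h x else x)" for x
  have "bij_betw \<rho> {..<n} {..<n}"
    using h(1) by (rule bij_betw_cong[THEN iffD1, rotated]) (simp add: \<rho>_def)
  then have "\<rho> \<in> perms n" using bij_imp_permutes[of \<rho> "{..<n}"] by (simp add: \<rho>_def)
  then show ?thesis using h(2) by (auto simp: \<rho>_def)
qed

definition orb :: "(nat \<Rightarrow> nat) \<Rightarrow> nat \<Rightarrow> nat set" where
  "orb \<sigma> x = range (\<lambda>k. (\<sigma> ^^ k) x)"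

lemma perms_funpow: "\<sigma> \<in> perms n \<Longrightarrow> \<sigma> ^^ k \<in> perms n"
  by (induction k) (auto simp: perms_id[simplified] permutes_compose)

lemma orb_subset: "\<sigma> \<in> perms n \<Longrightarrow> x < n \<Longrightarrow> orb \<sigma> x \<subseteq> {..<n}"
  using perms_less[OF perms_funpow, of \<sigma> n _ x] by (auto simp: orb_def)

lemma orb_refl: "x \<in> orb \<sigma> x"
  unfolding orb_def by (rule range_eqI[of _ _ 0]) simp

text \<open>The size of the orbit is the least period of x: by injectivity, two equal iterates
  differ by a return to x.\<close>

lemma funpow_eq_iff:
  assumes \<sigma>: "\<sigma> \<in> perms n" and x: "x < n"
  shows "(\<sigma> ^^ i) x = (\<sigma> ^^ j) x \<longleftrightarrow> i mod card (orb \<sigma> x) = j mod card (orb \<sigma> x)"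
    and "card (orb \<sigma> x) > 0"
proof -
  have inj: "inj (\<sigma> ^^ k)" for k using perms_funpow[OF \<sigma>] permutes_inj by blast
  have fin: "finite (orb \<sigma> x)" using orb_subset[OF \<sigma> x] finite_subset by blast
  have cancel: "(\<sigma> ^^ (j - i)) x = x" if "(\<sigma> ^^ i) x = (\<sigma> ^^ j) x" "i \<le> j" for i j
  proof -
    have "(\<sigma> ^^ i) ((\<sigma> ^^ (j - i)) x) = (\<sigma> ^^ i) x"
      using that by (metis comp_apply funpow_add le_add_diff_inverse)
    then show ?thesis using inj by (auto dest: injD)
  qed
  have "\<not> inj (\<lambda>k. (\<sigma> ^^ k) x)"
    using fin finite_imageD[of "\<lambda>k. (\<sigma> ^^ k) x" UNIV] by (auto simp: orb_def)
  then obtain a b where ij: "a \<noteq> b" "(\<sigma> ^^ a) x = (\<sigma> ^^ b) x" by (auto simp: inj_def)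
  have "\<exists>p>0. (\<sigma> ^^ p) x = x"
  proof (cases "a < b")
    case True
    then show ?thesis using cancel[OF ij(2)] by (intro exI[of _ "b - a"]) auto
  next
    case False
    then show ?thesis using cancel[OF ij(2)[symmetric]] ij(1) by (intro exI[of _ "a - b"]) auto
  qed
  then obtain p where p: "p > 0" "(\<sigma> ^^ p) x = x" and least: "\<And>q. 0 < q \<Longrightarrow> q < p \<Longrightarrow> (\<sigma> ^^ q) x \<noteq> x"
    using exists_least_iff[of "\<lambda>p. p > 0 \<and> (\<sigma> ^^ p) x = x"] by blast
  have md: "(\<sigma> ^^ k) x = (\<sigma> ^^ (k mod p)) x" for k
    using funpow_mod_eq[OF p(2), of k] by simp
  have injp: "inj_on (\<lambda>k. (\<sigma> ^^ k) x) {..<p}"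
  proof (rule inj_onI)
    fix i j assume "i \<in> {..<p}" "j \<in> {..<p}" and e: "(\<sigma> ^^ i) x = (\<sigma> ^^ j) x"
    then show "i = j"
      using cancel[OF e] cancel[OF e[symmetric]] least[of "j - i"] least[of "i - j"]
      by (cases i j rule: linorder_cases) auto
  qed
  have "orb \<sigma> x = (\<lambda>k. (\<sigma> ^^ k) x) ` {..<p}"
  proof
    show "orb \<sigma> x \<subseteq> (\<lambda>k. (\<sigma> ^^ k) x) ` {..<p}"
    proof
      fix y assume "y \<in> orb \<sigma> x"
      then obtain k where "y = (\<sigma> ^^ k) x" by (auto simp: orb_def)
      then have "y = (\<sigma> ^^ (k mod p)) x" using md[of k] by simp
      then show "y \<in> (\<lambda>k. (\<sigma> ^^ k) x) ` {..<p}" using p(1) by auto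
    qed
  qed (auto simp: orb_def)
  then have c: "card (orb \<sigma> x) = p" by (simp add: card_image[OF injp])
  show "card (orb \<sigma> x) > 0" using c p by simp
  have "(\<sigma> ^^ i) x = (\<sigma> ^^ j) x \<longleftrightarrow> (\<sigma> ^^ (i mod p)) x = (\<sigma> ^^ (j mod p)) x"
    using md[of i] md[of j] by simp
  also have "\<dots> \<longleftrightarrow> i mod p = j mod p"
    using inj_on_eq_iff[OF injp, of "i mod p" "j mod p"] p(1) by simp
  finally show "(\<sigma> ^^ i) x = (\<sigma> ^^ j) x \<longleftrightarrow> i mod card (orb \<sigma> x) = j mod card (orb \<sigma> x)" using c by simp
qed

lemma orb_eq:
  assumes \<sigma>: "\<sigma> \<in> perms n" and x: "x < n" and y: "y \<in> orb \<sigma> x"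
  shows "orb \<sigma> y = orb \<sigma> x"
proof -
  obtain k where k: "y = (\<sigma> ^^ k) x" using y by (auto simp: orb_def)
  define m where "m = card (orb \<sigma> x)"
  have m: "m > 0" using funpow_eq_iff(2)[OF \<sigma> x] by (simp add: m_def)
  have "orb \<sigma> y \<subseteq> orb \<sigma> x"
    unfolding orb_def k by clarify (metis comp_apply funpow_add rangeI)
  moreover have "orb \<sigma> x \<subseteq> orb \<sigma> y"
  proof
    fix z assume "z \<in> orb \<sigma> x"
    then obtain j where j: "z = (\<sigma> ^^ j) x" by (auto simp: orb_def)
    \<comment> \<open>Going k steps back is going \<open>k * (m - 1)\<close> steps forward, since m
      is the period.\<close>
    have "j mod m = (j + k * (m - 1) + k) mod m"
    proof -
      have e: "j + k * (m - 1) + k = j + k * m" using m by (cases m) auto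
      show ?thesis unfolding e by simp
    qed
    then have "z = (\<sigma> ^^ (j + k * (m - 1) + k)) x"
      using funpow_eq_iff(1)[OF \<sigma> x] j by (simp add: m_def)
    also have "\<dots> = (\<sigma> ^^ (j + k * (m - 1))) y" by (simp add: k funpow_add)
    finally show "z \<in> orb \<sigma> y" by (auto simp: orb_def)
  qed
  ultimately show ?thesis by simp
qed

definition orbs :: "nat \<Rightarrow> (nat \<Rightarrow> nat) \<Rightarrow> nat set set" where
  "orbs n \<sigma> = orb \<sigma> ` {..<n}"

lemma finite_orbs [simp]: "finite (orbs n \<sigma>)"
  by (simp add: orbs_def)

text \<open>Fix a point \<open>s Q\<close> in each orbit and send its k-th iterate under \<sigma> to
  the k-th iterate of \<open>s (h Q)\<close> under \<tau>. Equal orbit sizes make this well defined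
  and injective.\<close>

lemma conjugate_if_orbs:
  assumes \<sigma>: "\<sigma> \<in> perms n" and \<tau>: "\<tau> \<in> perms n"
    and h: "bij_betw h (orbs n \<sigma>) (orbs n \<tau>)" "\<And>Q. Q \<in> orbs n \<sigma> \<Longrightarrow> card (h Q) = card Q"
  shows "\<exists>\<rho>\<in>perms n. \<rho> \<circ> \<sigma> = \<tau> \<circ> \<rho>"
proof -
  define s where "s Q = (SOME x. x \<in> Q \<and> x < n)" for Q :: "nat set"
  have rep: "s Q < n \<and> orb \<pi> (s Q) = Q" if \<pi>: "\<pi> \<in> perms n" and Q: "Q \<in> orbs n \<pi>" for \<pi> Q
  proof -
    obtain x where x: "x < n" "Q = orb \<pi> x" using Q by (auto simp: orbs_def)
    then have "x \<in> Q \<and> x < n" using orb_refl by simp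
    then have "s Q \<in> Q \<and> s Q < n" unfolding s_def by (rule someI)
    then show ?thesis using orb_eq[OF \<pi> x(1)] x by auto
  qed
  have Q\<sigma>: "orb \<sigma> x \<in> orbs n \<sigma>" if "x < n" for x using that by (auto simp: orbs_def)
  have hO: "h Q \<in> orbs n \<tau>" if "Q \<in> orbs n \<sigma>" for Q using bij_betwE[OF h(1)] that by blast
  have exk: "\<exists>k. (\<sigma> ^^ k) (s (orb \<sigma> x)) = x" if "x < n" for x
  proof -
    have "x \<in> orb \<sigma> (s (orb \<sigma> x))" using rep[OF \<sigma> Q\<sigma>[OF that]] orb_refl by simp
    then obtain k where "x = (\<sigma> ^^ k) (s (orb \<sigma> x))" unfolding orb_def[of \<sigma> "s (orb \<sigma> x)"] by blast
    then show ?thesis by metis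
  qed
  define K where "K x = (SOME k. (\<sigma> ^^ k) (s (orb \<sigma> x)) = x)" for x
  have K: "(\<sigma> ^^ K x) (s (orb \<sigma> x)) = x" if "x < n" for x
    unfolding K_def by (rule someI_ex[OF exk[OF that]])
  define \<rho> where "\<rho> x = (if x < n then (\<tau> ^^ K x) (s (h (orb \<sigma> x))) else x)" for x
  have shift: "(\<tau> ^^ i) (s (h Q)) = (\<tau> ^^ j) (s (h Q)) \<longleftrightarrow> (\<sigma> ^^ i) (s Q) = (\<sigma> ^^ j) (s Q)" if Q: "Q \<in> orbs n \<sigma>" for i j Q
    using funpow_eq_iff(1)[OF \<sigma>, of "s Q" i j] funpow_eq_iff(1)[OF \<tau>, of "s (h Q)" i j]
      rep[OF \<sigma> Q] rep[OF \<tau> hO[OF Q]] h(2)[OF Q] by simp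
  have \<rho>k: "\<rho> x = (\<tau> ^^ k) (s (h (orb \<sigma> x)))" if "x < n" "(\<sigma> ^^ k) (s (orb \<sigma> x)) = x" for x k
    using shift[OF Q\<sigma>[OF that(1)], of "K x" k] K[OF that(1)] that by (simp add: \<rho>_def)
  have lt: "\<rho> x < n" if "x < n" for x
    using perms_less[OF perms_funpow[OF \<tau>]] rep[OF \<tau> hO[OF Q\<sigma>[OF that]]] that by (simp add: \<rho>_def)
  have orb\<rho>: "orb \<tau> (\<rho> x) = h (orb \<sigma> x)" if "x < n" for x
  proof -
    have r: "s (h (orb \<sigma> x)) < n" "orb \<tau> (s (h (orb \<sigma> x))) = h (orb \<sigma> x)"
      using rep[OF \<tau> hO[OF Q\<sigma>[OF that]]] by auto
    have "\<rho> x \<in> orb \<tau> (s (h (orb \<sigma> x)))" using that by (auto simp: \<rho>_def orb_def)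
    then show ?thesis using orb_eq[OF \<tau> r(1)] r(2) by simp
  qed
  have "inj_on \<rho> {..<n}"
  proof (rule inj_onI)
    fix x y assume xy: "x \<in> {..<n}" "y \<in> {..<n}" "\<rho> x = \<rho> y"
    then have "h (orb \<sigma> x) = h (orb \<sigma> y)" using orb\<rho> by (metis lessThan_iff)
    then have Q: "orb \<sigma> x = orb \<sigma> y"
      using inj_onD[OF bij_betw_imp_inj_on[OF h(1)]] Q\<sigma> xy by auto
    have "(\<tau> ^^ K x) (s (h (orb \<sigma> x))) = (\<tau> ^^ K y) (s (h (orb \<sigma> x)))" using xy Q by (simp add: \<rho>_def)
    then have "(\<sigma> ^^ K x) (s (orb \<sigma> x)) = (\<sigma> ^^ K y) (s (orb \<sigma> x))" using shift[OF Q\<sigma>, of x] xy by simp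
    then have "(\<sigma> ^^ K x) (s (orb \<sigma> x)) = (\<sigma> ^^ K y) (s (orb \<sigma> y))" unfolding Q .
    moreover have "(\<sigma> ^^ K x) (s (orb \<sigma> x)) = x" "(\<sigma> ^^ K y) (s (orb \<sigma> y)) = y" by (rule K, use xy in simp)+
    ultimately show "x = y" by metis
  qed
  then have "bij_betw \<rho> {..<n} {..<n}"
    using lt endo_inj_surj[of "{..<n}" \<rho>] by (auto simp: bij_betw_def)
  then have \<rho>: "\<rho> \<in> perms n" using bij_imp_permutes[of \<rho> "{..<n}"] by (simp add: \<rho>_def)
  have "\<rho> \<circ> \<sigma> = \<tau> \<circ> \<rho>"
  proof (rule perms_eqI[OF perms_comp[OF \<rho> \<sigma>] perms_comp[OF \<tau> \<rho>]])
    fix x assume x: "x < n"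
    have sx: "\<sigma> x < n" using perms_less[OF \<sigma>] x by simp
    have "\<sigma> x \<in> orb \<sigma> x" unfolding orb_def by (rule range_eqI[of _ _ 1]) simp
    then have Q: "orb \<sigma> (\<sigma> x) = orb \<sigma> x" by (rule orb_eq[OF \<sigma> x])
    have "(\<sigma> ^^ Suc (K x)) (s (orb \<sigma> (\<sigma> x))) = \<sigma> x" using K[OF x] Q by simp
    then have "\<rho> (\<sigma> x) = (\<tau> ^^ Suc (K x)) (s (h (orb \<sigma> (\<sigma> x))))" by (rule \<rho>k[OF sx])
    then show "(\<rho> \<circ> \<sigma>) x = (\<tau> \<circ> \<rho>) x" using Q x by (simp add: \<rho>_def)
  qed
  then show ?thesis using \<rho> by blast
qed

text \<open>Cycle type: the orbit sizes in decreasing order, hence a partition.\<close>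

definition cyc :: "nat \<Rightarrow> (nat \<Rightarrow> nat) \<Rightarrow> nat list" where
  "cyc n \<sigma> = rev (sorted_list_of_multiset (image_mset card (mset_set (orbs n \<sigma>))))"

lemma mset_cyc: "mset (cyc n \<sigma>) = image_mset card (mset_set (orbs n \<sigma>))"
  by (simp add: cyc_def)

lemma cyc_partition:
  assumes \<sigma>: "\<sigma> \<in> perms n"
  shows "cyc n \<sigma> \<in> partitions_of n"
proof -
  have "sorted_wrt (\<ge>) (cyc n \<sigma>)"
    unfolding cyc_def sorted_wrt_rev using sorted_sorted_list_of_multiset by simp
  moreover have "0 \<notin> set (cyc n \<sigma>)"
  proof -
    have "set (cyc n \<sigma>) = card ` orbs n \<sigma>"
      by (metis finite_orbs finite_set_mset_mset_set mset_cyc set_image_mset set_mset_mset)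
    then show ?thesis using funpow_eq_iff(2)[OF \<sigma>] by (auto simp: orbs_def) (metis less_irrefl)
  qed
  moreover have "sum_list (cyc n \<sigma>) = n"
  proof -
    have "sum_list (cyc n \<sigma>) = sum_mset (mset (cyc n \<sigma>))" by (simp add: sum_mset_sum_list)
    also have "\<dots> = (\<Sum>Q\<in>orbs n \<sigma>. card Q)" unfolding mset_cyc by (simp add: sum_unfold_sum_mset)
    also have "\<dots> = card (\<Union>(orbs n \<sigma>))"
    proof (rule card_Union_disjoint[symmetric])
      show "pairwise disjnt (orbs n \<sigma>)"
      proof (rule pairwiseI)
        fix A B assume AB: "A \<in> orbs n \<sigma>" "B \<in> orbs n \<sigma>" "A \<noteq> B"
        then obtain x y where xy: "x < n" "y < n" "A = orb \<sigma> x" "B = orb \<sigma> y" by (auto simp: orbs_def)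
        show "disjnt A B"
        proof (rule ccontr)
          assume "\<not> disjnt A B"
          then obtain z where "z \<in> orb \<sigma> x" "z \<in> orb \<sigma> y" using xy by (auto simp: disjnt_def)
          then have "A = B" using orb_eq[OF \<sigma> xy(1)] orb_eq[OF \<sigma> xy(2)] xy by metis
          then show False using AB by simp
        qed
      qed
      show "finite A" if "A \<in> orbs n \<sigma>" for A
        using that finite_subset[OF orb_subset[OF \<sigma>]] by (auto simp: orbs_def)
    qed
    also have "\<Union>(orbs n \<sigma>) = {..<n}"
      using orb_subset[OF \<sigma>] orb_refl by (auto simp: orbs_def)
    finally show ?thesis by simp
  qed
  ultimately show ?thesis by (simp add: partitions_of_def is_partition_def)
qed

lemma cyc_conjugate:
  assumes \<sigma>: "\<sigma> \<in> perms n" and \<tau>: "\<tau> \<in> perms n" and eq: "cyc n \<sigma> = cyc n \<tau>"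
  shows "\<exists>\<rho>\<in>perms n. \<rho> \<circ> \<sigma> = \<tau> \<circ> \<rho>"
proof -
  have count: "count (mset (cyc n \<pi>)) k = card {Q \<in> orbs n \<pi>. card Q = k}" for \<pi> k
    unfolding mset_cyc count_image_mset by (simp add: vimage_def Int_def conj_commute)
  have "card {Q \<in> orbs n \<sigma>. card Q = k} = card {Q \<in> orbs n \<tau>. card Q = k}" for k
    using count[of \<sigma> k] count[of \<tau> k] eq by simp
  then obtain h where "bij_betw h (orbs n \<sigma>) (orbs n \<tau>)" "\<forall>Q\<in>orbs n \<sigma>. card (h Q) = card Q"
    using fibre_bij[of "orbs n \<sigma>" "orbs n \<tau>" card card] by auto
  then show ?thesis using conjugate_if_orbs[OF \<sigma> \<tau>] by blast
qed

lemma class_fun_cyc: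
  assumes f: "class_fun n f" and "\<sigma> \<in> perms n" "\<tau> \<in> perms n" "cyc n \<sigma> = cyc n \<tau>"
  shows "f \<sigma> = f \<tau>"
proof -
  obtain \<rho> where \<rho>: "\<rho> \<in> perms n" "\<rho> \<circ> \<sigma> = \<tau> \<circ> \<rho>" using cyc_conjugate[OF assms(2-4)] by blast
  then have "\<sigma> = inv \<rho> \<circ> (\<tau> \<circ> \<rho>)" using perms_cancel(3)[OF \<rho>(1), of \<sigma>] by simp
  then show ?thesis using f assms(3) \<rho>(1) by (simp add: class_fun_def)
qed

section \<open>Expansion of class functions in irreducible characters\<close>

lemma finite_partitions_of [simp]: "finite (partitions_of n)"
proof (rule finite_subset)
  show "partitions_of n \<subseteq> {l. set l \<subseteq> {..n} \<and> length l \<le> n}"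
  proof
    fix l assume l: "l \<in> partitions_of n"
    have "set l \<subseteq> {..n}" using l member_le_sum_list[of _ l] by (auto simp: partitions_of_def)
    moreover have "length l \<le> sum_list l"
    proof -
      have "0 \<notin> set l \<Longrightarrow> length l \<le> sum_list l" for l :: "nat list"
        by (induction l) (auto simp: Suc_le_eq)
      moreover have "0 \<notin> set l" using l by (simp add: partitions_of_def is_partition_def)
      ultimately show ?thesis by blast
    qed
    ultimately show "l \<in> {l. set l \<subseteq> {..n} \<and> length l \<le> n}" using l by (simp add: partitions_of_def)
  qed
qed (simp add: finite_lists_length_le)

lemma ip_sum_left: "ip n (\<lambda>\<sigma>. \<Sum>a\<in>A. F a \<sigma>) g = (\<Sum>a\<in>A. ip n (F a) g)"
proof -
  have "(\<Sum>\<sigma>\<in>perms n. (\<Sum>a\<in>A. F a \<sigma>) * g (inv \<sigma>)) = (\<Sum>\<sigma>\<in>perms n. \<Sum>a\<in>A. F a \<sigma> * g (inv \<sigma>))"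
    by (simp add: sum_distrib_right)
  also have "\<dots> = (\<Sum>a\<in>A. \<Sum>\<sigma>\<in>perms n. F a \<sigma> * g (inv \<sigma>))" by (rule sum.swap)
  finally show ?thesis by (simp add: ip_def sum_divide_distrib)
qed

lemma ip_scale_left: "ip n (\<lambda>\<sigma>. k * f \<sigma>) g = k * ip n f g"
  by (simp add: ip_def sum_distrib_left mult.assoc)

lemma ip_commute: "ip n f g = ip n g f"
proof -
  have "(\<Sum>\<sigma>\<in>perms n. f \<sigma> * g (inv \<sigma>)) = (\<Sum>\<sigma>\<in>perms n. f (inv \<sigma>) * g (inv (inv \<sigma>)))"
    by (rule sum_perms_inv[symmetric])
  also have "\<dots> = (\<Sum>\<sigma>\<in>perms n. g \<sigma> * f (inv \<sigma>))"
    by (intro sum.cong refl) (simp add: permutes_inv_inv mult.commute)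
  finally show ?thesis by (simp add: ip_def)
qed

lemma ip_diff_left: "ip n (\<lambda>\<sigma>. f \<sigma> - f' \<sigma>) g = ip n f g - ip n f' g"
  by (simp add: ip_def left_diff_distrib sum_subtractf diff_divide_distrib)

lemma ip_diff_right: "ip n g (\<lambda>\<sigma>. f \<sigma> - f' \<sigma>) = ip n g f - ip n g f'"
  by (simp add: ip_commute[of n g] ip_diff_left)

lemma ip_combination:
  assumes m: "m \<in> partitions_of n" and f: "\<And>\<sigma>. \<sigma> \<in> perms n \<Longrightarrow> f \<sigma> = (\<Sum>l\<in>partitions_of n. g l * irr_char l \<sigma>)"
  shows "ip n f (irr_char m) = g m"
proof -
  have "ip n f (irr_char m) = ip n (\<lambda>\<sigma>. \<Sum>l\<in>partitions_of n. g l * irr_char l \<sigma>) (irr_char m)"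
    by (rule ip_cong) (use f in auto)
  also have "\<dots> = (\<Sum>l\<in>partitions_of n. g l * ip n (irr_char l) (irr_char m))"
    by (simp add: ip_sum_left ip_scale_left)
  also have "\<dots> = (\<Sum>l\<in>partitions_of n. if l = m then g m else 0)"
    by (intro sum.cong refl) (use m in \<open>auto simp: ip_irr_char\<close>)
  also have "\<dots> = g m" using m by simp
  finally show ?thesis .
qed

text \<open>Dimension count: the irreducible characters are orthonormal, hence independent, and
  there is one for each partition of n; the class functions are spanned by the indicators of cycle
  types, of which there are no more.\<close>

lemma class_fun_expansion:
  assumes f: "class_fun n f" and \<sigma>: "\<sigma> \<in> perms n"
  shows "f \<sigma> = (\<Sum>l\<in>partitions_of n. ip n f (irr_char l) * irr_char l \<sigma>)"
proof -
  \<comment> \<open>Values off the group are arbitrary and would leave the span of the indicators,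
    so functions are cut to the group.\<close>
  define res where "res h = (\<lambda>\<sigma>. if \<sigma> \<in> perms n then h \<sigma> else 0)" for h :: "(nat \<Rightarrow> nat) \<Rightarrow> complex"
  define ind where "ind t = res (\<lambda>\<sigma>. if cyc n \<sigma> = t then 1 else 0)" for t
  define C where "C = ind ` partitions_of n"
  define B where "B = (\<lambda>l. res (irr_char l)) ` partitions_of n"
  have spanC: "res h \<in> fs.span C" if h: "class_fun n h" for h
  proof -
    define v where "v t = h (SOME \<sigma>. \<sigma> \<in> perms n \<and> cyc n \<sigma> = t)" for t
    have "res h = (\<Sum>t\<in>partitions_of n. fscale (v t) (ind t))"
    proof
      fix \<sigma>
      show "res h \<sigma> = (\<Sum>t\<in>partitions_of n. fscale (v t) (ind t)) \<sigma>"
      proof (cases "\<sigma> \<in> perms n")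
        case True
        have "(SOME \<sigma>'. \<sigma>' \<in> perms n \<and> cyc n \<sigma>' = cyc n \<sigma>) \<in> perms n \<and>
            cyc n (SOME \<sigma>'. \<sigma>' \<in> perms n \<and> cyc n \<sigma>' = cyc n \<sigma>) = cyc n \<sigma>"
          by (rule someI[of "\<lambda>\<sigma>'. \<sigma>' \<in> perms n \<and> cyc n \<sigma>' = cyc n \<sigma>" \<sigma>]) (use True in auto)
        then have "v (cyc n \<sigma>) = h \<sigma>" unfolding v_def using class_fun_cyc[OF h _ True] by blast
        moreover have "(\<Sum>t\<in>partitions_of n. fscale (v t) (ind t)) \<sigma> =
            (\<Sum>t\<in>partitions_of n. if t = cyc n \<sigma> then v (cyc n \<sigma>) else 0)"
          unfolding sum_fun_apply by (intro sum.cong refl) (use True in \<open>auto simp: fscale_def ind_def res_def\<close>)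
        ultimately show ?thesis using True cyc_partition[OF True] by (simp add: res_def)
      next
        case False
        then show ?thesis by (simp add: sum_fun_apply res_def ind_def fscale_def)
      qed
    qed
    also have "\<dots> \<in> fs.span C"
      by (intro fs.span_sum fs.span_scale fs.span_base) (auto simp: C_def)
    finally show ?thesis .
  qed
  have ipres: "ip n (res h) g = ip n h g" for h g by (rule ip_cong) (auto simp: res_def)
  have injB: "inj_on (\<lambda>l. res (irr_char l)) (partitions_of n)"
  proof (rule inj_onI)
    fix l m assume lm: "l \<in> partitions_of n" "m \<in> partitions_of n" "res (irr_char l) = res (irr_char m)"
    have "ip n (irr_char l) (irr_char m) = ip n (irr_char m) (irr_char m)" using lm(3) ipres by metis
    then show "l = m" using lm by (simp add: ip_irr_char split: if_splits)
  qed
  have finB: "finite B" by (simp add: B_def)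
  have comb: "ip n (\<Sum>b\<in>B. fscale (u b) b) (irr_char m) = u (res (irr_char m))" if m: "m \<in> partitions_of n" for u m
  proof (rule ip_combination[OF m])
    fix \<sigma> assume "\<sigma> \<in> perms n"
    then show "(\<Sum>b\<in>B. fscale (u b) b) \<sigma> = (\<Sum>l\<in>partitions_of n. u (res (irr_char l)) * irr_char l \<sigma>)"
      by (simp add: sum_fun_apply B_def sum.reindex[OF injB] fscale_def) (simp add: res_def)
  qed
  have indB: "fs.independent B"
  proof -
    have "u b = 0" if u: "(\<Sum>b\<in>B. fscale (u b) b) = 0" and b: "b \<in> B" for u b
    proof -
      obtain m where m: "m \<in> partitions_of n" "b = res (irr_char m)" using b by (auto simp: B_def)
      show ?thesis using comb[OF m(1), of u] u m(2) by (simp add: ip_def)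
    qed
    then show ?thesis using fs.dependent_finite[OF finB] by blast
  qed
  have cB: "card B = card (partitions_of n)" by (simp add: B_def card_image[OF injB])
  have BC: "B \<subseteq> fs.span C" using spanC[OF class_fun_irr_char] by (auto simp: B_def)
  have "res f \<in> fs.span B"
  proof (rule ccontr)
    assume "res f \<notin> fs.span B"
    \<comment> \<open>One more independent element would exceed the size of the spanning set
      C.\<close>
    then have "fs.independent (insert (res f) B)" using indB by (simp add: fs.independent_insert)
    then have "card (insert (res f) B) \<le> card C"
      using fs.independent_span_bound[of C "insert (res f) B"] BC spanC[OF f] by (auto simp: C_def)
    moreover have "res f \<notin> B" using \<open>res f \<notin> fs.span B\<close> fs.span_base by blast
    moreover have "card C \<le> card (partitions_of n)" by (simp add: C_def card_image_le)
    ultimately show False using cB finB by simp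
  qed
  then obtain u where u: "res f = (\<Sum>b\<in>B. fscale (u b) b)"
    using fs.span_finite[OF finB] by auto
  have eq: "f \<sigma> = (\<Sum>l\<in>partitions_of n. u (res (irr_char l)) * irr_char l \<sigma>)" if "\<sigma> \<in> perms n" for \<sigma>
  proof -
    have "f \<sigma> = (\<Sum>b\<in>B. fscale (u b) b) \<sigma>" using fun_cong[OF u, of \<sigma>] that by (simp add: res_def)
    also have "\<dots> = (\<Sum>l\<in>partitions_of n. u (res (irr_char l)) * irr_char l \<sigma>)"
      using that by (simp add: sum_fun_apply B_def sum.reindex[OF injB] fscale_def) (simp add: res_def)
    finally show ?thesis .
  qed
  have "ip n f (irr_char m) = u (res (irr_char m))" if "m \<in> partitions_of n" for m
    by (rule ip_combination[OF that eq])
  then show ?thesis using eq[OF \<sigma>] by simp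
qed

text \<open>For the description under \<open>THE\<close>, existence is
  \<open>class_fun_expansion\<close> and uniqueness is \<open>ip_combination\<close>.\<close>

lemma irr_multiplicity_eq:
  assumes f: "class_fun n f"
  shows "irr_multiplicity n f \<nu> = (if \<nu> \<in> partitions_of n then ip n f (irr_char \<nu>) else 0)"
proof -
  define g where "g \<nu> = (if \<nu> \<in> partitions_of n then ip n f (irr_char \<nu>) else 0)" for \<nu>
  have "irr_multiplicity n f = g"
    unfolding irr_multiplicity_def
  proof (rule the_equality)
    show "(\<forall>\<nu>. \<nu> \<notin> partitions_of n \<longrightarrow> g \<nu> = 0) \<and>
      (\<forall>\<sigma>. \<sigma> permutes {..<n} \<longrightarrow> f \<sigma> = (\<Sum>\<nu>\<in>partitions_of n. g \<nu> * irr_char \<nu> \<sigma>))"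
      using class_fun_expansion[OF f] by (simp add: g_def)
  next
    fix g' assume g': "(\<forall>\<nu>. \<nu> \<notin> partitions_of n \<longrightarrow> g' \<nu> = 0) \<and>
      (\<forall>\<sigma>. \<sigma> permutes {..<n} \<longrightarrow> f \<sigma> = (\<Sum>\<nu>\<in>partitions_of n. g' \<nu> * irr_char \<nu> \<sigma>))"
    show "g' = g"
    proof
      fix \<nu>
      show "g' \<nu> = g \<nu>"
        using g' ip_combination[of \<nu> n f g'] by (cases "\<nu> \<in> partitions_of n") (auto simp: g_def)
    qed
  qed
  then show ?thesis by (simp add: g_def)
qed

lemma class_fun_mult: "class_fun n f \<Longrightarrow> class_fun n g \<Longrightarrow> class_fun n (\<lambda>\<sigma>. f \<sigma> * g \<sigma>)"
  by (simp add: class_fun_def)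

lemma class_fun_diff: "class_fun n f \<Longrightarrow> class_fun n g \<Longrightarrow> class_fun n (\<lambda>\<sigma>. f \<sigma> - g \<sigma>)"
  by (simp add: class_fun_def)

lemma kronecker_coeff_eq:
  assumes "l \<in> partitions_of n" "m \<in> partitions_of n"
  shows "kronecker_coeff l m \<nu> =
    (if \<nu> \<in> partitions_of n then ip n (\<lambda>\<sigma>. irr_char l \<sigma> * irr_char m \<sigma>) (irr_char \<nu>) else 0)"
proof -
  have "sum_list l = n" using assms(1) by (simp add: partitions_of_def)
  then show ?thesis
    unfolding kronecker_coeff_def
    by (simp add: irr_multiplicity_eq[OF class_fun_mult[OF class_fun_irr_char[OF assms(1)] class_fun_irr_char[OF assms(2)]]])
qed

lemma parseval:
  assumes f: "class_fun n f"
  shows "ip n f g = (\<Sum>l\<in>partitions_of n. ip n f (irr_char l) * ip n g (irr_char l))"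
proof -
  have "ip n f g = ip n (\<lambda>\<sigma>. \<Sum>l\<in>partitions_of n. ip n f (irr_char l) * irr_char l \<sigma>) g"
    by (rule ip_cong) (use class_fun_expansion[OF f] in auto)
  then show ?thesis by (simp add: ip_sum_left ip_scale_left ip_commute[of n g])
qed

section \<open>Kronecker coefficients as dimensions of spaces of highest weight polynomials\<close>

text \<open>
  For tableaux \<open>(r\<^sub>i, c\<^sub>i)\<close> of shapes \<open>f\<^sub>i\<close>, antisymmetrizing the monomial
  \<open>\<Prod>x. X (r\<^sub>1 x, r\<^sub>2 x, r\<^sub>3 x)\<close> along the columns gives a polynomial in the variables \<open>X (i, j, k)\<close>;
  these polynomials span a space of dimension the Kronecker coefficient. Disjoint unions of tableaux
  multiply the polynomials, whence the semigroup property.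
\<close>

definition hw :: "nat \<Rightarrow> (nat \<Rightarrow> nat) \<Rightarrow> (nat \<Rightarrow> nat) \<Rightarrow> (nat \<Rightarrow> nat) \<Rightarrow> (nat \<Rightarrow> nat) \<Rightarrow>
    (nat \<Rightarrow> nat) \<Rightarrow> (nat \<Rightarrow> nat) \<Rightarrow> (nat \<times> nat \<times> nat \<Rightarrow> complex) \<Rightarrow> complex" where
  "hw n r1 c1 r2 c2 r3 c3 X =
     (\<Sum>q1\<in>stab n c1. of_int (sign q1) * (\<Sum>q2\<in>stab n c2. of_int (sign q2) * (\<Sum>q3\<in>stab n c3. of_int (sign q3) *
        (\<Prod>x<n. X (r1 (q1 x), r2 (q2 x), r3 (q3 x))))))"

definition hws :: "nat \<Rightarrow> (nat \<Rightarrow> nat) \<Rightarrow> (nat \<Rightarrow> nat) \<Rightarrow> (nat \<Rightarrow> nat) \<Rightarrow> ((nat \<times> nat \<times> nat \<Rightarrow> complex) \<Rightarrow> complex) set" where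
  "hws n f1 f2 f3 = {hw n r1 c1 r2 c2 r3 c3 | r1 c1 r2 c2 r3 c3. tab n r1 c1 f1 \<and> tab n r2 c2 f2 \<and> tab n r3 c3 f3}"

definition W :: "nat \<Rightarrow> (nat \<Rightarrow> nat) \<Rightarrow> (nat \<Rightarrow> nat) \<Rightarrow> (nat \<Rightarrow> nat) \<Rightarrow> ((nat \<times> nat \<times> nat \<Rightarrow> complex) \<Rightarrow> complex) set" where
  "W n f1 f2 f3 = fs.span (hws n f1 f2 f3)"

definition kr :: "nat \<Rightarrow> (nat \<Rightarrow> nat) \<Rightarrow> (nat \<Rightarrow> nat) \<Rightarrow> (nat \<Rightarrow> nat) \<Rightarrow> nat" where
  "kr n f1 f2 f3 = fs.dim (W n f1 f2 f3)"

section \<open>Recovering a multiset of exponents from one number\<close>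

lemma digits_unique:
  fixes d d' :: "nat \<Rightarrow> nat"
  assumes "\<And>k. d k < B" "\<And>k. d' k < B" "(\<Sum>k<K. d k * B ^ k) = (\<Sum>k<K. d' k * B ^ k)" "k < K"
  shows "d k = d' k"
  using assms
proof (induction K arbitrary: d d' k)
  case (Suc K)
  have e: "(\<Sum>k<Suc K. d k * B ^ k) = d 0 + B * (\<Sum>k<K. d (Suc k) * B ^ k)" for d
    by (simp only: sum.lessThan_Suc_shift) (simp add: sum_distrib_left mult_ac)
  have eq: "d 0 + B * (\<Sum>k<K. d (Suc k) * B ^ k) = d' 0 + B * (\<Sum>k<K. d' (Suc k) * B ^ k)"
    using Suc.prems(3) unfolding e .
  have B: "B > 0" using Suc.prems(1)[of 0] by simp
  have "d 0 = d' 0"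
    using arg_cong[OF eq, of "\<lambda>x. x mod B"] Suc.prems(1,2)[of 0] by simp
  moreover have "(\<Sum>k<K. d (Suc k) * B ^ k) = (\<Sum>k<K. d' (Suc k) * B ^ k)"
    using eq calculation B by simp
  then have "d (Suc k) = d' (Suc k)" if "k < K" for k
    by (rule Suc.IH[rotated 2]) (use Suc.prems that in auto)
  ultimately show ?case using Suc.prems(4) by (cases k) auto
qed simp

text \<open>The fibre sizes of u are at most n, so they are the base n + 1 digits of the sum. In
  \<open>Phi_zero\<close> this identifies a monomial by a single exponent.\<close>

lemma power_sums_eq:
  fixes u u' :: "nat \<Rightarrow> nat"
  assumes eq: "(\<Sum>x<n. (n + 1) ^ u x) = (\<Sum>x<n. (n + 1) ^ u' x)"
  shows "card {x. x < n \<and> u x = k} = card {x. x < n \<and> u' x = k}"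
proof -
  have bd: "\<exists>K. \<forall>x<n. u x < K" for u :: "nat \<Rightarrow> nat"
  proof -
    have "finite (u ` {..<n})" by simp
    then show ?thesis unfolding finite_nat_set_iff_bounded by auto
  qed
  obtain K1 K2 where "\<forall>x<n. u x < K1" "\<forall>x<n. u' x < K2" using bd by metis
  then obtain K where K: "\<forall>x<n. u x < K" "\<forall>x<n. u' x < K" "k < K"
    by (intro that[of "K1 + K2 + Suc k"]) (auto simp: trans_less_add1 trans_less_add2)
  have sums: "(\<Sum>x<n. (n + 1) ^ u x) = (\<Sum>k<K. card {x. x < n \<and> u x = k} * (n + 1) ^ k)" if "\<forall>x<n. u x < K" for u :: "nat \<Rightarrow> nat"
  proof -
    have "(\<Sum>x<n. (n + 1) ^ u x) = (\<Sum>k<K. \<Sum>x | x \<in> {..<n} \<and> u x = k. (n + 1) ^ u x)"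
      by (rule sum.group[symmetric]) (use that in auto)
    also have "\<dots> = (\<Sum>k<K. card {x. x < n \<and> u x = k} * (n + 1) ^ k)"
      by (intro sum.cong refl) simp
    finally show ?thesis .
  qed
  have small: "card {x. x < n \<and> u x = k} < n + 1" for u :: "nat \<Rightarrow> nat" and k
  proof -
    have "card {x. x < n \<and> u x = k} \<le> card {..<n}" by (rule card_mono) auto
    then show ?thesis by simp
  qed
  show ?thesis
    by (rule digits_unique[of "\<lambda>k. card {x. x < n \<and> u x = k}" "n + 1" "\<lambda>k. card {x. x < n \<and> u' x = k}" K])
      (use small eq sums K in auto)
qed

lemma sum_triple_factor:
  fixes f1 f2 f3 :: "'a \<Rightarrow> complex"
  shows "(\<Sum>(a, b, c)\<in>A \<times> A \<times> A. f1 a * f2 b * f3 c) = (\<Sum>a\<in>A. f1 a) * (\<Sum>b\<in>A. f2 b) * (\<Sum>c\<in>A. f3 c)"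
  unfolding sum.cartesian_product[symmetric]
  by (simp add: sum_distrib_left[symmetric] sum_distrib_right[symmetric])

lemma ysym_left: "\<tau> \<in> stab n r \<Longrightarrow> ysym n r c (\<tau> \<circ> \<sigma>) = ysym n r c \<sigma>"
proof -
  assume \<tau>: "\<tau> \<in> stab n r"
  have "ysym n r c (\<tau> \<circ> \<sigma>) = (\<Sum>\<rho>\<in>stab n r. csym n c (inv (inv \<rho>) \<circ> (\<tau> \<circ> \<sigma>)))"
    unfolding ysym_def gm_rsym by (rule sum_stab_inv[symmetric])
  also have "\<dots> = (\<Sum>\<rho>\<in>stab n r. csym n c ((\<rho> \<circ> \<tau>) \<circ> \<sigma>))"
    by (intro sum.cong refl) (simp add: perms_inv_inv[OF stab_perms] comp_assoc)
  also have "\<dots> = (\<Sum>\<rho>\<in>stab n r. csym n c (\<rho> \<circ> \<sigma>))"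
    by (rule sum_stab_right[OF \<tau>])
  also have "\<dots> = (\<Sum>\<rho>\<in>stab n r. csym n c (inv \<rho> \<circ> \<sigma>))"
    by (rule sum_stab_inv[symmetric])
  finally show ?thesis by (simp add: ysym_def gm_rsym)
qed

lemma ye_left: "\<tau> \<in> stab n r \<Longrightarrow> ye n r c (\<tau> \<circ> \<sigma>) = ye n r c \<sigma>"
  by (simp add: ye_def fscale_def ysym_left)

text \<open>F is constant along the row group, so the row sum inside \<open>ye\<close> contributes
  only a factor and the signs of the column group remain.\<close>

lemma sum_ye:
  assumes F: "\<And>\<tau> q. \<tau> \<in> stab n r \<Longrightarrow> q \<in> perms n \<Longrightarrow> F (\<tau> \<circ> q) = F q"
  shows "(\<Sum>q\<in>perms n. ye n r c q * F q) =
     of_nat (card (stab n r)) / yk n r c * (\<Sum>q\<in>stab n c. of_int (sign q) * F q)"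
proof -
  have "(\<Sum>q\<in>perms n. ysym n r c q * F q) = (\<Sum>q\<in>perms n. \<Sum>\<tau>\<in>stab n r. csym n c (inv \<tau> \<circ> q) * F q)"
    by (simp add: ysym_def gm_rsym sum_distrib_right)
  also have "\<dots> = (\<Sum>\<tau>\<in>stab n r. \<Sum>q\<in>perms n. csym n c (inv \<tau> \<circ> q) * F q)"
    by (rule sum.swap)
  also have "\<dots> = (\<Sum>\<tau>\<in>stab n r. \<Sum>q\<in>perms n. csym n c q * F q)"
  proof (rule sum.cong[OF refl])
    fix \<tau> assume \<tau>: "\<tau> \<in> stab n r"
    have "(\<Sum>q\<in>perms n. csym n c (inv \<tau> \<circ> q) * F q) = (\<Sum>q\<in>perms n. csym n c (inv \<tau> \<circ> (\<tau> \<circ> q)) * F (\<tau> \<circ> q))"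
      by (rule sum_perms_left[OF stab_perms[OF \<tau>], symmetric])
    also have "\<dots> = (\<Sum>q\<in>perms n. csym n c q * F q)"
      by (intro sum.cong refl) (simp only: perms_cancel(3)[OF stab_perms[OF \<tau>]] F[OF \<tau>])
    finally show "(\<Sum>q\<in>perms n. csym n c (inv \<tau> \<circ> q) * F q) = (\<Sum>q\<in>perms n. csym n c q * F q)" .
  qed
  also have "(\<Sum>q\<in>perms n. csym n c q * F q) = (\<Sum>q\<in>perms n. if q \<in> stab n c then of_int (sign q) * F q else 0)"
    by (intro sum.cong refl) (simp add: csym_def)
  also have "\<dots> = (\<Sum>q\<in>perms n \<inter> stab n c. of_int (sign q) * F q)"
    by (subst sum.inter_restrict) auto
  also have "perms n \<inter> stab n c = stab n c" by (auto simp: stab_def)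
  finally show ?thesis by (simp add: ye_def fscale_def mult.assoc sum_distrib_left[symmetric] sum_divide_distrib[symmetric])
qed

text \<open>Conjugation by s carries the column group of the relabelled tableau, with labels
  \<open>c \<circ> s\<close>, onto that of \<open>c\<close>, and preserves signs.\<close>

lemma sum_stab_conj:
  assumes s: "s \<in> perms n"
  shows "(\<Sum>q\<in>stab n (c \<circ> s). of_int (sign q) * F (s \<circ> q)) = (\<Sum>q\<in>stab n c. of_int (sign q) * (F (q \<circ> s) :: complex))"
proof (rule sum.reindex_bij_witness[of _ "\<lambda>q. inv s \<circ> (q \<circ> s)" "\<lambda>q. s \<circ> (q \<circ> inv s)"])
  have iff: "s \<circ> (q \<circ> inv s) \<in> stab n c \<longleftrightarrow> q \<in> stab n (c \<circ> s)" if "q \<in> perms n" for q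
    by (rule stab_conj[OF s that]) simp
  have sg: "sign (s \<circ> (q \<circ> inv s)) = sign q" if "q \<in> perms n" for q
    using sign_perms_comp[OF s perms_comp[OF that perms_inv[OF s]]] sign_perms_comp[OF that perms_inv[OF s]]
      sign_perms_inv[OF s] by (simp add: mult.left_commute)
  fix q
  have 1: "s \<circ> (inv s \<circ> (q \<circ> s) \<circ> inv s) = q" "inv s \<circ> (s \<circ> (q \<circ> inv s) \<circ> s) = q" "s \<circ> (q \<circ> inv s) \<circ> s = s \<circ> q"
    by (simp_all add: comp_assoc perms_cancel(1-4)[OF s])
  {
    assume q: "q \<in> stab n (c \<circ> s)"
    show "inv s \<circ> (s \<circ> (q \<circ> inv s) \<circ> s) = q" by (rule 1)
    show "s \<circ> (q \<circ> inv s) \<in> stab n c" using iff[OF stab_perms[OF q]] q by simp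
    show "of_int (sign (s \<circ> (q \<circ> inv s))) * F (s \<circ> (q \<circ> inv s) \<circ> s) = of_int (sign q) * F (s \<circ> q)"
      by (simp only: sg[OF stab_perms[OF q]] 1)
  }
  assume q: "q \<in> stab n c"
  have p: "inv s \<circ> (q \<circ> s) \<in> perms n" by (intro perms_comp perms_inv s stab_perms[OF q])
  show "s \<circ> (inv s \<circ> (q \<circ> s) \<circ> inv s) = q" by (rule 1)
  show "inv s \<circ> (q \<circ> s) \<in> stab n (c \<circ> s)" using iff[OF p] q by (simp only: 1)
qed

lemma sum3_perms_right:
  assumes g: "g1 \<in> perms n" "g2 \<in> perms n" "g3 \<in> perms n"
  shows "(\<Sum>a\<in>perms n. \<Sum>b\<in>perms n. \<Sum>c\<in>perms n. Z (a \<circ> g1) (b \<circ> g2) (c \<circ> g3)) =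
    (\<Sum>a\<in>perms n. \<Sum>b\<in>perms n. \<Sum>c\<in>perms n. Z a b c)"
proof -
  have "(\<Sum>a\<in>perms n. \<Sum>b\<in>perms n. \<Sum>c\<in>perms n. Z (a \<circ> g1) (b \<circ> g2) (c \<circ> g3)) =
    (\<Sum>a\<in>perms n. \<Sum>b\<in>perms n. \<Sum>c\<in>perms n. Z (a \<circ> g1) (b \<circ> g2) c)"
    by (intro sum.cong refl sum_perms_right[OF g(3)])
  also have "\<dots> = (\<Sum>a\<in>perms n. \<Sum>b\<in>perms n. \<Sum>c\<in>perms n. Z (a \<circ> g1) b c)"
    by (rule sum.cong[OF refl], rule sum_perms_right[OF g(2)])
  also have "\<dots> = (\<Sum>a\<in>perms n. \<Sum>b\<in>perms n. \<Sum>c\<in>perms n. Z a b c)"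
    by (rule sum_perms_right[OF g(1)])
  finally show ?thesis .
qed

section \<open>The idempotent whose rank is the Kronecker coefficient\<close>

locale triple =
  fixes n :: nat and r1 c1 f1 r2 c2 f2 r3 c3 f3 :: "nat \<Rightarrow> nat"
  assumes t1: "tab n r1 c1 f1" and t2: "tab n r2 c2 f2" and t3: "tab n r3 c3 f3"
begin

definition "e1 = ye n r1 c1"
definition "e2 = ye n r2 c2"
definition "e3 = ye n r3 c3"

definition "G3 = perms n \<times> perms n \<times> perms n"

text \<open>Kernel of an operator on functions on triples of permutations: left convolution with the
  tensor product of \<open>e1\<close>, \<open>e2\<close>, \<open>e3\<close>, then averaging over
  right translation by the diagonal. Its range corresponds to the invariants in the tensor product
  of the three modules.\<close>

definition ker :: "(nat \<Rightarrow> nat) \<times> (nat \<Rightarrow> nat) \<times> (nat \<Rightarrow> nat) \<Rightarrow> (nat \<Rightarrow> nat) \<times> (nat \<Rightarrow> nat) \<times> (nat \<Rightarrow> nat) \<Rightarrow> complex" where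
  "ker = (\<lambda>(a1, a2, a3) (b1, b2, b3). (\<Sum>g\<in>perms n. e1 (a1 \<circ> (g \<circ> inv b1)) * e2 (a2 \<circ> (g \<circ> inv b2)) * e3 (a3 \<circ> (g \<circ> inv b3))) / fact n)"

definition proj where
  "proj x = (\<lambda>a. if a \<in> G3 then \<Sum>b\<in>G3. ker a b * x b else 0)"

definition mon :: "(nat \<Rightarrow> nat) \<times> (nat \<Rightarrow> nat) \<times> (nat \<Rightarrow> nat) \<Rightarrow> (nat \<times> nat \<times> nat \<Rightarrow> complex) \<Rightarrow> complex" where
  "mon = (\<lambda>(a1, a2, a3) X. \<Prod>x<n. X (r1 (a1 x), r2 (a2 x), r3 (a3 x)))"

definition Phi where
  "Phi v = (\<lambda>X. \<Sum>a\<in>G3. v a * mon a X)"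

lemma finite_G3 [simp]: "finite G3"
  by (simp add: G3_def)

lemma e_conv:
  assumes e: "galg_mult n e e = e" and a: "a \<in> perms n" and b: "b \<in> perms n" and g: "g \<in> perms n" and h: "h \<in> perms n"
  shows "(\<Sum>s\<in>perms n. e (a \<circ> (g \<circ> inv s)) * e (s \<circ> (h \<circ> inv b))) = e (a \<circ> ((g \<circ> h) \<circ> inv b))"
proof -
  define \<pi> where "\<pi> = a \<circ> ((g \<circ> h) \<circ> inv b)"
  have ag: "a \<circ> g \<in> perms n" by (intro perms_comp a g)
  have "e \<pi> = (\<Sum>\<tau>\<in>perms n. e \<tau> * e (inv \<tau> \<circ> \<pi>))" by (subst e[symmetric]) (simp add: galg_mult_def)
  also have "\<dots> = (\<Sum>\<tau>\<in>perms n. e (a \<circ> g \<circ> \<tau>) * e (inv (a \<circ> g \<circ> \<tau>) \<circ> \<pi>))"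
    by (rule sum_perms_left[OF ag, symmetric])
  also have "\<dots> = (\<Sum>s\<in>perms n. e (a \<circ> g \<circ> inv s) * e (inv (a \<circ> g \<circ> inv s) \<circ> \<pi>))"
    by (rule sum_perms_inv[symmetric])
  also have "\<dots> = (\<Sum>s\<in>perms n. e (a \<circ> (g \<circ> inv s)) * e (s \<circ> (h \<circ> inv b)))"
  proof (rule sum.cong[OF refl])
    fix s assume s: "s \<in> perms n"
    have "inv (a \<circ> g \<circ> inv s) = s \<circ> (inv g \<circ> inv a)"
      using perms_inv_comp[OF ag perms_inv[OF s]] perms_inv_comp[OF a g] perms_inv_inv[OF s] by simp
    then have "inv (a \<circ> g \<circ> inv s) \<circ> \<pi> = s \<circ> (h \<circ> inv b)"
      by (simp add: \<pi>_def comp_assoc perms_cancel(3)[OF a] perms_cancel(3)[OF g])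
    then show "e (a \<circ> g \<circ> inv s) * e (inv (a \<circ> g \<circ> inv s) \<circ> \<pi>) = e (a \<circ> (g \<circ> inv s)) * e (s \<circ> (h \<circ> inv b))"
      by (simp add: comp_assoc)
  qed
  finally show ?thesis by (simp add: \<pi>_def)
qed

text \<open>In each tensor factor the sum over the middle triple contracts by \<open>e_conv\<close>,
  that is by \<open>e e = e\<close>. What is left depends on g and h only through
  \<open>g \<circ> h\<close>, so the two averages collapse into one.\<close>

lemma ker_idem:
  assumes a: "a \<in> G3" and b: "b \<in> G3"
  shows "(\<Sum>s\<in>G3. ker a s * ker s b) = ker a b"
proof -
  obtain a1 a2 a3 where A: "a = (a1, a2, a3)" "a1 \<in> perms n" "a2 \<in> perms n" "a3 \<in> perms n" using a by (auto simp: G3_def)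
  obtain b1 b2 b3 where B: "b = (b1, b2, b3)" "b1 \<in> perms n" "b2 \<in> perms n" "b3 \<in> perms n" using b by (auto simp: G3_def)
  define T where "T g = e1 (a1 \<circ> (g \<circ> inv b1)) * e2 (a2 \<circ> (g \<circ> inv b2)) * e3 (a3 \<circ> (g \<circ> inv b3))" for g
  have "(\<Sum>s\<in>G3. ker a s * ker s b) = (\<Sum>(s1, s2, s3)\<in>G3. (\<Sum>g\<in>perms n. \<Sum>h\<in>perms n.
      (e1 (a1 \<circ> (g \<circ> inv s1)) * e1 (s1 \<circ> (h \<circ> inv b1))) * (e2 (a2 \<circ> (g \<circ> inv s2)) * e2 (s2 \<circ> (h \<circ> inv b2))) *
      (e3 (a3 \<circ> (g \<circ> inv s3)) * e3 (s3 \<circ> (h \<circ> inv b3)))) / (fact n * fact n))"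
    by (rule sum.cong[OF refl]) (clarsimp simp: A(1) B(1) ker_def times_divide_times_eq sum_product,
      intro arg_cong2[of _ _ _ _ "(/)"] sum.cong refl, simp add: mult_ac)
  also have "\<dots> = (\<Sum>(s1, s2, s3)\<in>G3. (\<Sum>g\<in>perms n. \<Sum>h\<in>perms n.
      (e1 (a1 \<circ> (g \<circ> inv s1)) * e1 (s1 \<circ> (h \<circ> inv b1))) * (e2 (a2 \<circ> (g \<circ> inv s2)) * e2 (s2 \<circ> (h \<circ> inv b2))) *
      (e3 (a3 \<circ> (g \<circ> inv s3)) * e3 (s3 \<circ> (h \<circ> inv b3))))) / (fact n * fact n)"
    by (simp add: sum_divide_distrib case_prod_unfold)
  also have "(\<Sum>(s1, s2, s3)\<in>G3. (\<Sum>g\<in>perms n. \<Sum>h\<in>perms n.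
      (e1 (a1 \<circ> (g \<circ> inv s1)) * e1 (s1 \<circ> (h \<circ> inv b1))) * (e2 (a2 \<circ> (g \<circ> inv s2)) * e2 (s2 \<circ> (h \<circ> inv b2))) *
      (e3 (a3 \<circ> (g \<circ> inv s3)) * e3 (s3 \<circ> (h \<circ> inv b3))))) =
     (\<Sum>g\<in>perms n. \<Sum>h\<in>perms n. \<Sum>(s1, s2, s3)\<in>G3.
      (e1 (a1 \<circ> (g \<circ> inv s1)) * e1 (s1 \<circ> (h \<circ> inv b1))) * (e2 (a2 \<circ> (g \<circ> inv s2)) * e2 (s2 \<circ> (h \<circ> inv b2))) *
      (e3 (a3 \<circ> (g \<circ> inv s3)) * e3 (s3 \<circ> (h \<circ> inv b3))))"
    unfolding case_prod_unfold by (subst sum.swap) (intro sum.cong refl sum.swap)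
  also have "\<dots> = (\<Sum>g\<in>perms n. \<Sum>h\<in>perms n. T (g \<circ> h))"
  proof (intro sum.cong refl)
    fix g h assume g: "g \<in> perms n" and h: "h \<in> perms n"
    show "(\<Sum>(s1, s2, s3)\<in>G3.
      (e1 (a1 \<circ> (g \<circ> inv s1)) * e1 (s1 \<circ> (h \<circ> inv b1))) * (e2 (a2 \<circ> (g \<circ> inv s2)) * e2 (s2 \<circ> (h \<circ> inv b2))) *
      (e3 (a3 \<circ> (g \<circ> inv s3)) * e3 (s3 \<circ> (h \<circ> inv b3)))) = T (g \<circ> h)"
      unfolding G3_def sum_triple_factor T_def
      by (simp only: e_conv[OF ye_idem[OF t1], folded e1_def, OF A(2) B(2) g h]
        e_conv[OF ye_idem[OF t2], folded e2_def, OF A(3) B(3) g h] e_conv[OF ye_idem[OF t3], folded e3_def, OF A(4) B(4) g h])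
  qed
  also have "\<dots> = (\<Sum>g\<in>perms n. \<Sum>h\<in>perms n. T h)"
    by (intro sum.cong refl sum_perms_left)
  also have "\<dots> = fact n * (\<Sum>h\<in>perms n. T h)" by (simp add: card_perms)
  finally show ?thesis by (simp add: A(1) B(1) ker_def T_def)
qed

lemma proj_linear: "flinear proj"
  by (rule flinearI) (auto simp: proj_def fun_eq_iff algebra_simps sum.distrib sum_distrib_left)

lemma proj_idem: "proj (proj x) = proj x"
proof
  fix a
  show "proj (proj x) a = proj x a"
  proof (cases "a \<in> G3")
    case True
    have "proj (proj x) a = (\<Sum>s\<in>G3. \<Sum>b\<in>G3. ker a s * ker s b * x b)"
      using True by (simp add: proj_def sum_distrib_left mult.assoc)
    also have "\<dots> = (\<Sum>b\<in>G3. \<Sum>s\<in>G3. ker a s * ker s b * x b)" by (rule sum.swap)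
    also have "\<dots> = (\<Sum>b\<in>G3. ker a b * x b)"
      by (intro sum.cong refl) (simp add: sum_distrib_right[symmetric] ker_idem[OF True])
    finally show ?thesis using True by (simp add: proj_def)
  qed (simp add: proj_def)
qed

lemma proj_funit: "b \<in> G3 \<Longrightarrow> a \<in> G3 \<Longrightarrow> proj (funit b) a = ker a b"
proof -
  assume b: "b \<in> G3" and a: "a \<in> G3"
  have "(\<Sum>s\<in>G3. ker a s * funit b s) = (\<Sum>s\<in>G3. if s = b then ker a b else 0)"
    by (intro sum.cong refl) (auto simp: funit_def)
  then show ?thesis using a b by (simp add: proj_def)
qed

text \<open>The rank is the trace of the kernel, and for each fixed g that trace factors into three
  sums, each a value of \<open>chr\<close>.\<close>

lemma dim_proj:
  "of_nat (fs.dim (range proj)) = (\<Sum>g\<in>perms n. chr n e1 g * chr n e2 g * chr n e3 g) / fact n"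
proof -
  have chr_eq: "(\<Sum>a\<in>perms n. ye n r c (a \<circ> (g \<circ> inv a))) = chr n (ye n r c) g" if g: "g \<in> perms n" for r c g
  proof -
    have "(\<Sum>a\<in>perms n. ye n r c (a \<circ> (g \<circ> inv a))) = (\<Sum>a\<in>perms n. ye n r c (inv a \<circ> (g \<circ> inv (inv a))))"
      by (rule sum_perms_inv[symmetric])
    also have "\<dots> = (\<Sum>a\<in>perms n. ye n r c (inv a \<circ> (inv (inv g) \<circ> a)))"
      by (intro sum.cong refl) (simp add: perms_inv_inv[OF g] permutes_inv_inv)
    also have "\<dots> = chr n (ye n r c) (inv g)" by (simp add: chr_def)
    also have "\<dots> = chr n (ye n r c) g" by (rule chr_ye_inv[OF g])
    finally show ?thesis .
  qed
  have "of_nat (fs.dim (range proj)) = (\<Sum>a\<in>G3. proj (funit a) a)"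
    by (rule trace_idempotent[OF finite_G3 proj_linear _ proj_idem, symmetric]) (simp add: proj_def)
  also have "\<dots> = (\<Sum>a\<in>G3. ker a a)" by (intro sum.cong refl) (simp add: proj_funit)
  also have "\<dots> = (\<Sum>(a1, a2, a3)\<in>G3. \<Sum>g\<in>perms n. e1 (a1 \<circ> (g \<circ> inv a1)) * e2 (a2 \<circ> (g \<circ> inv a2)) * e3 (a3 \<circ> (g \<circ> inv a3))) / fact n"
    unfolding sum_divide_distrib by (intro sum.cong refl) (auto simp: ker_def sum_divide_distrib)
  also have "(\<Sum>(a1, a2, a3)\<in>G3. \<Sum>g\<in>perms n. e1 (a1 \<circ> (g \<circ> inv a1)) * e2 (a2 \<circ> (g \<circ> inv a2)) * e3 (a3 \<circ> (g \<circ> inv a3))) =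
     (\<Sum>g\<in>perms n. \<Sum>(a1, a2, a3)\<in>G3. e1 (a1 \<circ> (g \<circ> inv a1)) * e2 (a2 \<circ> (g \<circ> inv a2)) * e3 (a3 \<circ> (g \<circ> inv a3)))"
    unfolding case_prod_unfold by (rule sum.swap)
  also have "\<dots> = (\<Sum>g\<in>perms n. chr n e1 g * chr n e2 g * chr n e3 g)"
    by (intro sum.cong refl) (simp only: G3_def sum_triple_factor e1_def e2_def e3_def chr_eq)
  finally show ?thesis .
qed

lemma mon_right:
  assumes "g \<in> perms n"
  shows "mon (a1 \<circ> g, a2 \<circ> g, a3 \<circ> g) X = mon (a1, a2, a3) X"
  unfolding mon_def using prod.permute[of g "{..<n}" "\<lambda>x. X (r1 (a1 x), r2 (a2 x), r3 (a3 x))"] assms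
  by (simp add: o_def)

lemma mon_left:
  assumes "a1 \<in> perms n" "a2 \<in> perms n" "a3 \<in> perms n" "q1 \<in> stab n r1" "q2 \<in> stab n r2" "q3 \<in> stab n r3"
  shows "mon (q1 \<circ> a1, q2 \<circ> a2, q3 \<circ> a3) X = mon (a1, a2, a3) X"
  unfolding mon_def prod.case
  by (intro prod.cong refl) (use assms perms_less in \<open>auto simp: stab_def\<close>)

definition "kap = (of_nat (card (stab n r1)) / yk n r1 c1) * (of_nat (card (stab n r2)) / yk n r2 c2) *
   (of_nat (card (stab n r3)) / yk n r3 c3)"

lemma kap_nonzero: "kap \<noteq> 0"
proof -
  have "stab n r \<noteq> {}" for r using stab_id by blast
  then show ?thesis using yk_nonzero[OF t1] yk_nonzero[OF t2] yk_nonzero[OF t3] by (simp add: kap_def)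
qed

text \<open>Diagonal averaging does not change a monomial (\<open>mon_right\<close>), and in each
  factor \<open>sum_ye\<close> trades the idempotent for signs on the column group, as the row group
  acts trivially on monomials (\<open>mon_left\<close>). So only the nonzero factor
  \<open>kap\<close> separates images of unit vectors from highest weight polynomials.\<close>

lemma Phi_column:
  assumes s: "s1 \<in> perms n" "s2 \<in> perms n" "s3 \<in> perms n"
  shows "Phi (proj (funit (s1, s2, s3))) = fscale kap (hw n (r1 \<circ> s1) (c1 \<circ> s1) (r2 \<circ> s2) (c2 \<circ> s2) (r3 \<circ> s3) (c3 \<circ> s3))"
proof
  fix X
  have sG: "(s1, s2, s3) \<in> G3" using s by (simp add: G3_def)
  define Z where "Z a1 a2 a3 = e1 (a1 \<circ> inv s1) * (e2 (a2 \<circ> inv s2) * (e3 (a3 \<circ> inv s3) * mon (a1, a2, a3) X))" for a1 a2 a3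
  have "Phi (proj (funit (s1, s2, s3))) X = (\<Sum>a\<in>G3. ker a (s1, s2, s3) * mon a X)"
    unfolding Phi_def by (intro sum.cong refl) (simp add: proj_funit[OF sG])
  also have "\<dots> = (\<Sum>(a1, a2, a3)\<in>G3. (\<Sum>g\<in>perms n. Z (a1 \<circ> g) (a2 \<circ> g) (a3 \<circ> g)) / fact n)"
    by (intro sum.cong refl)
      (auto simp: ker_def Z_def mon_right comp_assoc sum_distrib_right mult.assoc intro!: sum.cong)
  also have "\<dots> = (\<Sum>(a1, a2, a3)\<in>G3. \<Sum>g\<in>perms n. Z (a1 \<circ> g) (a2 \<circ> g) (a3 \<circ> g)) / fact n"
    by (simp add: sum_divide_distrib case_prod_unfold)
  also have "(\<Sum>(a1, a2, a3)\<in>G3. \<Sum>g\<in>perms n. Z (a1 \<circ> g) (a2 \<circ> g) (a3 \<circ> g)) =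
     (\<Sum>g\<in>perms n. \<Sum>(a1, a2, a3)\<in>G3. Z (a1 \<circ> g) (a2 \<circ> g) (a3 \<circ> g))"
    unfolding case_prod_unfold by (rule sum.swap)
  also have "\<dots> = (\<Sum>g\<in>perms n. \<Sum>a1\<in>perms n. \<Sum>a2\<in>perms n. \<Sum>a3\<in>perms n. Z a1 a2 a3)"
  proof (rule sum.cong[OF refl])
    fix g assume g: "g \<in> perms n"
    have "(\<Sum>(a1, a2, a3)\<in>G3. Z (a1 \<circ> g) (a2 \<circ> g) (a3 \<circ> g)) =
      (\<Sum>a1\<in>perms n. \<Sum>a2\<in>perms n. \<Sum>a3\<in>perms n. Z (a1 \<circ> g) (a2 \<circ> g) (a3 \<circ> g))"
      by (simp add: G3_def sum.cartesian_product)
    also have "\<dots> = (\<Sum>a1\<in>perms n. \<Sum>a2\<in>perms n. \<Sum>a3\<in>perms n. Z a1 a2 a3)"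
      by (rule sum3_perms_right[OF g g g])
    finally show "(\<Sum>(a1, a2, a3)\<in>G3. Z (a1 \<circ> g) (a2 \<circ> g) (a3 \<circ> g)) =
      (\<Sum>a1\<in>perms n. \<Sum>a2\<in>perms n. \<Sum>a3\<in>perms n. Z a1 a2 a3)" .
  qed
  also have "\<dots> / fact n = (\<Sum>a1\<in>perms n. \<Sum>a2\<in>perms n. \<Sum>a3\<in>perms n. Z a1 a2 a3)"
    by (simp add: card_perms)
  also have "\<dots> = (\<Sum>a1\<in>perms n. \<Sum>a2\<in>perms n. \<Sum>a3\<in>perms n. Z (a1 \<circ> s1) (a2 \<circ> s2) (a3 \<circ> s3))"
    by (rule sum3_perms_right[OF s, symmetric])
  also have "\<dots> = (\<Sum>a1\<in>perms n. e1 a1 * (\<Sum>a2\<in>perms n. e2 a2 * (\<Sum>a3\<in>perms n. e3 a3 * mon (a1 \<circ> s1, a2 \<circ> s2, a3 \<circ> s3) X)))"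
    by (simp add: Z_def perms_cancel(5)[OF s(1)] perms_cancel(5)[OF s(2)] perms_cancel(5)[OF s(3)] sum_distrib_left)
  also have "\<dots> = kap * (\<Sum>q1\<in>stab n c1. of_int (sign q1) * (\<Sum>q2\<in>stab n c2. of_int (sign q2) * (\<Sum>q3\<in>stab n c3. of_int (sign q3) *
      mon (q1 \<circ> s1, q2 \<circ> s2, q3 \<circ> s3) X)))"
  proof -
    define k1 where "k1 = of_nat (card (stab n r1)) / yk n r1 c1"
    define k2 where "k2 = of_nat (card (stab n r2)) / yk n r2 c2"
    define k3 where "k3 = of_nat (card (stab n r3)) / yk n r3 c3"
    define S3 where "S3 a1 a2 = (\<Sum>q3\<in>stab n c3. of_int (sign q3) * mon (a1 \<circ> s1, a2 \<circ> s2, q3 \<circ> s3) X)" for a1 a2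
    define S2 where "S2 a1 = (\<Sum>q2\<in>stab n c2. of_int (sign q2) * S3 a1 q2)" for a1
    have inv: "mon (\<tau>1 \<circ> a1 \<circ> s1, \<tau>2 \<circ> a2 \<circ> s2, \<tau>3 \<circ> a3 \<circ> s3) X = mon (a1 \<circ> s1, a2 \<circ> s2, a3 \<circ> s3) X"
      if "\<tau>1 \<in> stab n r1" "\<tau>2 \<in> stab n r2" "\<tau>3 \<in> stab n r3" "a1 \<in> perms n" "a2 \<in> perms n" "a3 \<in> perms n"
      for \<tau>1 \<tau>2 \<tau>3 a1 a2 a3
      using mon_left[OF perms_comp[OF that(4) s(1)] perms_comp[OF that(5) s(2)] perms_comp[OF that(6) s(3)] that(1-3)]
      by (simp add: comp_assoc)
    have i3: "mon (a1 \<circ> s1, a2 \<circ> s2, \<tau> \<circ> a3 \<circ> s3) X = mon (a1 \<circ> s1, a2 \<circ> s2, a3 \<circ> s3) X"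
      if "\<tau> \<in> stab n r3" "a1 \<in> perms n" "a2 \<in> perms n" "a3 \<in> perms n" for \<tau> a1 a2 a3
      using inv[OF stab_id stab_id that] by simp
    have i2: "mon (a1 \<circ> s1, \<tau> \<circ> a2 \<circ> s2, a3 \<circ> s3) X = mon (a1 \<circ> s1, a2 \<circ> s2, a3 \<circ> s3) X"
      if "\<tau> \<in> stab n r2" "a1 \<in> perms n" "a2 \<in> perms n" "a3 \<in> perms n" for \<tau> a1 a2 a3
      using inv[OF stab_id that(1) stab_id that(2-)] by simp
    have i1: "mon (\<tau> \<circ> a1 \<circ> s1, a2 \<circ> s2, a3 \<circ> s3) X = mon (a1 \<circ> s1, a2 \<circ> s2, a3 \<circ> s3) X"
      if "\<tau> \<in> stab n r1" "a1 \<in> perms n" "a2 \<in> perms n" "a3 \<in> perms n" for \<tau> a1 a2 a3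
      using inv[OF that(1) stab_id stab_id that(2-)] by simp
    have 3: "(\<Sum>a3\<in>perms n. e3 a3 * mon (a1 \<circ> s1, a2 \<circ> s2, a3 \<circ> s3) X) = k3 * S3 a1 a2"
      if "a1 \<in> perms n" "a2 \<in> perms n" for a1 a2
      unfolding e3_def k3_def S3_def by (rule sum_ye) (rule i3[OF _ that])
    have S3i: "S3 a1 (\<tau> \<circ> a2) = S3 a1 a2" if "\<tau> \<in> stab n r2" "a1 \<in> perms n" "a2 \<in> perms n" for \<tau> a1 a2
      unfolding S3_def by (intro sum.cong refl) (simp only: i2[OF that stab_perms])
    have S3i': "S3 (\<tau> \<circ> a1) a2 = S3 a1 a2" if "\<tau> \<in> stab n r1" "a1 \<in> perms n" "a2 \<in> perms n" for \<tau> a1 a2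
      unfolding S3_def by (intro sum.cong refl) (simp only: i1[OF that stab_perms])
    have 2: "(\<Sum>a2\<in>perms n. e2 a2 * S3 a1 a2) = k2 * S2 a1" if "a1 \<in> perms n" for a1
      unfolding e2_def k2_def S2_def by (rule sum_ye) (rule S3i[OF _ that])
    have S2i: "S2 (\<tau> \<circ> a1) = S2 a1" if "\<tau> \<in> stab n r1" "a1 \<in> perms n" for \<tau> a1
      unfolding S2_def by (intro sum.cong refl) (simp only: S3i'[OF that stab_perms])
    have 1: "(\<Sum>a1\<in>perms n. e1 a1 * S2 a1) = k1 * (\<Sum>q1\<in>stab n c1. of_int (sign q1) * S2 q1)"
      unfolding e1_def k1_def by (rule sum_ye) (rule S2i)
    have "(\<Sum>a1\<in>perms n. e1 a1 * (\<Sum>a2\<in>perms n. e2 a2 * (\<Sum>a3\<in>perms n. e3 a3 * mon (a1 \<circ> s1, a2 \<circ> s2, a3 \<circ> s3) X))) =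
      (\<Sum>a1\<in>perms n. e1 a1 * (\<Sum>a2\<in>perms n. e2 a2 * (k3 * S3 a1 a2)))"
      by (intro sum.cong refl arg_cong2[of _ _ _ _ "(*)"] 3)
    also have "\<dots> = (\<Sum>a1\<in>perms n. e1 a1 * (k3 * (\<Sum>a2\<in>perms n. e2 a2 * S3 a1 a2)))"
      by (simp add: sum_distrib_left mult_ac)
    also have "\<dots> = (\<Sum>a1\<in>perms n. e1 a1 * (k3 * (k2 * S2 a1)))"
      by (intro sum.cong refl arg_cong2[of _ _ _ _ "(*)"] 2)
    also have "\<dots> = k3 * k2 * (\<Sum>a1\<in>perms n. e1 a1 * S2 a1)"
      by (simp add: sum_distrib_left mult_ac)
    also have "\<dots> = kap * (\<Sum>q1\<in>stab n c1. of_int (sign q1) * S2 q1)"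
      unfolding 1 by (simp add: kap_def k1_def k2_def k3_def mult_ac)
    finally show ?thesis unfolding S2_def S3_def .
  qed
  also have "\<dots> = kap * hw n (r1 \<circ> s1) (c1 \<circ> s1) (r2 \<circ> s2) (c2 \<circ> s2) (r3 \<circ> s3) (c3 \<circ> s3) X"
  proof -
    have 3: "(\<Sum>q\<in>stab n (c3 \<circ> s3). of_int (sign q) * mon (a1, a2, s3 \<circ> q) X) =
       (\<Sum>q\<in>stab n c3. of_int (sign q) * mon (a1, a2, q \<circ> s3) X)" for a1 a2
      by (rule sum_stab_conj[OF s(3), where c = c3 and F = "\<lambda>q. mon (a1, a2, q) X"])
    have 2: "(\<Sum>q\<in>stab n (c2 \<circ> s2). of_int (sign q) * (\<Sum>q'\<in>stab n c3. of_int (sign q') * mon (a1, s2 \<circ> q, q' \<circ> s3) X)) =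
       (\<Sum>q\<in>stab n c2. of_int (sign q) * (\<Sum>q'\<in>stab n c3. of_int (sign q') * mon (a1, q \<circ> s2, q' \<circ> s3) X))" for a1
      by (rule sum_stab_conj[OF s(2), where c = c2 and F = "\<lambda>q. \<Sum>q'\<in>stab n c3. of_int (sign q') * mon (a1, q, q' \<circ> s3) X"])
    have 1: "(\<Sum>p\<in>stab n (c1 \<circ> s1). of_int (sign p) * (\<Sum>q\<in>stab n c2. of_int (sign q) * (\<Sum>q'\<in>stab n c3. of_int (sign q') * mon (s1 \<circ> p, q \<circ> s2, q' \<circ> s3) X))) =
       (\<Sum>p\<in>stab n c1. of_int (sign p) * (\<Sum>q\<in>stab n c2. of_int (sign q) * (\<Sum>q'\<in>stab n c3. of_int (sign q') * mon (p \<circ> s1, q \<circ> s2, q' \<circ> s3) X)))"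
      by (rule sum_stab_conj[OF s(1), where c = c1 and F = "\<lambda>p. \<Sum>q\<in>stab n c2. of_int (sign q) * (\<Sum>q'\<in>stab n c3. of_int (sign q') * mon (p, q \<circ> s2, q' \<circ> s3) X)"])
    have "hw n (r1 \<circ> s1) (c1 \<circ> s1) (r2 \<circ> s2) (c2 \<circ> s2) (r3 \<circ> s3) (c3 \<circ> s3) X =
      (\<Sum>p\<in>stab n (c1 \<circ> s1). of_int (sign p) * (\<Sum>q\<in>stab n (c2 \<circ> s2). of_int (sign q) * (\<Sum>q'\<in>stab n (c3 \<circ> s3). of_int (sign q') * mon (s1 \<circ> p, s2 \<circ> q, s3 \<circ> q') X)))"
      by (simp add: hw_def mon_def)
    then show ?thesis unfolding 3 2 1 by simp
  qed
  finally show "Phi (proj (funit (s1, s2, s3))) X =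
    fscale kap (hw n (r1 \<circ> s1) (c1 \<circ> s1) (r2 \<circ> s2) (c2 \<circ> s2) (r3 \<circ> s3) (c3 \<circ> s3)) X"
    by (simp add: fscale_def)
qed

lemma Phi_linear: "flinear Phi"
  by (rule flinearI) (auto simp: Phi_def fun_eq_iff algebra_simps sum.distrib sum_distrib_left)

text \<open>Triples that differ by row permutations on the left and a diagonal permutation on the
  right give the same monomial. The kernel sees neither: the average absorbs g, and
  \<open>ye_left\<close> removes the row permutations.\<close>

lemma ker_invariant:
  assumes a: "a1 \<in> perms n" "a2 \<in> perms n" "a3 \<in> perms n"
    and q: "q1 \<in> stab n r1" "q2 \<in> stab n r2" "q3 \<in> stab n r3" and g: "g \<in> perms n" and b: "b \<in> G3"
    and e: "b1 \<circ> g = q1 \<circ> a1" "b2 \<circ> g = q2 \<circ> a2" "b3 \<circ> g = q3 \<circ> a3"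
  shows "ker (b1, b2, b3) b = ker (a1, a2, a3) b"
proof -
  obtain d1 d2 d3 where D: "b = (d1, d2, d3)" using b by (cases b) auto
  have "(\<Sum>h\<in>perms n. e1 (b1 \<circ> (h \<circ> inv d1)) * e2 (b2 \<circ> (h \<circ> inv d2)) * e3 (b3 \<circ> (h \<circ> inv d3))) =
     (\<Sum>h\<in>perms n. e1 (b1 \<circ> ((g \<circ> h) \<circ> inv d1)) * e2 (b2 \<circ> ((g \<circ> h) \<circ> inv d2)) * e3 (b3 \<circ> ((g \<circ> h) \<circ> inv d3)))"
    by (rule sum_perms_left[OF g, symmetric])
  also have "\<dots> = (\<Sum>h\<in>perms n. e1 (a1 \<circ> (h \<circ> inv d1)) * e2 (a2 \<circ> (h \<circ> inv d2)) * e3 (a3 \<circ> (h \<circ> inv d3)))"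
  proof (intro sum.cong refl)
    fix h
    have "b1 \<circ> ((g \<circ> h) \<circ> inv d1) = q1 \<circ> (a1 \<circ> (h \<circ> inv d1))" "b2 \<circ> ((g \<circ> h) \<circ> inv d2) = q2 \<circ> (a2 \<circ> (h \<circ> inv d2))"
      "b3 \<circ> ((g \<circ> h) \<circ> inv d3) = q3 \<circ> (a3 \<circ> (h \<circ> inv d3))"
      using e by (metis comp_assoc)+
    then show "e1 (b1 \<circ> ((g \<circ> h) \<circ> inv d1)) * e2 (b2 \<circ> ((g \<circ> h) \<circ> inv d2)) * e3 (b3 \<circ> ((g \<circ> h) \<circ> inv d3)) =
      e1 (a1 \<circ> (h \<circ> inv d1)) * e2 (a2 \<circ> (h \<circ> inv d2)) * e3 (a3 \<circ> (h \<circ> inv d3))"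
      by (simp only: e1_def e2_def e3_def ye_left[OF q(1)] ye_left[OF q(2)] ye_left[OF q(3)])
  qed
  finally show ?thesis by (simp add: D ker_def)
qed

text \<open>Functions in the range of \<open>proj\<close> are constant on the triples that give one
  monomial (\<open>ker_invariant\<close>), so the coefficient of that monomial in
  \<open>Phi v\<close> is a positive multiple of the value of v there.\<close>

lemma Phi_zero:
  assumes v: "v \<in> range proj" and z: "Phi v = 0"
  shows "v = 0"
proof
  fix a0
  show "v a0 = 0 a0"
  proof (cases "a0 \<in> G3")
    case False
    then show ?thesis using v by (auto simp: proj_def)
  next
    case True
    obtain a1 a2 a3 where A: "a0 = (a1, a2, a3)" "a1 \<in> perms n" "a2 \<in> perms n" "a3 \<in> perms n"
      using True by (auto simp: G3_def)
    obtain x where x: "v = proj x" using v by auto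
    define w where "w = (\<lambda>(b1 :: nat \<Rightarrow> nat, b2 :: nat \<Rightarrow> nat, b3 :: nat \<Rightarrow> nat) (y :: nat). prod_encode (r1 (b1 y), prod_encode (r2 (b2 y), r3 (b3 y))))"
    define E where "E b = (\<Sum>y<n. (n + 1) ^ w b y)" for b
    define p where "p = (\<Sum>b\<in>G3. monom (v b) (E b))"
    have "poly p s = 0" for s
    proof -
      \<comment> \<open>The variable with code k becomes \<open>s ^ ((n + 1) ^ k)\<close> and the
        monomial of b becomes \<open>s ^ E b\<close>. Since \<open>E b\<close> determines the
        monomial by \<open>power_sums_eq\<close>, one polynomial in s separates all
        monomials.\<close>
      define X where "X = (\<lambda>(i, j, k). s ^ ((n + 1) ^ prod_encode (i, prod_encode (j, k))))"
      have "mon b X = s ^ E b" for b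
        by (cases b) (simp add: mon_def X_def E_def w_def power_sum)
      then have "poly p s = Phi v X" by (simp add: p_def Phi_def poly_sum poly_monom)
      then show ?thesis using z by simp
    qed
    then have "p = 0" using poly_all_0_iff_0 by blast
    then have "0 = coeff p (E a0)" by simp
    also have "\<dots> = (\<Sum>b\<in>G3. if E b = E a0 then v b else 0)"
      unfolding p_def coeff_sum by (intro sum.cong refl) auto
    also have "\<dots> = (\<Sum>b\<in>{b \<in> G3. E b = E a0}. v b)"
      by (simp add: sum.inter_filter)
    also have "\<dots> = (\<Sum>b\<in>{b \<in> G3. E b = E a0}. v a0)"
    proof (rule sum.cong[OF refl])
      fix b assume b: "b \<in> {b \<in> G3. E b = E a0}"
      obtain b1 b2 b3 where B: "b = (b1, b2, b3)" "b1 \<in> perms n" "b2 \<in> perms n" "b3 \<in> perms n"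
        using b by (auto simp: G3_def)
      have "(\<Sum>y<n. (n + 1) ^ w a0 y) = (\<Sum>y<n. (n + 1) ^ w b y)" using b by (simp add: E_def)
      from power_sums_eq[OF this] obtain g where g: "g \<in> perms n" "\<forall>y<n. w b (g y) = w a0 y"
        using perms_of_fibres[of n "w a0" "w b"] by blast
      have st: "d \<circ> g \<circ> inv a \<in> stab n r" and eq: "d \<circ> g = (d \<circ> g \<circ> inv a) \<circ> a"
        if d: "d \<in> perms n" "a \<in> perms n" and r: "\<forall>y<n. r (d (g y)) = r (a y)" for d a r
      proof -
        have "r (d (g (inv a y))) = r y" if "y < n" for y
        proof -
          have "inv a y < n" using perms_less[OF perms_inv[OF d(2)]] that by simp
          then have "r (d (g (inv a y))) = r (a (inv a y))" using r by blast
          then show ?thesis using d(2) by (simp add: permutes_inverses)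
        qed
        then show "d \<circ> g \<circ> inv a \<in> stab n r"
          using perms_comp[OF perms_comp[OF d(1) g(1)] perms_inv[OF d(2)]] by (simp add: stab_def)
        show "d \<circ> g = (d \<circ> g \<circ> inv a) \<circ> a" using perms_cancel(6)[OF d(2)] by simp
      qed
      have rs: "\<forall>y<n. r1 (b1 (g y)) = r1 (a1 y)" "\<forall>y<n. r2 (b2 (g y)) = r2 (a2 y)" "\<forall>y<n. r3 (b3 (g y)) = r3 (a3 y)"
        using g(2) by (auto simp: w_def A(1) B(1) prod_encode_eq)
      have "ker b s = ker a0 s" if "s \<in> G3" for s
        unfolding A(1) B(1)
        by (rule ker_invariant[OF A(2-4) st[OF B(2) A(2) rs(1)] st[OF B(3) A(3) rs(2)] st[OF B(4) A(4) rs(3)] g(1) that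
            eq[OF B(2) A(2) rs(1)] eq[OF B(3) A(3) rs(2)] eq[OF B(4) A(4) rs(3)]])
      then show "v b = v a0" using b True by (simp add: x proj_def)
    qed
    also have "\<dots> = of_nat (card {b \<in> G3. E b = E a0}) * v a0" by simp
    finally have "of_nat (card {b \<in> G3. E b = E a0}) * v a0 = 0" by simp
    moreover have "card {b \<in> G3. E b = E a0} \<noteq> 0"
      by (subst card_0_eq) (simp, use True in blast)
    ultimately show ?thesis by simp
  qed
qed

lemma hw_cong:
  assumes "\<And>x. x < n \<Longrightarrow> ra x = ra' x" "\<And>x. x < n \<Longrightarrow> rb x = rb' x" "\<And>x. x < n \<Longrightarrow> rc x = rc' x"
    and "stab n ca = stab n ca'" "stab n cb = stab n cb'" "stab n cc = stab n cc'"
  shows "hw n ra ca rb cb rc cc = hw n ra' ca' rb' cb' rc' cc'"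
proof
  fix X :: "nat \<times> nat \<times> nat \<Rightarrow> complex"
  have "(\<Prod>x<n. X (ra (q1 x), rb (q2 x), rc (q3 x))) = (\<Prod>x<n. X (ra' (q1 x), rb' (q2 x), rc' (q3 x)))"
    if "q1 \<in> stab n ca" "q2 \<in> stab n cb" "q3 \<in> stab n cc" for q1 q2 q3
    by (intro prod.cong refl) (use that perms_less[OF stab_perms] assms(1-3) in auto)
  then show "hw n ra ca rb cb rc cc X = hw n ra' ca' rb' cb' rc' cc' X"
    unfolding hw_def assms(4-6)[symmetric] by (intro sum.cong refl arg_cong2[of _ _ _ _ "(*)"]) auto
qed

text \<open>The column group depends only on which entries share a label.\<close>

lemma stab_kernel_cong:
  assumes "\<And>x y. x < n \<Longrightarrow> y < n \<Longrightarrow> c x = c y \<longleftrightarrow> c' x = c' y"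
  shows "stab n c = stab n c'"
proof -
  have "c (\<sigma> k) = c k \<longleftrightarrow> c' (\<sigma> k) = c' k" if "\<sigma> \<in> perms n" "k < n" for \<sigma> k
    using assms[of "\<sigma> k" k] perms_less[OF that(1), of k] that(2) by simp
  then show ?thesis by (auto simp: stab_def)
qed

text \<open>Any three tableaux of the given shapes are relabellings of the fixed ones
  (\<open>tab_same_shape\<close>), so \<open>Phi_column\<close> matches generators with images of
  unit vectors.\<close>

lemma W_eq: "W n f1 f2 f3 = Phi ` range proj"
proof
  interpret L: Vector_Spaces.linear fscale fscale Phi by (rule Phi_linear)
  interpret P: Vector_Spaces.linear fscale fscale proj by (rule proj_linear)
  have sub: "fs.subspace (Phi ` range proj)"
    by (intro L.subspace_image P.subspace_image) simp
  have "hws n f1 f2 f3 \<subseteq> Phi ` range proj"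
  proof
    fix H assume "H \<in> hws n f1 f2 f3"
    then obtain ra ca rb cb rc cc where H: "H = hw n ra ca rb cb rc cc" "tab n ra ca f1" "tab n rb cb f2" "tab n rc cc f3"
      by (auto simp: hws_def)
    obtain s1 where s1: "s1 \<in> perms n" "\<forall>x<n. r1 (s1 x) = ra x" "\<forall>x<n. \<forall>y<n. ca x = ca y \<longleftrightarrow> c1 (s1 x) = c1 (s1 y)"
      using tab_same_shape[OF H(2) t1] by blast
    obtain s2 where s2: "s2 \<in> perms n" "\<forall>x<n. r2 (s2 x) = rb x" "\<forall>x<n. \<forall>y<n. cb x = cb y \<longleftrightarrow> c2 (s2 x) = c2 (s2 y)"
      using tab_same_shape[OF H(3) t2] by blast
    obtain s3 where s3: "s3 \<in> perms n" "\<forall>x<n. r3 (s3 x) = rc x" "\<forall>x<n. \<forall>y<n. cc x = cc y \<longleftrightarrow> c3 (s3 x) = c3 (s3 y)"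
      using tab_same_shape[OF H(4) t3] by blast
    have "H = hw n (r1 \<circ> s1) (c1 \<circ> s1) (r2 \<circ> s2) (c2 \<circ> s2) (r3 \<circ> s3) (c3 \<circ> s3)"
      unfolding H(1) by (rule hw_cong; (rule stab_kernel_cong)?) (use s1 s2 s3 in auto)
    also have "\<dots> = fscale (1 / kap) (Phi (proj (funit (s1, s2, s3))))"
      by (simp add: Phi_column[OF s1(1) s2(1) s3(1)] kap_nonzero)
    also have "\<dots> \<in> Phi ` range proj" by (intro fs.subspace_scale[OF sub]) auto
    finally show "H \<in> Phi ` range proj" .
  qed
  then show "W n f1 f2 f3 \<subseteq> Phi ` range proj"
    unfolding W_def by (rule fs.span_minimal[OF _ sub])
  show "Phi ` range proj \<subseteq> W n f1 f2 f3"
  proof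
    fix F assume "F \<in> Phi ` range proj"
    then obtain x where x: "F = Phi (proj x)" by auto
    define x' where "x' = (\<Sum>b\<in>G3. fscale (x b) (funit b))"
    have "x' b = x b" if "b \<in> G3" for b
    proof -
      have "x' b = (\<Sum>d\<in>G3. if d = b then x b else 0)"
        unfolding x'_def sum_fun_apply by (intro sum.cong refl) (auto simp: fscale_def funit_def)
      then show ?thesis using that by simp
    qed
    then have "proj x = proj x'"
      unfolding proj_def by (intro ext if_cong refl sum.cong arg_cong2[of _ _ _ _ "(*)"]) simp
    then have "F = (\<Sum>b\<in>G3. fscale (x b) (Phi (proj (funit b))))"
      by (simp add: x x'_def P.sum L.sum P.scale L.scale)
    also have "\<dots> \<in> W n f1 f2 f3"
      unfolding W_def
    proof (intro fs.span_sum fs.span_scale)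
      fix b assume "b \<in> G3"
      then obtain s1 s2 s3 where b: "b = (s1, s2, s3)" "s1 \<in> perms n" "s2 \<in> perms n" "s3 \<in> perms n" by (auto simp: G3_def)
      show "Phi (proj (funit b)) \<in> fs.span (hws n f1 f2 f3)"
        unfolding b(1) Phi_column[OF b(2-4)]
        by (intro fs.span_scale fs.span_base)
          (use tab_comp[OF t1 b(2)] tab_comp[OF t2 b(3)] tab_comp[OF t3 b(4)] in \<open>unfold hws_def, blast\<close>)
    qed
    finally show "F \<in> W n f1 f2 f3" .
  qed
qed

lemma W_finite: "\<exists>C. finite C \<and> W n f1 f2 f3 \<subseteq> fs.span C"
proof -
  interpret L: Vector_Spaces.linear fscale fscale Phi by (rule Phi_linear)
  have "range proj \<subseteq> fs.span (funit ` G3)"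
  proof
    fix v assume "v \<in> range proj"
    then have "v = (\<Sum>i\<in>G3. fscale (v i) (funit i))"
      by (intro fun_eq_sum_funit) (auto simp: proj_def)
    also have "\<dots> \<in> fs.span (funit ` G3)"
      by (intro fs.span_sum fs.span_scale fs.span_base) auto
    finally show "v \<in> fs.span (funit ` G3)" .
  qed
  then have "W n f1 f2 f3 \<subseteq> fs.span (Phi ` funit ` G3)"
    unfolding W_eq L.span_image by blast
  then show ?thesis by (intro exI[of _ "Phi ` funit ` G3"]) auto
qed

text \<open>\<open>Phi\<close> maps the range of \<open>proj\<close> onto \<open>W\<close> and is
  injective there by \<open>Phi_zero\<close>.\<close>

lemma kr_eq_dim: "kr n f1 f2 f3 = fs.dim (range proj)"
proof -
  interpret L: Vector_Spaces.linear fscale fscale Phi by (rule Phi_linear)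
  interpret P: Vector_Spaces.linear fscale fscale proj by (rule proj_linear)
  have sub: "fs.subspace (range proj)" by (intro P.subspace_image) simp
  obtain B where B: "B \<subseteq> range proj" "fs.independent B" "range proj \<subseteq> fs.span B" "card B = fs.dim (range proj)"
    by (rule fs.basis_exists[of "range proj"])
  have sp: "fs.span B = range proj" using fs.span_minimal[OF B(1) sub] B(3) by auto
  have inj: "inj_on Phi (range proj)"
    using L.inj_on_iff_eq_0[OF sub] Phi_zero by blast
  have ind: "fs.independent (Phi ` B)"
    by (rule L.independent_injective_image[OF B(2)]) (simp add: sp inj)
  have "fs.span (Phi ` B) = W n f1 f2 f3" unfolding W_eq L.span_image sp ..
  then have "fs.dim (W n f1 f2 f3) = card (Phi ` B)"
    using fs.dim_eq_card[OF _ ind, of "W n f1 f2 f3"] by (metis fs.span_span)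
  also have "\<dots> = card B" by (rule card_image) (rule inj_on_subset[OF inj B(1)])
  finally show ?thesis by (simp add: kr_def B(4))
qed

lemma kr_chr: "of_nat (kr n f1 f2 f3) = (\<Sum>g\<in>perms n. chr n e1 g * chr n e2 g * chr n e3 g) / fact n"
  unfolding kr_eq_dim by (rule dim_proj)

end

subsection \<open>Symmetries\<close>

lemma partition_tab: "l \<in> partitions_of n \<Longrightarrow> tab n (row_of l) (col_of l) (rl l)"
  using tab_row_col[of l] by (auto simp: partitions_of_def)

lemma kr_irr_char:
  assumes l: "l1 \<in> partitions_of n" "l2 \<in> partitions_of n" "l3 \<in> partitions_of n"
  shows "of_nat (kr n (rl l1) (rl l2) (rl l3)) = (\<Sum>g\<in>perms n. irr_char l1 g * irr_char l2 g * irr_char l3 g) / fact n"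
proof -
  interpret triple n "row_of l1" "col_of l1" "rl l1" "row_of l2" "col_of l2" "rl l2" "row_of l3" "col_of l3" "rl l3"
    by unfold_locales (rule partition_tab, rule l)+
  have "(\<Sum>g\<in>perms n. irr_char l1 g * irr_char l2 g * irr_char l3 g) = (\<Sum>g\<in>perms n. chr n e1 g * chr n e2 g * chr n e3 g)"
    unfolding e1_def e2_def e3_def
    by (intro sum.cong refl) (simp only: irr_char_canonical[OF l(1)] irr_char_canonical[OF l(2)] irr_char_canonical[OF l(3)])
  then show ?thesis using kr_chr by simp
qed

lemma kr_ip:
  assumes l: "l1 \<in> partitions_of n" "l2 \<in> partitions_of n" "l3 \<in> partitions_of n"
  shows "ip n (\<lambda>\<sigma>. irr_char l1 \<sigma> * irr_char l2 \<sigma>) (irr_char l3) = of_nat (kr n (rl l1) (rl l2) (rl l3))"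
  unfolding kr_irr_char[OF l] ip_def
  by (intro arg_cong2[of _ _ _ _ "(/)"] sum.cong refl) (simp add: irr_char_inv[OF l(3)])

lemma kr_swap12:
  assumes "pt n f1" "pt n f2" "pt n f3"
  shows "kr n f1 f2 f3 = kr n f2 f1 f3"
proof -
  obtain l1 l2 l3 where l: "l1 \<in> partitions_of n" "l2 \<in> partitions_of n" "l3 \<in> partitions_of n"
    and f: "f1 = rl l1" "f2 = rl l2" "f3 = rl l3"
    using pt_list assms by metis
  have "of_nat (kr n f1 f2 f3) = (of_nat (kr n f2 f1 f3) :: complex)"
    unfolding f kr_irr_char[OF l] kr_irr_char[OF l(2,1,3)] by (simp add: mult_ac)
  then show ?thesis by (simp only: of_nat_eq_iff)
qed

text \<open>Conjugating two of the three shapes multiplies the product of characters by the square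
  of the sign.\<close>

lemma kr_conj:
  assumes "pt n f1" "pt n f2" "pt n f3"
  shows "kr n (conjf f1) f2 (conjf f3) = kr n f1 f2 f3"
proof -
  obtain l1 l2 l3 where l: "l1 \<in> partitions_of n" "l2 \<in> partitions_of n" "l3 \<in> partitions_of n"
    and f: "f1 = rl l1" "f2 = rl l2" "f3 = rl l3"
    using pt_list assms by metis
  obtain m1 m3 where m: "m1 \<in> partitions_of n" "m3 \<in> partitions_of n" and mf: "rl m1 = conjf f1" "rl m3 = conjf f3"
    using pt_list[OF pt_conjf[OF assms(1)]] pt_list[OF pt_conjf[OF assms(3)]] by metis
  have sq: "of_int (sign \<sigma>) * z * (of_int (sign \<sigma>) * w) = (z * w :: complex)" for \<sigma> :: "nat \<Rightarrow> nat" and z w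
  proof -
    have "(of_int (sign \<sigma>) :: complex) * of_int (sign \<sigma>) = 1" by (metis of_int_1 of_int_mult sign_idempotent)
    then show ?thesis by (metis (no_types, opaque_lifting) mult.assoc mult.commute mult_1)
  qed
  have "(\<Sum>g\<in>perms n. irr_char m1 g * irr_char l2 g * irr_char m3 g) = (\<Sum>g\<in>perms n. irr_char l1 g * irr_char l2 g * irr_char l3 g)"
  proof (intro sum.cong refl)
    fix g assume g: "g \<in> perms n"
    have "irr_char m1 g = of_int (sign g) * irr_char l1 g" "irr_char m3 g = of_int (sign g) * irr_char l3 g"
      using irr_char_conj[OF l(1) m(1) _ g] irr_char_conj[OF l(3) m(2) _ g] mf f by auto
    then show "irr_char m1 g * irr_char l2 g * irr_char m3 g = irr_char l1 g * irr_char l2 g * irr_char l3 g"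
      using sq[of g "irr_char l1 g * irr_char l2 g" "irr_char l3 g"] by (simp add: mult.assoc)
  qed
  then have "of_nat (kr n (conjf f1) f2 (conjf f3)) = (of_nat (kr n f1 f2 f3) :: complex)"
    unfolding mf[symmetric] unfolding f kr_irr_char[OF l] kr_irr_char[OF m(1) l(2) m(2)] by simp
  then show ?thesis by (simp only: of_nat_eq_iff)
qed

definition onerow :: "nat \<Rightarrow> nat \<Rightarrow> nat" where
  "onerow n = (\<lambda>i. if i = 0 then n else 0)"

lemma tab_onerow: "tab n (\<lambda>_. 0) (\<lambda>x. x) (onerow n)"
  by (auto simp: tab_def onerow_def)

lemma pt_onerow: "pt n (onerow n)"
  by (rule tab_pt[OF tab_onerow])

text \<open>The row group is everything and the column group is trivial, so the Young symmetrizer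
  takes the value 1 on the whole group.\<close>

lemma irr_char_onerow:
  assumes l: "l \<in> partitions_of n" "rl l = onerow n" and \<sigma>: "\<sigma> \<in> perms n"
  shows "irr_char l \<sigma> = 1"
proof -
  have t: "tab n (\<lambda>_. 0) (\<lambda>x. x) (rl l)" using tab_onerow l(2) by simp
  have R: "stab n (\<lambda>_. 0) = perms n" by (auto simp: stab_def)
  have C: "stab n (\<lambda>x. x) = {id}"
    using tab_stab_trivial[OF tab_onerow, of _ n] R stab_perms stab_id by blast
  have y: "ysym n (\<lambda>_. 0) (\<lambda>x. x) \<tau> = 1" if \<tau>: "\<tau> \<in> perms n" for \<tau>
  proof -
    have "ysym n (\<lambda>_. 0) (\<lambda>x. x) \<tau> = ysym n (\<lambda>_. 0) (\<lambda>x. x) (\<tau> \<circ> id)" by simp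
    also have "\<dots> = ysym n (\<lambda>_. 0) (\<lambda>x. x) id" by (rule ysym_left) (use R \<tau> in simp)
    also have "\<dots> = 1" by (rule ysym_id[OF t])
    finally show ?thesis .
  qed
  have "yk n (\<lambda>_. 0) (\<lambda>x. x) = (\<Sum>\<tau>\<in>perms n. 1)"
    unfolding yk_def galg_mult_def by (intro sum.cong refl) (simp add: y permutes_inv)
  then have k: "yk n (\<lambda>_. 0) (\<lambda>x. x) = fact n" by (simp add: card_perms)
  have "chr n (ye n (\<lambda>_. 0) (\<lambda>x. x)) \<sigma> = (\<Sum>\<tau>\<in>perms n. 1 / fact n)"
    unfolding chr_def ye_def fscale_def k
  proof (intro sum.cong refl)
    fix \<tau> assume "\<tau> \<in> perms n"
    then have "inv \<tau> \<circ> (inv \<sigma> \<circ> \<tau>) \<in> perms n" by (intro perms_comp perms_inv \<sigma>)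
    then show "1 / fact n * ysym n (\<lambda>_. 0) (\<lambda>x. x) (inv \<tau> \<circ> (inv \<sigma> \<circ> \<tau>)) = 1 / fact n" using y by simp
  qed
  also have "\<dots> = 1" by (simp add: card_perms)
  finally show ?thesis using irr_char_tab[OF l(1) t \<sigma>] by simp
qed

lemma kr_onerow:
  assumes f: "pt n f"
  shows "kr n f (onerow n) f = 1"
proof -
  obtain l m where l: "l \<in> partitions_of n" "rl l = f" and m: "m \<in> partitions_of n" "rl m = onerow n"
    using pt_list[OF f] pt_list[OF pt_onerow] by metis
  have "of_nat (kr n f (onerow n) f) = ip n (\<lambda>\<sigma>. irr_char l \<sigma> * irr_char m \<sigma>) (irr_char l)"
    using kr_ip[OF l(1) m(1) l(1)] l m by simp
  also have "\<dots> = ip n (irr_char l) (irr_char l)"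
    by (rule ip_cong) (use irr_char_onerow[OF m] in auto)
  also have "\<dots> = 1" using ip_irr_char[OF l(1) l(1)] by simp
  finally show ?thesis by (metis of_nat_1 of_nat_eq_iff)
qed

subsection \<open>Disjoint unions of tableaux\<close>

definition cat :: "nat \<Rightarrow> (nat \<Rightarrow> nat) \<Rightarrow> (nat \<Rightarrow> nat) \<Rightarrow> nat \<Rightarrow> nat" where
  "cat n a b = (\<lambda>x. if x < n then a x else b (x - n))"

text \<open>Even labels for the first tableau and odd ones for the second keep their columns
  apart.\<close>

abbreviation ccat :: "nat \<Rightarrow> (nat \<Rightarrow> nat) \<Rightarrow> (nat \<Rightarrow> nat) \<Rightarrow> nat \<Rightarrow> nat" where
  "ccat n c d \<equiv> cat n (\<lambda>x. 2 * c x) (\<lambda>x. Suc (2 * d x))"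

lemma tab_cat:
  assumes t: "tab n r c f" and t': "tab m r' c' h"
  shows "tab (n + m) (cat n r r') (ccat n c c') (\<lambda>i. f i + h i)"
  unfolding tab_def
proof (intro conjI allI impI)
  fix x y assume xy: "x < n + m" "y < n + m" "cat n r r' x = cat n r r' y" "ccat n c c' x = ccat n c c' y"
  have par: "2 * a \<noteq> Suc (2 * b)" "Suc (2 * b) \<noteq> 2 * a" for a b :: nat by presburger+
  show "x = y"
  proof (cases "x < n")
    case True
    then have "y < n" using xy(4) par by (auto simp: cat_def split: if_splits)
    then show ?thesis using True xy t by (auto simp: cat_def tab_def)
  next
    case False
    then have ny: "\<not> y < n" using xy(4) par by (auto simp: cat_def split: if_splits)
    have "x - n < m" "y - n < m" "r' (x - n) = r' (y - n)" "c' (x - n) = c' (y - n)"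
      using False ny xy by (auto simp: cat_def)
    then have "x - n = y - n" using t' unfolding tab_def by blast
    then show ?thesis using False ny by simp
  qed
next
  fix x i assume x: "x < n + m" and i: "i < cat n r r' x"
  show "\<exists>y<n + m. ccat n c c' y = ccat n c c' x \<and> cat n r r' y = i"
  proof (cases "x < n")
    case True
    then have "i < r x" using i by (simp add: cat_def)
    then obtain y where "y < n" "c y = c x" "r y = i" using t True unfolding tab_def by blast
    then show ?thesis using True by (intro exI[of _ y]) (auto simp: cat_def)
  next
    case False
    then have "x - n < m" "i < r' (x - n)" using x i by (auto simp: cat_def)
    then obtain y where "y < m" "c' y = c' (x - n)" "r' y = i" using t' unfolding tab_def by blast
    then show ?thesis using False by (intro exI[of _ "y + n"]) (auto simp: cat_def)
  qed
next
  fix i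
  have e: "{x. x < n + m \<and> cat n r r' x = i} = {x. x < n \<and> r x = i} \<union> (\<lambda>y. y + n) ` {y. y < m \<and> r' y = i}"
  proof (intro equalityI subsetI)
    fix x assume x: "x \<in> {x. x < n + m \<and> cat n r r' x = i}"
    show "x \<in> {x. x < n \<and> r x = i} \<union> (\<lambda>y. y + n) ` {y. y < m \<and> r' y = i}"
    proof (cases "x < n")
      case False
      then show ?thesis using x by (intro UnI2 image_eqI[of _ _ "x - n"]) (auto simp: cat_def)
    qed (use x in \<open>auto simp: cat_def\<close>)
  qed (auto simp: cat_def)
  have "card {x. x < n + m \<and> cat n r r' x = i} = card {x. x < n \<and> r x = i} + card ((\<lambda>y. y + n) ` {y. y < m \<and> r' y = i})"
    unfolding e by (rule card_Un_disjoint) auto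
  moreover have "card ((\<lambda>y. y + n) ` {y. y < m \<and> r' y = i}) = card {y. y < m \<and> r' y = i}"
    by (rule card_image) simp
  moreover have "card {x. x < n \<and> r x = i} = f i" "card {y. y < m \<and> r' y = i} = h i"
    using t t' unfolding tab_def by blast+
  ultimately show "card {x. x < n + m \<and> cat n r r' x = i} = f i + h i" by linarith
qed

definition jn :: "nat \<Rightarrow> nat \<Rightarrow> (nat \<Rightarrow> nat) \<Rightarrow> (nat \<Rightarrow> nat) \<Rightarrow> nat \<Rightarrow> nat" where
  "jn n m q p = q \<circ> map_permutation {..<m} (\<lambda>y. y + n) p"

lemma jn_facts:
  assumes q: "q \<in> perms n" and p: "p \<in> perms m"
  shows "jn n m q p \<in> perms (n + m)" "x < n \<Longrightarrow> jn n m q p x = q x"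
    "y < m \<Longrightarrow> jn n m q p (y + n) = p y + n" "sign (jn n m q p) = sign q * sign p"
proof -
  define s where "s = map_permutation {..<m} (\<lambda>y. y + n) p"
  have inj: "inj_on (\<lambda>y. y + n) {..<m}" by (simp add: inj_on_def)
  have im: "(\<lambda>y. y + n) ` {..<m} = {n..<n + m}"
  proof (intro equalityI subsetI)
    fix x assume "x \<in> {n..<n + m}"
    then show "x \<in> (\<lambda>y. y + n) ` {..<m}" by (intro image_eqI[of _ _ "x - n"]) auto
  qed auto
  have sp: "s permutes {n..<n + m}"
    unfolding s_def by (rule map_permutation_permutes) (use p inj im in \<open>auto simp: bij_betw_def\<close>)
  then have s: "s \<in> perms (n + m)" using permutes_subset[OF sp, of "{..<n + m}"] by (simp add: subset_iff)
  have q': "q \<in> perms (n + m)" using permutes_subset[of q "{..<n}" "{..<n + m}"] q by auto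
  show "jn n m q p \<in> perms (n + m)" unfolding jn_def s_def[symmetric] by (rule perms_comp[OF q' s])
  show "jn n m q p x = q x" if "x < n"
    unfolding jn_def s_def[symmetric] using permutes_not_in[OF sp, of x] that by simp
  have sy: "s (y + n) = p y + n" if "y < m" for y
    unfolding s_def using map_permutation_apply[OF inj, of y p] that by simp
  show "jn n m q p (y + n) = p y + n" if "y < m"
    unfolding jn_def s_def[symmetric] using sy[OF that] permutes_not_in[of q "{..<n}" "p y + n"] q by simp
  have "sign s = sign p" unfolding s_def by (rule sign_map_permutation[OF inj]) (use p in auto)
  then show "sign (jn n m q p) = sign q * sign p"
    unfolding jn_def s_def[symmetric] using sign_perms_comp[OF q' s] by simp
qed

text \<open>The parity of the labels prevents a column permutation of the union from mixing the two
  blocks, so its column group is the product of the two column groups.\<close>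

lemma jn_bij: "bij_betw (\<lambda>(q, p). jn n m q p) (stab n c \<times> stab m d) (stab (n + m) (ccat n c d))"
  unfolding bij_betw_def
proof
  show "inj_on (\<lambda>(q, p). jn n m q p) (stab n c \<times> stab m d)"
  proof (rule inj_onI, clarify)
    fix q p q' p' assume a: "q \<in> stab n c" "p \<in> stab m d" "q' \<in> stab n c" "p' \<in> stab m d" and e: "jn n m q p = jn n m q' p'"
    note f = jn_facts[OF stab_perms[OF a(1)] stab_perms[OF a(2)]] and f' = jn_facts[OF stab_perms[OF a(3)] stab_perms[OF a(4)]]
    have "q = q'" by (rule perms_eqI[OF stab_perms[OF a(1)] stab_perms[OF a(3)]]) (metis e f(2) f'(2))
    moreover have "p = p'" by (rule perms_eqI[OF stab_perms[OF a(2)] stab_perms[OF a(4)]]) (metis e f(3) f'(3) add_right_cancel)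
    ultimately show "q = q' \<and> p = p'" by simp
  qed
  show "(\<lambda>(q, p). jn n m q p) ` (stab n c \<times> stab m d) = stab (n + m) (ccat n c d)"
  proof (intro equalityI subsetI)
    fix \<sigma> assume "\<sigma> \<in> (\<lambda>(q, p). jn n m q p) ` (stab n c \<times> stab m d)"
    then obtain q p where a: "q \<in> stab n c" "p \<in> stab m d" "\<sigma> = jn n m q p" by auto
    note f = jn_facts[OF stab_perms[OF a(1)] stab_perms[OF a(2)]]
    have "ccat n c d (\<sigma> k) = ccat n c d k" if k: "k < n + m" for k
    proof (cases "k < n")
      case True
      then show ?thesis using f(2)[OF True] a perms_less[OF stab_perms[OF a(1)]] by (simp add: cat_def stab_def)
    next
      case False
      then obtain y where y: "k = y + n" "y < m" using k by (metis add.commute add_less_cancel_left le_Suc_ex not_less)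
      then show ?thesis using f(3)[OF y(2)] a by (simp add: cat_def stab_def)
    qed
    then show "\<sigma> \<in> stab (n + m) (ccat n c d)" using f(1) a(3) by (simp add: stab_def)
  next
    fix \<sigma> assume \<sigma>: "\<sigma> \<in> stab (n + m) (ccat n c d)"
    have sp: "\<sigma> \<in> perms (n + m)" by (rule stab_perms[OF \<sigma>])
    have inj: "\<sigma> x = \<sigma> y \<Longrightarrow> x = y" for x y using permutes_inj[of \<sigma> "{..<n + m}"] sp by (auto dest: injD)
    have cc: "ccat n c d (\<sigma> k) = ccat n c d k" if "k < n + m" for k using \<sigma> that by (simp add: stab_def)
    have par: "2 * a \<noteq> Suc (2 * b)" "Suc (2 * b) \<noteq> 2 * a" for a b :: nat by presburger+
    have low: "\<sigma> x < n" "c (\<sigma> x) = c x" if "x < n" for x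
      using cc[of x] that par by (auto simp: cat_def split: if_splits)
    have high: "n \<le> \<sigma> (y + n)" "\<sigma> (y + n) < n + m" "d (\<sigma> (y + n) - n) = d y" if "y < m" for y
      using cc[of "y + n"] that par perms_less[OF sp, of "y + n"] by (auto simp: cat_def split: if_splits)
    define q where "q x = (if x < n then \<sigma> x else x)" for x
    define p where "p y = (if y < m then \<sigma> (y + n) - n else y)" for y
    have "inj_on q {..<n}" by (rule inj_onI) (use inj in \<open>auto simp: q_def\<close>)
    moreover have "q ` {..<n} \<subseteq> {..<n}" using low by (auto simp: q_def)
    ultimately have "bij_betw q {..<n} {..<n}" by (simp add: bij_betw_def endo_inj_surj)
    then have q: "q \<in> perms n" using bij_imp_permutes[of q "{..<n}"] by (simp add: q_def)
    have "inj_on p {..<m}"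
    proof (rule inj_onI)
      fix x y assume xy: "x \<in> {..<m}" "y \<in> {..<m}" "p x = p y"
      then have "\<sigma> (x + n) = \<sigma> (y + n)" using high(1)[of x] high(1)[of y] by (auto simp: p_def)
      then show "x = y" using inj[of "x + n" "y + n"] by simp
    qed
    moreover have "p ` {..<m} \<subseteq> {..<m}" using high by (force simp: p_def)
    ultimately have "bij_betw p {..<m} {..<m}" by (simp add: bij_betw_def endo_inj_surj)
    then have p: "p \<in> perms m" using bij_imp_permutes[of p "{..<m}"] by (simp add: p_def)
    note f = jn_facts[OF q p]
    have "jn n m q p = \<sigma>"
    proof (rule perms_eqI[OF f(1) sp])
      fix x assume x: "x < n + m"
      show "jn n m q p x = \<sigma> x"
      proof (cases "x < n")
        case True
        then show ?thesis using f(2) by (simp add: q_def)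
      next
        case False
        then obtain y where y: "x = y + n" "y < m" using x by (metis add.commute add_less_cancel_left le_Suc_ex not_less)
        then show ?thesis using f(3)[OF y(2)] high(1)[OF y(2)] by (simp add: p_def)
      qed
    qed
    moreover have "q \<in> stab n c" "p \<in> stab m d" using q p low high by (auto simp: stab_def q_def p_def)
    ultimately show "\<sigma> \<in> (\<lambda>(q, p). jn n m q p) ` (stab n c \<times> stab m d)" by force
  qed
qed

lemma sum_stab_join_factor:
  fixes F A B :: "(nat \<Rightarrow> nat) \<Rightarrow> complex"
  assumes F: "\<And>q p. q \<in> stab n c \<Longrightarrow> p \<in> stab m d \<Longrightarrow> F (jn n m q p) = A q * B p"
  shows "(\<Sum>\<sigma>\<in>stab (n + m) (ccat n c d). of_int (sign \<sigma>) * F \<sigma>) =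
    (\<Sum>q\<in>stab n c. of_int (sign q) * A q) * (\<Sum>p\<in>stab m d. of_int (sign p) * B p)"
proof -
  have "(\<Sum>\<sigma>\<in>stab (n + m) (ccat n c d). of_int (sign \<sigma>) * F \<sigma>) =
    (\<Sum>(q, p)\<in>stab n c \<times> stab m d. of_int (sign (jn n m q p)) * F (jn n m q p))"
    using sum.reindex_bij_betw[OF jn_bij, of "\<lambda>\<sigma>. of_int (sign \<sigma>) * F \<sigma>" n m c d] by (simp add: case_prod_unfold)
  also have "\<dots> = (\<Sum>(q, p)\<in>stab n c \<times> stab m d. (of_int (sign q) * A q) * (of_int (sign p) * B p))"
    by (intro sum.cong refl) (auto simp: F jn_facts(4)[OF stab_perms stab_perms])
  finally show ?thesis by (simp add: sum_product sum.cartesian_product)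
qed

text \<open>Column groups, signs and products over entries all split along the two blocks; the
  factorization is applied to the three nested sums in turn.\<close>

lemma hw_cat:
  "hw (n + m) (cat n r1 s1) (ccat n c1 d1) (cat n r2 s2) (ccat n c2 d2) (cat n r3 s3) (ccat n c3 d3) X =
   hw n r1 c1 r2 c2 r3 c3 X * hw m s1 d1 s2 d2 s3 d3 X"
  unfolding hw_def
proof (rule sum_stab_join_factor)
  fix q1 p1 assume 1: "q1 \<in> stab n c1" "p1 \<in> stab m d1"
  note f1 = jn_facts[OF stab_perms[OF 1(1)] stab_perms[OF 1(2)]]
  show "(\<Sum>q2\<in>stab (n + m) (ccat n c2 d2). of_int (sign q2) * (\<Sum>q3\<in>stab (n + m) (ccat n c3 d3). of_int (sign q3) *
      (\<Prod>x<n + m. X (cat n r1 s1 (jn n m q1 p1 x), cat n r2 s2 (q2 x), cat n r3 s3 (q3 x))))) =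
    (\<Sum>q2\<in>stab n c2. of_int (sign q2) * (\<Sum>q3\<in>stab n c3. of_int (sign q3) * (\<Prod>x<n. X (r1 (q1 x), r2 (q2 x), r3 (q3 x))))) *
    (\<Sum>q2\<in>stab m d2. of_int (sign q2) * (\<Sum>q3\<in>stab m d3. of_int (sign q3) * (\<Prod>x<m. X (s1 (p1 x), s2 (q2 x), s3 (q3 x)))))"
  proof (rule sum_stab_join_factor)
    fix q2 p2 assume 2: "q2 \<in> stab n c2" "p2 \<in> stab m d2"
    note f2 = jn_facts[OF stab_perms[OF 2(1)] stab_perms[OF 2(2)]]
    show "(\<Sum>q3\<in>stab (n + m) (ccat n c3 d3). of_int (sign q3) *
        (\<Prod>x<n + m. X (cat n r1 s1 (jn n m q1 p1 x), cat n r2 s2 (jn n m q2 p2 x), cat n r3 s3 (q3 x)))) =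
      (\<Sum>q3\<in>stab n c3. of_int (sign q3) * (\<Prod>x<n. X (r1 (q1 x), r2 (q2 x), r3 (q3 x)))) *
      (\<Sum>q3\<in>stab m d3. of_int (sign q3) * (\<Prod>x<m. X (s1 (p1 x), s2 (p2 x), s3 (q3 x))))"
    proof (rule sum_stab_join_factor)
      fix q3 p3 assume 3: "q3 \<in> stab n c3" "p3 \<in> stab m d3"
      note f3 = jn_facts[OF stab_perms[OF 3(1)] stab_perms[OF 3(2)]]
      define T where "T x = X (cat n r1 s1 (jn n m q1 p1 x), cat n r2 s2 (jn n m q2 p2 x), cat n r3 s3 (jn n m q3 p3 x))" for x
      have "(\<Prod>x<n + m. T x) = (\<Prod>x<n. T x) * (\<Prod>x\<in>{n..<n + m}. T x)"
        by (subst prod.union_disjoint[symmetric]) (auto intro!: prod.cong)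
      also have "(\<Prod>x\<in>{n..<n + m}. T x) = (\<Prod>y<m. T (y + n))"
        by (rule prod.reindex_bij_witness[of _ "\<lambda>y. y + n" "\<lambda>x. x - n"]) auto
      also have "(\<Prod>x<n. T x) = (\<Prod>x<n. X (r1 (q1 x), r2 (q2 x), r3 (q3 x)))"
      proof (intro prod.cong refl)
        fix x assume "x \<in> {..<n}"
        then have x: "x < n" by simp
        then show "T x = X (r1 (q1 x), r2 (q2 x), r3 (q3 x))"
          using perms_less[OF stab_perms[OF 1(1)], of x] perms_less[OF stab_perms[OF 2(1)], of x] perms_less[OF stab_perms[OF 3(1)], of x]
          by (simp add: T_def cat_def f1(2) f2(2) f3(2))
      qed
      also have "(\<Prod>y<m. T (y + n)) = (\<Prod>y<m. X (s1 (p1 y), s2 (p2 y), s3 (p3 y)))"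
        by (intro prod.cong refl) (simp add: T_def cat_def f1(3) f2(3) f3(3))
      finally show "(\<Prod>x<n + m. X (cat n r1 s1 (jn n m q1 p1 x), cat n r2 s2 (jn n m q2 p2 x), cat n r3 s3 (jn n m q3 p3 x))) =
        (\<Prod>x<n. X (r1 (q1 x), r2 (q2 x), r3 (q3 x))) * (\<Prod>x<m. X (s1 (p1 x), s2 (p2 x), s3 (p3 x)))"
        by (simp add: T_def)
    qed
  qed
qed

text \<open>Bilinear extension of \<open>hw_cat\<close>, by one induction over the span for each
  factor.\<close>

lemma W_mult:
  assumes F: "F \<in> W n f1 f2 f3" and H: "H \<in> W m h1 h2 h3"
  shows "(\<lambda>X. F X * H X) \<in> W (n + m) (\<lambda>i. f1 i + h1 i) (\<lambda>i. f2 i + h2 i) (\<lambda>i. f3 i + h3 i)"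
    (is "_ \<in> ?W")
proof -
  have sub: "fs.subspace ?W" by (simp add: W_def)
  have gen: "(\<lambda>X. F X * H X) \<in> ?W" if F: "F \<in> hws n f1 f2 f3" and H: "H \<in> hws m h1 h2 h3" for F H
  proof -
    obtain r1 c1 r2 c2 r3 c3 where F: "F = hw n r1 c1 r2 c2 r3 c3" and t: "tab n r1 c1 f1" "tab n r2 c2 f2" "tab n r3 c3 f3"
      using F by (auto simp: hws_def)
    obtain s1 d1 s2 d2 s3 d3 where H: "H = hw m s1 d1 s2 d2 s3 d3" and u: "tab m s1 d1 h1" "tab m s2 d2 h2" "tab m s3 d3 h3"
      using H by (auto simp: hws_def)
    have "(\<lambda>X. F X * H X) = hw (n + m) (cat n r1 s1) (ccat n c1 d1) (cat n r2 s2) (ccat n c2 d2) (cat n r3 s3) (ccat n c3 d3)"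
      by (rule ext) (simp only: F H hw_cat)
    moreover have "\<dots> \<in> hws (n + m) (\<lambda>i. f1 i + h1 i) (\<lambda>i. f2 i + h2 i) (\<lambda>i. f3 i + h3 i)"
      unfolding hws_def using tab_cat[OF t(1) u(1)] tab_cat[OF t(2) u(2)] tab_cat[OF t(3) u(3)] by blast
    ultimately show ?thesis unfolding W_def by (metis fs.span_base)
  qed
  have left: "(\<lambda>X. F X * H X) \<in> ?W" if F: "F \<in> W n f1 f2 f3" and H: "H \<in> hws m h1 h2 h3" for F H
    using F unfolding W_def[of n f1]
  proof (induction rule: fs.span_induct_alt)
    case base
    then show ?case using fs.subspace_0[OF sub] by (simp add: zero_fun_def)
  next
    case (step k x y)
    have "(\<lambda>X. (fscale k x + y) X * H X) = fscale k (\<lambda>X. x X * H X) + (\<lambda>X. y X * H X)"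
      by (auto simp: fscale_def fun_eq_iff algebra_simps)
    then show ?case
      using fs.subspace_add[OF sub fs.subspace_scale[OF sub gen[OF step(1) H]] step(2)] by simp
  qed
  show ?thesis
    using H unfolding W_def[of m h1]
  proof (induction rule: fs.span_induct_alt)
    case base
    then show ?case using fs.subspace_0[OF sub] by (simp add: zero_fun_def)
  next
    case (step k x y)
    have "(\<lambda>X. F X * (fscale k x + y) X) = fscale k (\<lambda>X. F X * x X) + (\<lambda>X. F X * y X)"
      by (auto simp: fscale_def fun_eq_iff algebra_simps)
    then show ?case
      using fs.subspace_add[OF sub fs.subspace_scale[OF sub left[OF F step(1)]] step(2)] by simp
  qed
qed

subsection \<open>Polynomial functions\<close>

text \<open>Polynomial along every affine line: enough to exclude zero divisors by univariate
  polynomials alone.\<close>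

definition pol :: "(('v \<Rightarrow> complex) \<Rightarrow> complex) \<Rightarrow> bool" where
  "pol F \<longleftrightarrow> (\<forall>Y Z. \<exists>p. \<forall>t. F (\<lambda>v. Y v + t * Z v) = poly p t)"

lemma pol_const: "pol (\<lambda>X. k)"
  unfolding pol_def by (intro allI exI[of _ "[:k:]"]) simp

lemma pol_var: "pol (\<lambda>X. X v)"
  unfolding pol_def
proof (intro allI)
  fix Y Z :: "'a \<Rightarrow> complex"
  show "\<exists>p. \<forall>t. Y v + t * Z v = poly p t" by (intro exI[of _ "[:Y v, Z v:]"]) simp
qed

lemma pol_add: "pol F \<Longrightarrow> pol H \<Longrightarrow> pol (\<lambda>X. F X + H X)"
  unfolding pol_def by (metis poly_add)

lemma pol_mult: "pol F \<Longrightarrow> pol H \<Longrightarrow> pol (\<lambda>X. F X * H X)"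
  unfolding pol_def by (metis poly_mult)

lemma pol_sum: "(\<And>a. a \<in> A \<Longrightarrow> pol (F a)) \<Longrightarrow> pol (\<lambda>X. \<Sum>a\<in>A. F a X)"
  by (induction A rule: infinite_finite_induct) (auto intro: pol_const pol_add)

lemma pol_prod: "(\<And>a. a \<in> A \<Longrightarrow> pol (F a)) \<Longrightarrow> pol (\<lambda>X. \<Prod>a\<in>A. F a X)"
  by (induction A rule: infinite_finite_induct) (auto intro: pol_const pol_mult)

lemma pol_hw: "pol (hw n r1 c1 r2 c2 r3 c3)"
  unfolding hw_def[abs_def] by (intro pol_sum pol_mult pol_const pol_prod pol_var)

lemma pol_W: "F \<in> W n f1 f2 f3 \<Longrightarrow> pol F"
  unfolding W_def
proof (induction rule: fs.span_induct_alt)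
  case base
  then show ?case using pol_const[of 0] by (simp add: zero_fun_def)
next
  case (step k x y)
  have "pol x" using step(1) pol_hw by (auto simp: hws_def)
  then have "pol (\<lambda>X. k * x X + y X)" by (intro pol_add pol_mult pol_const step)
  then show ?case by (simp add: fscale_def plus_fun_def)
qed

text \<open>On the line through Y and Z both functions become nonzero univariate polynomials, so
  some point of the line avoids the roots of both. Coordinates that vanish at Y and Z vanish along
  the line, which keeps U in a coordinate subspace.\<close>

lemma pol_common_nonzero:
  assumes F: "pol F" "F Y \<noteq> 0" and H: "pol H" "H Z \<noteq> 0"
  shows "\<exists>U. F U * H U \<noteq> 0 \<and> (\<forall>v. Y v = 0 \<and> Z v = 0 \<longrightarrow> U v = 0)"
proof -
  obtain p where p: "\<And>t. F (\<lambda>v. Y v + t * (Z v - Y v)) = poly p t" using F(1) unfolding pol_def by metis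
  obtain q where q: "\<And>t. H (\<lambda>v. Y v + t * (Z v - Y v)) = poly q t" using H(1) unfolding pol_def by metis
  have "poly p 0 \<noteq> 0" using p[of 0] F(2) by simp
  moreover have "poly q 1 \<noteq> 0" using q[of 1] H(2) by simp
  ultimately have "p * q \<noteq> 0" by auto
  then obtain t where "poly (p * q) t \<noteq> 0" using poly_all_0_iff_0 by blast
  then have "F (\<lambda>v. Y v + t * (Z v - Y v)) * H (\<lambda>v. Y v + t * (Z v - Y v)) \<noteq> 0" using p q by simp
  then show ?thesis by (intro exI[of _ "\<lambda>v. Y v + t * (Z v - Y v)"]) auto
qed

section \<open>Positivity and monotonicity of the coefficients\<close>

lemma W_finite_dim:
  assumes "pt n f1" "pt n f2" "pt n f3"
  shows "\<exists>C. finite C \<and> W n f1 f2 f3 \<subseteq> fs.span C"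
proof -
  obtain r1 c1 r2 c2 r3 c3 where "tab n r1 c1 f1" "tab n r2 c2 f2" "tab n r3 c3 f3"
    using pt_tab assms by metis
  then interpret triple n r1 c1 f1 r2 c2 f2 r3 c3 f3 by unfold_locales
  show ?thesis by (rule W_finite)
qed

lemma kr_pos_iff:
  assumes "pt n f1" "pt n f2" "pt n f3"
  shows "kr n f1 f2 f3 \<ge> 1 \<longleftrightarrow> (\<exists>F\<in>W n f1 f2 f3. \<exists>X. F X \<noteq> 0)"
proof -
  obtain C where "finite C" "W n f1 f2 f3 \<subseteq> fs.span C" using W_finite_dim[OF assms] by blast
  then have "kr n f1 f2 f3 = 0 \<longleftrightarrow> W n f1 f2 f3 \<subseteq> {0}" unfolding kr_def by (intro fdim_zero_iff)
  also have "\<dots> \<longleftrightarrow> \<not> (\<exists>F\<in>W n f1 f2 f3. \<exists>X. F X \<noteq> 0)" by (auto simp: fun_eq_iff subset_iff)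
  finally show ?thesis by linarith
qed

lemma pt_add:
  assumes "pt n f" "pt m h"
  shows "pt (n + m) (\<lambda>i. f i + h i)"
proof -
  obtain r c r' c' where "tab n r c f" "tab m r' c' h" using pt_tab assms by metis
  then show ?thesis using tab_pt[OF tab_cat] by blast
qed

lemma kr_add:
  assumes f: "pt n f1" "pt n f2" "pt n f3" and h: "pt m h1" "pt m h2" "pt m h3" and pos: "kr m h1 h2 h3 \<ge> 1"
  shows "kr n f1 f2 f3 \<le> kr (n + m) (\<lambda>i. f1 i + h1 i) (\<lambda>i. f2 i + h2 i) (\<lambda>i. f3 i + h3 i)"
proof -
  obtain H Z where H: "H \<in> W m h1 h2 h3" "H Z \<noteq> 0" using pos kr_pos_iff[OF h] by blast
  define M where "M F = (\<lambda>X. F X * H X)" for F :: "(nat \<times> nat \<times> nat \<Rightarrow> complex) \<Rightarrow> complex"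
  have lin: "flinear M" by (rule flinearI) (auto simp: M_def algebra_simps)
  interpret M: Vector_Spaces.linear fscale fscale M by (rule lin)
  have sub: "fs.subspace (W n f1 f2 f3)" by (simp add: W_def)
  obtain B where B: "B \<subseteq> W n f1 f2 f3" "fs.independent B" "W n f1 f2 f3 \<subseteq> fs.span B" "card B = fs.dim (W n f1 f2 f3)"
    by (rule fs.basis_exists[of "W n f1 f2 f3"])
  have sp: "fs.span B = W n f1 f2 f3" using fs.span_minimal[OF B(1) sub] B(3) by auto
  have inj: "inj_on M (W n f1 f2 f3)"
    unfolding M.inj_on_iff_eq_0[OF sub]
  proof (intro ballI impI)
    fix F assume F: "F \<in> W n f1 f2 f3" and z: "M F = 0"
    show "F = 0"
    proof (rule ccontr)
      assume "F \<noteq> 0"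
      then obtain Y where "F Y \<noteq> 0" by (auto simp: fun_eq_iff)
      then obtain U where "F U * H U \<noteq> 0" using pol_common_nonzero[OF pol_W[OF F] _ pol_W[OF H(1)] H(2)] by blast
      then show False using fun_cong[OF z, of U] by (simp add: M_def)
    qed
  qed
  have ind: "fs.independent (M ` B)"
    by (rule M.independent_injective_image[OF B(2)]) (simp add: sp inj)
  have sub': "M ` B \<subseteq> W (n + m) (\<lambda>i. f1 i + h1 i) (\<lambda>i. f2 i + h2 i) (\<lambda>i. f3 i + h3 i)"
    using W_mult[OF _ H(1)] B(1) by (auto simp: M_def)
  obtain C where C: "finite C" "W (n + m) (\<lambda>i. f1 i + h1 i) (\<lambda>i. f2 i + h2 i) (\<lambda>i. f3 i + h3 i) \<subseteq> fs.span C"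
    using W_finite_dim[OF pt_add[OF f(1) h(1)] pt_add[OF f(2) h(2)] pt_add[OF f(3) h(3)]] by blast
  have "card (M ` B) = card B" by (rule card_image) (rule inj_on_subset[OF inj B(1)])
  then show ?thesis
    using fdim_ge_card[OF ind sub' C(2,1)] B(4) by (simp add: kr_def)
qed

lemma kr_ge_2I:
  assumes f: "pt n f1" "pt n f2" "pt n f3"
    and F: "F \<in> W n f1 f2 f3" "F Y \<noteq> 0" and H: "H \<in> W n f1 f2 f3" "H Z \<noteq> 0" "F Z = 0"
  shows "kr n f1 f2 f3 \<ge> 2"
proof -
  have H0: "H \<noteq> 0" using H(2) by auto
  have "F \<notin> fs.span {H}"
  proof
    assume "F \<in> fs.span {H}"
    then obtain k where k: "F = fscale k H" by (auto simp: fs.span_singleton)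
    then have "k = 0" using H(2,3) by (simp add: fscale_def)
    then show False using F(2) k by (simp add: fscale_def)
  qed
  moreover have "F \<noteq> H" using H by auto
  ultimately have ind: "fs.independent {F, H}" using H0 by (simp add: fs.independent_insert)
  obtain C where "finite C" "W n f1 f2 f3 \<subseteq> fs.span C" using W_finite_dim[OF f] by blast
  then have "card {F, H} \<le> kr n f1 f2 f3"
    using fdim_ge_card[OF ind, of "W n f1 f2 f3" C] F(1) H(1) by (simp add: kr_def)
  then show ?thesis using \<open>F \<noteq> H\<close> by simp
qed

subsection \<open>Evaluating highest weight polynomials at integer points\<close>

text \<open>Executable form of the signed sum over the column group. A permutation in it that fixes
  all points below i is uniquely the transposition of i with some y \<ge> i of the same column, or
  the identity if y = i, times one that also fixes i; k counts the points still free.\<close>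

primrec asx :: "nat \<Rightarrow> nat \<Rightarrow> (nat \<Rightarrow> nat) \<Rightarrow> ((nat \<Rightarrow> nat) \<Rightarrow> int) \<Rightarrow> int" where
  "asx n 0 c F = F id"
| "asx n (Suc k) c F = (\<Sum>y\<leftarrow>filter (\<lambda>y. c y = c (n - Suc k)) [n - Suc k..<n].
     (if y = n - Suc k then 1 else -1) * asx n k c (\<lambda>q. F (transpose (n - Suc k) y \<circ> q)))"

lemma asx_eq:
  "k \<le> n \<Longrightarrow> (\<Sum>q | q \<in> stab n c \<and> (\<forall>x<n - k. q x = x). sign q * F q) = asx n k c F"
proof (induction k arbitrary: F)
  case 0
  have "{q. q \<in> stab n c \<and> (\<forall>x<n - 0. q x = x)} = {id}"
  proof -
    have "q = id" if "q \<in> stab n c" "\<forall>x<n. q x = x" for q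
      by (rule perms_eqI[OF stab_perms[OF that(1)] perms_id]) (use that in auto)
    then show ?thesis by auto
  qed
  then show ?case by (simp add: id_def)
next
  case (Suc k)
  define i where "i = n - Suc k"
  have i: "i < n" "n - k = Suc i" using Suc.prems by (auto simp: i_def)
  define Y where "Y = {y \<in> {i..<n}. c y = c i}"
  define S where "S j = {q. q \<in> stab n c \<and> (\<forall>x<j. q x = x)}" for j
  have tr: "transpose i y \<in> stab n c" if "y \<in> Y" for y
    using that i by (auto simp: Y_def stab_def permutes_swap_id transpose_def)
  have inv: "transpose i y \<circ> (transpose i y \<circ> q) = q" for y and q :: "nat \<Rightarrow> nat"
    by (simp add: fun_eq_iff)
  have fwd: "transpose i y \<circ> q \<in> S i" if y: "y \<in> Y" and q: "q \<in> S (Suc i)" for y q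
    using stab_comp[OF tr[OF y]] q y by (auto simp: S_def Y_def transpose_def)
  have q_i: "q i \<in> Y" if q: "q \<in> S i" for q
  proof -
    have "q i < n" using perms_less[OF stab_perms] q i by (auto simp: S_def)
    moreover have "\<not> q i < i"
    proof
      assume "q i < i"
      then have "q (q i) = q i" using q by (simp add: S_def)
      moreover have "inj q" by (rule permutes_inj[of q "{..<n}"]) (use q in \<open>simp add: S_def stab_def\<close>)
      ultimately have "q i = i" by (auto dest: injD)
      then show False using \<open>q i < i\<close> by simp
    qed
    moreover have "c (q i) = c i" using q i by (simp add: S_def stab_def)
    ultimately show ?thesis by (simp add: Y_def)
  qed
  have bwd: "transpose i (q i) \<circ> q \<in> S (Suc i)" if q: "q \<in> S i" for q
  proof -
    have "(transpose i (q i) \<circ> q) x = x" if x: "x < Suc i" for x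
    proof (cases "x = i")
      case False
      then have xi: "x < i" using x by simp
      then have "q x = x" using q by (simp add: S_def)
      moreover have "x \<noteq> q i" using q_i[OF q] xi by (auto simp: Y_def)
      ultimately show ?thesis using False by (simp add: transpose_def)
    qed simp
    moreover have "transpose i (q i) \<circ> q \<in> stab n c"
      using stab_comp[OF tr[OF q_i[OF q]]] q by (simp add: S_def)
    ultimately show ?thesis by (simp add: S_def)
  qed
  have "(\<Sum>q\<in>S i. sign q * F q) = (\<Sum>(y, q)\<in>Y \<times> S (Suc i). sign (transpose i y \<circ> q) * F (transpose i y \<circ> q))"
    unfolding case_prod_unfold
  proof (rule sum.reindex_bij_witness[of _ "\<lambda>p. transpose i (fst p) \<circ> snd p" "\<lambda>q. (q i, transpose i (q i) \<circ> q)"])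
    fix q assume q: "q \<in> S i"
    show "transpose i (fst (q i, transpose i (q i) \<circ> q)) \<circ> snd (q i, transpose i (q i) \<circ> q) = q"
      by (simp add: fun_eq_iff)
    show "(q i, transpose i (q i) \<circ> q) \<in> Y \<times> S (Suc i)" using q_i[OF q] bwd[OF q] by simp
    show "sign (transpose i (fst (q i, transpose i (q i) \<circ> q)) \<circ> snd (q i, transpose i (q i) \<circ> q)) *
      F (transpose i (fst (q i, transpose i (q i) \<circ> q)) \<circ> snd (q i, transpose i (q i) \<circ> q)) = sign q * F q"
      using inv[of "q i" q] by simp
  next
    fix p assume p: "p \<in> Y \<times> S (Suc i)"
    then have "snd p i = i" by (auto simp: S_def)
    then show "((transpose i (fst p) \<circ> snd p) i, transpose i ((transpose i (fst p) \<circ> snd p) i) \<circ> (transpose i (fst p) \<circ> snd p)) = p"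
      using inv[of "fst p" "snd p"] by (cases p) simp
    show "transpose i (fst p) \<circ> snd p \<in> S i" using fwd p by auto
  qed
  also have "\<dots> = (\<Sum>y\<in>Y. \<Sum>q\<in>S (Suc i). (if y = i then 1 else - 1) * (sign q * F (transpose i y \<circ> q)))"
    unfolding sum.cartesian_product
  proof (intro sum.cong refl, clarify)
    fix y q assume y: "y \<in> Y" and q: "q \<in> S (Suc i)"
    have "sign (transpose i y \<circ> q) = sign (transpose i y) * sign q"
      using sign_perms_comp[OF stab_perms[OF tr[OF y]] stab_perms] q by (auto simp: S_def)
    then show "sign (transpose i y \<circ> q) * F (transpose i y \<circ> q) = (if y = i then 1 else - 1) * (sign q * F (transpose i y \<circ> q))"
      by (auto simp: sign_swap_id)
  qed
  also have "\<dots> = (\<Sum>y\<in>Y. (if y = i then 1 else - 1) * asx n k c (\<lambda>q. F (transpose i y \<circ> q)))"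
  proof (rule sum.cong[OF refl])
    fix y
    have "(\<Sum>q\<in>S (Suc i). sign q * F (transpose i y \<circ> q)) = asx n k c (\<lambda>q. F (transpose i y \<circ> q))"
      using Suc.IH[of "\<lambda>q. F (transpose i y \<circ> q)"] Suc.prems unfolding S_def i(2) by simp
    then show "(\<Sum>q\<in>S (Suc i). (if y = i then 1 else - 1) * (sign q * F (transpose i y \<circ> q))) =
      (if y = i then 1 else - 1) * asx n k c (\<lambda>q. F (transpose i y \<circ> q))"
      by (simp only: sum_distrib_left[symmetric])
  qed
  also have "Y = set (filter (\<lambda>y. c y = c i) [i..<n])" by (auto simp: Y_def)
  also have "(\<Sum>y\<in>set (filter (\<lambda>y. c y = c i) [i..<n]). (if y = i then 1 else - 1) * asx n k c (\<lambda>q. F (transpose i y \<circ> q))) =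
     (\<Sum>y\<leftarrow>filter (\<lambda>y. c y = c i) [i..<n]. (if y = i then 1 else - 1) * asx n k c (\<lambda>q. F (transpose i y \<circ> q)))"
    by (rule sum_list_distinct_conv_sum_set[symmetric]) simp
  finally show ?case by (simp add: S_def i_def)
qed

lemma asx_stab: "(\<Sum>q\<in>stab n c. sign q * F q) = asx n n c F"
  using asx_eq[OF order_refl, where c = c and F = F] by simp

text \<open>
  The same sum for the indicator of \<open>\<forall>x. ok x (q x)\<close>: the value \<open>q i\<close> is already determined by the
  first transpositions, so that the recursion can be pruned.
\<close>

primrec asp :: "nat \<Rightarrow> nat \<Rightarrow> (nat \<Rightarrow> nat) \<Rightarrow> (nat \<Rightarrow> nat \<Rightarrow> bool) \<Rightarrow> (nat \<Rightarrow> nat) \<Rightarrow> int" where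
  "asp n 0 c ok g = 1"
| "asp n (Suc k) c ok g = (\<Sum>y\<leftarrow>filter (\<lambda>y. c y = c (n - Suc k) \<and> ok (n - Suc k) (g y)) [n - Suc k..<n].
     (if y = n - Suc k then 1 else -1) * asp n k c ok (g \<circ> transpose (n - Suc k) y))"

lemma asp_eq:
  "k \<le> n \<Longrightarrow> (\<Sum>q | q \<in> stab n c \<and> (\<forall>x<n - k. q x = x).
     sign q * (if \<forall>x\<in>{n - k..<n}. ok x (g (q x)) then 1 else 0)) = asp n k c ok g"
proof (induction k arbitrary: g)
  case 0
  show ?case using asx_eq[where k = 0 and n = n and c = c and F = "\<lambda>q. if \<forall>x\<in>{n - 0..<n}. ok x (g (q x)) then 1 else 0"] by simp
next
  case (Suc k)
  define i where "i = n - Suc k"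
  have i: "i < n" "n - k = Suc i" using Suc.prems by (auto simp: i_def)
  define F :: "(nat \<Rightarrow> nat) \<Rightarrow> int" where "F q = (if \<forall>x\<in>{i..<n}. ok x (g (q x)) then 1 else 0)" for q
  have step: "asx n k c (\<lambda>q. F (transpose i y \<circ> q)) = (if ok i (g y) then asp n k c ok (g \<circ> transpose i y) else 0)" for y
  proof -
    have "asx n k c (\<lambda>q. F (transpose i y \<circ> q)) =
      (\<Sum>q | q \<in> stab n c \<and> (\<forall>x<n - k. q x = x). sign q * F (transpose i y \<circ> q))"
      using asx_eq[where k = k and n = n and c = c and F = "\<lambda>q. F (transpose i y \<circ> q)"] Suc.prems by simp
    also have "\<dots> = (\<Sum>q | q \<in> stab n c \<and> (\<forall>x<n - k. q x = x). (if ok i (g y) then 1 else 0) *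
       (sign q * (if \<forall>x\<in>{n - k..<n}. ok x ((g \<circ> transpose i y) (q x)) then 1 else 0)))"
    proof (intro sum.cong refl)
      fix q assume "q \<in> {q. q \<in> stab n c \<and> (\<forall>x<n - k. q x = x)}"
      then have "q i = i" using i by simp
      then have "(\<forall>x\<in>{i..<n}. ok x (g ((transpose i y \<circ> q) x))) \<longleftrightarrow> ok i (g y) \<and> (\<forall>x\<in>{n - k..<n}. ok x ((g \<circ> transpose i y) (q x)))"
      proof -
        have "{i..<n} = insert i {n - k..<n}" using i by auto
        then show ?thesis using \<open>q i = i\<close> by simp
      qed
      then show "sign q * F (transpose i y \<circ> q) = (if ok i (g y) then 1 else 0) *
       (sign q * (if \<forall>x\<in>{n - k..<n}. ok x ((g \<circ> transpose i y) (q x)) then 1 else 0))"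
        unfolding F_def by auto
    qed
    also have "\<dots> = (if ok i (g y) then 1 else 0) * asp n k c ok (g \<circ> transpose i y)"
      using Suc.IH[of "g \<circ> transpose i y"] Suc.prems unfolding sum_distrib_left[symmetric] by (simp add: comp_def)
    finally show ?thesis by simp
  qed
  have fl: "(\<Sum>y\<leftarrow>filter P ys. a y * (if R y then b y else 0)) = (\<Sum>y\<leftarrow>filter (\<lambda>y. P y \<and> R y) ys. a y * b y)"
    for P R and ys :: "nat list" and a b :: "nat \<Rightarrow> int"
    by (induction ys) auto
  have "(\<Sum>q | q \<in> stab n c \<and> (\<forall>x<n - Suc k. q x = x). sign q * F q) = asx n (Suc k) c F"
    by (rule asx_eq[OF Suc.prems])
  also have "\<dots> = asp n (Suc k) c ok g"
    unfolding asx.simps asp.simps i_def[symmetric] step fl ..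
  finally show ?case unfolding F_def i_def .
qed

text \<open>At a 0/1 point every monomial is 0 or 1, so the innermost sum runs over an indicator and
  can be pruned by \<open>asp\<close>.\<close>

definition hwi :: "nat \<Rightarrow> nat list \<Rightarrow> nat list \<Rightarrow> nat list \<Rightarrow> nat list \<Rightarrow> nat list \<Rightarrow> nat list \<Rightarrow> (nat \<times> nat \<times> nat) list \<Rightarrow> int" where
  "hwi n r1 c1 r2 c2 r3 c3 vs = asx n n ((!) c1) (\<lambda>q1. asx n n ((!) c2) (\<lambda>q2.
     asp n n ((!) c3) (\<lambda>x k. (r1 ! q1 x, r2 ! q2 x, r3 ! k) \<in> set vs) id))"

definition supp_pt :: "(nat \<times> nat \<times> nat) list \<Rightarrow> nat \<times> nat \<times> nat \<Rightarrow> complex" where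
  "supp_pt vs = (\<lambda>v. if v \<in> set vs then 1 else 0)"

lemma hw_supp_pt:
  "hw n ((!) r1) ((!) c1) ((!) r2) ((!) c2) ((!) r3) ((!) c3) (supp_pt vs) = of_int (hwi n r1 c1 r2 c2 r3 c3 vs)"
proof -
  have pr: "(\<Prod>x<n. supp_pt vs (r1 ! q1 x, r2 ! q2 x, r3 ! q3 x)) =
    of_int (if \<forall>x\<in>{n - n..<n}. (r1 ! q1 x, r2 ! q2 x, r3 ! id (q3 x)) \<in> set vs then 1 else 0)" for q1 q2 q3 :: "nat \<Rightarrow> nat"
  proof (cases "\<forall>x<n. (r1 ! q1 x, r2 ! q2 x, r3 ! q3 x) \<in> set vs")
    case True
    then show ?thesis by (simp add: supp_pt_def)
  next
    case False
    then obtain x where "x < n" "(r1 ! q1 x, r2 ! q2 x, r3 ! q3 x) \<notin> set vs" by blast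
    then have "(\<Prod>x<n. supp_pt vs (r1 ! q1 x, r2 ! q2 x, r3 ! q3 x)) = 0"
      by (intro prod_zero) (auto simp: supp_pt_def)
    moreover have "\<not> (\<forall>x\<in>{n - n..<n}. (r1 ! q1 x, r2 ! q2 x, r3 ! id (q3 x)) \<in> set vs)"
      using False by auto
    ultimately show ?thesis by (simp only: if_False of_int_0)
  qed
  have st: "(\<Sum>q\<in>stab n c. of_int (sign q) * of_int (F q)) = (of_int (asx n n c F) :: complex)" for c and F :: "(nat \<Rightarrow> nat) \<Rightarrow> int"
    unfolding asx_stab[symmetric] by simp
  have st3: "(\<Sum>q\<in>stab n c. of_int (sign q) * of_int (if \<forall>x\<in>{n - n..<n}. ok x (id (q x)) then 1 else 0)) = (of_int (asp n n c ok id) :: complex)"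
    for c and ok :: "nat \<Rightarrow> nat \<Rightarrow> bool"
    unfolding asp_eq[OF order_refl, symmetric] by simp
  show ?thesis unfolding hw_def pr st3[where ok = "\<lambda>x k. (r1 ! _ x, r2 ! _ x, r3 ! k) \<in> set vs"] st hwi_def ..
qed

definition tchk :: "nat \<Rightarrow> nat list \<Rightarrow> nat list \<Rightarrow> nat list \<Rightarrow> bool" where
  "tchk n r c l \<longleftrightarrow> list_all (\<lambda>x. list_all (\<lambda>y. r ! x = r ! y \<and> c ! x = c ! y \<longrightarrow> x = y) [0..<n]) [0..<n] \<and>
     list_all (\<lambda>x. list_all (\<lambda>i. list_ex (\<lambda>y. c ! y = c ! x \<and> r ! y = i) [0..<n]) [0..<r ! x]) [0..<n] \<and>
     list_all (\<lambda>x. r ! x < length l) [0..<n] \<and>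
     list_all (\<lambda>i. length (filter (\<lambda>x. r ! x = i) [0..<n]) = l ! i) [0..<length l]"

lemma tchk_tab:
  assumes "tchk n r c l"
  shows "tab n ((!) r) ((!) c) (rl l)"
  unfolding tab_def
proof (intro conjI)
  show "\<forall>x<n. \<forall>y<n. r ! x = r ! y \<longrightarrow> c ! x = c ! y \<longrightarrow> x = y"
    using assms by (auto simp: tchk_def list_all_iff)
  show "\<forall>x<n. \<forall>i<r ! x. \<exists>y<n. c ! y = c ! x \<and> r ! y = i"
  proof (intro allI impI)
    fix x i assume "x < n" "i < r ! x"
    then have "list_ex (\<lambda>y. c ! y = c ! x \<and> r ! y = i) [0..<n]"
      using assms by (simp add: tchk_def list_all_iff)
    then show "\<exists>y<n. c ! y = c ! x \<and> r ! y = i" by (auto simp: list_ex_iff)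
  qed
  show "\<forall>i. card {x. x < n \<and> r ! x = i} = rl l i"
  proof
    fix i
    show "card {x. x < n \<and> r ! x = i} = rl l i"
    proof (cases "i < length l")
      case True
      have "{x. x < n \<and> r ! x = i} = set (filter (\<lambda>x. r ! x = i) [0..<n])" by auto
      then have "card {x. x < n \<and> r ! x = i} = length (filter (\<lambda>x. r ! x = i) [0..<n])"
        using distinct_card[of "filter (\<lambda>x. r ! x = i) [0..<n]"] by simp
      then show ?thesis using assms True by (auto simp: tchk_def list_all_iff rl_def)
    next
      case False
      have "{x. x < n \<and> r ! x = i} = {}" using assms False by (auto simp: tchk_def list_all_iff)
      then show ?thesis using False by (simp add: rl_def)
    qed
  qed
qed

text \<open>
  \<open>NZ\<close>: some highest weight polynomial is not identically zero on the coordinate subspace \<open>X = 0\<close> on \<open>S\<close>.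
  \<open>VZ\<close>: some nonzero one vanishes there. Together they exhibit two independent polynomials.
\<close>

definition NZ where
  "NZ n f1 f2 f3 S \<longleftrightarrow> pt n f1 \<and> pt n f2 \<and> pt n f3 \<and> (\<exists>F\<in>W n f1 f2 f3. \<exists>X. F X \<noteq> 0 \<and> (\<forall>v\<in>S. X v = 0))"

definition VZ where
  "VZ n f1 f2 f3 S \<longleftrightarrow> pt n f1 \<and> pt n f2 \<and> pt n f3 \<and>
     (\<exists>F\<in>W n f1 f2 f3. (\<exists>X. F X \<noteq> 0) \<and> (\<forall>X. (\<forall>v\<in>S. X v = 0) \<longrightarrow> F X = 0))"

text \<open>Both witnesses lie in the coordinate subspace, hence so does the common nonzero point
  supplied by \<open>pol_common_nonzero\<close>.\<close>

lemma NZ_mult: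
  assumes "NZ n f1 f2 f3 S" "NZ m h1 h2 h3 S"
  shows "NZ (n + m) (\<lambda>i. f1 i + h1 i) (\<lambda>i. f2 i + h2 i) (\<lambda>i. f3 i + h3 i) S"
proof -
  obtain F X where F: "F \<in> W n f1 f2 f3" "F X \<noteq> 0" "\<forall>v\<in>S. X v = 0" using assms(1) by (auto simp: NZ_def)
  obtain H Y where H: "H \<in> W m h1 h2 h3" "H Y \<noteq> 0" "\<forall>v\<in>S. Y v = 0" using assms(2) by (auto simp: NZ_def)
  obtain U where "F U * H U \<noteq> 0" "\<forall>v. X v = 0 \<and> Y v = 0 \<longrightarrow> U v = 0"
    using pol_common_nonzero[OF pol_W[OF F(1)] F(2) pol_W[OF H(1)] H(2)] by blast
  then show ?thesis
    using assms F(3) H(3) W_mult[OF F(1) H(1)] unfolding NZ_def by (auto intro!: pt_add bexI[rotated])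
qed

text \<open>A product vanishes on the subspace as soon as one factor does; the other is only asked
  to be nonzero somewhere, hence the empty set.\<close>

lemma VZ_mult:
  assumes "VZ n f1 f2 f3 S" "NZ m h1 h2 h3 {}"
  shows "VZ (n + m) (\<lambda>i. f1 i + h1 i) (\<lambda>i. f2 i + h2 i) (\<lambda>i. f3 i + h3 i) S"
proof -
  obtain F X where F: "F \<in> W n f1 f2 f3" "F X \<noteq> 0" "\<And>X. (\<forall>v\<in>S. X v = 0) \<Longrightarrow> F X = 0" using assms(1) by (auto simp: VZ_def)
  obtain H Y where H: "H \<in> W m h1 h2 h3" "H Y \<noteq> 0" using assms(2) by (auto simp: NZ_def)
  obtain U where U: "F U * H U \<noteq> 0"
    using pol_common_nonzero[OF pol_W[OF F(1)] F(2) pol_W[OF H(1)] H(2)] by blast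
  have "\<exists>F\<in>W (n + m) (\<lambda>i. f1 i + h1 i) (\<lambda>i. f2 i + h2 i) (\<lambda>i. f3 i + h3 i). (\<exists>X. F X \<noteq> 0) \<and> (\<forall>X. (\<forall>v\<in>S. X v = 0) \<longrightarrow> F X = 0)"
    by (rule bexI[OF _ W_mult[OF F(1) H(1)]]) (use U F(3) in auto)
  then show ?thesis using assms by (auto simp: VZ_def NZ_def intro!: pt_add)
qed

lemma NZ_VZ_kr: "NZ n f1 f2 f3 S \<Longrightarrow> VZ n f1 f2 f3 S \<Longrightarrow> kr n f1 f2 f3 \<ge> 2"
  unfolding NZ_def VZ_def using kr_ge_2I by blast

lemma NZ_kr: "NZ n f1 f2 f3 S \<Longrightarrow> kr n f1 f2 f3 \<ge> 1"
  using kr_pos_iff unfolding NZ_def by blast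

lemma NZ_subset: "NZ n f1 f2 f3 S \<Longrightarrow> T \<subseteq> S \<Longrightarrow> NZ n f1 f2 f3 T"
  unfolding NZ_def by blast

lemma hw_in_W:
  assumes "tab n r1 c1 f1" "tab n r2 c2 f2" "tab n r3 c3 f3"
  shows "hw n r1 c1 r2 c2 r3 c3 \<in> W n f1 f2 f3"
  unfolding W_def by (rule fs.span_base) (use assms in \<open>unfold hws_def, blast\<close>)

lemma NZ_eval:
  assumes t: "tchk n r1 c1 l1" "tchk n r2 c2 l2" "tchk n r3 c3 l3"
    and nz: "hwi n r1 c1 r2 c2 r3 c3 vs \<noteq> 0" and S: "list_all (\<lambda>v. v \<notin> set vs) S"
  shows "NZ n (rl l1) (rl l2) (rl l3) (set S)"
  unfolding NZ_def
proof (intro conjI bexI[OF _ hw_in_W[OF tchk_tab[OF t(1)] tchk_tab[OF t(2)] tchk_tab[OF t(3)]]] exI[of _ "supp_pt vs"] tab_pt[OF tchk_tab[OF t(1)]]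
    tab_pt[OF tchk_tab[OF t(2)]] tab_pt[OF tchk_tab[OF t(3)]])
  show "hw n ((!) r1) ((!) c1) ((!) r2) ((!) c2) ((!) r3) ((!) c3) (supp_pt vs) \<noteq> 0"
    unfolding hw_supp_pt using nz by simp
  show "\<forall>v\<in>set S. supp_pt vs v = 0" using S by (auto simp: supp_pt_def list_all_iff)
qed

text \<open>The first permutation hits the entry x somewhere, so every monomial contains a variable
  whose first index is \<open>r1 x\<close>.\<close>

lemma hw_vanish:
  assumes x: "x < n" and X: "\<And>a b. a < n \<Longrightarrow> b < n \<Longrightarrow> X (r1 x, r2 a, r3 b) = 0"
  shows "hw n r1 c1 r2 c2 r3 c3 X = 0"
proof -
  have "(\<Prod>y<n. X (r1 (q1 y), r2 (q2 y), r3 (q3 y))) = 0"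
    if "q1 \<in> stab n c1" "q2 \<in> stab n c2" "q3 \<in> stab n c3" for q1 q2 q3
  proof (rule prod_zero)
    have y: "inv q1 x < n" using perms_less[OF perms_inv[OF stab_perms[OF that(1)]]] x by simp
    have "q1 (inv q1 x) = x" using stab_perms[OF that(1)] by (simp add: permutes_inverses)
    then show "\<exists>y\<in>{..<n}. X (r1 (q1 y), r2 (q2 y), r3 (q3 y)) = 0"
      using y X perms_less[OF stab_perms[OF that(2)]] perms_less[OF stab_perms[OF that(3)]]
      by (intro bexI[of _ "inv q1 x"]) auto
  qed simp
  then show ?thesis
    unfolding hw_def by (intro sum.neutral ballI) (simp add: sum.neutral del: prod_zero_iff)
qed

lemma VZ_eval:
  assumes t: "tchk n r1 c1 l1" "tchk n r2 c2 l2" "tchk n r3 c3 l3"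
    and nz: "hwi n r1 c1 r2 c2 r3 c3 vs \<noteq> 0"
    and S: "x < n" "list_all (\<lambda>a. list_all (\<lambda>b. (r1 ! x, r2 ! a, r3 ! b) \<in> set S) [0..<n]) [0..<n]"
  shows "VZ n (rl l1) (rl l2) (rl l3) (set S)"
  unfolding VZ_def
proof (intro conjI bexI[OF _ hw_in_W[OF tchk_tab[OF t(1)] tchk_tab[OF t(2)] tchk_tab[OF t(3)]]] allI impI tab_pt[OF tchk_tab[OF t(1)]]
    tab_pt[OF tchk_tab[OF t(2)]] tab_pt[OF tchk_tab[OF t(3)]])
  show "\<exists>X. hw n ((!) r1) ((!) c1) ((!) r2) ((!) c2) ((!) r3) ((!) c3) X \<noteq> 0"
    by (rule exI[of _ "supp_pt vs"]) (unfold hw_supp_pt, use nz in simp)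
  fix X :: "nat \<times> nat \<times> nat \<Rightarrow> complex" assume X: "\<forall>v\<in>set S. X v = 0"
  show "hw n ((!) r1) ((!) c1) ((!) r2) ((!) c2) ((!) r3) ((!) c3) X = 0"
    by (rule hw_vanish[OF S(1)]) (use S(2) X in \<open>auto simp: list_all_iff\<close>)
qed

subsection \<open>Products with a multiplicity two\<close>

lemma rl_Nil [simp]: "rl [] = (\<lambda>_. 0)"
  by (simp add: rl_def fun_eq_iff)

lemma rl_Cons: "rl (a # l) i = (case i of 0 \<Rightarrow> a | Suc j \<Rightarrow> rl l j)"
  by (cases i) (auto simp: rl_def)

text \<open>
  The tableaux and the support of the evaluation point in the following lemmas were found by a computer
  search. The products are \<open>X\<^sub>0\<^sub>0\<^sub>0\<^sup>2 D\<close> (\<open>D\<close> the hyperdeterminant) against three \<open>2\<times>2\<close> minors for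
  \<open>(4,2)\<close>, \<open>X\<^sub>0\<^sub>0\<^sub>0 H\<close> against a single polynomial for \<open>(3,1,1)\<close>, and \<open>M\<^sup>2 M' G\<close> (\<open>M\<close>, \<open>M'\<close> minors)
  against \<open>E\<^sup>2 D\<close> for \<open>(6,6)\<close>.
\<close>

abbreviation Z0 :: "(nat \<times> nat \<times> nat) set" where "Z0 \<equiv> set [(0,0,0)]"
abbreviation Z1 :: "(nat \<times> nat \<times> nat) set" where "Z1 \<equiv> set [(0,0,0), (0,0,1)]"

lemma piece_X000: "VZ 1 (rl [1]) (rl [1]) (rl [1]) Z0"
  by (rule VZ_eval[of 1 "[0]" "[0]" _ "[0]" "[0]" _ "[0]" "[0]" _ "[(0,0,0)]" 0]) code_simp+

lemma piece_X000': "NZ 1 (rl [1]) (rl [1]) (rl [1]) (set [])"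
  by (rule NZ_eval[of 1 "[0]" "[0]" _ "[0]" "[0]" _ "[0]" "[0]" _ "[(0,0,0)]"]) code_simp+

lemma piece_minor1: "NZ 2 (rl [2]) (rl [1,1]) (rl [1,1]) Z0"
  by (rule NZ_eval[of 2 "[0,0]" "[0,1]" _ "[0,1]" "[0,0]" _ "[0,1]" "[0,0]" _ "[(0,0,1),(0,1,0)]"]) code_simp+

lemma piece_minor2: "NZ 2 (rl [1,1]) (rl [2]) (rl [1,1]) Z0"
  by (rule NZ_eval[of 2 "[0,1]" "[0,0]" _ "[0,0]" "[0,1]" _ "[0,1]" "[0,0]" _ "[(0,0,1),(1,0,0)]"]) code_simp+

lemma piece_minor3: "NZ 2 (rl [1,1]) (rl [1,1]) (rl [2]) Z0"
  by (rule NZ_eval[of 2 "[0,1]" "[0,0]" _ "[0,1]" "[0,0]" _ "[0,0]" "[0,1]" _ "[(0,1,0),(1,0,0)]"]) code_simp+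

text \<open>The second shape is a single row, so the variables with first index 0 that can occur are
  exactly those of \<open>Z1\<close>, and \<open>hw_vanish\<close> applies.\<close>

lemma piece_minor2_vanish: "VZ 2 (rl [1,1]) (rl [2]) (rl [1,1]) Z1"
  by (rule VZ_eval[of 2 "[0,1]" "[0,0]" _ "[0,0]" "[0,1]" _ "[0,1]" "[0,0]" _ "[(0,0,1),(1,0,0)]" 0]) code_simp+

lemma piece_disc: "NZ 4 (rl [2,2]) (rl [2,2]) (rl [2,2]) Z1"
  by (rule NZ_eval[of 4 "[0,1,0,1]" "[1,0,0,1]" _ "[0,0,1,1]" "[0,1,0,1]" _ "[1,0,1,0]" "[1,0,0,1]" _ "[(0,1,1),(1,0,0)]"]) code_simp+

lemma piece_E2: "NZ 4 (rl [2,2]) (rl [3,1]) (rl [2,1,1]) Z1"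
  by (rule NZ_eval[of 4 "[0,1,1,0]" "[0,0,1,1]" _ "[0,1,0,0]" "[2,0,0,1]" _ "[2,0,0,1]" "[0,0,1,0]" _ "[(0,0,2),(0,1,1),(1,0,0)]"]) code_simp+

lemma piece_H4: "NZ 4 (rl [2,1,1]) (rl [2,2]) (rl [2,1,1]) (set [])"
  by (rule NZ_eval[of 4 "[0,1,2,0]" "[1,0,0,0]" _ "[1,1,0,0]" "[0,1,1,0]" _ "[1,0,2,0]" "[0,1,0,0]" _ "[(0,0,0),(1,1,1),(2,1,2)]"]) code_simp+

lemma piece_fa: "NZ 5 (rl [3,1,1]) (rl [3,2]) (rl [3,1,1]) Z0"
  by (rule NZ_eval[of 5 "[1,0,2,0,0]" "[0,1,0,2,0]" _ "[1,0,0,0,1]" "[1,2,0,1,0]" _ "[0,2,0,1,0]" "[0,0,1,0,2]" _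
    "[(0,0,1),(0,1,0),(1,0,2),(2,0,0)]"]) code_simp+

lemma piece_G6: "NZ 6 (rl [3,3]) (rl [3,3]) (rl [2,2,2]) (set [])"
  by (rule NZ_eval[of 6 "[0,0,0,1,1,1]" "[0,1,2,0,1,2]" _ "[0,0,0,1,1,1]" "[0,1,2,0,1,2]" _ "[0,1,2,0,1,2]" "[0,0,0,1,1,1]" _
    "[(0,0,0),(1,1,1),(0,1,2),(1,0,2)]"]) code_simp+

lemma base_42: "kr 6 (rl [4,2]) (rl [4,2]) (rl [4,2]) \<ge> 2"
proof (rule NZ_VZ_kr)
  have e: "(\<lambda>i. rl [1] i + rl [1] i + rl [2,2] i) = rl [4,2]"
    "(\<lambda>i. rl [2] i + rl [1,1] i + rl [1,1] i) = rl [4,2]"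
    "(\<lambda>i. rl [1,1] i + rl [2] i + rl [1,1] i) = rl [4,2]"
    "(\<lambda>i. rl [1,1] i + rl [1,1] i + rl [2] i) = rl [4,2]"
    by (auto simp: fun_eq_iff rl_Cons split: nat.splits)
  have "VZ (1 + 1 + 4) (rl [4,2]) (rl [4,2]) (rl [4,2]) Z0"
    using VZ_mult[OF VZ_mult[OF piece_X000 piece_X000'[unfolded list.set]] NZ_subset[OF piece_disc, of "{}"]] unfolding e by simp
  then show "VZ 6 (rl [4,2]) (rl [4,2]) (rl [4,2]) Z0" by simp
  have "NZ (2 + 2 + 2) (rl [4,2]) (rl [4,2]) (rl [4,2]) Z0"
    using NZ_mult[OF NZ_mult[OF piece_minor1 piece_minor2] piece_minor3] unfolding e .
  then show "NZ 6 (rl [4,2]) (rl [4,2]) (rl [4,2]) Z0" by simp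
qed

lemma base_311: "kr 5 (rl [3,1,1]) (rl [3,2]) (rl [3,1,1]) \<ge> 2"
proof (rule NZ_VZ_kr[OF piece_fa])
  have e: "(\<lambda>i. rl [1] i + rl [2,1,1] i) = rl [3,1,1]" "(\<lambda>i. rl [1] i + rl [2,2] i) = rl [3,2]"
    by (auto simp: fun_eq_iff rl_Cons split: nat.splits)
  have "VZ (1 + 4) (rl [3,1,1]) (rl [3,2]) (rl [3,1,1]) Z0"
    using VZ_mult[OF piece_X000 piece_H4[unfolded list.set]] unfolding e .
  then show "VZ 5 (rl [3,1,1]) (rl [3,2]) (rl [3,1,1]) Z0" by simp
qed

lemma base_66: "kr 12 (rl [6,6]) (rl [8,4]) (rl [6,4,2]) \<ge> 2"
proof (rule NZ_VZ_kr)
  have e: "(\<lambda>i. rl [1,1] i + rl [1,1] i + rl [1,1] i + rl [3,3] i) = rl [6,6]"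
    "(\<lambda>i. rl [2] i + rl [2] i + rl [1,1] i + rl [3,3] i) = rl [8,4]"
    "(\<lambda>i. rl [1,1] i + rl [1,1] i + rl [2] i + rl [2,2,2] i) = rl [6,4,2]"
    "(\<lambda>i. rl [2,2] i + rl [2,2] i + rl [2,2] i) = rl [6,6]"
    "(\<lambda>i. rl [3,1] i + rl [3,1] i + rl [2,2] i) = rl [8,4]"
    "(\<lambda>i. rl [2,1,1] i + rl [2,1,1] i + rl [2,2] i) = rl [6,4,2]"
    by (auto simp: fun_eq_iff rl_Cons split: nat.splits)
  have "VZ (2 + 2 + 2 + 6) (rl [6,6]) (rl [8,4]) (rl [6,4,2]) Z1"
    using VZ_mult[OF VZ_mult[OF VZ_mult[OF piece_minor2_vanish NZ_subset[OF piece_minor2 empty_subsetI]]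
      NZ_subset[OF piece_minor3 empty_subsetI]] piece_G6[unfolded list.set]] unfolding e .
  then show "VZ 12 (rl [6,6]) (rl [8,4]) (rl [6,4,2]) Z1" by simp
  have "NZ (4 + 4 + 4) (rl [6,6]) (rl [8,4]) (rl [6,4,2]) Z1"
    using NZ_mult[OF NZ_mult[OF piece_E2 piece_E2] piece_disc] unfolding e .
  then show "NZ 12 (rl [6,6]) (rl [8,4]) (rl [6,4,2]) Z1" by simp
qed

section \<open>Products with a two-row character that are not multiplicity free\<close>

definition repeated :: "nat \<Rightarrow> nat \<Rightarrow> (nat \<Rightarrow> nat) \<Rightarrow> bool" where
  "repeated p n f \<longleftrightarrow> pt n f \<and> 2 * p \<le> n \<and> (\<exists>h. pt n h \<and> kr n f (rl [n - p, p]) h \<ge> 2)"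

lemma pt_sorted:
  assumes "sorted_wrt (\<ge>) l"
  shows "pt (sum_list l) (rl l)"
  unfolding pt_def
proof (intro conjI exI[of _ "length l"])
  show "antimono (rl l)"
  proof (rule antimonoI)
    fix i j :: nat assume "i \<le> j"
    then show "rl l j \<le> rl l i"
      using sorted_wrt_nth_less[OF assms, of i j] by (cases "i = j") (auto simp: rl_def)
  qed
  show "(\<Sum>i<length l. rl l i) = sum_list l" by (rule sum_list_rl[symmetric])
qed (simp add: rl_def)

lemma pt_two: "2 * p \<le> n \<Longrightarrow> pt n (rl [n - p, p])"
  using pt_sorted[of "[n - p, p]"] by simp

lemma repeated_add:
  assumes G: "repeated p n f" and g: "pt m g" "pt m h" "2 * s \<le> m" and k: "kr m g (rl [m - s, s]) h \<ge> 1"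
  shows "repeated (p + s) (n + m) (\<lambda>i. f i + g i)"
proof -
  obtain h0 where h0: "pt n h0" "kr n f (rl [n - p, p]) h0 \<ge> 2" and f: "pt n f" "2 * p \<le> n"
    using G by (auto simp: repeated_def)
  \<comment> \<open>Two-row shapes add up to two-row shapes; \<open>2 * p \<le> n\<close> and
    \<open>2 * s \<le> m\<close> keep the subtractions from truncating.\<close>
  have e: "(\<lambda>i. rl [n - p, p] i + rl [m - s, s] i) = rl [n + m - (p + s), p + s]"
    using f(2) g(3) by (auto simp: fun_eq_iff rl_Cons split: nat.splits)
  have "kr n f (rl [n - p, p]) h0 \<le> kr (n + m) (\<lambda>i. f i + g i) (\<lambda>i. rl [n - p, p] i + rl [m - s, s] i) (\<lambda>i. h0 i + h i)"
    by (rule kr_add[OF f(1) pt_two[OF f(2)] h0(1) g(1) pt_two[OF g(3)] g(2) k])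
  then have "kr (n + m) (\<lambda>i. f i + g i) (rl [n + m - (p + s), p + s]) (\<lambda>i. h0 i + h i) \<ge> 2"
    unfolding e using h0(2) by simp
  then show ?thesis
    unfolding repeated_def using pt_add[OF f(1) g(1)] pt_add[OF h0(1) g(2)] f(2) g(3) by auto
qed

definition colf :: "nat \<Rightarrow> nat \<Rightarrow> nat" where
  "colf k = (\<lambda>i. if i < k then 1 else 0)"

lemma pt_colf: "pt k (colf k)"
  unfolding pt_def by (intro conjI antimonoI exI[of _ k]) (auto simp: colf_def)

lemma rl_onerow: "rl [k, 0] = onerow k" "rl [k] = onerow k"
  by (auto simp: fun_eq_iff onerow_def rl_Cons split: nat.splits)

text \<open>A column added to the first shape is paired with a single row in the second and the same
  column in the third. That triple has coefficient 1 and leaves p unchanged.\<close>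

lemma repeated_col: "repeated p n f \<Longrightarrow> repeated p (n + k) (\<lambda>i. f i + colf k i)"
  using repeated_add[of p n f k "colf k" "colf k" 0] pt_colf kr_onerow[OF pt_colf] by (simp add: rl_onerow)

text \<open>The added triple is (2), (1,1), (1,1) with coefficient 1; its second shape raises p by
  one.\<close>

lemma repeated_row2: "repeated p n f \<Longrightarrow> repeated (Suc p) (n + 2) (\<lambda>i. f i + rl [2] i)"
proof -
  assume G: "repeated p n f"
  have p: "pt 2 (rl [1,1])" "pt 2 (rl [2])" using pt_sorted[of "[1,1]"] pt_sorted[of "[2]"] by (simp_all add: numeral_2_eq_2)
  have "kr 2 (rl [2]) (rl [1,1]) (rl [1,1]) = kr 2 (rl [1,1]) (rl [2]) (rl [1,1])"
    by (rule kr_swap12[OF p(2) p(1) p(1)])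
  also have "\<dots> = 1" unfolding rl_onerow by (rule kr_onerow[OF p(1)])
  finally have "kr 2 (rl [2]) (rl [2 - 1, 1]) (rl [1,1]) \<ge> 1" by simp
  then show ?thesis using repeated_add[OF G p(2) p(1), of 1] by simp
qed

text \<open>The added triple is (2,2), (3,1), (2,1,1), positive by \<open>piece_E2\<close>; its
  second shape raises p by one.\<close>

lemma repeated_square2: "repeated p n f \<Longrightarrow> repeated (Suc p) (n + 4) (\<lambda>i. f i + rl [2,2] i)"
proof -
  assume G: "repeated p n f"
  have p: "pt 4 (rl [2,2])" "pt 4 (rl [2,1,1])" using piece_E2 by (auto simp: NZ_def)
  have "kr 4 (rl [2,2]) (rl [4 - 1, 1]) (rl [2,1,1]) \<ge> 1" using NZ_kr[OF piece_E2] by simp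
  then show ?thesis using repeated_add[OF G p, of 1] by simp
qed

lemma repeated_conj: "repeated p n f \<Longrightarrow> repeated p n (conjf f)"
proof -
  assume "repeated p n f"
  then obtain h where h: "pt n h" "kr n f (rl [n - p, p]) h \<ge> 2" and f: "pt n f" "2 * p \<le> n" by (auto simp: repeated_def)
  have "kr n (conjf f) (rl [n - p, p]) (conjf h) \<ge> 2" using kr_conj[OF f(1) pt_two[OF f(2)] h(1)] h(2) by simp
  then show ?thesis using pt_conjf[OF f(1)] pt_conjf[OF h(1)] f(2) by (auto simp: repeated_def)
qed

section \<open>Reduction to the first rows\<close>

definition trunc :: "nat \<Rightarrow> (nat \<Rightarrow> nat) \<Rightarrow> nat \<Rightarrow> nat" where
  "trunc k f = (\<lambda>i. if i < k then f i else 0)"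

lemma pt_trunc:
  assumes "antimono f"
  shows "pt (\<Sum>i<k. f i) (trunc k f)"
  unfolding pt_def
proof (intro conjI exI[of _ k])
  show "antimono (trunc k f)"
  proof (rule antimonoI)
    fix i j :: nat assume "i \<le> j"
    then show "trunc k f j \<le> trunc k f i" using antimonoD[OF assms \<open>i \<le> j\<close>] by (simp add: trunc_def)
  qed
qed (auto simp: trunc_def)

lemma conjf_trunc_Suc: "conjf (trunc (Suc k) f) = (\<lambda>j. conjf (trunc k f) j + colf (f k) j)"
proof
  fix j
  have fin: "finite {i. j < trunc k f i}" by (rule finite_subset[of _ "{..<k}"]) (auto simp: trunc_def split: if_splits)
  have nk: "k \<notin> {i. j < trunc k f i}" by (simp add: trunc_def)
  show "conjf (trunc (Suc k) f) j = conjf (trunc k f) j + colf (f k) j"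
  proof (cases "j < f k")
    case True
    then have "{i. j < trunc (Suc k) f i} = insert k {i. j < trunc k f i}" by (auto simp: trunc_def less_Suc_eq split: if_splits)
    then show ?thesis using fin nk True by (simp add: conjf_def colf_def)
  next
    case False
    then have "{i. j < trunc (Suc k) f i} = {i. j < trunc k f i}" by (auto simp: trunc_def less_Suc_eq split: if_splits)
    then show ?thesis using False by (simp add: conjf_def colf_def)
  qed
qed

text \<open>A further row is a further column of the conjugate: conjugate, apply
  \<open>repeated_col\<close>, conjugate back. So the starting shapes have to match only the first
  rows of f.\<close>

lemma repeated_rows:
  assumes f: "pt n f" and G: "repeated p (\<Sum>i<k. f i) (trunc k f)"
  shows "repeated p n f"
proof -
  have anti: "antimono f" using f by (simp add: pt_def)
  have "repeated p (\<Sum>i<k + d. f i) (trunc (k + d) f)" for d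
  proof (induction d)
    case (Suc d)
    define m where "m = k + d"
    have "repeated p (\<Sum>i<m. f i) (conjf (trunc m f))" using repeated_conj Suc by (simp add: m_def)
    then have "repeated p ((\<Sum>i<m. f i) + f m) (conjf (trunc (Suc m) f))"
      unfolding conjf_trunc_Suc by (rule repeated_col)
    then have "repeated p (\<Sum>i<Suc m. f i) (conjf (conjf (trunc (Suc m) f)))" using repeated_conj by simp
    then have "repeated p (\<Sum>i<Suc m. f i) (trunc (Suc m) f)" unfolding conjf_conjf[OF pt_trunc[OF anti]] .
    then show ?case by (simp only: m_def add_Suc_right)
  qed (use G in simp)
  moreover obtain N where N: "\<forall>i\<ge>N. f i = 0" "(\<Sum>i<N. f i) = n" using f by (auto simp: pt_def)
  moreover have "(\<Sum>i<k + N. f i) = n"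
    unfolding N(2)[symmetric] by (rule sum.mono_neutral_right) (use N(1) in auto)
  moreover have "trunc (k + N) f = f" using N(1) by (auto simp: trunc_def fun_eq_iff)
  ultimately show ?thesis by metis
qed

lemma repeated_cols: "repeated p n f \<Longrightarrow> repeated p (n + d * k) (\<lambda>i. f i + d * colf k i)"
proof (induction d)
  case (Suc d)
  then have "repeated p (n + d * k + k) (\<lambda>i. f i + d * colf k i + colf k i)" by (intro repeated_col) simp
  then show ?case by (simp add: algebra_simps)
qed simp

lemma repeated_rows2: "repeated p n f \<Longrightarrow> repeated (p + d) (n + 2 * d) (\<lambda>i. f i + d * rl [2] i)"
proof (induction d)
  case (Suc d)
  then have "repeated (Suc (p + d)) (n + 2 * d + 2) (\<lambda>i. f i + d * rl [2] i + rl [2] i)" by (intro repeated_row2) simp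
  then show ?case by (simp add: algebra_simps)
qed simp

lemma repeated_squares2: "repeated p n f \<Longrightarrow> repeated (p + d) (n + 4 * d) (\<lambda>i. f i + d * rl [2,2] i)"
proof (induction d)
  case (Suc d)
  then have "repeated (Suc (p + d)) (n + 4 * d + 4) (\<lambda>i. f i + d * rl [2,2] i + rl [2,2] i)" by (intro repeated_square2) simp
  then show ?case by (simp add: algebra_simps)
qed simp

lemma repeated_base:
  "repeated 2 6 (rl [4,2])" "repeated 2 5 (rl [3,1,1])" "repeated 4 12 (rl [6,6])"
proof -
  have p: "pt 6 (rl [4,2])" "pt 5 (rl [3,1,1])" "pt 12 (rl [6,6])" "pt 12 (rl [6,4,2])"
    using pt_sorted[of "[4,2]"] pt_sorted[of "[3,1,1]"] pt_sorted[of "[6,6]"] pt_sorted[of "[6,4,2]"] by simp_all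
  show "repeated 2 6 (rl [4,2])" unfolding repeated_def using p base_42 by auto
  show "repeated 2 5 (rl [3,1,1])" unfolding repeated_def using p base_311 by auto
  show "repeated 4 12 (rl [6,6])" unfolding repeated_def using p base_66 by auto
qed

lemma sum_lessThan_2: "(\<Sum>i<2::nat. f i) = f 0 + (f 1 :: nat)"
  by (simp add: numeral_2_eq_2)

lemma sum_lessThan_3: "(\<Sum>i<3::nat. f i) = f 0 + f 1 + (f 2 :: nat)"
  by (simp add: numeral_3_eq_3 numeral_2_eq_2)

lemma trunc_2I:
  assumes "g 0 = f 0" "g 1 = f 1" "\<And>i. i \<ge> 2 \<Longrightarrow> g i = 0"
  shows "g = trunc 2 f"
proof
  fix i :: nat
  consider "i = 0" | "i = 1" | "i \<ge> 2" by linarith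
  then show "g i = trunc 2 f i" by cases (use assms in \<open>auto simp: trunc_def\<close>)
qed

lemma trunc_3I:
  assumes "g 0 = f 0" "g 1 = f 1" "g 2 = f 2" "\<And>i. i \<ge> 3 \<Longrightarrow> g i = 0"
  shows "g = trunc 3 f"
proof
  fix i :: nat
  consider "i = 0" | "i = 1" | "i = 2" | "i \<ge> 3" by linarith
  then show "g i = trunc 3 f i" by cases (use assms in \<open>auto simp: trunc_def\<close>)
qed

text \<open>The first two rows are (6,6), p - 4 squares (2,2), and columns of height 2 and 1. Before
  the columns the second row has 6 + 2(p - 4) = 2p - 2 cells.\<close>

lemma repeated_rectangle:
  assumes f: "pt n f" and p: "p \<ge> 4" and f1: "f 1 \<ge> 2 * p - 2"
  shows "repeated p n f"
proof (rule repeated_rows[OF f, of p 2])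
  have anti: "f 1 \<le> f 0" using f by (auto simp: pt_def dest: antimonoD[of f 0 1])
  obtain d where d: "p = 4 + d" using p le_Suc_ex by blast
  obtain u where u: "f 1 = 6 + 2 * d + u" using f1 d le_Suc_ex[of "6 + 2 * d" "f 1"] by auto
  obtain v where v: "f 0 = f 1 + v" using anti le_Suc_ex by blast
  have "repeated (4 + d) (12 + 4 * d + u * 2 + v * 1)
     (\<lambda>i. rl [6,6] i + d * rl [2,2] i + u * colf 2 i + v * colf 1 i)"
    by (intro repeated_cols repeated_squares2 repeated_base)
  moreover have "(\<lambda>i. rl [6,6] i + d * rl [2,2] i + u * colf 2 i + v * colf 1 i) = trunc 2 f"
    by (rule trunc_2I) (use u v in \<open>auto simp: rl_def colf_def\<close>)
  moreover have "12 + 4 * d + u * 2 + v * 1 = (\<Sum>i<2. f i)" unfolding sum_lessThan_2 using u v by simp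
  ultimately show "repeated p (\<Sum>i<2. f i) (trunc 2 f)" using d by metis
qed

text \<open>Start from (3,1,1) if there is a third row and from (4,2) otherwise, both with p = 2 and
  a gap of 2 between the first two rows. Then p - 2 copies of (2) bring the gap to 2p - 2, and
  columns supply the rest.\<close>

lemma repeated_long:
  assumes f: "pt n f" and p: "p \<ge> 4" and gap: "f 0 \<ge> f 1 + (2 * p - 2)" and low: "f 2 \<ge> 1 \<or> f 1 \<ge> 2"
  shows "repeated p n f"
proof -
  have anti: "f 1 \<le> f 0" "f 2 \<le> f 1" using f by (auto simp: pt_def dest: antimonoD[of f 0 1] antimonoD[of f 1 2])
  obtain d where d: "p = 2 + d" using p le_Suc_ex[of 2 p] by auto
  obtain v where v: "f 0 = f 1 + (2 + 2 * d) + v" using gap d le_Suc_ex[of "f 1 + (2 + 2 * d)" "f 0"] by auto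
  show ?thesis
  proof (cases "f 2 \<ge> 1")
    case True
    obtain w where w: "f 2 = 1 + w" using True le_Suc_ex by blast
    obtain u where u: "f 1 = f 2 + u" using anti le_Suc_ex by blast
    have "repeated (2 + d) (5 + 2 * d + w * 3 + u * 2 + v * 1)
       (\<lambda>i. rl [3,1,1] i + d * rl [2] i + w * colf 3 i + u * colf 2 i + v * colf 1 i)"
      by (intro repeated_cols repeated_rows2 repeated_base)
    moreover have "(\<lambda>i. rl [3,1,1] i + d * rl [2] i + w * colf 3 i + u * colf 2 i + v * colf 1 i) = trunc 3 f"
      by (rule trunc_3I) (use u v w in \<open>auto simp: rl_def colf_def\<close>)
    moreover have "5 + 2 * d + w * 3 + u * 2 + v * 1 = (\<Sum>i<3. f i)" unfolding sum_lessThan_3 using u v w by simp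
    ultimately have "repeated p (\<Sum>i<3. f i) (trunc 3 f)" using d by metis
    then show ?thesis by (rule repeated_rows[OF f])
  next
    case False
    then have "f 1 \<ge> 2" using low by simp
    then obtain u where u: "f 1 = 2 + u" using le_Suc_ex by blast
    have "repeated (2 + d) (6 + 2 * d + u * 2 + v * 1) (\<lambda>i. rl [4,2] i + d * rl [2] i + u * colf 2 i + v * colf 1 i)"
      by (intro repeated_cols repeated_rows2 repeated_base)
    moreover have "(\<lambda>i. rl [4,2] i + d * rl [2] i + u * colf 2 i + v * colf 1 i) = trunc 2 f"
      by (rule trunc_2I) (use u v in \<open>auto simp: rl_def colf_def\<close>)
    moreover have "6 + 2 * d + u * 2 + v * 1 = (\<Sum>i<2. f i)" unfolding sum_lessThan_2 using u v by simp
    ultimately have "repeated p (\<Sum>i<2. f i) (trunc 2 f)" using d by metis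
    then show ?thesis by (rule repeated_rows[OF f])
  qed
qed

section \<open>Size of a diagram with short second row and second column\<close>

lemma less_conjf_iff:
  assumes "pt n f"
  shows "i < conjf f j \<longleftrightarrow> j < f i"
proof -
  obtain N where N: "\<forall>i\<ge>N. f i = 0" and anti: "antimono f" using assms by (auto simp: pt_def)
  have "finite {i. j < f i}"
    by (rule finite_subset[of _ "{..<N}"]) (use N in \<open>auto simp: not_less[symmetric] intro: ccontr\<close>)
  moreover have "k \<in> {i. j < f i}" if "i \<in> {i. j < f i}" "k < i" for i k
    using antimonoD[OF anti, of k i] that by simp
  ultimately have "{i. j < f i} = {..<conjf f j}" using down_closed_eq[of "{i. j < f i}"] by (simp add: conjf_def)
  then show ?thesis by blast
qed

text \<open>Without its first row and first column the diagram fits into a square of side T. The 1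
  on the left is the corner cell, counted both in the first row and in the first column.\<close>

lemma pt_size_bound:
  assumes f: "pt n f" and T: "f 1 \<le> Suc T" "conjf f 1 \<le> Suc T" and n: "n > 0"
  shows "n + 1 \<le> f 0 + conjf f 0 + T * T"
proof -
  define L where "L = conjf f 0"
  obtain N where N: "\<forall>i\<ge>N. f i = 0" "(\<Sum>i<N. f i) = n" and anti: "antimono f" using f by (auto simp: pt_def)
  have L: "i < L \<longleftrightarrow> 0 < f i" for i unfolding L_def by (rule less_conjf_iff[OF f])
  have zero: "f i = 0" if "\<not> i < L" for i using L[of i] that by simp
  have "L > 0"
  proof (rule ccontr)
    assume "\<not> L > 0"
    then have "f i = 0" for i using L[of i] by simp
    then show False using N(2) n by simp
  qed
  then obtain M where M: "L = Suc M" using gr0_implies_Suc by blast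
  have "(\<Sum>i<N. f i) = (\<Sum>i<L. f i)"
  proof -
    have "(\<Sum>i<N. f i) = (\<Sum>i<N + L. f i)" by (rule sum.mono_neutral_left) (use N in auto)
    also have "\<dots> = (\<Sum>i<L. f i)" by (rule sum.mono_neutral_right) (auto intro!: zero)
    finally show ?thesis .
  qed
  then have "n = f 0 + (\<Sum>i<M. f (Suc i))" using N(2) by (simp add: M sum.lessThan_Suc_shift del: sum.lessThan_Suc)
  \<comment> \<open>A later row has one cell in the first column and at most T others, and only the
    first T of these rows reach the second column.\<close>
  also have "(\<Sum>i<M. f (Suc i)) \<le> (\<Sum>i<M. 1 + (if i < T then T else 0))"
  proof (rule sum_mono)
    fix i
    have "f (Suc i) \<le> Suc T" using antimonoD[OF anti, of 1 "Suc i"] T(1) by simp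
    moreover have "f (Suc i) \<le> 1" if "\<not> i < T"
      using less_conjf_iff[OF f, of "Suc i" 1] T(2) that by linarith
    ultimately show "f (Suc i) \<le> 1 + (if i < T then T else 0)" by auto
  qed
  also have "(\<Sum>i<M. 1 + (if i < T then T else 0)) = M + (\<Sum>i<M. if i < T then T else 0)" by (simp only: sum.distrib) simp
  also have "(\<Sum>i<M. if i < T then T else 0) \<le> (\<Sum>i<T. T)"
  proof -
    have "(\<Sum>i<M. if i < T then T else 0) = (\<Sum>i\<in>{..<M} \<inter> {..<T}. T)"
      by (subst sum.inter_restrict) (auto intro!: sum.cong)
    also have "\<dots> \<le> (\<Sum>i<T. T)" by (rule sum_mono2) auto
    finally show ?thesis .
  qed
  finally show ?thesis using M by (simp add: L_def)
qed

lemma not_multiplicity_free_cases: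
  assumes f: "pt n f" and p: "p \<ge> 4" and n: "n > (2 * p - 2)\<^sup>2"
    and nf: "\<not> (f 1 \<le> 1 \<and> f 2 = 0)" and nc: "\<not> (conjf f 1 \<le> 1 \<and> conjf f 2 = 0)"
  shows "repeated p n f"
proof -
  have fc: "pt n (conjf f)" by (rule pt_conjf[OF f])
  have from_conj: "repeated p n f" if "repeated p n (conjf f)" using repeated_conj[OF that] conjf_conjf[OF f] by simp
  show ?thesis
  proof (cases "f 1 \<ge> 2 * p - 2 \<or> conjf f 1 \<ge> 2 * p - 2")
    case True
    then show ?thesis using repeated_rectangle[OF f p] repeated_rectangle[OF fc p] from_conj by blast
  next
    case False
    obtain d where d: "p = 4 + d" using p le_Suc_ex by blast
    have T: "f 1 \<le> Suc (2 * p - 4)" "conjf f 1 \<le> Suc (2 * p - 4)" using False p by auto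
    have "n + 1 \<le> f 0 + conjf f 0 + (2 * p - 4) * (2 * p - 4)" by (rule pt_size_bound[OF f T]) (use n in simp)
    \<comment> \<open>(2p - 2)^2 - (2p - 4)^2 = 8p - 12; the strict bound on n and the corner cell
      add 2. Half of this is 4p - 5 = (2p - 3) + (2p - 2): the maximal second row plus the gap that
      \<open>repeated_long\<close> asks for.\<close>
    then have "f 0 + conjf f 0 \<ge> 8 * p - 10" using n d by (simp add: power2_eq_square algebra_simps)
    then have "f 0 \<ge> 4 * p - 5 \<or> conjf f 0 \<ge> 4 * p - 5" by linarith
    then show ?thesis
    proof
      assume "f 0 \<ge> 4 * p - 5"
      then have "f 0 \<ge> f 1 + (2 * p - 2)" using T(1) p by linarith
      then show ?thesis using repeated_long[OF f p] nf by force
    next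
      assume "conjf f 0 \<ge> 4 * p - 5"
      then have "conjf f 0 \<ge> conjf f 1 + (2 * p - 2)" using T(2) p by linarith
      then show ?thesis using repeated_long[OF fc p] nc from_conj by force
    qed
  qed
qed

section \<open>Two-row characters\<close>

text \<open>The permutation character on subsets of size p.\<close>

definition pc :: "nat \<Rightarrow> nat \<Rightarrow> (nat \<Rightarrow> nat) \<Rightarrow> complex" where
  "pc n p \<sigma> = of_nat (card {A. A \<subseteq> {..<n} \<and> card A = p \<and> \<sigma> ` A = A})"

text \<open>Orbit counting for a single orbit: by transitivity as many elements carry w0 to w as fix
  w, and each element carries w0 to exactly one point.\<close>

lemma transitive_burnside:
  assumes fin: "finite \<Omega>" and ne: "w0 \<in> \<Omega>"
    and act: "\<And>\<sigma> w. \<sigma> \<in> perms n \<Longrightarrow> w \<in> \<Omega> \<Longrightarrow> act \<sigma> w \<in> \<Omega>"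
    and comp: "\<And>\<sigma> \<tau> w. act (\<sigma> \<circ> \<tau>) w = act \<sigma> (act \<tau> w)"
    and trans: "\<And>w. w \<in> \<Omega> \<Longrightarrow> \<exists>\<rho>\<in>perms n. act \<rho> w0 = w"
  shows "(\<Sum>\<sigma>\<in>perms n. card {w \<in> \<Omega>. act \<sigma> w = w}) = fact n"
proof -
  have "(\<Sum>\<sigma>\<in>perms n. card {w \<in> \<Omega>. act \<sigma> w = w}) = (\<Sum>\<sigma>\<in>perms n. \<Sum>w\<in>\<Omega>. if act \<sigma> w = w then 1 else 0)"
    by (intro sum.cong refl) (simp add: sum.If_cases fin Int_def)
  also have "\<dots> = (\<Sum>w\<in>\<Omega>. \<Sum>\<sigma>\<in>perms n. if act \<sigma> w = w then 1 else 0)" by (rule sum.swap)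
  also have "\<dots> = (\<Sum>w\<in>\<Omega>. \<Sum>\<sigma>\<in>perms n. if act \<sigma> w0 = w then 1 else 0)"
  proof (rule sum.cong[OF refl])
    fix w assume "w \<in> \<Omega>"
    then obtain \<rho> where \<rho>: "\<rho> \<in> perms n" "act \<rho> w0 = w" using trans by blast
    have "(\<Sum>\<sigma>\<in>perms n. if act \<sigma> w0 = w then 1 else 0) = (\<Sum>\<sigma>\<in>perms n. if act (\<sigma> \<circ> \<rho>) w0 = w then 1 else (0::nat))"
      by (rule sum_perms_right[OF \<rho>(1), symmetric])
    then show "(\<Sum>\<sigma>\<in>perms n. if act \<sigma> w = w then 1 else 0) = (\<Sum>\<sigma>\<in>perms n. if act \<sigma> w0 = w then 1 else (0::nat))"
      by (simp add: comp \<rho>(2))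
  qed
  also have "\<dots> = (\<Sum>\<sigma>\<in>perms n. \<Sum>w\<in>\<Omega>. if act \<sigma> w0 = w then 1 else 0)" by (rule sum.swap)
  also have "\<dots> = (\<Sum>\<sigma>\<in>perms n. 1)"
    by (intro sum.cong refl) (simp add: fin act ne)
  also have "\<dots> = fact n" by (simp add: card_perms)
  finally show ?thesis .
qed

text \<open>The orbits of the symmetric group on pairs of a p-set and a q-set, indexed by the size
  of the intersection.\<close>

definition pairs :: "nat \<Rightarrow> nat \<Rightarrow> nat \<Rightarrow> nat \<Rightarrow> (nat set \<times> nat set) set" where
  "pairs n p q i = {(A, B). A \<subseteq> {..<n} \<and> B \<subseteq> {..<n} \<and> card A = p \<and> card B = q \<and> card (A \<inter> B) = i}"

lemma finite_pairs: "finite (pairs n p q i)"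
  by (rule finite_subset[of _ "Pow {..<n} \<times> Pow {..<n}"]) (auto simp: pairs_def)

lemma pairs_burnside:
  assumes i: "i \<le> p" "i \<le> q" "p + q \<le> n"
  shows "(\<Sum>\<sigma>\<in>perms n. card {(A, B). (A, B) \<in> pairs n p q i \<and> \<sigma> ` A = A \<and> \<sigma> ` B = B}) = fact n"
proof -
  define A0 where "A0 = {..<p}"
  \<comment> \<open>B0 begins i places before the end of A0, so that they share i points, and ends
    at p - i + q \<le> n.\<close>
  define B0 where "B0 = {p - i..<p - i + q}"
  have "A0 \<inter> B0 = {p - i..<p}" using i by (auto simp: A0_def B0_def)
  then have "card (A0 \<inter> B0) = i" using i by simp
  moreover have "card A0 = p" "card B0 = q" by (simp_all add: A0_def B0_def)
  moreover have "A0 \<subseteq> {..<n}" "B0 \<subseteq> {..<n}" using i by (auto simp: A0_def B0_def)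
  ultimately have w0: "(A0, B0) \<in> pairs n p q i" by (simp add: pairs_def)
  have img: "\<sigma> ` A \<subseteq> {..<n} \<and> card (\<sigma> ` A) = card A" if "\<sigma> \<in> perms n" "A \<subseteq> {..<n}" for \<sigma> A
  proof -
    have "inj \<sigma>" using that(1) permutes_inj by blast
    then have "card (\<sigma> ` A) = card A" by (intro card_image) (auto intro: inj_on_subset)
    moreover have "\<sigma> ` A \<subseteq> {..<n}" using perms_less[OF that(1)] that(2) by auto
    ultimately show ?thesis by simp
  qed
  have "(\<Sum>\<sigma>\<in>perms n. card {w \<in> pairs n p q i. (\<lambda>(A, B). (\<sigma> ` A, \<sigma> ` B)) w = w}) = fact n"
  proof (rule transitive_burnside[OF finite_pairs w0])
    fix \<sigma> w assume s: "\<sigma> \<in> perms n" and w: "w \<in> pairs n p q i"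
    have "inj \<sigma>" using s permutes_inj by blast
    obtain A B where AB: "w = (A, B)" "A \<subseteq> {..<n}" "B \<subseteq> {..<n}" "card A = p" "card B = q" "card (A \<inter> B) = i"
      using w by (auto simp: pairs_def)
    have "\<sigma> ` A \<inter> \<sigma> ` B = \<sigma> ` (A \<inter> B)" using image_Int[OF \<open>inj \<sigma>\<close>, of A B] by simp
    then show "(\<lambda>(A, B). (\<sigma> ` A, \<sigma> ` B)) w \<in> pairs n p q i"
      using img[OF s AB(2)] img[OF s AB(3)] img[OF s, of "A \<inter> B"] AB by (auto simp: pairs_def)
  next
    fix w assume "w \<in> pairs n p q i"
    then obtain A B where AB: "w = (A, B)" "(A, B) \<in> pairs n p q i" by (cases w) auto
    \<comment> \<open>The four classes of points, by membership in A and in B, have the same sizes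
      for all pairs of one type; \<open>perms_of_fibres\<close> then gives transitivity.\<close>
    have counts: "card {x. x < n \<and> (x \<in> A, x \<in> B) = k} =
      (case k of (True, True) \<Rightarrow> i | (True, False) \<Rightarrow> p - i | (False, True) \<Rightarrow> q - i | (False, False) \<Rightarrow> n - (p + q - i))"
      if AB: "(A, B) \<in> pairs n p q i" for A B k
    proof -
      have s: "A \<subseteq> {..<n}" "B \<subseteq> {..<n}" "card A = p" "card B = q" "card (A \<inter> B) = i" using AB by (auto simp: pairs_def)
      have fin: "finite A" "finite B" using s finite_subset[of _ "{..<n}"] by auto
      have 1: "{x. x < n \<and> x \<in> A \<and> x \<in> B} = A \<inter> B" "{x. x < n \<and> x \<in> A \<and> x \<notin> B} = A - (A \<inter> B)"
        "{x. x < n \<and> x \<notin> A \<and> x \<in> B} = B - (A \<inter> B)" "{x. x < n \<and> x \<notin> A \<and> x \<notin> B} = {..<n} - (A \<union> B)"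
        using s by auto
      have "card (A \<union> B) = p + q - i" using card_Un_Int[OF fin] s by simp
      then have "card ({..<n} - (A \<union> B)) = n - (p + q - i)" using card_Diff_subset[of "A \<union> B" "{..<n}"] fin s by auto
      moreover have "card (A - (A \<inter> B)) = p - i" "card (B - (A \<inter> B)) = q - i"
        using card_Diff_subset[of "A \<inter> B" A] card_Diff_subset[of "A \<inter> B" B] fin s by auto
      ultimately show ?thesis using s(5) 1 by (cases k) (auto split: bool.splits)
    qed
    have "\<exists>\<rho>\<in>perms n. \<forall>x<n. (\<rho> x \<in> A, \<rho> x \<in> B) = (x \<in> A0, x \<in> B0)"
      by (rule perms_of_fibres) (simp only: counts[OF w0] counts[OF AB(2)])
    then obtain \<rho> where \<rho>: "\<rho> \<in> perms n" "\<forall>x<n. (\<rho> x \<in> A) = (x \<in> A0) \<and> (\<rho> x \<in> B) = (x \<in> B0)" by auto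
    have s: "A \<subseteq> {..<n}" "B \<subseteq> {..<n}" "card A = p" "card B = q" using AB(2) by (auto simp: pairs_def)
    have s0: "A0 \<subseteq> {..<n}" "B0 \<subseteq> {..<n}" "card A0 = p" "card B0 = q" using w0 by (auto simp: pairs_def)
    have "\<rho> ` A0 = A"
      by (rule card_subset_eq) (use \<rho>(2) s s0 img[OF \<rho>(1) s0(1)] finite_subset[of _ "{..<n}"] in auto)
    moreover have "\<rho> ` B0 = B"
      by (rule card_subset_eq) (use \<rho>(2) s s0 img[OF \<rho>(1) s0(2)] finite_subset[of _ "{..<n}"] in auto)
    ultimately show "\<exists>\<rho>\<in>perms n. (\<lambda>(A, B). (\<rho> ` A, \<rho> ` B)) (A0, B0) = w" using \<rho>(1) AB(1) by auto
  qed (auto simp: image_comp)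
  moreover have "{w \<in> pairs n p q i. (\<lambda>(A, B). (\<sigma> ` A, \<sigma> ` B)) w = w} =
     {(A, B). (A, B) \<in> pairs n p q i \<and> \<sigma> ` A = A \<and> \<sigma> ` B = B}" for \<sigma> by auto
  ultimately show ?thesis by simp
qed

lemma pc_inv:
  assumes "\<sigma> \<in> perms n"
  shows "pc n p (inv \<sigma>) = pc n p \<sigma>"
proof -
  have "inv \<sigma> ` A = A \<longleftrightarrow> \<sigma> ` A = A" for A
  proof -
    have "\<sigma> ` (inv \<sigma> ` A) = A" "inv \<sigma> ` (\<sigma> ` A) = A" using assms by (simp_all add: image_comp permutes_inv_o)
    then show ?thesis by metis
  qed
  then show ?thesis by (simp add: pc_def)
qed

text \<open>A pair of invariant subsets is an invariant pair, so the inner product counts orbits on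
  pairs. By \<open>p + q \<le> n\<close> every intersection size from 0 to \<open>min p q\<close>
  occurs.\<close>

lemma ip_pc_pc:
  assumes pq: "p + q \<le> n"
  shows "ip n (pc n p) (pc n q) = of_nat (min p q + 1)"
proof -
  have prodE: "pc n p \<sigma> * pc n q \<sigma> = of_nat (\<Sum>i\<le>min p q. card {(A, B). (A, B) \<in> pairs n p q i \<and> \<sigma> ` A = A \<and> \<sigma> ` B = B})" for \<sigma>
  proof -
    define X where "X i = {(A, B). (A, B) \<in> pairs n p q i \<and> \<sigma> ` A = A \<and> \<sigma> ` B = B}" for i
    have e: "{A. A \<subseteq> {..<n} \<and> card A = p \<and> \<sigma> ` A = A} \<times> {B. B \<subseteq> {..<n} \<and> card B = q \<and> \<sigma> ` B = B} = (\<Union>i\<le>min p q. X i)"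
    proof (intro equalityI subsetI)
      fix w assume "w \<in> {A. A \<subseteq> {..<n} \<and> card A = p \<and> \<sigma> ` A = A} \<times> {B. B \<subseteq> {..<n} \<and> card B = q \<and> \<sigma> ` B = B}"
      then obtain A B where w: "w = (A, B)" "A \<subseteq> {..<n}" "B \<subseteq> {..<n}" "card A = p" "card B = q" "\<sigma> ` A = A" "\<sigma> ` B = B" by auto
      have "finite A" "finite B" using w finite_subset[of _ "{..<n}"] by auto
      then have "card (A \<inter> B) \<le> min p q" using w card_mono[of A "A \<inter> B"] card_mono[of B "A \<inter> B"] by auto
      then show "w \<in> (\<Union>i\<le>min p q. X i)" using w by (auto simp: X_def pairs_def)
    qed (auto simp: X_def pairs_def)
    have "card (\<Union>i\<le>min p q. X i) = (\<Sum>i\<le>min p q. card (X i))"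
    proof (rule card_UN_disjoint)
      show "\<forall>i\<in>{..min p q}. finite (X i)"
      proof
        fix i
        show "finite (X i)" by (rule finite_subset[OF _ finite_pairs[of n p q i]]) (auto simp: X_def)
      qed
    qed (auto simp: X_def pairs_def)
    then have "card {A. A \<subseteq> {..<n} \<and> card A = p \<and> \<sigma> ` A = A} * card {B. B \<subseteq> {..<n} \<and> card B = q \<and> \<sigma> ` B = B} =
      (\<Sum>i\<le>min p q. card (X i))" unfolding e[symmetric] card_cartesian_product .
    then show ?thesis unfolding pc_def X_def of_nat_mult[symmetric] by (rule arg_cong[of _ _ of_nat])
  qed
  have "(\<Sum>\<sigma>\<in>perms n. pc n p \<sigma> * pc n q (inv \<sigma>)) = (\<Sum>\<sigma>\<in>perms n. pc n p \<sigma> * pc n q \<sigma>)"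
    by (intro sum.cong refl) (simp add: pc_inv)
  also have "\<dots> = of_nat (\<Sum>\<sigma>\<in>perms n. \<Sum>i\<le>min p q. card {(A, B). (A, B) \<in> pairs n p q i \<and> \<sigma> ` A = A \<and> \<sigma> ` B = B})"
    unfolding prodE of_nat_sum ..
  also have "(\<Sum>\<sigma>\<in>perms n. \<Sum>i\<le>min p q. card {(A, B). (A, B) \<in> pairs n p q i \<and> \<sigma> ` A = A \<and> \<sigma> ` B = B}) =
    (\<Sum>i\<le>min p q. \<Sum>\<sigma>\<in>perms n. card {(A, B). (A, B) \<in> pairs n p q i \<and> \<sigma> ` A = A \<and> \<sigma> ` B = B})"
    by (rule sum.swap)
  also have "\<dots> = (\<Sum>i\<le>min p q. fact n)"
    by (intro sum.cong refl pairs_burnside) (use pq in auto)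
  finally show ?thesis by (simp add: ip_def add_divide_distrib)
qed

text \<open>The row group is the stabilizer of the set of entries in the second row, so the
  normalized row sum generates the permutation module on p-subsets.\<close>

lemma pc_eq_chr:
  assumes t: "tab n r c (rl [n - p, p])" and p: "2 * p \<le> n" and \<sigma>: "\<sigma> \<in> perms n"
  shows "pc n p \<sigma> = chr n (rsym n r) \<sigma> / of_nat (card (stab n r))"
proof -
  have r01: "r x = 0 \<or> r x = 1" if "x < n" for x
  proof (rule ccontr)
    assume a: "\<not> (r x = 0 \<or> r x = 1)"
    have "card {y. y < n \<and> r y = r x} = rl [n - p, p] (r x)" using t unfolding tab_def by blast
    also have "\<dots> = 0" using a by (auto simp: rl_def)
    finally have "{y. y < n \<and> r y = r x} = {}" by simp
    then show False using that by blast
  qed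
  define A0 where "A0 = {x. x < n \<and> r x = 1}"
  have A0: "A0 \<subseteq> {..<n}" "card A0 = p"
  proof -
    have "card {x. x < n \<and> r x = 1} = rl [n - p, p] 1" using t unfolding tab_def by blast
    then show "card A0 = p" by (simp add: A0_def rl_def)
  qed (auto simp: A0_def)
  have inj: "inj \<tau>" if "\<tau> \<in> perms n" for \<tau> using that permutes_inj by blast
  have img: "\<tau> ` A0 \<subseteq> {..<n} \<and> card (\<tau> ` A0) = p" if "\<tau> \<in> perms n" for \<tau>
  proof -
    have "card (\<tau> ` A0) = card A0" using inj[OF that] by (intro card_image) (auto intro: inj_on_subset)
    then show ?thesis using perms_less[OF that] A0 by auto
  qed
  have stab_iff: "\<tau> \<in> stab n r \<longleftrightarrow> \<tau> ` A0 = A0" if \<tau>: "\<tau> \<in> perms n" for \<tau>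
  proof
    assume "\<tau> \<in> stab n r"
    then have "\<tau> ` A0 \<subseteq> A0" using perms_less[OF \<tau>] by (auto simp: stab_def A0_def)
    then show "\<tau> ` A0 = A0" using img[OF \<tau>] A0 finite_subset[of _ "{..<n}"] by (intro card_subset_eq) auto
  next
    assume e: "\<tau> ` A0 = A0"
    have "r (\<tau> k) = r k" if k: "k < n" for k
    proof (cases "k \<in> A0")
      case True
      then have "\<tau> k \<in> A0" using e by blast
      then show ?thesis using True by (simp add: A0_def)
    next
      case False
      then have "\<tau> k \<notin> A0" using e inj[OF \<tau>] by (metis image_iff injD)
      then show ?thesis using False k r01[OF k] r01[of "\<tau> k"] perms_less[OF \<tau>] by (auto simp: A0_def)
    qed
    then show "\<tau> \<in> stab n r" using \<tau> by (simp add: stab_def)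
  qed
  \<comment> \<open>The permutations that carry A0 to A form a coset of the row group.\<close>
  have count: "card {\<tau> \<in> perms n. \<tau> ` A0 = A} = card (stab n r)" if A: "A \<subseteq> {..<n}" "card A = p" for A
  proof -
    have cA: "card {x. x < n \<and> (x \<in> B) = k} = (if k then p else n - p)" if "B \<subseteq> {..<n}" "card B = p" for B k
    proof -
      have "{x. x < n \<and> x \<in> B} = B" "{x. x < n \<and> x \<notin> B} = {..<n} - B" using that by auto
      moreover have "card ({..<n} - B) = n - p" using card_Diff_subset[of B "{..<n}"] that finite_subset[of _ "{..<n}"] by auto
      ultimately show ?thesis using that by (cases k) auto
    qed
    have "\<exists>\<rho>\<in>perms n. \<forall>x<n. (\<rho> x \<in> A) = (x \<in> A0)"
      by (rule perms_of_fibres) (simp only: cA[OF A] cA[OF A0])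
    then obtain \<rho> where \<rho>: "\<rho> \<in> perms n" "\<forall>x<n. (\<rho> x \<in> A) = (x \<in> A0)" by blast
    have e: "\<rho> ` A0 = A"
      by (rule card_subset_eq) (use \<rho>(2) A A0 img[OF \<rho>(1)] finite_subset[of _ "{..<n}"] in auto)
    have "bij_betw (\<lambda>\<tau>. \<rho> \<circ> \<tau>) (stab n r) {\<tau> \<in> perms n. \<tau> ` A0 = A}"
    proof (rule bij_betw_byWitness[of _ "\<lambda>\<tau>. inv \<rho> \<circ> \<tau>"])
      show "\<forall>\<tau>\<in>stab n r. inv \<rho> \<circ> (\<rho> \<circ> \<tau>) = \<tau>" "\<forall>\<tau>\<in>{\<tau> \<in> perms n. \<tau> ` A0 = A}. \<rho> \<circ> (inv \<rho> \<circ> \<tau>) = \<tau>"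
        using perms_cancel(3,4)[OF \<rho>(1)] by auto
      show "(\<lambda>\<tau>. \<rho> \<circ> \<tau>) ` stab n r \<subseteq> {\<tau> \<in> perms n. \<tau> ` A0 = A}"
      proof
        fix \<pi> assume "\<pi> \<in> (\<lambda>\<tau>. \<rho> \<circ> \<tau>) ` stab n r"
        then obtain \<tau> where \<pi>: "\<pi> = \<rho> \<circ> \<tau>" and \<tau>: "\<tau> \<in> stab n r" by auto
        have "(\<rho> \<circ> \<tau>) ` A0 = \<rho> ` (\<tau> ` A0)" by (simp only: image_comp)
        then show "\<pi> \<in> {\<tau> \<in> perms n. \<tau> ` A0 = A}"
          unfolding \<pi> using perms_comp[OF \<rho>(1) stab_perms[OF \<tau>]] stab_iff[OF stab_perms[OF \<tau>]] \<tau> e by simp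
      qed
      show "(\<lambda>\<tau>. inv \<rho> \<circ> \<tau>) ` {\<tau> \<in> perms n. \<tau> ` A0 = A} \<subseteq> stab n r"
      proof
        fix \<pi> assume "\<pi> \<in> (\<lambda>\<tau>. inv \<rho> \<circ> \<tau>) ` {\<tau> \<in> perms n. \<tau> ` A0 = A}"
        then obtain \<tau> where \<pi>: "\<pi> = inv \<rho> \<circ> \<tau>" and \<tau>: "\<tau> permutes {..<n}" and A: "A = \<tau> ` A0" by auto
        have p': "inv \<rho> \<circ> \<tau> \<in> perms n" using perms_comp[OF perms_inv[OF \<rho>(1)]] \<tau> by simp
        have "(inv \<rho> \<circ> \<tau>) ` A0 = inv \<rho> ` (\<rho> ` A0)" unfolding e using A by (simp only: image_comp)
        also have "\<dots> = A0" using \<rho>(1) by (simp only: image_comp perms_cancel(1)[OF \<rho>(1)]) simp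
        finally show "\<pi> \<in> stab n r" unfolding \<pi> using stab_iff[OF p'] by simp
      qed
    qed
    from bij_betw_same_card[OF this] show ?thesis by (rule sym)
  qed
  define \<A> where "\<A> = {A. A \<subseteq> {..<n} \<and> card A = p \<and> inv \<sigma> ` A = A}"
  have finA: "finite \<A>" by (rule finite_subset[of _ "Pow {..<n}"]) (auto simp: \<A>_def)
  have fix_iff: "inv \<tau> \<circ> (inv \<sigma> \<circ> \<tau>) \<in> stab n r \<longleftrightarrow> \<tau> ` A0 \<in> \<A>" if \<tau>: "\<tau> \<in> perms n" for \<tau>
  proof -
    have p': "inv \<tau> \<circ> (inv \<sigma> \<circ> \<tau>) \<in> perms n" by (intro perms_comp perms_inv \<tau> \<sigma>)
    have "(inv \<tau> \<circ> (inv \<sigma> \<circ> \<tau>)) ` A0 = inv \<tau> ` (inv \<sigma> ` (\<tau> ` A0))" by (simp only: image_comp)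
    moreover have "inv \<tau> ` (inv \<sigma> ` (\<tau> ` A0)) = A0 \<longleftrightarrow> inv \<sigma> ` (\<tau> ` A0) = \<tau> ` A0"
    proof
      assume "inv \<tau> ` (inv \<sigma> ` (\<tau> ` A0)) = A0"
      then have "\<tau> ` (inv \<tau> ` (inv \<sigma> ` (\<tau> ` A0))) = \<tau> ` A0" by simp
      then show "inv \<sigma> ` (\<tau> ` A0) = \<tau> ` A0" by (simp only: image_comp[of \<tau> "inv \<tau>"] perms_cancel(2)[OF \<tau>] image_id id_apply)
    next
      assume "inv \<sigma> ` (\<tau> ` A0) = \<tau> ` A0"
      then show "inv \<tau> ` (inv \<sigma> ` (\<tau> ` A0)) = A0" by (simp only: image_comp[of "inv \<tau>" \<tau>] perms_cancel(1)[OF \<tau>] image_id id_apply)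
    qed
    ultimately show ?thesis using stab_iff[OF p'] img[OF \<tau>] by (simp add: \<A>_def)
  qed
  have "chr n (rsym n r) \<sigma> = (\<Sum>\<tau>\<in>perms n. if \<tau> ` A0 \<in> \<A> then 1 else 0)"
    unfolding chr_def by (intro sum.cong refl) (simp only: rsym_def fix_iff)
  also have "\<dots> = (\<Sum>\<tau>\<in>perms n. \<Sum>A\<in>\<A>. if \<tau> ` A0 = A then 1 else 0)"
    by (intro sum.cong refl) (simp add: finA)
  also have "\<dots> = (\<Sum>A\<in>\<A>. \<Sum>\<tau>\<in>perms n. if \<tau> ` A0 = A then 1 else 0)" by (rule sum.swap)
  also have "\<dots> = (\<Sum>A\<in>\<A>. of_nat (card {\<tau> \<in> perms n. \<tau> ` A0 = A}))"
    by (intro sum.cong refl) (simp add: sum.If_cases Int_def)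
  also have "\<dots> = (\<Sum>A\<in>\<A>. of_nat (card (stab n r)))"
  proof (rule sum.cong[OF refl])
    fix A assume "A \<in> \<A>"
    then show "of_nat (card {\<tau> \<in> perms n. \<tau> ` A0 = A}) = (of_nat (card (stab n r)) :: complex)"
      by (subst count) (auto simp: \<A>_def)
  qed
  also have "\<dots> = pc n p (inv \<sigma>) * of_nat (card (stab n r))"
    by (simp add: pc_def \<A>_def)
  finally have "chr n (rsym n r) \<sigma> = pc n p (inv \<sigma>) * of_nat (card (stab n r))" .
  moreover have "stab n r \<noteq> {}" using stab_id by blast
  ultimately show ?thesis using pc_inv[OF \<sigma>, of p] by simp
qed

text \<open>With \<open>a\<close> the normalized row sum, \<open>x \<mapsto> e x a\<close> is
  idempotent, and its trace is the inner product; so the inner product is a rank, and rank 0 means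
  that the map vanishes.\<close>

lemma ip_chr_rsym:
  assumes t: "tab n r c f"
  shows "\<exists>d. ip n (chr n (ye n r c)) (\<lambda>\<sigma>. chr n (rsym n r') \<sigma> / of_nat (card (stab n r'))) = of_nat d \<and>
    (d = 0 \<longrightarrow> (\<forall>x. galg_mult n (ye n r c) (galg_mult n x (rsym n r')) = 0))"
proof -
  define k where "k = (of_nat (card (stab n r')) :: complex)"
  have "stab n r' \<noteq> {}" using stab_id by blast
  then have k: "k \<noteq> 0" by (simp add: k_def)
  define a where "a = fscale (1 / k) (rsym n r')"
  define e where "e = ye n r c"
  have aa: "galg_mult n a a = a" using k by (simp add: a_def gm_scale_left gm_scale_right gm_rsym_rsym k_def[symmetric])
  have ee: "galg_mult n e e = e" unfolding e_def by (rule ye_idem[OF t])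
  have ac: "a \<in> galg_carrier n" using sym_carrier(1)[of n r'] by (auto simp: a_def galg_carrier_def fscale_def)
  define P where "P x = galg_mult n e (galg_mult n x a)" for x
  have lin: "flinear P"
    unfolding P_def by (rule flinearI) (auto simp: galg_mult_def algebra_simps sum.distrib sum_distrib_left)
  have supp: "P x i = 0" if "i \<notin> perms n" for x i
    using gm_carrier[OF gm_carrier[OF ac], of e x] that by (auto simp: P_def galg_carrier_def)
  have idem: "P (P x) = P x" for x
  proof -
    have "P (P x) = galg_mult n (galg_mult n e e) (galg_mult n x (galg_mult n a a))" by (simp add: P_def gm_assoc)
    then show ?thesis by (simp add: aa ee P_def)
  qed
  have "(\<Sum>\<pi>\<in>perms n. P (funit \<pi>) \<pi>) = of_nat (fs.dim (range P))"
    by (rule trace_idempotent[OF finite_perms lin supp idem])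
  moreover have "ip n (chr n e) (\<lambda>\<sigma>. chr n (rsym n r') \<sigma> / k) = (\<Sum>\<pi>\<in>perms n. P (funit \<pi>) \<pi>)"
  proof -
    have "(\<lambda>\<sigma>. chr n (rsym n r') \<sigma> / k) = chr n a" by (simp add: a_def chr_scale fun_eq_iff)
    moreover have "funit \<pi> = galg_single \<pi>" for \<pi> by (simp add: funit_def galg_single_def)
    ultimately show ?thesis by (simp add: ip_chr_chr P_def)
  qed
  moreover have "galg_mult n e (galg_mult n x (rsym n r')) = 0" if "fs.dim (range P) = 0" for x
  proof -
    have "range P \<subseteq> fs.span (funit ` perms n)"
    proof
      fix v assume "v \<in> range P"
      then have "v = (\<Sum>i\<in>perms n. fscale (v i) (funit i))"
        by (intro fun_eq_sum_funit) (use supp in auto)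
      also have "\<dots> \<in> fs.span (funit ` perms n)"
        by (intro fs.span_sum fs.span_scale fs.span_base) auto
      finally show "v \<in> fs.span (funit ` perms n)" .
    qed
    then have "range P \<subseteq> {0}" using fdim_zero_iff[of "range P" "funit ` perms n"] that by simp
    then have "P x = 0" by blast
    then have "fscale k (P x) = 0" by (simp add: fscale_def fun_eq_iff)
    then show ?thesis using k by (simp add: P_def a_def gm_scale_right)
  qed
  ultimately show ?thesis unfolding e_def k_def by metis
qed

lemma two_row_partition: "1 \<le> p \<Longrightarrow> 2 * p \<le> n \<Longrightarrow> [n - p, p] \<in> partitions_of n"
  by (auto simp: partitions_of_def is_partition_def)

lemma tab_two_row:
  assumes "2 * p \<le> n"
  shows "\<exists>r c. tab n r c (rl [n - p, p])"
  using pt_tab[OF pt_two[OF assms]] by blast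

lemma ip_irr_char_pc:
  assumes l: "l \<in> partitions_of n" and p: "2 * p \<le> n"
  shows "\<exists>d. ip n (irr_char l) (pc n p) = of_nat d"
proof -
  obtain r c where t: "tab n r c (rl [n - p, p])" using tab_two_row[OF p] by blast
  have "ip n (irr_char l) (pc n p) = ip n (chr n (ye n (row_of l) (col_of l))) (\<lambda>\<sigma>. chr n (rsym n r) \<sigma> / of_nat (card (stab n r)))"
    by (rule ip_cong) (use irr_char_canonical[OF l] pc_eq_chr[OF t p] in auto)
  then show ?thesis using ip_chr_rsym[OF partition_tab[OF l], of r] by auto
qed

text \<open>Otherwise e would annihilate the row sum, hence the Young symmetrizer, hence itself,
  although \<open>e e = e\<close> is nonzero.\<close>

lemma ip_two_row_pc_pos:
  assumes p: "1 \<le> p" "2 * p \<le> n"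
  shows "ip n (irr_char [n - p, p]) (pc n p) \<noteq> 0"
proof
  assume z: "ip n (irr_char [n - p, p]) (pc n p) = 0"
  note l = two_row_partition[OF p]
  obtain r c where t: "tab n r c (rl [n - p, p])" using tab_two_row[OF p(2)] by blast
  have "ip n (irr_char [n - p, p]) (pc n p) = ip n (chr n (ye n r c)) (\<lambda>\<sigma>. chr n (rsym n r) \<sigma> / of_nat (card (stab n r)))"
    by (rule ip_cong) (use irr_char_tab[OF l t] pc_eq_chr[OF t p(2)] in auto)
  then have d: "galg_mult n (ye n r c) (galg_mult n x (rsym n r)) = 0" for x
    using ip_chr_rsym[OF t, of r] z by auto
  have "galg_mult n (galg_single id) (rsym n r) = rsym n r" using gm_single_left[OF perms_id, of n "rsym n r"] by simp
  then have "galg_mult n (ye n r c) (rsym n r) = 0" using d[of "galg_single id"] by simp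
  then have "galg_mult n (galg_mult n (ye n r c) (rsym n r)) (csym n c) = 0" by simp
  then have "galg_mult n (ye n r c) (ysym n r c) = 0" by (simp add: gm_assoc ysym_def)
  moreover have "galg_mult n (ye n r c) (ye n r c) = fscale (1 / yk n r c) (galg_mult n (ye n r c) (ysym n r c))"
    by (subst (2) ye_def) (simp only: gm_scale_right)
  ultimately have "galg_mult n (ye n r c) (ye n r c) = 0" by (simp add: fun_eq_iff fscale_def)
  then have "ye n r c = 0" using ye_idem[OF t] by simp
  then show False using ye_id[OF t] by simp
qed

text \<open>\<open>(n - p + 1, p - 1)\<close> is not dominated by \<open>(n - p, p)\<close>, so the
  column sum of the latter annihilates every translate of the row sum of the former.\<close>

lemma ip_two_row_pc_zero:
  assumes p: "1 \<le> p" "2 * p \<le> n"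
  shows "ip n (irr_char [n - p, p]) (pc n (p - 1)) = 0"
proof -
  note l = two_row_partition[OF p]
  have p': "2 * (p - 1) \<le> n" using p by simp
  obtain r c where t: "tab n r c (rl [n - p, p])" using tab_two_row[OF p(2)] by blast
  obtain r' c' where t': "tab n r' c' (rl [n - (p - 1), p - 1])" using tab_two_row[OF p'] by blast
  define k where "k = (of_nat (card (stab n r')) :: complex)"
  have nd: "\<not> dom (rl [n - (p - 1), p - 1]) (rl [n - p, p])"
    unfolding dom_def by (rule notI, drule spec[of _ 1]) (use p in \<open>auto simp: rl_def\<close>)
  have "galg_mult n (ye n r c) (galg_mult n (galg_single \<pi>) (rsym n r')) = 0" if "\<pi> \<in> perms n" for \<pi>
    using rc_sandwich_not_dom[OF t t' nd that] by (simp add: ye_def ysym_def gm_scale_left gm_assoc)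
  then have "ip n (chr n (ye n r c)) (chr n (rsym n r')) = 0" by (simp add: ip_chr_chr)
  moreover have "ip n (irr_char [n - p, p]) (pc n (p - 1)) = ip n (chr n (ye n r c)) (\<lambda>\<sigma>. (1 / k) * chr n (rsym n r') \<sigma>)"
    by (rule ip_cong) (use irr_char_tab[OF l t] pc_eq_chr[OF t' p'] in \<open>auto simp: k_def\<close>)
  ultimately show ?thesis by (simp only: ip_commute[of n "chr n (ye n r c)"] ip_scale_left mult_zero_right)
qed

lemma class_fun_pc: "2 * p \<le> n \<Longrightarrow> class_fun n (pc n p)"
proof -
  assume p: "2 * p \<le> n"
  obtain r c where t: "tab n r c (rl [n - p, p])" using tab_two_row[OF p] by blast
  have "class_fun n (chr n (fscale (1 / of_nat (card (stab n r))) (rsym n r)))" by (rule class_fun_chr)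
  then show ?thesis
    by (rule class_fun_cong[rotated]) (simp add: chr_scale pc_eq_chr[OF t p])
qed

text \<open>By \<open>ip_pc_pc\<close> the difference has norm (p + 1) - p - p + p = 1, and its
  coordinates are integers, so it is an irreducible character up to sign. Its coordinate at
  \<open>[n - p, p]\<close> is a positive integer, which settles both sign and shape.\<close>

lemma two_row_char:
  assumes p: "1 \<le> p" "2 * p \<le> n" and \<sigma>: "\<sigma> \<in> perms n"
  shows "irr_char [n - p, p] \<sigma> = pc n p \<sigma> - pc n (p - 1) \<sigma>"
proof -
  define m where "m = [n - p, p]"
  have m: "m \<in> partitions_of n" unfolding m_def by (rule two_row_partition[OF p])
  define \<psi> where "\<psi> = (\<lambda>\<sigma>. pc n p \<sigma> - pc n (p - 1) \<sigma>)"
  have cl: "class_fun n \<psi>" unfolding \<psi>_def by (intro class_fun_diff class_fun_pc) (use p in auto)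
  have norm: "ip n \<psi> \<psi> = 1"
    unfolding \<psi>_def ip_diff_left ip_diff_right using p
    by (simp add: ip_pc_pc)
  define w where "w l = ip n \<psi> (irr_char l)" for l
  have wint: "w l \<in> \<int>" if l: "l \<in> partitions_of n" for l
  proof -
    have p': "2 * (p - 1) \<le> n" using p by simp
    obtain d where "ip n (irr_char l) (pc n p) = of_nat d" using ip_irr_char_pc[OF l p(2)] by blast
    moreover obtain d' where "ip n (irr_char l) (pc n (p - 1)) = of_nat d'" using ip_irr_char_pc[OF l p'] by blast
    ultimately have "w l = of_nat d - of_nat d'" unfolding w_def \<psi>_def ip_diff_left ip_commute[of n _ "irr_char l"] by simp
    then show ?thesis by simp
  qed
  have "\<exists>z. \<forall>l\<in>partitions_of n. w l = of_int (z l)" by (rule bchoice) (use wint in \<open>auto elim!: Ints_cases\<close>)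
  then obtain z where z: "\<And>l. l \<in> partitions_of n \<Longrightarrow> w l = of_int (z l)" by blast
  have "(\<Sum>l\<in>partitions_of n. w l * w l) = 1" using parseval[OF cl, of \<psi>] norm by (simp add: w_def)
  then have "of_int (\<Sum>l\<in>partitions_of n. z l * z l) = (1 :: complex)" by (simp add: z)
  then have sum1: "(\<Sum>l\<in>partitions_of n. z l * z l) = 1" by (metis of_int_eq_1_iff)
  obtain d where d: "ip n (irr_char m) (pc n p) = of_nat d" using ip_irr_char_pc[OF m p(2)] by blast
  have "w m = of_nat d"
    unfolding w_def \<psi>_def ip_diff_left ip_commute[of n _ "irr_char m"] using d ip_two_row_pc_zero[OF p] by (simp add: m_def)
  moreover have "d \<noteq> 0" using ip_two_row_pc_pos[OF p] d by (auto simp: m_def)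
  ultimately have "z m = int d" "d \<ge> 1" using z[OF m] by (metis of_int_eq_iff of_int_of_nat_eq, simp)
  then have zm: "z m * z m \<ge> 1" by (metis mult_le_mono nat_mult_1 of_nat_1 of_nat_le_iff of_nat_mult)
  have split: "(\<Sum>l\<in>partitions_of n. z l * z l) = z m * z m + (\<Sum>l\<in>partitions_of n - {m}. z l * z l)"
    by (rule sum.remove) (use m in auto)
  have nn: "(\<Sum>l\<in>partitions_of n - {m}. z l * z l) \<ge> 0" by (intro sum_nonneg) simp
  have rest: "(\<Sum>l\<in>partitions_of n - {m}. z l * z l) = 0" and "z m * z m = 1" using split nn zm sum1 by linarith+
  then have zm1: "z m = 1" using \<open>z m = int d\<close> by (simp add: zmult_eq_1_iff)
  have z0: "z l = 0" if "l \<in> partitions_of n" "l \<noteq> m" for l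
    using rest that by (subst (asm) sum_nonneg_eq_0_iff) auto
  have "\<psi> \<sigma> = (\<Sum>l\<in>partitions_of n. w l * irr_char l \<sigma>)"
    unfolding w_def by (rule class_fun_expansion[OF cl \<sigma>])
  also have "\<dots> = (\<Sum>l\<in>partitions_of n. if l = m then irr_char m \<sigma> else 0)"
    by (intro sum.cong refl) (auto simp: z zm1 z0)
  also have "\<dots> = irr_char m \<sigma>" using m by simp
  finally show ?thesis by (simp add: \<psi>_def m_def)
qed

subsection \<open>Restriction to point stabilizers\<close>

text \<open>The multiplicity of the trivial character. Unlike \<open>ip\<close> it has a single
  argument, so products of several characters can be regrouped freely.\<close>

definition av :: "nat \<Rightarrow> ((nat \<Rightarrow> nat) \<Rightarrow> complex) \<Rightarrow> complex" where
  "av n f = (\<Sum>\<sigma>\<in>perms n. f \<sigma>) / fact n"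

lemma av_cong: "(\<And>\<sigma>. \<sigma> \<in> perms n \<Longrightarrow> f \<sigma> = g \<sigma>) \<Longrightarrow> av n f = av n g"
  unfolding av_def by (intro arg_cong2[of _ _ _ _ "(/)"] sum.cong refl) auto

lemma av_add: "av n (\<lambda>\<sigma>. f \<sigma> + g \<sigma>) = av n f + av n g"
  by (simp add: av_def sum.distrib add_divide_distrib)

lemma av_diff: "av n (\<lambda>\<sigma>. f \<sigma> - g \<sigma>) = av n f - av n g"
  by (simp add: av_def sum_subtractf diff_divide_distrib)

lemma av_irr: "m \<in> partitions_of n \<Longrightarrow> av n (\<lambda>\<sigma>. f \<sigma> * irr_char m \<sigma>) = ip n f (irr_char m)"
  unfolding av_def ip_def by (intro arg_cong2[of _ _ _ _ "(/)"] sum.cong refl) (simp add: irr_char_inv)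

lemma perms_Suc_subset: "\<sigma> \<in> perms m \<Longrightarrow> \<sigma> \<in> perms (Suc m)"
  using permutes_subset[of \<sigma> "{..<m}" "{..<Suc m}"] by auto

text \<open>Since permutations are functions on all of \<open>nat\<close>, the stabilizer of the
  last point is literally \<open>perms m\<close>, and restricting a character to it requires no
  operation.\<close>

lemma perms_Suc_fix: "{\<sigma> \<in> perms (Suc m). \<sigma> m = m} = perms m"
proof (intro equalityI subsetI)
  fix \<sigma> assume "\<sigma> \<in> {\<sigma> \<in> perms (Suc m). \<sigma> m = m}"
  then have s: "\<sigma> permutes {..<Suc m}" "\<sigma> m = m" by auto
  have "\<sigma> permutes {..<m}"
    by (rule permutes_superset[OF s(1)]) (use s(2) in \<open>auto simp: less_Suc_eq\<close>)
  then show "\<sigma> \<in> perms m" by simp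
next
  fix \<sigma> assume "\<sigma> \<in> perms m"
  then show "\<sigma> \<in> {\<sigma> \<in> perms (Suc m). \<sigma> m = m}" using perms_Suc_subset[of \<sigma> m] by (auto simp: permutes_not_in)
qed

lemma class_fun_restrict: "class_fun (Suc m) f \<Longrightarrow> class_fun m f"
  unfolding class_fun_def using perms_Suc_subset by blast

lemma pc_1: "pc n 1 \<sigma> = (\<Sum>x<n. if \<sigma> x = x then 1 else 0)"
proof -
  have "{A. A \<subseteq> {..<n} \<and> card A = 1 \<and> \<sigma> ` A = A} = (\<lambda>x. {x}) ` {x. x < n \<and> \<sigma> x = x}"
    by (auto simp: card_1_singleton_iff)
  then have "card {A. A \<subseteq> {..<n} \<and> card A = 1 \<and> \<sigma> ` A = A} = card {x. x < n \<and> \<sigma> x = x}"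
    by (simp add: card_image)
  moreover have "(\<Sum>x<n. if \<sigma> x = x then 1 else 0) = (of_nat (card {x. x < n \<and> \<sigma> x = x}) :: complex)"
    by (simp add: sum.If_cases Int_def)
  ultimately show ?thesis by (simp add: pc_def)
qed

lemma pc_0: "pc n 0 \<sigma> = 1"
proof -
  have "{A. A \<subseteq> {..<n} \<and> card A = 0 \<and> \<sigma> ` A = A} = {{}}"
    using finite_subset[of _ "{..<n}"] by (auto simp: card_eq_0_iff)
  then show ?thesis by (simp add: pc_def)
qed

text \<open>Frobenius reciprocity for the permutation character on points. Summing over the fixed
  point x first leaves averages over point stabilizers, all conjugate by transpositions to the
  stabilizer of m.\<close>

lemma av_fixed_points:
  assumes f: "class_fun (Suc m) f"
  shows "av (Suc m) (\<lambda>\<sigma>. f \<sigma> * pc (Suc m) 1 \<sigma>) = av m f"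
proof -
  have "(\<Sum>\<sigma>\<in>perms (Suc m). f \<sigma> * pc (Suc m) 1 \<sigma>) = (\<Sum>\<sigma>\<in>perms (Suc m). \<Sum>x<Suc m. if \<sigma> x = x then f \<sigma> else 0)"
    unfolding pc_1 sum_distrib_left by (intro sum.cong refl) auto
  also have "\<dots> = (\<Sum>x<Suc m. \<Sum>\<sigma>\<in>perms (Suc m). if \<sigma> x = x then f \<sigma> else 0)" by (rule sum.swap)
  also have "\<dots> = (\<Sum>x<Suc m. \<Sum>\<sigma>\<in>perms m. f \<sigma>)"
  proof (rule sum.cong[OF refl])
    fix x assume x: "x \<in> {..<Suc m}"
    define t where "t = transpose x m"
    have t: "t \<in> perms (Suc m)" using x by (auto simp: t_def intro!: permutes_swap_id)
    have it: "inv t = t" by (simp add: t_def)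
    have "(\<Sum>\<sigma>\<in>perms (Suc m). if \<sigma> x = x then f \<sigma> else 0) =
      (\<Sum>\<sigma>\<in>perms (Suc m). if (inv t \<circ> (\<sigma> \<circ> t)) x = x then f (inv t \<circ> (\<sigma> \<circ> t)) else 0)"
      by (rule sum_perms_conj'[OF t, symmetric])
    also have "\<dots> = (\<Sum>\<sigma>\<in>perms (Suc m). if \<sigma> m = m then f \<sigma> else 0)"
    proof (intro sum.cong refl)
      fix \<sigma> assume \<sigma>: "\<sigma> \<in> perms (Suc m)"
      have "(inv t \<circ> (\<sigma> \<circ> t)) x = x \<longleftrightarrow> t (\<sigma> m) = x" by (simp add: it) (simp add: t_def)
      also have "\<dots> \<longleftrightarrow> \<sigma> m = m" by (auto simp: t_def transpose_def split: if_splits)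
      finally show "(if (inv t \<circ> (\<sigma> \<circ> t)) x = x then f (inv t \<circ> (\<sigma> \<circ> t)) else 0) = (if \<sigma> m = m then f \<sigma> else 0)"
        using f \<sigma> t by (simp add: class_fun_def)
    qed
    also have "\<dots> = (\<Sum>\<sigma>\<in>{\<sigma> \<in> perms (Suc m). \<sigma> m = m}. f \<sigma>)" by (rule sum.inter_filter[symmetric]) simp
    finally show "(\<Sum>\<sigma>\<in>perms (Suc m). if \<sigma> x = x then f \<sigma> else 0) = (\<Sum>\<sigma>\<in>perms m. f \<sigma>)"
      unfolding perms_Suc_fix .
  qed
  also have "\<dots> = of_nat (Suc m) * (\<Sum>\<sigma>\<in>perms m. f \<sigma>)" by simp
  finally show ?thesis unfolding av_def by (simp add: field_simps del: of_nat_Suc)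
qed

text \<open>Invariant sets split by whether they contain the fixed point m.\<close>

lemma pc_Suc:
  assumes p: "1 \<le> p" and \<sigma>: "\<sigma> \<in> perms m"
  shows "pc (Suc m) p \<sigma> = pc m p \<sigma> + pc m (p - 1) \<sigma>"
proof -
  have sm: "\<sigma> m = m" using \<sigma> by (simp add: permutes_not_in)
  define X where "X = {A. A \<subseteq> {..<m} \<and> card A = p \<and> \<sigma> ` A = A}"
  define Y where "Y = {A. A \<subseteq> {..<m} \<and> card A = p - 1 \<and> \<sigma> ` A = A}"
  have fin: "finite X" "finite Y" by (rule finite_subset[of _ "Pow {..<m}"], auto simp: X_def Y_def)+
  have "{A. A \<subseteq> {..<Suc m} \<and> card A = p \<and> \<sigma> ` A = A} = X \<union> insert m ` Y"
  proof (intro equalityI subsetI)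
    fix A assume A: "A \<in> {A. A \<subseteq> {..<Suc m} \<and> card A = p \<and> \<sigma> ` A = A}"
    show "A \<in> X \<union> insert m ` Y"
    proof (cases "m \<in> A")
      case False
      then have "A \<subseteq> {..<m}" using A by (auto simp: less_Suc_eq subset_iff)
      then show ?thesis using A by (simp add: X_def)
    next
      case True
      define B where "B = A - {m}"
      have AB: "A = insert m B" "m \<notin> B" using True by (auto simp: B_def)
      have "finite A" using A finite_subset[of A "{..<Suc m}"] by auto
      then have "card B = p - 1" using A True by (simp add: B_def)
      moreover have "B \<subseteq> {..<m}" using A by (auto simp: B_def less_Suc_eq subset_iff)
      moreover have "\<sigma> ` B = B"
      proof -
        have "inj \<sigma>" using \<sigma> permutes_inj by blast
        then have "\<sigma> ` B = \<sigma> ` A - \<sigma> ` {m}" unfolding B_def by (rule image_set_diff)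
        then show ?thesis using A sm by (simp add: B_def)
      qed
      ultimately show ?thesis using AB by (auto simp: Y_def)
    qed
  next
    fix A assume "A \<in> X \<union> insert m ` Y"
    then show "A \<in> {A. A \<subseteq> {..<Suc m} \<and> card A = p \<and> \<sigma> ` A = A}"
    proof
      assume "A \<in> insert m ` Y"
      then obtain B where B: "A = insert m B" "B \<subseteq> {..<m}" "card B = p - 1" "\<sigma> ` B = B" by (auto simp: Y_def)
      have "finite B" "m \<notin> B" using B finite_subset[of B "{..<m}"] by auto
      then show ?thesis using B p sm by (auto simp: less_Suc_eq)
    qed (auto simp: X_def less_Suc_eq)
  qed
  moreover have "card (X \<union> insert m ` Y) = card X + card (insert m ` Y)"
    by (rule card_Un_disjoint) (use fin in \<open>auto simp: X_def Y_def\<close>)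
  moreover have "card (insert m ` Y) = card Y"
    by (rule card_image) (auto simp: inj_on_def Y_def insert_eq_iff)
  ultimately show ?thesis by (simp add: pc_def X_def Y_def)
qed

text \<open>Branching rule, obtained from \<open>pc_Suc\<close> by taking differences.
  \<open>2 \<le> p\<close> keeps p - 1 within the range of \<open>two_row_char\<close>.\<close>

lemma two_row_restrict:
  assumes p: "2 \<le> p" "2 * p \<le> m" and \<sigma>: "\<sigma> \<in> perms m"
  shows "irr_char [Suc m - p, p] \<sigma> = irr_char [m - p, p] \<sigma> + irr_char [m - (p - 1), p - 1] \<sigma>"
proof -
  have "irr_char [Suc m - p, p] \<sigma> = pc (Suc m) p \<sigma> - pc (Suc m) (p - 1) \<sigma>"
    by (rule two_row_char[OF _ _ perms_Suc_subset[OF \<sigma>]]) (use p in auto)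
  moreover have "irr_char [m - p, p] \<sigma> = pc m p \<sigma> - pc m (p - 1) \<sigma>"
    by (rule two_row_char[OF _ _ \<sigma>]) (use p in auto)
  moreover have "irr_char [m - (p - 1), p - 1] \<sigma> = pc m (p - 1) \<sigma> - pc m (p - 1 - 1) \<sigma>"
    by (rule two_row_char[OF _ _ \<sigma>]) (use p in auto)
  moreover have "pc (Suc m) p \<sigma> = pc m p \<sigma> + pc m (p - 1) \<sigma>" by (rule pc_Suc[OF _ \<sigma>]) (use p in simp)
  moreover have "pc (Suc m) (p - 1) \<sigma> = pc m (p - 1) \<sigma> + pc m (p - 1 - 1) \<sigma>" by (rule pc_Suc[OF _ \<sigma>]) (use p in simp)
  ultimately show ?thesis by simp
qed

lemma av_two_row:
  assumes "1 \<le> p" "2 * p \<le> n" "1 \<le> q" "2 * q \<le> n"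
  shows "av n (\<lambda>\<sigma>. irr_char [n - p, p] \<sigma> * irr_char [n - q, q] \<sigma>) = (if p = q then 1 else 0)"
  using av_irr[OF two_row_partition[OF assms(3,4)], of "irr_char [n - p, p]"]
    ip_irr_char[OF two_row_partition[OF assms(1,2)] two_row_partition[OF assms(3,4)]] assms by auto

lemma av_two_row_restrict:
  assumes p: "2 \<le> p" "2 * p \<le> m" and q: "2 \<le> q" "2 * q \<le> m"
  shows "av m (\<lambda>\<sigma>. irr_char [Suc m - p, p] \<sigma> * irr_char [Suc m - q, q] \<sigma>) =
    (if p = q then 2 else if p = q + 1 \<or> q = p + 1 then 1 else 0)"
proof -
  have "av m (\<lambda>\<sigma>. irr_char [Suc m - p, p] \<sigma> * irr_char [Suc m - q, q] \<sigma>) =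
    av m (\<lambda>\<sigma>. irr_char [m - p, p] \<sigma> * irr_char [m - q, q] \<sigma> + irr_char [m - p, p] \<sigma> * irr_char [m - (q - 1), q - 1] \<sigma> +
      (irr_char [m - (p - 1), p - 1] \<sigma> * irr_char [m - q, q] \<sigma> + irr_char [m - (p - 1), p - 1] \<sigma> * irr_char [m - (q - 1), q - 1] \<sigma>))"
    by (rule av_cong) (simp only: two_row_restrict[OF p] two_row_restrict[OF q] ring_distribs add_ac)
  also have "\<dots> = (if p = q then 1 else 0) + (if p = q - 1 then 1 else 0) + ((if p - 1 = q then 1 else 0) + (if p - 1 = q - 1 then 1 else 0))"
    unfolding av_add by (intro arg_cong2[of _ _ _ _ "(+)"] av_two_row) (use p q in auto)
  also have "\<dots> = (if p = q then 2 else if p = q + 1 \<or> q = p + 1 then 1 else 0)"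
  proof -
    obtain p' q' where "p = Suc p'" "q = Suc q'" using p q by (metis Suc_le_D numeral_2_eq_2)
    then show ?thesis by auto
  qed
  finally show ?thesis .
qed

text \<open>Restricting twice gives \<open>b p\<close> + 2 \<open>b (p - 1)\<close> +
  \<open>b (p - 2)\<close>, of norm 1 + 4 + 1.\<close>

lemma av_two_row_restrict2:
  assumes p: "3 \<le> p" "2 * p \<le> m"
  shows "av m (\<lambda>\<sigma>. irr_char [Suc (Suc m) - p, p] \<sigma> * irr_char [Suc (Suc m) - p, p] \<sigma>) = 6"
proof -
  define b where "b q = irr_char [m - q, q]" for q
  have X: "irr_char [Suc (Suc m) - p, p] \<sigma> = b p \<sigma> + b (p - 1) \<sigma> + (b (p - 1) \<sigma> + b (p - 2) \<sigma>)" if "\<sigma> \<in> perms m" for \<sigma>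
  proof -
    have "irr_char [Suc (Suc m) - p, p] \<sigma> = irr_char [Suc m - p, p] \<sigma> + irr_char [Suc m - (p - 1), p - 1] \<sigma>"
      by (rule two_row_restrict[OF _ _ perms_Suc_subset[OF that]]) (use p in auto)
    also have "irr_char [Suc m - p, p] \<sigma> = b p \<sigma> + b (p - 1) \<sigma>"
      unfolding b_def by (rule two_row_restrict[OF _ _ that]) (use p in auto)
    also have "irr_char [Suc m - (p - 1), p - 1] \<sigma> = b (p - 1) \<sigma> + b (p - 1 - 1) \<sigma>"
      unfolding b_def by (rule two_row_restrict[OF _ _ that]) (use p in auto)
    finally show ?thesis by (simp add: numeral_2_eq_2)
  qed
  have bb: "av m (\<lambda>\<sigma>. b q \<sigma> * b q' \<sigma>) = (if q = q' then 1 else 0)" if "q \<in> {p, p - 1, p - 2}" "q' \<in> {p, p - 1, p - 2}" for q q'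
    unfolding b_def by (rule av_two_row) (use p that in auto)
  have "av m (\<lambda>\<sigma>. irr_char [Suc (Suc m) - p, p] \<sigma> * irr_char [Suc (Suc m) - p, p] \<sigma>) =
    av m (\<lambda>\<sigma>. (b p \<sigma> + b (p - 1) \<sigma> + (b (p - 1) \<sigma> + b (p - 2) \<sigma>)) * (b p \<sigma> + b (p - 1) \<sigma> + (b (p - 1) \<sigma> + b (p - 2) \<sigma>)))"
    by (rule av_cong) (simp only: X)
  also have "\<dots> = 6"
  proof -
    have ne: "p - 1 \<noteq> p" "p - 2 \<noteq> p" "p - 1 \<noteq> p - 2" "p \<noteq> p - 1" "p \<noteq> p - 2" "p - 2 \<noteq> p - 1" using p by auto
    show ?thesis unfolding ring_distribs av_add by (simp add: bb ne del: One_nat_def)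
  qed
  finally show ?thesis .
qed

section \<open>The product with the character of (n - 1, 1)\<close>

lemma kr_hook_le_1:
  assumes p: "3 \<le> p" "2 * p + 4 \<le> n" and h: "pt n h"
  shows "kr n (rl [n - p, p]) (rl [n - 1, 1]) h \<le> 1"
proof -
  obtain m where m: "n = Suc (Suc m)" using p by (intro that[of "n - 2"]) linarith
  define X where "X = irr_char [n - p, p]"
  define Y where "Y = irr_char [n - 1, 1]"
  define \<pi> where "\<pi> = pc n 1"
  have part: "[n - q, q] \<in> partitions_of n" if "1 \<le> q" "q \<le> p + 1" for q
    by (rule two_row_partition) (use that p in auto)
  have pX: "[n - p, p] \<in> partitions_of n" and pY: "[n - 1, 1] \<in> partitions_of n" using part p by auto
  have clX: "class_fun n X" unfolding X_def by (rule class_fun_irr_char[OF pX])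
  have cl\<pi>: "class_fun n \<pi>" unfolding \<pi>_def by (rule class_fun_pc) (use p in simp)
  have Y: "Y \<sigma> = \<pi> \<sigma> - 1" if "\<sigma> \<in> perms n" for \<sigma>
    unfolding Y_def \<pi>_def using two_row_char[of 1 n \<sigma>] p that by (simp add: pc_0)
  have fix1: "av n (\<lambda>\<sigma>. f \<sigma> * \<pi> \<sigma>) = av (Suc m) f" if "class_fun n f" for f
    unfolding \<pi>_def m by (rule av_fixed_points) (use that m in simp)
  define F where "F = (\<lambda>\<sigma>. X \<sigma> * Y \<sigma>)"
  define g where "g l = kr n (rl [n - p, p]) (rl [n - 1, 1]) (rl l)" for l
  have gip: "ip n F (irr_char l) = of_nat (g l)" if "l \<in> partitions_of n" for l
    unfolding F_def X_def Y_def g_def by (rule kr_ip[OF pX pY that])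
  have clF: "class_fun n F" unfolding F_def Y_def by (intro class_fun_mult clX class_fun_irr_char pY)
  have XX: "class_fun n (\<lambda>\<sigma>. X \<sigma> * X \<sigma>)" by (intro class_fun_mult clX)
  have XX1: "av (Suc m) (\<lambda>\<sigma>. X \<sigma> * X \<sigma>) = 2"
    unfolding X_def m by (subst av_two_row_restrict) (use p m in auto)
  have XX2: "av m (\<lambda>\<sigma>. X \<sigma> * X \<sigma>) = 6"
    unfolding X_def m by (rule av_two_row_restrict2) (use p m in auto)
  have XX0: "av n (\<lambda>\<sigma>. X \<sigma> * X \<sigma>) = 1"
    unfolding X_def by (subst av_two_row) (use p in auto)
  \<comment> \<open>The first \<pi> restricts to \<open>Suc m\<close> points; there the second one
    is the number of fixed points among them plus 1. This gives 6 + 2.\<close>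
  have "av n (\<lambda>\<sigma>. (X \<sigma> * X \<sigma> * \<pi> \<sigma>) * \<pi> \<sigma>) = av (Suc m) (\<lambda>\<sigma>. X \<sigma> * X \<sigma> * \<pi> \<sigma>)"
    by (rule fix1) (intro class_fun_mult clX cl\<pi>)
  also have "\<dots> = av (Suc m) (\<lambda>\<sigma>. X \<sigma> * X \<sigma> * pc (Suc m) 1 \<sigma> + X \<sigma> * X \<sigma>)"
  proof (rule av_cong)
    fix \<sigma> assume "\<sigma> \<in> perms (Suc m)"
    then have "\<pi> \<sigma> = pc (Suc m) 1 \<sigma> + 1" unfolding \<pi>_def m using pc_Suc[of 1 \<sigma> "Suc m"] by (simp add: pc_0)
    then show "X \<sigma> * X \<sigma> * \<pi> \<sigma> = X \<sigma> * X \<sigma> * pc (Suc m) 1 \<sigma> + X \<sigma> * X \<sigma>" by (simp add: algebra_simps)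
  qed
  also have "\<dots> = av m (\<lambda>\<sigma>. X \<sigma> * X \<sigma>) + av (Suc m) (\<lambda>\<sigma>. X \<sigma> * X \<sigma>)"
    unfolding av_add using av_fixed_points[OF class_fun_restrict[OF XX[unfolded m]]] by simp
  finally have XXpp: "av n (\<lambda>\<sigma>. (X \<sigma> * X \<sigma> * \<pi> \<sigma>) * \<pi> \<sigma>) = 8" by (simp add: XX1 XX2)
  have XXp: "av n (\<lambda>\<sigma>. X \<sigma> * X \<sigma> * \<pi> \<sigma>) = 2" using fix1[OF XX] XX1 by simp
  \<comment> \<open>With Y = \<pi> - 1 the norm is 8 - 2 - 2 + 1.\<close>
  have "ip n F F = av n (\<lambda>\<sigma>. F \<sigma> * F \<sigma>)"
    unfolding ip_def av_def F_def X_def Y_def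
    by (intro arg_cong2[of _ _ _ _ "(/)"] sum.cong refl) (simp only: irr_char_inv[OF pX] irr_char_inv[OF pY])
  also have "\<dots> = av n (\<lambda>\<sigma>. (X \<sigma> * X \<sigma> * \<pi> \<sigma>) * \<pi> \<sigma> - X \<sigma> * X \<sigma> * \<pi> \<sigma> - X \<sigma> * X \<sigma> * \<pi> \<sigma> + X \<sigma> * X \<sigma>)"
    by (rule av_cong) (simp add: F_def Y algebra_simps)
  also have "\<dots> = 5" unfolding av_add av_diff by (simp add: XXpp XXp XX0)
  finally have "(\<Sum>l\<in>partitions_of n. of_nat (g l) * of_nat (g l)) = (5 :: complex)"
    using parseval[OF clF, of F] by (simp add: gip)
  then have "of_nat (\<Sum>l\<in>partitions_of n. g l * g l) = (of_nat 5 :: complex)" by simp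
  then have sum5: "(\<Sum>l\<in>partitions_of n. g l * g l) = 5" by (simp only: of_nat_eq_iff)
  \<comment> \<open>Pairing with \<pi> minus pairing with 1: this is 2 - 1 for q = p and 1 - 0 for
    the two neighbours.\<close>
  have g1: "g [n - q, q] = 1" if q: "q \<in> {p - 1, p, p + 1}" for q
  proof -
    have qb: "2 \<le> q" "q \<le> p + 1" "2 * q \<le> Suc m" using q p m by auto
    define V where "V = irr_char [n - q, q]"
    have pV: "[n - q, q] \<in> partitions_of n" using part qb by simp
    have "of_nat (g [n - q, q]) = av n (\<lambda>\<sigma>. F \<sigma> * V \<sigma>)" unfolding V_def using av_irr[OF pV, of F] gip[OF pV] by simp
    also have "\<dots> = av n (\<lambda>\<sigma>. X \<sigma> * V \<sigma> * \<pi> \<sigma> - X \<sigma> * V \<sigma>)"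
      by (rule av_cong) (simp add: F_def Y algebra_simps)
    also have "\<dots> = av (Suc m) (\<lambda>\<sigma>. X \<sigma> * V \<sigma>) - av n (\<lambda>\<sigma>. X \<sigma> * V \<sigma>)"
      unfolding av_diff using fix1[of "\<lambda>\<sigma>. X \<sigma> * V \<sigma>"] class_fun_mult[OF clX class_fun_irr_char[OF pV]] by (simp add: V_def)
    also have "av (Suc m) (\<lambda>\<sigma>. X \<sigma> * V \<sigma>) = (if p = q then 2 else if p = q + 1 \<or> q = p + 1 then 1 else 0)"
      unfolding X_def V_def m by (rule av_two_row_restrict) (use p qb m in auto)
    also have "av n (\<lambda>\<sigma>. X \<sigma> * V \<sigma>) = (if p = q then 1 else 0)"
      unfolding X_def V_def by (rule av_two_row) (use p qb m in auto)
    also have "(if p = q then 2 else if p = q + 1 \<or> q = p + 1 then 1 else 0) - (if p = q then 1 else 0) = (of_nat 1 :: complex)"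
      using q p by auto
    finally show ?thesis by (simp only: of_nat_eq_iff)
  qed
  define S where "S = (\<lambda>q. [n - q, q]) ` {p - 1, p, p + 1}"
  have inj: "inj_on (\<lambda>q. [n - q, q]) {p - 1, p, p + 1}" by (auto simp: inj_on_def)
  have Ssub: "S \<subseteq> partitions_of n"
  proof
    fix l assume "l \<in> S"
    then obtain q where q: "q \<in> {p - 1, p, p + 1}" "l = [n - q, q]" unfolding S_def by blast
    show "l \<in> partitions_of n" unfolding q(2) by (rule part) (use q(1) p in auto)
  qed
  have "(\<Sum>l\<in>S. g l * g l) = (\<Sum>q\<in>{p - 1, p, p + 1}. g [n - q, q] * g [n - q, q])"
    unfolding S_def by (simp only: sum.reindex[OF inj] o_def)
  also have "\<dots> = (\<Sum>q\<in>{p - 1, p, p + 1}. 1)" by (intro sum.cong refl) (simp only: g1 mult_1)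
  also have "\<dots> = 3"
  proof -
    obtain t where "p = Suc t" using p by (cases p) auto
    then show ?thesis by simp
  qed
  finally have S3: "(\<Sum>l\<in>S. g l * g l) = 3" .
  \<comment> \<open>5 - 3 is left, whereas a further multiplicity of 2 would contribute 4.\<close>
  have rest: "(\<Sum>l\<in>partitions_of n - S. g l * g l) = 2"
    using sum.subset_diff[OF Ssub finite_partitions_of, of "\<lambda>l. g l * g l"] sum5 S3 by simp
  obtain l where l: "l \<in> partitions_of n" "rl l = h" using pt_list[OF h] by blast
  have "g l \<le> 1"
  proof (cases "l \<in> S")
    case True
    then obtain q where q: "q \<in> {p - 1, p, p + 1}" "l = [n - q, q]" unfolding S_def by blast
    show ?thesis unfolding q(2) g1[OF q(1)] ..
  next
    case False
    have "g l * g l \<le> (\<Sum>l\<in>partitions_of n - S. g l * g l)"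
      by (rule member_le_sum) (use False l in auto)
    then have "g l * g l \<le> 2" using rest by simp
    then show ?thesis
    proof (rule contrapos_pp)
      assume "\<not> g l \<le> 1"
      then have "2 * 2 \<le> g l * g l" by (intro mult_le_mono) auto
      then show "\<not> g l * g l \<le> 2" by simp
    qed
  qed
  then show ?thesis by (simp add: g_def l)
qed

section \<open>Linear independence of Schur functions\<close>

lemma finite_cells: "finite (cells l)"
proof (rule finite_subset)
  show "cells l \<subseteq> (SIGMA i:{..<length l}. {..<l ! i})" by (auto simp: cells_def)
qed auto

lemma card_cells_rows: "card {c \<in> cells l. fst c < k} = (\<Sum>i<k. rl l i)"
proof -
  have "{c \<in> cells l. fst c < k} = (SIGMA i:{..<k}. {..<rl l i})"
    by (auto simp: cells_def rl_def split: if_splits)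
  then show ?thesis by simp
qed

lemma ssyt_ge_row:
  assumes l: "is_partition l" and T: "T \<in> ssyt l"
  shows "(i, j) \<in> cells l \<Longrightarrow> i \<le> T (i, j)"
proof (induction i)
  case (Suc i)
  have "(i, j) \<in> cells l" using Suc.prems partition_nth_mono[OF l, of i "Suc i"] by (auto simp: cells_def)
  then have "i \<le> T (i, j)" by (rule Suc.IH)
  also have "T (i, j) < T (Suc i, j)" using T Suc.prems by (auto simp: ssyt_def)
  finally show ?case by simp
qed simp

lemma content_less: "card {c \<in> cells l. T c < k} = (\<Sum>i<k. Defs.content l T i)"
proof -
  have "{c \<in> cells l. T c < k} = (\<Union>i<k. {c \<in> cells l. T c = i})" by auto
  also have "card (\<Union>i<k. {c \<in> cells l. T c = i}) = (\<Sum>i<k. card {c \<in> cells l. T c = i})"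
    by (rule card_UN_disjoint) (auto simp: finite_cells)
  finally show ?thesis by (simp add: Defs.content_def)
qed

text \<open>Columns increase strictly, so an entry in row i is at least i; hence all entries below k
  lie in the first k rows.\<close>

lemma schur_dom:
  assumes l: "is_partition l" and e: "schur l e \<noteq> 0"
  shows "dom e (rl l)"
proof -
  have "{T \<in> ssyt l. Defs.content l T = e} \<noteq> {}" using e unfolding schur_def by (metis card.empty of_nat_0)
  then obtain T where T: "T \<in> ssyt l" "Defs.content l T = e" by blast
  have "(\<Sum>i<k. e i) \<le> (\<Sum>i<k. rl l i)" for k
  proof -
    have "(\<Sum>i<k. e i) = card {c \<in> cells l. T c < k}" using content_less[of l T k] T(2) by simp
    also have "\<dots> \<le> card {c \<in> cells l. fst c < k}"
    proof (rule card_mono)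
      show "{c \<in> cells l. T c < k} \<subseteq> {c \<in> cells l. fst c < k}"
      proof clarify
        fix i j assume "(i, j) \<in> cells l" "T (i, j) < k"
        then show "fst (i, j) < k" using ssyt_ge_row[OF l T(1), of i j] by simp
      qed
    qed (simp add: finite_cells)
    finally show ?thesis by (simp add: card_cells_rows)
  qed
  then show ?thesis by (simp add: dom_def)
qed

lemma schur_self:
  assumes l: "is_partition l"
  shows "schur l (rl l) \<noteq> 0"
proof -
  \<comment> \<open>The tableau whose i-th row is filled with i.\<close>
  define T where "T c = (if c \<in> cells l then fst c else 0)" for c :: "nat \<times> nat"
  have "T \<in> ssyt l"
    unfolding ssyt_def
  proof (intro CollectI conjI allI impI)
    fix i j assume a: "(i, Suc j) \<in> cells l"
    then have "(i, j) \<in> cells l" by (auto simp: cells_def)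
    then show "T (i, j) \<le> T (i, Suc j)" using a by (simp add: T_def)
  next
    fix i j assume a: "(Suc i, j) \<in> cells l"
    then have "(i, j) \<in> cells l" using partition_nth_mono[OF l, of i "Suc i"] by (auto simp: cells_def)
    then show "T (i, j) < T (Suc i, j)" using a by (simp add: T_def)
  qed (simp add: T_def)
  moreover have "Defs.content l T = rl l"
  proof
    fix k
    have "{c \<in> cells l. T c = k} = (\<lambda>j. (k, j)) ` {..<rl l k}"
      by (auto simp: T_def cells_def rl_def split: if_splits)
    then show "Defs.content l T k = rl l k" by (simp add: Defs.content_def card_image inj_on_def)
  qed
  ultimately have ne: "T \<in> {T \<in> ssyt l. Defs.content l T = rl l}" by simp
  \<comment> \<open>An infinite set would have \<open>card\<close> 0. The prescribed content keeps
    all entries below \<open>length l\<close>.\<close>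
  have "finite {T \<in> ssyt l. Defs.content l T = rl l}"
  proof (rule finite_subset)
    show "{T \<in> ssyt l. Defs.content l T = rl l} \<subseteq> {T. \<forall>c. (c \<in> cells l \<longrightarrow> T c \<in> {..<length l}) \<and> (c \<notin> cells l \<longrightarrow> T c = 0)}"
    proof clarify
      fix T i j assume T: "T \<in> ssyt l" "Defs.content l T = rl l"
      have "T c < length l" if c: "c \<in> cells l" for c
      proof (rule ccontr)
        assume "\<not> T c < length l"
        then have "Defs.content l T (T c) = 0" using T(2) by (simp add: rl_def)
        then have "{d \<in> cells l. T d = T c} = {}" using finite_cells by (simp add: Defs.content_def)
        then show False using c by blast
      qed
      then show "((i, j) \<in> cells l \<longrightarrow> T (i, j) \<in> {..<length l}) \<and> ((i, j) \<notin> cells l \<longrightarrow> T (i, j) = 0)"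
        using T(1) by (auto simp: ssyt_def)
    qed
    show "finite {T. \<forall>c. (c \<in> cells l \<longrightarrow> T c \<in> {..<length l}) \<and> (c \<notin> cells l \<longrightarrow> T c = (0::nat))}"
      by (rule finite_set_of_finite_funs[OF finite_cells]) simp
  qed
  then have "card {T \<in> ssyt l. Defs.content l T = rl l} \<noteq> 0" using ne by (metis card_0_eq empty_iff)
  then show ?thesis by (simp only: schur_def of_nat_eq_0_iff not_False_eq_True)
qed

text \<open>Triangularity: among the shapes with nonzero coefficient choose m maximal for dominance;
  by \<open>schur_dom\<close> the monomial with exponents \<open>rl m\<close> occurs in none of the
  others.\<close>

lemma schur_independent:
  assumes fin: "finite S" and part: "\<And>\<nu>. \<nu> \<in> S \<Longrightarrow> is_partition \<nu>"
    and zero: "\<And>e. (\<Sum>\<nu>\<in>S. d \<nu> * schur \<nu> e) = 0" and \<nu>: "\<nu> \<in> S"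
  shows "d \<nu> = 0"
proof (rule ccontr)
  assume "d \<nu> \<noteq> 0"
  define S' where "S' = {\<nu> \<in> S. d \<nu> \<noteq> 0}"
  have S': "finite S'" "S' \<noteq> {}" using fin \<nu> \<open>d \<nu> \<noteq> 0\<close> by (auto simp: S'_def)
  have "finite (length ` S)" using fin by simp
  then obtain K where K: "\<And>\<nu>. \<nu> \<in> S \<Longrightarrow> length \<nu> < K"
    unfolding finite_nat_set_iff_bounded by auto
  \<comment> \<open>The sum of all partial sums refines dominance to numbers: if \<open>rl m\<close>
    is dominated by \<open>rl \<nu>\<close> and the two values agree, so do all partial sums. Beyond
    K all rows are empty.\<close>
  define M where "M \<nu> = (\<Sum>k<Suc K. \<Sum>i<k. rl \<nu> i)" for \<nu>
  obtain m where m: "m \<in> S'" "\<And>\<nu>. \<nu> \<in> S' \<Longrightarrow> M \<nu> \<le> M m"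
    using finite_has_maximal[of "M ` S'"] S' by (metis (no_types, lifting) finite_imageI image_iff image_is_empty nle_le)
  have only: "\<nu> = m" if v: "\<nu> \<in> S'" and nz: "schur \<nu> (rl m) \<noteq> 0" for \<nu>
  proof -
    have S: "\<nu> \<in> S" "m \<in> S" using v m(1) by (auto simp: S'_def)
    have dm: "dom (rl m) (rl \<nu>)" by (rule schur_dom[OF part[OF S(1)] nz])
    have "M m = M \<nu>"
    proof (rule antisym)
      show "M m \<le> M \<nu>" unfolding M_def by (rule sum_mono) (use dm in \<open>simp add: dom_def\<close>)
      show "M \<nu> \<le> M m" by (rule m(2)[OF v])
    qed
    then have eq: "(\<Sum>i<k. rl m i) = (\<Sum>i<k. rl \<nu> i)" if "k < Suc K" for k
      unfolding M_def by (rule sum_mono_inv) (use dm that in \<open>auto simp: dom_def\<close>)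
    have "rl m k = rl \<nu> k" for k
    proof (cases "k < K")
      case True
      then show ?thesis using eq[of k] eq[of "Suc k"] by simp
    next
      case False
      then show ?thesis using K[OF S(1)] K[OF S(2)] by (simp add: rl_def)
    qed
    then show ?thesis using rl_inj[OF part[OF S(1)] part[OF S(2)]] by (metis ext)
  qed
  have mS: "m \<in> S" using m(1) by (simp add: S'_def)
  have "0 = (\<Sum>\<nu>\<in>S. d \<nu> * schur \<nu> (rl m))" using zero by simp
  also have "\<dots> = (\<Sum>\<nu>\<in>S. if \<nu> = m then d m * schur m (rl m) else 0)"
  proof (rule sum.cong[OF refl])
    fix \<nu> assume "\<nu> \<in> S"
    then show "d \<nu> * schur \<nu> (rl m) = (if \<nu> = m then d m * schur m (rl m) else 0)"
      using only[of \<nu>] by (cases "d \<nu> = 0") (auto simp: S'_def)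
  qed
  also have "\<dots> = d m * schur m (rl m)" using fin mS by simp
  finally show False using schur_self[OF part[OF mS]] m(1) by (simp add: S'_def)
qed

text \<open>Schur expansions are unique by \<open>schur_independent\<close>, so an expansion with
  coefficients 0 and 1 must be the defining one.\<close>

lemma multiplicity_free_iff:
  assumes l: "l \<in> partitions_of n" and m: "m \<in> partitions_of n"
  shows "multiplicity_free (kronecker_product l m) \<longleftrightarrow> (\<forall>\<nu>\<in>partitions_of n. kronecker_coeff l m \<nu> \<in> {0, 1})"
proof -
  define g where "g = kronecker_coeff l m"
  have g0: "g \<nu> = 0" if "\<nu> \<notin> partitions_of n" for \<nu> using that kronecker_coeff_eq[OF l m] by (simp add: g_def)
  have sl: "sum_list l = n" using l by (simp add: partitions_of_def)
  have F: "kronecker_product l m e = (\<Sum>\<nu>\<in>partitions_of n. g \<nu> * schur \<nu> e)" for e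
    by (simp add: kronecker_product_def sl g_def)
  show ?thesis
  proof
    assume "multiplicity_free (kronecker_product l m)"
    then obtain c where c: "schur_expansion (kronecker_product l m) c" "\<And>\<nu>. c \<nu> \<in> {0, 1}" by (auto simp: multiplicity_free_def)
    have fin: "finite {\<nu>. c \<nu> \<noteq> 0}" and part: "\<And>\<nu>. c \<nu> \<noteq> 0 \<Longrightarrow> is_partition \<nu>"
      and Fc: "kronecker_product l m e = (\<Sum>\<nu> | c \<nu> \<noteq> 0. c \<nu> * schur \<nu> e)" for e
      using c(1) by (auto simp: schur_expansion_def)
    \<comment> \<open>A priori \<open>c\<close> may involve partitions of other numbers, so the
      expansions are compared on the union of both supports.\<close>
    define S where "S = partitions_of n \<union> {\<nu>. c \<nu> \<noteq> 0}"
    have finS: "finite S" using fin by (simp add: S_def)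
    have "g \<nu> - c \<nu> = 0" if "\<nu> \<in> S" for \<nu>
    proof (rule schur_independent[OF finS _ _ that, where d = "\<lambda>\<nu>. g \<nu> - c \<nu>"])
      show "is_partition \<nu>" if "\<nu> \<in> S" for \<nu> using that part by (auto simp: S_def partitions_of_def)
      fix e
      have "(\<Sum>\<nu>\<in>S. g \<nu> * schur \<nu> e) = (\<Sum>\<nu>\<in>partitions_of n. g \<nu> * schur \<nu> e)"
        by (rule sum.mono_neutral_right[OF finS]) (auto simp: S_def g0)
      moreover have "(\<Sum>\<nu>\<in>S. c \<nu> * schur \<nu> e) = (\<Sum>\<nu> | c \<nu> \<noteq> 0. c \<nu> * schur \<nu> e)"
        by (rule sum.mono_neutral_right[OF finS]) (auto simp: S_def)
      ultimately show "(\<Sum>\<nu>\<in>S. (g \<nu> - c \<nu>) * schur \<nu> e) = 0"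
        using F[of e] Fc[of e] by (simp add: left_diff_distrib sum_subtractf)
    qed
    then have "g \<nu> = c \<nu>" if "\<nu> \<in> partitions_of n" for \<nu> using that by (simp add: S_def)
    then show "\<forall>\<nu>\<in>partitions_of n. kronecker_coeff l m \<nu> \<in> {0, 1}" using c(2) by (simp add: g_def[symmetric])
  next
    assume g01: "\<forall>\<nu>\<in>partitions_of n. kronecker_coeff l m \<nu> \<in> {0, 1}"
    have sub: "{\<nu>. g \<nu> \<noteq> 0} \<subseteq> partitions_of n" using g0 by blast
    have "schur_expansion (kronecker_product l m) g"
      unfolding schur_expansion_def
    proof (intro conjI allI impI)
      show "finite {\<nu>. g \<nu> \<noteq> 0}" by (rule finite_subset[OF sub finite_partitions_of])
      show "is_partition \<nu>" if "g \<nu> \<noteq> 0" for \<nu> using that sub by (auto simp: partitions_of_def)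
      show "kronecker_product l m = (\<lambda>e. \<Sum>\<nu> | g \<nu> \<noteq> 0. g \<nu> * schur \<nu> e)"
        by (rule ext, unfold F, rule sum.mono_neutral_right) (use sub in auto)
    qed
    moreover have "g \<nu> \<in> {0, 1}" for \<nu> using g01 g0 by (cases "\<nu> \<in> partitions_of n") (auto simp: g_def)
    ultimately show "multiplicity_free (kronecker_product l m)" by (auto simp: multiplicity_free_def)
  qed
qed

lemma multiplicity_free_iff_kr:
  assumes l: "l \<in> partitions_of n" and m: "m \<in> partitions_of n"
  shows "multiplicity_free (kronecker_product l m) \<longleftrightarrow> (\<forall>h. pt n h \<longrightarrow> kr n (rl l) (rl m) h \<le> 1)"
proof -
  have "kronecker_coeff l m \<nu> \<in> {0, 1} \<longleftrightarrow> kr n (rl l) (rl m) (rl \<nu>) \<le> 1" if \<nu>: "\<nu> \<in> partitions_of n" for \<nu>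
  proof -
    have "kronecker_coeff l m \<nu> = of_nat (kr n (rl l) (rl m) (rl \<nu>))"
      using kronecker_coeff_eq[OF l m, of \<nu>] kr_ip[OF l m \<nu>] \<nu> by simp
    then have "kronecker_coeff l m \<nu> \<in> {0, 1} \<longleftrightarrow> kr n (rl l) (rl m) (rl \<nu>) = 0 \<or> kr n (rl l) (rl m) (rl \<nu>) = 1"
      by (metis insertCI insertE of_nat_0 of_nat_1 of_nat_eq_iff singletonD)
    then show ?thesis by linarith
  qed
  then show ?thesis unfolding multiplicity_free_iff[OF l m] using pt_list[of n] pt_rl[of _ n] by metis
qed

section \<open>The classification\<close>

lemma conjf_onerow: "conjf (rl [n]) = rl (replicate n 1)"
proof
  fix j
  have "{i. j < rl [n] i} = (if j < n then {0} else {})" by (auto simp: rl_def split: if_splits)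
  then show "conjf (rl [n]) j = rl (replicate n 1) j" by (simp add: conjf_def rl_def)
qed

lemma conjf_hook:
  assumes "n \<ge> 2"
  shows "conjf (rl [n - 1, 1]) = rl (2 # replicate (n - 2) 1)"
proof
  fix j
  have "{i. j < rl [n - 1, 1] i} = (if j = 0 then {0, 1} else if j < n - 1 then {0} else {})"
  proof -
    have "j < rl [n - 1, 1] i \<longleftrightarrow> i = 0 \<and> j < n - 1 \<or> i = 1 \<and> j = 0" for i
      by (cases i; cases "i - 1") (auto simp: rl_def)
    then have e: "{i. j < rl [n - 1, 1] i} = {i. i = 0 \<and> j < n - 1 \<or> i = 1 \<and> j = 0}" by (intro Collect_cong)
    show ?thesis unfolding e using assms by auto
  qed
  then show "conjf (rl [n - 1, 1]) j = rl (2 # replicate (n - 2) 1) j"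
    using assms by (cases j) (auto simp: conjf_def rl_Cons, auto simp: rl_def)
qed

lemma pt_short:
  assumes f: "pt n f" and "f 1 \<le> 1" "f 2 = 0"
  shows "f = rl [n] \<or> f = rl [n - 1, 1]"
proof -
  obtain N where N: "\<forall>i\<ge>N. f i = 0" "(\<Sum>i<N. f i) = n" and anti: "antimono f" using f by (auto simp: pt_def)
  have z: "f i = 0" if "i \<ge> 2" for i using antimonoD[OF anti that] assms(3) by simp
  have "(\<Sum>i<N. f i) = (\<Sum>i<N + 2. f i)" by (rule sum.mono_neutral_left) (use N in auto)
  also have "\<dots> = (\<Sum>i<2. f i)" by (rule sum.mono_neutral_right) (use z in auto)
  finally have s: "f 0 + f 1 = n" unfolding sum_lessThan_2 using N(2) by simp
  have "f = rl [f 0, f 1]"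
  proof
    fix i :: nat
    consider "i = 0" | "i = 1" | "i \<ge> 2" by linarith
    then show "f i = rl [f 0, f 1] i" by cases (auto simp: rl_def z)
  qed
  moreover have "f 1 = 0 \<or> f 1 = 1" using assms(2) by linarith
  moreover have "rl [f 0, 0] = rl [f 0]" by (simp add: rl_onerow)
  ultimately show ?thesis using s by (metis add.right_neutral add_diff_cancel_right')
qed

lemma kr_trivial_le_1:
  assumes f: "pt n f" and h: "pt n h"
  shows "kr n f (rl [n]) h \<le> 1"
proof -
  obtain l m k where l: "l \<in> partitions_of n" "rl l = f" and m: "m \<in> partitions_of n" "rl m = onerow n"
    and k: "k \<in> partitions_of n" "rl k = h" using pt_list[OF f] pt_list[OF pt_onerow] pt_list[OF h] by metis
  have "of_nat (kr n f (rl [n]) h) = ip n (\<lambda>\<sigma>. irr_char l \<sigma> * irr_char m \<sigma>) (irr_char k)"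
    using kr_ip[OF l(1) m(1) k(1)] l m k by (simp add: rl_onerow)
  also have "\<dots> = ip n (irr_char l) (irr_char k)"
    by (rule ip_cong) (use irr_char_onerow[OF m] in auto)
  also have "\<dots> = of_nat (if l = k then 1 else 0)" using ip_irr_char[OF l(1) k(1)] by simp
  finally have "kr n f (rl [n]) h = (if l = k then 1 else 0)" by (simp only: of_nat_eq_iff)
  then show ?thesis by simp
qed

theorem theorem4p9:
  fixes p n :: nat and l :: "nat list"
  assumes "p \<ge> 4" and "n > (2 * p - 2)\<^sup>2" and "l \<in> partitions_of n"
  shows "multiplicity_free (kronecker_product [n - p, p] l) \<longleftrightarrow>
    l \<in> {[n], replicate n 1, [n - 1, 1], 2 # replicate (n - 2) 1}"
proof -
  obtain d where d: "p = 4 + d" using assms(1) le_Suc_ex by blast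
  have n: "2 * p + 4 \<le> n" using assms(2) d by (simp add: power2_eq_square algebra_simps)
  have p: "1 \<le> p" "2 * p \<le> n" "3 \<le> p" using n assms(1) by auto
  note mu = two_row_partition[OF p(1,2)]
  note iff = multiplicity_free_iff_kr[OF mu assms(3)]
  define f where "f = rl l"
  have f: "pt n f" unfolding f_def by (rule pt_rl[OF assms(3)])
  have ptmu: "pt n (rl [n - p, p])" by (rule pt_two[OF p(2)])
  have lp: "is_partition l" using assms(3) by (simp add: partitions_of_def)
  have parts: "is_partition [n]" "is_partition (replicate n 1)" "is_partition [n - 1, 1]" "is_partition (2 # replicate (n - 2) 1)"
    using n by (auto simp: is_partition_def sorted_wrt_iff_nth_less nth_Cons split: nat.split)
  \<comment> \<open>\<open>kr_conj\<close> conjugates the first and third shapes, while the two-row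
    shape stands first here and must stay; it is swapped into the second place and back.\<close>
  have conj_le: "kr n (rl [n - p, p]) (conjf g) h \<le> 1" if "\<And>h. pt n h \<Longrightarrow> kr n (rl [n - p, p]) g h \<le> 1" "pt n g" "pt n h" for g h
  proof -
    have c: "pt n (conjf h)" "pt n (conjf g)" using pt_conjf that by blast+
    have "kr n (rl [n - p, p]) (conjf g) h = kr n (conjf g) (rl [n - p, p]) (conjf (conjf h))"
      using kr_swap12[OF ptmu c(2) that(3)] conjf_conjf[OF that(3)] by simp
    also have "\<dots> = kr n g (rl [n - p, p]) (conjf h)" by (rule kr_conj[OF that(2) ptmu c(1)])
    also have "\<dots> = kr n (rl [n - p, p]) g (conjf h)" by (rule kr_swap12[OF that(2) ptmu c(1)])
    finally show ?thesis using that(1)[OF c(1)] by simp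
  qed
  show ?thesis
  proof
    assume mf: "multiplicity_free (kronecker_product [n - p, p] l)"
    have "\<not> repeated p n f"
    proof
      assume "repeated p n f"
      then obtain h where h: "pt n h" "kr n f (rl [n - p, p]) h \<ge> 2" by (auto simp: repeated_def)
      then have "kr n (rl [n - p, p]) (rl l) h \<ge> 2" using kr_swap12[OF f ptmu h(1)] by (simp add: f_def)
      then show False using mf h(1) unfolding iff by fastforce
    qed
    then have "(f 1 \<le> 1 \<and> f 2 = 0) \<or> (conjf f 1 \<le> 1 \<and> conjf f 2 = 0)"
      using not_multiplicity_free_cases[OF f assms(1,2)] by blast
    then show "l \<in> {[n], replicate n 1, [n - 1, 1], 2 # replicate (n - 2) 1}"
    proof
      assume "f 1 \<le> 1 \<and> f 2 = 0"
      then have "rl l = rl [n] \<or> rl l = rl [n - 1, 1]" using pt_short[OF f] by (simp add: f_def)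
      then show ?thesis using rl_inj[OF lp] parts by blast
    next
      assume "conjf f 1 \<le> 1 \<and> conjf f 2 = 0"
      then have "conjf f = rl [n] \<or> conjf f = rl [n - 1, 1]" using pt_short[OF pt_conjf[OF f]] by blast
      then have "f = conjf (rl [n]) \<or> f = conjf (rl [n - 1, 1])" using conjf_conjf[OF f] by metis
      then have "rl l = rl (replicate n 1) \<or> rl l = rl (2 # replicate (n - 2) 1)"
        using conjf_onerow conjf_hook[of n] n by (simp add: f_def)
      then show ?thesis using rl_inj[OF lp] parts by blast
    qed
  next
    assume l: "l \<in> {[n], replicate n 1, [n - 1, 1], 2 # replicate (n - 2) 1}"
    have triv: "kr n (rl [n - p, p]) (rl [n]) h \<le> 1" if "pt n h" for h by (rule kr_trivial_le_1[OF ptmu that])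
    have hook: "kr n (rl [n - p, p]) (rl [n - 1, 1]) h \<le> 1" if "pt n h" for h by (rule kr_hook_le_1[OF p(3) n that])
    have ptn: "pt n (rl [n])" "pt n (rl [n - 1, 1])" using pt_onerow[of n] pt_two[of 1 n] n by (auto simp: rl_onerow)
    have "kr n (rl [n - p, p]) (rl l) h \<le> 1" if h: "pt n h" for h
      using l triv[OF h] hook[OF h] conj_le[OF triv ptn(1) h, unfolded conjf_onerow] conj_le[OF hook ptn(2) h, unfolded conjf_hook[OF order_trans[OF _ n]]]
        conjf_hook[of n] conj_le[OF hook ptn(2) h] n by auto
    then show "multiplicity_free (kronecker_product [n - p, p] l)" unfolding iff by blast
  qed
qed

end
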